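(* Let $H\in\mathbb R^{d\times d}$ be a Hurwitz matrix (all eigenvalues have strictly negative real part), let $\alpha_k=\alpha/(k+K)^\xi$ be a step-size schedule, and let $\{z_k\}_{k\ge0}$ be given by $$z_{k+1}=(I+\alpha_kH_k)z_k+\sqrt{\alpha_k}\,\chi_k,\qquad H_k=H+\frac{\xi}{2\alpha(k+K)^{1-\xi}}I.$$ Suppose that the noise sequence $\{\chi_k\}_{k\ge0}$ is zero-mean i.i.d. and has bounded third moment. Let $\mathcal E_0=\mathbb E[\|z_0\|^2]$, let $\Sigma_k^{(\alpha,\xi)}$ be the covariance of $z_k$, let $V_H$ be the unique solution of $HV_H+V_HH^T+I=0$, let $\iota_{V_H}=1/(4\lambda_{\max}(V_H))$, and let $Z$ be a standard Gaussian vector in $\mathbb R^d$. Then the following bounds hold for all $k\ge1$. 1. When $\xi=0$ and $\alpha$ is small enough, $$d_{\mathcal W}\big(z_k,(\Sigma_k^{(\alpha,0)})^{1/2}Z\big)\le \mathcal O\Big(\sqrt\alpha\,\log\frac1\alpha\Big)+\mathcal O\big(\mathcal E_0\,e^{-\iota_{V_H}\alpha k}\big).$$ 2. When $\xi\in(0,1)$ and $K$ is large enough, $$d_{\mathcal W}\big(z_k,(\Sigma_k^{(\alpha,\xi)})^{1/2}Z\big)\le \mathcal O\Big(\frac{\log(k+K)}{(k+K)^{\xi/2}}\Big)+\mathcal O\Big(\mathcal E_0\,e^{-\frac{\iota_{V_H}\alpha}{1-\xi}(k+K)^{1-\xi}}\Big).$$ 3. When $\xi=1$, $\iota_{V_H}\alpha>1/2$,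 and $K$ is large enough, $$d_{\mathcal W}\big(z_k,(\Sigma_k^{(\alpha,1)})^{1/2}Z\big)\le \mathcal O\Big(\frac{\log(k+K)}{\sqrt{k+K}}\Big)+\mathcal O\Big(\frac{\mathcal E_0}{(k+K)^{\iota_{V_H}\alpha}}\Big).$$
   Context: $d_{\mathcal W}(X,Y)=\inf\mathbb E\|X-Y\|$ over all couplings of the laws of $X,Y$ (Wasserstein-1 distance, Euclidean norm). The step-size parameters satisfy $\alpha>0$, $K\ge2$, $\xi\in[0,1]$, and $\alpha_k\le1$ for all $k\ge0$. With $\Sigma_\chi=\mathbb E[\chi_k\chi_k^T]$, the covariances of $z_k$ satisfy $\Sigma_{k+1}^{(\alpha,\xi)}=(I+\alpha_kH_k)\Sigma_k^{(\alpha,\xi)}(I+\alpha_kH_k)^T+\alpha_k\Sigma_\chi$. $\lambda_{\max}(V_H)$ is the largest eigenvalue of $V_H$. $\mathcal O(\cdot)$ hides multiplicative constants. *)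

theory Defs
  imports "HOL-Probability.Probability"
begin

section \<open>Matrices\<close>

definition mat_eigenvalue :: "'a::field ^ 'n ^ 'n \<Rightarrow> 'a \<Rightarrow> bool" where
  "mat_eigenvalue A l \<longleftrightarrow> (\<exists>v. v \<noteq> 0 \<and> A *v v = l *s v)"

(* The eigenvalues of a real matrix in this definition are its complex ones. *)
definition hurwitz :: "real ^ 'n ^ 'n \<Rightarrow> bool" where
  "hurwitz A \<longleftrightarrow>
     (\<forall>l::complex. mat_eigenvalue (\<chi> i j. complex_of_real (A $ i $ j)) l \<longrightarrow> Re l < 0)"

definition lambda_max :: "real ^ 'n ^ 'n \<Rightarrow> real" where
  "lambda_max A = Max {l. mat_eigenvalue A l}"

(* For Hurwitz H the Lyapunov equation has exactly one solution; V_H denotes it. *)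
definition lyapunov_sol :: "real ^ 'n ^ 'n \<Rightarrow> real ^ 'n ^ 'n" where
  "lyapunov_sol H = (THE V. H ** V + V ** transpose H + mat 1 = 0)"

definition iota :: "real ^ 'n ^ 'n \<Rightarrow> real" where
  "iota H = 1 / (4 * lambda_max (lyapunov_sol H))"

definition psd :: "real ^ 'n ^ 'n \<Rightarrow> bool" where
  "psd A \<longleftrightarrow> transpose A = A \<and> (\<forall>x. 0 \<le> x \<bullet> (A *v x))"

(* The principal square root; meaningful for positive semidefinite A, singular A included. *)
definition mat_sqrt :: "real ^ 'n ^ 'n \<Rightarrow> real ^ 'n ^ 'n" where
  "mat_sqrt A = (THE B. psd B \<and> B ** B = A)"

section \<open>Random vectors\<close>

definition covariance :: "'w measure \<Rightarrow> ('w \<Rightarrow> real ^ 'n) \<Rightarrow> real ^ 'n ^ 'n" where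
  "covariance M X = (\<chi> i j.
     \<integral>\<omega>. (X \<omega> $ i - (\<integral>\<omega>. X \<omega> $ i \<partial>M)) * (X \<omega> $ j - (\<integral>\<omega>. X \<omega> $ j \<partial>M)) \<partial>M)"

definition second_moment :: "'w measure \<Rightarrow> ('w \<Rightarrow> real ^ 'n) \<Rightarrow> real" where
  "second_moment M X = (\<integral>\<omega>. (norm (X \<omega>))\<^sup>2 \<partial>M)"

definition square_integrable :: "'w measure \<Rightarrow> ('w \<Rightarrow> real ^ 'n) \<Rightarrow> bool" where
  "square_integrable M X \<longleftrightarrow>
     X \<in> borel_measurable M \<and> integrable M (\<lambda>\<omega>. (norm (X \<omega>))\<^sup>2)"

definition standard_gaussian :: "'v measure \<Rightarrow> ('v \<Rightarrow> real ^ 'n) \<Rightarrow> bool" where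
  "standard_gaussian N Z \<longleftrightarrow>
     distributed N lborel Z (\<lambda>x. ennreal (\<Prod>i\<in>UNIV. std_normal_density (x $ i)))"

definition couplings :: "'a measure \<Rightarrow> 'b measure \<Rightarrow> ('a \<times> 'b) measure set" where
  "couplings \<mu> \<nu> =
     {\<pi>. sets \<pi> = sets (\<mu> \<Otimes>\<^sub>M \<nu>) \<and> distr \<pi> \<mu> fst = \<mu> \<and> distr \<pi> \<nu> snd = \<nu>}"

(* X and Y may live on different probability spaces: only their laws enter.  The values are
   in ennreal, so that a coupling of infinite cost does not count as one of cost 0. *)
definition wasserstein1 ::
  "'w measure \<Rightarrow> ('w \<Rightarrow> real ^ 'n) \<Rightarrow> 'v measure \<Rightarrow> ('v \<Rightarrow> real ^ 'n) \<Rightarrow> ennreal" where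
  "wasserstein1 M X N Y =
     (INF \<pi>\<in>couplings (distr M borel X) (distr N borel Y).
        \<integral>\<^sup>+ p. ennreal (norm (fst p - snd p)) \<partial>\<pi>)"

section \<open>The recursion\<close>

definition stepsize :: "real \<Rightarrow> real \<Rightarrow> real \<Rightarrow> nat \<Rightarrow> real" where
  "stepsize \<alpha> K \<xi> k = \<alpha> / (real k + K) powr \<xi>"

definition drift :: "real ^ 'n ^ 'n \<Rightarrow> real \<Rightarrow> real \<Rightarrow> real \<Rightarrow> nat \<Rightarrow> real ^ 'n ^ 'n" where
  "drift H \<alpha> K \<xi> k = H + (\<xi> / (2 * \<alpha> * (real k + K) powr (1 - \<xi>))) *\<^sub>R mat 1"

primrec iterate :: "real ^ 'n ^ 'n \<Rightarrow> real \<Rightarrow> real \<Rightarrow> real \<Rightarrow> (nat \<Rightarrow> 'w \<Rightarrow> real ^ 'n) \<Rightarrow>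
    ('w \<Rightarrow> real ^ 'n) \<Rightarrow> nat \<Rightarrow> 'w \<Rightarrow> real ^ 'n" where
  "iterate H \<alpha> K \<xi> noise z0 0 = z0"
| "iterate H \<alpha> K \<xi> noise z0 (Suc k) =
     (\<lambda>\<omega>. (mat 1 + stepsize \<alpha> K \<xi> k *\<^sub>R drift H \<alpha> K \<xi> k) *v iterate H \<alpha> K \<xi> noise z0 k \<omega>
          + sqrt (stepsize \<alpha> K \<xi> k) *\<^sub>R noise k \<omega>)"

end

theory Submission
  imports Defs
begin

text \<open>
  Unrolling the recursion writes \<open>z\<^sub>k\<close> as a propagated initial vector plus a weighted sum
  \<open>S\<close> of the independent noises. In the norm given by \<open>V\<^sub>H\<close> every step is a contraction by
  \<open>1 - \<iota> \<alpha>\<^sub>j\<close> once the step sizes are small, so the initial vector contributes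
  \<open>exp (- \<iota> \<Sum> \<alpha>\<^sub>j)\<close>, and each weight in \<open>S\<close> has norm \<open>O(\<surd>\<alpha>\<^sub>k)\<close>. The initial vector may depend
  on the noise; it is split off in mean square, and the two Gaussians are compared through a square
  root of the joint covariance.

  For \<open>S\<close> the noises are replaced one at a time by Gaussians. The Gaussians already inserted,
  together with an auxiliary \<open>N(0, t\<^sup>2 I)\<close> with \<open>t\<close> of order \<open>\<surd>\<alpha>\<^sub>k\<close>, smooth a 1-Lipschitz test
  function, and the third-order error of a step with covariance increment \<open>A\<close> over the smoothing
  covariance \<open>\<Gamma>\<close> is at most a multiple of \<open>t tr (\<Gamma>\<^sup>-\<^sup>1 A)\<close>, which is bounded by an increment of
  \<open>log det \<Gamma>\<close>. Hence the total error is \<open>O(t log (1 / t))\<close>, also for degenerate noise.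
  Kantorovich duality turns the bound for test functions into one for the Wasserstein distance.
\<close>

section \<open>Spectral theorem and square roots\<close>

text \<open>A step contracts the \<open>V_H\<close> norm at rate \<open>2 * iota H\<close>, and only
  \<open>iota H\<close> of it is kept: the other half pays for the quadratic term in the step size
  and for the correction in \<open>drift\<close>. For \<open>\<xi> = 1\<close> that correction is
  the constant \<open>1 / (2 * \<alpha>)\<close>, whence the threshold
  \<open>iota H * \<alpha> > 1 / 2\<close>. The same inequality controls the weights: the square
  root of the step size loses a factor of about \<open>1 - \<xi> / (2 * n)\<close> at time
  \<open>n\<close>, and the contraction factor is at most that, so that an old noise never outweighs
  the newest one by more than a constant. Degenerate noise shapes the replacement argument, because
  the Gaussians already inserted smooth only the directions which the noise reaches. Of the three
  factors in the third-order error, one is therefore measured in the Euclidean norm, where it is at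
  most of order \<open>t\<close>, and the other two in the norm of \<Gamma>^(-1/2), where they
  average to a trace. Splitting off the initial vector in mean square produces the square root of
  its second moment. The bound linear in that moment comes from the gap: a nonzero second moment is
  at least \<epsilon>, at the price of a factor \<open>1 / sqrt \<epsilon>\<close> in the
  constant.\<close>

lemma inner_matrix_vector_left:
  fixes A :: "real ^ 'm ^ 'n"
  shows "(A *v x) \<bullet> y = x \<bullet> (transpose A *v y)"
  by (metis dot_lmul_matrix inner_commute transpose_matrix_vector transpose_transpose)

lemma matrix_diff_ldistrib: "A ** (B - C) = A ** B - A ** C"
  for A :: "real ^ 'm ^ 'n" and B C :: "real ^ 'k ^ 'm"
  by (simp add: matrix_matrix_mult_def vec_eq_iff algebra_simps sum_subtractf)

lemma matrix_diff_rdistrib: "(B - C) ** D = B ** D - C ** D"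
  for B C :: "real ^ 'm ^ 'n" and D :: "real ^ 'k ^ 'm"
  by (simp add: matrix_matrix_mult_def vec_eq_iff algebra_simps sum_subtractf)

lemma matrix_add_rdistrib: "(B + C) ** D = B ** D + C ** D"
  for B C :: "real ^ 'm ^ 'n" and D :: "real ^ 'k ^ 'm"
  by (simp add: matrix_matrix_mult_def vec_eq_iff algebra_simps sum.distrib)

text \<open>The first-order optimality condition in algebraic form: a quadratic without constant
  term that never becomes negative has slope 0 at the origin. The variational arguments below use it
  in place of a derivative.\<close>

lemma linear_coefficient_zero:
  fixes b c :: real
  assumes "\<And>t. 0 \<le> t * b + t\<^sup>2 * c"
  shows "b = 0"
proof (rule ccontr)
  assume "b \<noteq> 0"
  define e where "e = \<bar>c\<bar> + 1"
  have e: "c \<le> e" "0 < e" by (auto simp: e_def)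
  \<comment> \<open>The vertex of the parabola with \<open>c\<close> enlarged to the positive number
    \<open>e\<close>.\<close>
  define t where "t = - b / (2 * e)"
  have "t * b + t\<^sup>2 * c \<le> t * b + t\<^sup>2 * e"
    using e by (intro add_left_mono mult_left_mono) auto
  also have "\<dots> = - b\<^sup>2 / (4 * e)"
    using e by (simp add: t_def power2_eq_square field_simps)
  also have "\<dots> < 0" using \<open>b \<noteq> 0\<close> e by (simp add: divide_neg_pos)
  finally show False using assms[of t] by simp
qed

text \<open>A null vector of a nonnegative form minimises it, so its derivative vanishes in all
  directions of \<open>S\<close>. Positivity is assumed on \<open>S\<close> only; the conclusion
  becomes \<open>A *v v = 0\<close> as soon as \<open>A *v v\<close> itself lies in
  \<open>S\<close>.\<close>

lemma psd_form_null:
  fixes A :: "real ^ 'n ^ 'n"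
  assumes sym: "transpose A = A" and S: "subspace S" and nn: "\<And>x. x \<in> S \<Longrightarrow> 0 \<le> x \<bullet> (A *v x)"
    and v: "v \<in> S" "v \<bullet> (A *v v) = 0" and y: "y \<in> S"
  shows "y \<bullet> (A *v v) = 0"
proof -
  have vy: "v \<bullet> (A *v y) = y \<bullet> (A *v v)"
    using inner_matrix_vector_left[of A v y] sym by (simp add: inner_commute)
  have "0 \<le> t * (2 * (y \<bullet> (A *v v))) + t\<^sup>2 * (y \<bullet> (A *v y))" for t
  proof -
    have "v + t *\<^sub>R y \<in> S" using S v y by (simp add: subspace_add subspace_scale)
    then have "0 \<le> (v + t *\<^sub>R y) \<bullet> (A *v (v + t *\<^sub>R y))" by (rule nn)
    also have "\<dots> = t * (2 * (y \<bullet> (A *v v))) + t\<^sup>2 * (y \<bullet> (A *v y))"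
      using v(2) vy
      by (simp add: matrix_vector_right_distrib matrix_vector_mult_scaleR inner_add_left inner_add_right power2_eq_square algebra_simps)
    finally show ?thesis .
  qed
  then show ?thesis using linear_coefficient_zero by fastforce
qed

lemma psd_null:
  assumes "psd A" "v \<bullet> (A *v v) = 0"
  shows "A *v v = 0"
  using psd_form_null[of A UNIV v "A *v v"] assms by (auto simp: psd_def)

text \<open>A maximiser \<open>v\<close> of the Rayleigh quotient on the unit sphere of
  \<open>S\<close> is a null vector of the form of \<open>B = l *\<^sub>R mat 1 - A\<close>, which
  is nonnegative on \<open>S\<close>. Invariance puts \<open>B *v v\<close> back into
  \<open>S\<close>, so \<open>psd_form_null\<close> makes it vanish.\<close>

lemma symmetric_max_eigenvector:
  fixes A :: "real ^ 'n ^ 'n"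
  assumes sym: "transpose A = A" and S: "subspace S" "S \<noteq> {0}" and inv: "\<And>x. x \<in> S \<Longrightarrow> A *v x \<in> S"
  obtains v l where "v \<in> S" "norm v = 1" "A *v v = l *\<^sub>R v" "\<And>x. x \<in> S \<Longrightarrow> x \<bullet> (A *v x) \<le> l * (x \<bullet> x)"
proof -
  let ?K = "sphere 0 1 \<inter> S"
  obtain s where s: "s \<in> S" "s \<noteq> 0" using S subspace_0 by blast
  then have "(1 / norm s) *\<^sub>R s \<in> ?K" using S by (simp add: subspace_scale)
  moreover have "compact ?K" using S by (simp add: closed_subspace compact_Int_closed)
  moreover have "continuous_on ?K (\<lambda>x. x \<bullet> (A *v x))"
    by (intro continuous_intros)
  ultimately obtain v where v: "v \<in> ?K" "\<And>x. x \<in> ?K \<Longrightarrow> x \<bullet> (A *v x) \<le> v \<bullet> (A *v v)"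
    using continuous_attains_sup[of ?K "\<lambda>x. x \<bullet> (A *v x)"] by blast
  define l where "l = v \<bullet> (A *v v)"
  have vv: "v \<bullet> v = 1" "v \<in> S" using v(1) by (auto simp: dot_square_norm)
  have le: "x \<bullet> (A *v x) \<le> l * (x \<bullet> x)" if "x \<in> S" for x
  proof (cases "x = 0")
    case False
    then have "(1 / norm x) *\<^sub>R x \<in> ?K" using that S by (simp add: subspace_scale)
    from v(2)[OF this] have "(x \<bullet> (A *v x)) / (norm x)\<^sup>2 \<le> l"
      by (simp add: l_def matrix_vector_mult_scaleR power2_eq_square)
    then show ?thesis using False by (simp add: divide_le_eq dot_square_norm)
  qed auto
  define B where "B = l *\<^sub>R mat 1 - A"
  have Bx: "B *v x = l *\<^sub>R x - A *v x" for x
    by (simp add: B_def matrix_vector_mult_diff_rdistrib scaleR_matrix_vector_assoc[symmetric])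
  have "transpose B = B"
    using sym by (simp add: B_def transpose_def mat_def vec_eq_iff)
  moreover have "0 \<le> x \<bullet> (B *v x)" if "x \<in> S" for x
    using le[OF that] by (simp add: Bx inner_diff_right)
  moreover have "v \<bullet> (B *v v) = 0" using vv by (simp add: Bx inner_diff_right l_def)
  moreover have "B *v v \<in> S" using vv inv S by (simp add: Bx subspace_diff subspace_scale)
  ultimately have "(B *v v) \<bullet> (B *v v) = 0" using psd_form_null[of B S v "B *v v"] S vv by blast
  then have "A *v v = l *\<^sub>R v" by (simp add: Bx)
  with that v(1) le show ?thesis by auto
qed

definition diag_mat :: "('n \<Rightarrow> real) \<Rightarrow> real ^ 'n ^ 'n" where
  "diag_mat d = (\<chi> i j. if i = j then d i else 0)"

text \<open>A symmetric matrix preserves the orthogonal complement of the eigenvectors found so far.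
  That complement is nontrivial as long as there are fewer than \<open>CARD('n)\<close> of them, so
  the Rayleigh quotient can be maximised there once more.\<close>

lemma orthonormal_eigenvectors:
  fixes A :: "real ^ 'n ^ 'n"
  assumes sym: "transpose A = A" and "k \<le> CARD('n)"
  shows "\<exists>B. finite B \<and> card B = k \<and> pairwise orthogonal B \<and>
    (\<forall>b\<in>B. norm b = 1 \<and> (\<exists>l. A *v b = l *\<^sub>R b))"
  using assms(2)
proof (induction k)
  case 0
  then show ?case by (intro exI[of _ "{}"]) auto
next
  case (Suc k)
  then obtain B where B: "finite B" "card B = k" "pairwise orthogonal B"
    "\<And>b. b \<in> B \<Longrightarrow> norm b = 1" "\<And>b. b \<in> B \<Longrightarrow> \<exists>l. A *v b = l *\<^sub>R b" by auto
  define S where "S = {x. \<forall>b\<in>B. b \<bullet> x = 0}"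
  have "dim B \<le> k" using B dim_le_card'[of B] by simp
  then obtain x where x: "x \<noteq> 0" "\<And>y. y \<in> span B \<Longrightarrow> orthogonal x y"
    using orthogonal_to_subspace_exists[of B] Suc.prems by auto
  have "x \<in> S" using x(2) by (auto simp: S_def orthogonal_def inner_commute span_base)
  with x have ne: "S \<noteq> {0}" by auto
  have sub: "subspace S"
    unfolding S_def by (rule subspaceI) (auto simp: inner_add_right)
  have inv: "A *v y \<in> S" if "y \<in> S" for y
  proof -
    have "b \<bullet> (A *v y) = 0" if "b \<in> B" for b
    proof -
      obtain l where "A *v b = l *\<^sub>R b" using B(5) \<open>b \<in> B\<close> by blast
      moreover have "b \<bullet> (A *v y) = (A *v b) \<bullet> y" using inner_matrix_vector_left[of A b y] sym by simp
      ultimately show ?thesis using \<open>y \<in> S\<close> that by (simp add: S_def)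
    qed
    then show ?thesis by (simp add: S_def)
  qed
  obtain v l where v: "v \<in> S" "norm v = 1" "A *v v = l *\<^sub>R v"
    by (rule symmetric_max_eigenvector[OF sym sub ne inv])
  have "v \<notin> B" using v by (auto simp: S_def dot_square_norm)
  moreover have "pairwise orthogonal (insert v B)"
    using B(3) v(1) by (auto simp: pairwise_insert S_def orthogonal_def inner_commute)
  ultimately show ?case using B v by (intro exI[of _ "insert v B"]) auto
qed

lemma diag_mat_mult: "(Q ** diag_mat d) $ i $ j = Q $ i $ j * d j"
  by (simp add: matrix_matrix_mult_def diag_mat_def if_distrib cong: if_cong)

lemma spectral_theorem:
  fixes A :: "real ^ 'n ^ 'n"
  assumes sym: "transpose A = A"
  obtains Q d where "orthogonal_matrix Q" "A = Q ** diag_mat d ** transpose Q"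
proof -
  obtain B where B: "finite B" "card B = CARD('n)" "pairwise orthogonal B"
    "\<And>b. b \<in> B \<Longrightarrow> norm b = 1" "\<And>b. b \<in> B \<Longrightarrow> \<exists>l. A *v b = l *\<^sub>R b"
    using orthonormal_eigenvectors[OF sym order_refl] by blast
  then obtain f where f: "bij_betw f (UNIV :: 'n set) B"
    by (metis finite_class.finite_UNIV finite_same_card_bij)
  define Q :: "real ^ 'n ^ 'n" where "Q = (\<chi> i j. f j $ i)"
  have col: "column j Q = f j" for j by (simp add: Q_def column_def vec_eq_iff)
  have fB: "f j \<in> B" for j using f by (auto simp: bij_betw_def)
  have Q: "orthogonal_matrix Q"
    unfolding orthogonal_matrix_orthonormal_columns col
  proof safe
    show "norm (f i) = 1" for i using B(4) fB by blast
    fix i j :: 'n assume "i \<noteq> j"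
    then have "f i \<noteq> f j" using f by (auto simp: bij_betw_def inj_on_def)
    then show "orthogonal (f i) (f j)" using pairwiseD[OF B(3) fB fB] by blast
  qed
  have "\<forall>j. \<exists>l. A *v f j = l *\<^sub>R f j" using B(5) fB by blast
  then obtain d where d: "\<And>j. A *v f j = d j *\<^sub>R f j" by metis
  have "A ** Q = Q ** diag_mat d"
  proof -
    have "(A ** Q) $ i $ j = (Q ** diag_mat d) $ i $ j" for i j
    proof -
      have "(A ** Q) $ i $ j = (A *v f j) $ i"
        by (simp add: matrix_matrix_mult_def matrix_vector_mult_def Q_def)
      then show ?thesis by (simp add: d diag_mat_mult Q_def)
    qed
    then show ?thesis by (simp add: vec_eq_iff)
  qed
  then have "A ** Q ** transpose Q = Q ** diag_mat d ** transpose Q" by simp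
  moreover have "Q ** transpose Q = mat 1" using Q by (simp add: orthogonal_matrix_def)
  ultimately have "A = Q ** diag_mat d ** transpose Q"
    by (simp add: matrix_mul_assoc[symmetric])
  with Q that show ?thesis by blast
qed

lemma diag_mat_vec: "(diag_mat d *v x) $ i = d i * x $ i"
  by (simp add: diag_mat_def matrix_vector_mult_def if_distrib[of "\<lambda>c. c * _"] cong: if_cong)

lemma transpose_vec_component:
  fixes Q :: "real ^ 'm ^ 'n"
  shows "(transpose Q *v x) $ i = column i Q \<bullet> x"
  unfolding matrix_vector_mul_component by (simp add: transpose_def column_def)

lemma spectral_quadratic:
  assumes "A = Q ** diag_mat d ** transpose Q"
  shows "x \<bullet> (A *v x) = (\<Sum>i\<in>UNIV. d i * (column i Q \<bullet> x)\<^sup>2)"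
proof -
  have "x \<bullet> (A *v x) = (transpose Q *v x) \<bullet> (diag_mat d *v (transpose Q *v x))"
    using inner_matrix_vector_left[of "transpose Q" x "diag_mat d *v (transpose Q *v x)"]
    by (simp add: assms matrix_vector_mul_assoc[symmetric])
  also have "\<dots> = (\<Sum>i\<in>UNIV. d i * (column i Q \<bullet> x)\<^sup>2)"
    unfolding inner_vec_def[of "transpose Q *v x"]
    by (intro sum.cong) (auto simp: diag_mat_vec transpose_vec_component power2_eq_square simp del: transpose_matrix_vector)
  finally show ?thesis .
qed

lemma orthogonal_columns_inner:
  fixes Q :: "real ^ 'n ^ 'n"
  assumes "orthogonal_matrix Q"
  shows "column i Q \<bullet> column j Q = (if i = j then 1 else 0)"
proof -
  have "(transpose Q ** Q) $ i $ j = mat 1 $ i $ j" using assms by (metis orthogonal_matrix)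
  then show ?thesis by (simp add: matrix_mult_transpose_dot_column mat_def)
qed

lemma spectral_eigenvector:
  assumes "orthogonal_matrix Q" "A = Q ** diag_mat d ** transpose Q"
  shows "A *v column j Q = d j *\<^sub>R column j Q"
proof -
  have "A ** Q = Q ** diag_mat d"
    using assms by (metis matrix_mul_assoc matrix_mul_rid orthogonal_matrix_def)
  moreover have "(A *v column j Q) $ i = (A ** Q) $ i $ j" for i
    by (simp add: matrix_matrix_mult_def matrix_vector_mult_def column_def)
  ultimately show ?thesis
    by (simp add: vec_eq_iff diag_mat_mult column_def mult.commute)
qed

lemma spectral_psd:
  assumes "orthogonal_matrix Q" "A = Q ** diag_mat d ** transpose Q" "psd A"
  shows "0 \<le> d i"
proof -
  have "0 \<le> column i Q \<bullet> (A *v column i Q)" using assms(3) by (simp add: psd_def)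
  then show ?thesis
    using assms by (simp add: spectral_eigenvector orthogonal_columns_inner)
qed

lemma psd_spectral:
  assumes "\<And>i. 0 \<le> d i"
  shows "psd (Q ** diag_mat d ** transpose Q)"
  unfolding psd_def
proof (intro conjI allI)
  have "transpose (diag_mat d) = diag_mat d" by (simp add: diag_mat_def transpose_def vec_eq_iff)
  then show "transpose (Q ** diag_mat d ** transpose Q) = Q ** diag_mat d ** transpose Q"
    by (simp add: matrix_transpose_mul matrix_mul_assoc)
  show "0 \<le> x \<bullet> (Q ** diag_mat d ** transpose Q *v x)" for x
    using assms by (simp add: spectral_quadratic[OF refl] sum_nonneg)
qed

lemma diag_mat_mult_diag_mat: "diag_mat d ** diag_mat e = diag_mat (\<lambda>i. d i * e i)"
  by (simp add: vec_eq_iff diag_mat_mult) (simp add: diag_mat_def)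

section \<open>Principal square roots of positive semidefinite matrices\<close>

lemma psd_sqrt_exists:
  assumes "psd A"
  shows "\<exists>B. psd B \<and> B ** B = A"
proof -
  have "transpose A = A" using assms by (simp add: psd_def)
  then obtain Q d where Q: "orthogonal_matrix Q" "A = Q ** diag_mat d ** transpose Q"
    by (rule spectral_theorem)
  have d: "0 \<le> d i" for i using spectral_psd[OF Q assms] .
  define B where "B = Q ** diag_mat (\<lambda>i. sqrt (d i)) ** transpose Q"
  have "B ** B = Q ** diag_mat (\<lambda>i. sqrt (d i)) ** (transpose Q ** Q) ** diag_mat (\<lambda>i. sqrt (d i)) ** transpose Q"
    by (simp add: B_def matrix_mul_assoc)
  also have "\<dots> = Q ** (diag_mat (\<lambda>i. sqrt (d i)) ** diag_mat (\<lambda>i. sqrt (d i))) ** transpose Q"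
    using Q(1) by (simp add: orthogonal_matrix_def matrix_mul_assoc)
  also have "\<dots> = A" using d by (simp add: diag_mat_mult_diag_mat Q)
  finally have "B ** B = A" .
  moreover have "psd B" unfolding B_def using d by (intro psd_spectral) simp
  ultimately show ?thesis by blast
qed

lemma transpose_diff: "transpose (A - B) = transpose A - transpose (B :: real ^ 'm ^ 'n)"
  and transpose_add: "transpose (A + B) = transpose A + transpose B"
  by (simp_all add: transpose_def vec_eq_iff)

text \<open>\<open>B\<close> and \<open>C\<close> need not commute, so they are not diagonalised
  together. Instead \<open>B ** B - C ** C = B ** (B - C) + (B - C) ** C\<close> is tested against
  an eigenvector \<open>v\<close> for the largest eigenvalue \<open>l\<close> of
  \<open>B - C\<close>: \<open>l\<close> times a sum of two nonnegative forms is 0. If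
  \<open>l\<close> were nonzero, both forms would vanish, hence \<open>B *v v = C *v v = 0\<close>
  and \<open>l *\<^sub>R v = 0\<close>.\<close>

lemma psd_sqrt_diff_nonpos:
  fixes B C :: "real ^ 'n ^ 'n"
  assumes "psd B" "psd C" "B ** B = C ** C"
  shows "x \<bullet> ((B - C) *v x) \<le> 0"
proof -
  have sym: "transpose (B - C) = B - C" using assms by (simp add: psd_def transpose_diff)
  have "axis undefined 1 \<noteq> (0 :: real ^ 'n)" by (simp add: axis_eq_0_iff)
  then have "UNIV \<noteq> {0 :: real ^ 'n}" by blast
  then obtain v l where v: "norm v = 1" "(B - C) *v v = l *\<^sub>R v" "\<And>x. x \<bullet> ((B - C) *v x) \<le> l * (x \<bullet> x)"
    using symmetric_max_eigenvector[OF sym subspace_UNIV] by auto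
  have "l = 0"
  proof (rule ccontr)
    assume l: "l \<noteq> 0"
    have "B ** B - C ** C = B ** (B - C) + (B - C) ** C"
      by (simp add: matrix_diff_ldistrib matrix_diff_rdistrib)
    then have "B *v ((B - C) *v v) + (B - C) *v (C *v v) = 0"
      using assms(3) by (simp add: matrix_vector_mul_assoc matrix_vector_mult_add_rdistrib[symmetric])
    then have "v \<bullet> (B *v ((B - C) *v v)) + v \<bullet> ((B - C) *v (C *v v)) = 0"
      by (metis inner_add_right inner_zero_right)
    moreover have "v \<bullet> ((B - C) *v (C *v v)) = ((B - C) *v v) \<bullet> (C *v v)"
      using inner_matrix_vector_left[of "B - C" v "C *v v"] sym by simp
    ultimately have "l * (v \<bullet> (B *v v) + v \<bullet> (C *v v)) = 0"
      using v(2) by (simp add: matrix_vector_mult_scaleR algebra_simps)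
    moreover have "0 \<le> v \<bullet> (B *v v)" "0 \<le> v \<bullet> (C *v v)" using assms by (auto simp: psd_def)
    ultimately have "v \<bullet> (B *v v) = 0" "v \<bullet> (C *v v) = 0" using l by auto
    then have "B *v v = 0" "C *v v = 0" using assms psd_null by blast+
    then have "l *\<^sub>R v = 0" using v(2) by (simp add: matrix_vector_mult_diff_rdistrib)
    then show False using l v(1) by auto
  qed
  then show ?thesis using v(3)[of x] by simp
qed

lemma psd_sqrt_unique:
  assumes "psd B" "psd C" "B ** B = C ** C"
  shows "B = C"
proof -
  have q: "x \<bullet> ((B - C) *v x) = 0" for x
    using psd_sqrt_diff_nonpos[OF assms, of x] psd_sqrt_diff_nonpos[OF assms(2,1) assms(3)[symmetric], of x]
    by (simp add: matrix_vector_mult_diff_rdistrib inner_diff_right)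
  have "psd (B - C)"
    using assms q by (simp add: psd_def transpose_diff)
  then have "(B - C) *v x = 0" for x using q psd_null by blast
  then have "B *v x = C *v x" for x by (simp add: matrix_vector_mult_diff_rdistrib)
  then show ?thesis unfolding matrix_eq by blast
qed

lemma mat_sqrt:
  assumes "psd A"
  shows "psd (mat_sqrt A)" "mat_sqrt A ** mat_sqrt A = A"
proof -
  have "\<exists>!B. psd B \<and> B ** B = A"
    using psd_sqrt_exists[OF assms] by (rule ex_ex1I) (auto intro: psd_sqrt_unique)
  from theI'[OF this] show "psd (mat_sqrt A)" "mat_sqrt A ** mat_sqrt A = A"
    unfolding mat_sqrt_def by auto
qed

lemma parseval_columns:
  fixes Q :: "real ^ 'n ^ 'n"
  assumes "orthogonal_matrix Q"
  shows "(\<Sum>i\<in>UNIV. (column i Q \<bullet> x)\<^sup>2) = x \<bullet> x"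
proof -
  have "(\<Sum>i\<in>UNIV. (column i Q \<bullet> x)\<^sup>2) = (transpose Q *v x) \<bullet> (transpose Q *v x)"
    unfolding inner_vec_def[of "transpose Q *v x"] transpose_vec_component by (simp add: power2_eq_square)
  also have "\<dots> = x \<bullet> ((Q ** transpose Q) *v x)"
    by (simp only: inner_matrix_vector_left transpose_transpose matrix_vector_mul_assoc)
  also have "\<dots> = x \<bullet> x"
    using assms by (simp add: orthogonal_matrix_def)
  finally show ?thesis .
qed

text \<open>Since \<open>lambda_max\<close> is a \<open>Max\<close>, the set of eigenvalues has to
  be identified with the finite range of the spectral coefficients \<open>d\<close>. The bound then
  holds term by term in the eigenbasis.\<close>

lemma lambda_max_bound:
  assumes sym: "transpose A = A"
  shows "x \<bullet> (A *v x) \<le> lambda_max A * (x \<bullet> x)"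
proof -
  obtain Q d where Q: "orthogonal_matrix Q" "A = Q ** diag_mat d ** transpose Q"
    using sym by (rule spectral_theorem)
  have "mat_eigenvalue A (d i)" for i
  proof -
    have "column i Q \<noteq> 0" using orthogonal_columns_inner[OF Q(1), of i i] by auto
    then show ?thesis using spectral_eigenvector[OF Q, of i]
      unfolding mat_eigenvalue_def scalar_mult_eq_scaleR by blast
  qed
  moreover have "l \<in> range d" if ev: "mat_eigenvalue A l" for l
  proof -
    obtain v where v: "v \<noteq> 0" "A *v v = l *\<^sub>R v"
      using ev by (auto simp: mat_eigenvalue_def scalar_mult_eq_scaleR)
    have "d i * (column i Q \<bullet> v) = l * (column i Q \<bullet> v)" for i
    proof -
      have "(A *v column i Q) \<bullet> v = column i Q \<bullet> (A *v v)"
        using inner_matrix_vector_left[of A "column i Q" v] sym by simp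
      then show ?thesis using spectral_eigenvector[OF Q, of i] v by simp
    qed
    moreover have "\<exists>i. column i Q \<bullet> v \<noteq> 0"
    proof (rule ccontr)
      assume "\<not> ?thesis"
      then have "transpose Q *v v = 0"
        unfolding vec_eq_iff transpose_vec_component by simp
      then have "(Q ** transpose Q) *v v = 0"
        by (simp add: matrix_vector_mul_assoc[symmetric] del: transpose_matrix_vector)
      then show False using Q(1) v(1) by (simp add: orthogonal_matrix_def)
    qed
    ultimately obtain i where "d i = l" by (metis mult_cancel_right)
    then show ?thesis by blast
  qed
  ultimately have ev: "{l. mat_eigenvalue A l} = range d" by blast
  have d: "d i \<le> lambda_max A" for i
    unfolding lambda_max_def ev by (rule Max_ge) auto
  have "x \<bullet> (A *v x) = (\<Sum>i\<in>UNIV. d i * (column i Q \<bullet> x)\<^sup>2)"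
    by (rule spectral_quadratic[OF Q(2)])
  also have "\<dots> \<le> (\<Sum>i\<in>UNIV. lambda_max A * (column i Q \<bullet> x)\<^sup>2)"
    by (intro sum_mono mult_right_mono d) auto
  also have "\<dots> = lambda_max A * (x \<bullet> x)"
    unfolding sum_distrib_left[symmetric] parseval_columns[OF Q(1)] ..
  finally show ?thesis .
qed

section \<open>The Lyapunov equation\<close>

definition posdef :: "real ^ 'n ^ 'n \<Rightarrow> bool" where
  "posdef P \<longleftrightarrow> transpose P = P \<and> (\<forall>x. x \<noteq> 0 \<longrightarrow> 0 < x \<bullet> (P *v x))"

definition lyap :: "real ^ 'n ^ 'n \<Rightarrow> real ^ 'n ^ 'n \<Rightarrow> real ^ 'n ^ 'n" where
  "lyap H V = H ** V + V ** transpose H"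

text \<open>A quadratic certificate of stability. It stands in for the Hurwitz condition because
  minimisation and continuity arguments can be run on it over the reals, without complex
  eigenvalues.\<close>

definition lyap_stable :: "real ^ 'n ^ 'n \<Rightarrow> real ^ 'n ^ 'n \<Rightarrow> bool" where
  "lyap_stable H P \<longleftrightarrow> posdef P \<and> (\<forall>x. x \<noteq> 0 \<longrightarrow> x \<bullet> (lyap H P *v x) < 0)"

lemma lyap_vec: "lyap H V *v x = H *v (V *v x) + V *v (transpose H *v x)"
  by (simp only: lyap_def matrix_vector_mult_add_rdistrib matrix_vector_mul_assoc)

lemma lyap_bilinear:
  "x \<bullet> (lyap H V *v y) = (transpose H *v x) \<bullet> (V *v y) + (transpose V *v x) \<bullet> (transpose H *v y)"
proof -
  have "(transpose H *v x) \<bullet> (V *v y) = x \<bullet> (H *v (V *v y))"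
    using inner_matrix_vector_left[of "transpose H" x] by (simp only: transpose_transpose)
  moreover have "(transpose V *v x) \<bullet> (transpose H *v y) = x \<bullet> (V *v (transpose H *v y))"
    using inner_matrix_vector_left[of "transpose V" x] by (simp only: transpose_transpose)
  ultimately show ?thesis by (simp only: lyap_vec inner_add_right)
qed

lemma lyap_quadratic:
  assumes "transpose V = V"
  shows "x \<bullet> (lyap H V *v x) = 2 * ((transpose H *v x) \<bullet> (V *v x))"
  by (simp only: lyap_bilinear assms inner_commute[of "V *v x"])

lemma lyap_add: "lyap H (V + W) = lyap H V + lyap H W"
  by (simp add: lyap_def matrix_add_rdistrib matrix_add_ldistrib)

lemma matrix_scaleR_left: "(c *\<^sub>R A) ** B = c *\<^sub>R (A ** B)"
  for A :: "real ^ 'm ^ 'n" and B :: "real ^ 'k ^ 'm"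
  by (simp add: matrix_matrix_mult_def vec_eq_iff sum_distrib_left mult.assoc)

lemma matrix_scaleR_right: "A ** (c *\<^sub>R B) = c *\<^sub>R (A ** B)"
  for A :: "real ^ 'm ^ 'n" and B :: "real ^ 'k ^ 'm"
  by (simp add: matrix_matrix_mult_def vec_eq_iff sum_distrib_left mult.left_commute)

lemma lyap_scale: "lyap H (c *\<^sub>R V) = c *\<^sub>R lyap H V"
  by (simp add: lyap_def matrix_scaleR_left matrix_scaleR_right scaleR_add_right)

lemma linear_lyap: "linear (lyap H)"
  by (rule linearI) (rule lyap_add lyap_scale)+

lemma lyap_shift: "lyap (H - s *\<^sub>R mat 1) V = lyap H V - (2 * s) *\<^sub>R V"
  by (simp add: lyap_def matrix_diff_rdistrib matrix_diff_ldistrib transpose_diff transpose_scalar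
    matrix_scaleR_left matrix_scaleR_right algebra_simps flip: scaleR_add_left scaleR_2)

lemma lyap_transpose: "lyap H (transpose V) = transpose (lyap H V)"
  by (simp add: lyap_def transpose_add matrix_transpose_mul add.commute)

lemma posdef_nonneg: "posdef P \<Longrightarrow> 0 \<le> x \<bullet> (P *v x)"
  by (cases "x = 0") (auto simp: posdef_def less_imp_le)

text \<open>A zero \<open>(x, y)\<close> of the form \<open>\<mu> (x\<^sup>T P x + y\<^sup>T P y) - x\<^sup>T V y \<ge> 0\<close> with optimal \<open>\<mu>\<close> satisfies
  \<open>V y = 2 \<mu> P x\<close> and \<open>V\<^sup>T x = 2 \<mu> P y\<close>, which contradicts \<open>lyap H V = 0\<close> unless \<open>\<mu> = 0\<close>.\<close>
lemma lyap_eq_0: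
  fixes H V :: "real ^ 'n ^ 'n"
  assumes P: "lyap_stable H P" and V: "lyap H V = 0"
  shows "V = 0"
proof (rule ccontr)
  assume "V \<noteq> 0"
  have symP: "transpose P = P" and posP: "\<And>x. x \<noteq> 0 \<Longrightarrow> 0 < x \<bullet> (P *v x)"
    using P by (auto simp: lyap_stable_def posdef_def)
  have nnP: "0 \<le> x \<bullet> (P *v x)" for x using P by (auto simp: lyap_stable_def posdef_nonneg)
  define D where "D z = fst z \<bullet> (P *v fst z) + snd z \<bullet> (P *v snd z)" for z :: "(real ^ 'n) \<times> (real ^ 'n)"
  define N where "N z = fst z \<bullet> (V *v snd z)" for z :: "(real ^ 'n) \<times> (real ^ 'n)"
  have Dpos: "0 < D z" if "z \<noteq> 0" for z
  proof -
    have "fst z \<noteq> 0 \<or> snd z \<noteq> 0" using that by (metis prod.collapse zero_prod_def)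
    then show ?thesis using posP[of "fst z"] posP[of "snd z"] nnP[of "fst z"] nnP[of "snd z"]
      unfolding D_def by linarith
  qed
  have "continuous_on (sphere 0 1) (\<lambda>z. N z / D z)"
    unfolding N_def D_def
  proof (intro continuous_intros bounded_linear.continuous_on[OF matrix_vector_mul_bounded_linear] ballI)
    fix z :: "(real ^ 'n) \<times> (real ^ 'n)" assume "z \<in> sphere 0 1"
    then have "z \<noteq> 0" by auto
    from Dpos[OF this] show "fst z \<bullet> (P *v fst z) + snd z \<bullet> (P *v snd z) \<noteq> 0" unfolding D_def by simp
  qed
  moreover have "sphere (0 :: (real ^ 'n) \<times> (real ^ 'n)) 1 \<noteq> {}" by simp
  ultimately obtain z where z: "z \<in> sphere 0 1" "\<And>y. y \<in> sphere 0 1 \<Longrightarrow> N y / D y \<le> N z / D z"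
    using continuous_attains_sup[OF compact_sphere, of 0 1 "\<lambda>z. N z / D z"] by auto
  define m where "m = N z / D z"
  have z0: "z \<noteq> 0" using z(1) by auto
  have scale: "N (c *\<^sub>R y) = c\<^sup>2 * N y" "D (c *\<^sub>R y) = c\<^sup>2 * D y" for c y
    by (simp_all add: N_def D_def matrix_vector_mult_scaleR power2_eq_square algebra_simps)
  have le: "N y \<le> m * D y" for y
  proof (cases "y = 0")
    case False
    then have "N ((1 / norm y) *\<^sub>R y) / D ((1 / norm y) *\<^sub>R y) \<le> m"
      unfolding m_def by (intro z(2)) simp
    then have "N y / D y \<le> m" using False unfolding scale by simp
    then show ?thesis using Dpos[OF False] by (simp add: divide_le_eq)
  qed (auto simp: N_def D_def)
  have eq: "N z = m * D z" using Dpos[OF z0] by (simp add: m_def)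
  obtain x y where xy: "z = (x, y)" by (cases z)
  have Pab: "a \<bullet> (P *v b) = b \<bullet> (P *v a)" for a b
    using inner_matrix_vector_left[of P a b] symP by (simp add: inner_commute)
  have Vy: "V *v y = (2 * m) *\<^sub>R (P *v x)"
  proof -
    have "0 \<le> t * (2 * m * (a \<bullet> (P *v x)) - a \<bullet> (V *v y)) + t\<^sup>2 * (m * (a \<bullet> (P *v a)))" for a t
    proof -
      have "N (x + t *\<^sub>R a, y) \<le> m * D (x + t *\<^sub>R a, y)" by (rule le)
      moreover have "N (x, y) = m * D (x, y)" using eq xy by simp
      ultimately show ?thesis using Pab[of x a]
        by (simp add: N_def D_def inner_add_left inner_add_right matrix_vector_right_distrib
          matrix_vector_mult_scaleR power2_eq_square algebra_simps)
    qed
    then have "2 * m * (a \<bullet> (P *v x)) - a \<bullet> (V *v y) = 0" for a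
      by (rule linear_coefficient_zero)
    then have "a \<bullet> (V *v y - (2 * m) *\<^sub>R (P *v x)) = 0" for a
      by (simp add: inner_diff_right)
    then show ?thesis by (metis inner_eq_zero_iff right_minus_eq)
  qed
  have Vx: "transpose V *v x = (2 * m) *\<^sub>R (P *v y)"
  proof -
    have "0 \<le> t * (2 * m * (a \<bullet> (P *v y)) - a \<bullet> (transpose V *v x)) + t\<^sup>2 * (m * (a \<bullet> (P *v a)))" for a t
    proof -
      have "x \<bullet> (V *v a) = a \<bullet> (transpose V *v x)"
        using inner_matrix_vector_left[of "transpose V" x a] by (simp only: transpose_transpose inner_commute)
      moreover have "N (x, y + t *\<^sub>R a) \<le> m * D (x, y + t *\<^sub>R a)" by (rule le)
      moreover have "N (x, y) = m * D (x, y)" using eq xy by simp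
      ultimately show ?thesis using Pab[of y a]
        by (simp add: N_def D_def inner_add_left inner_add_right matrix_vector_right_distrib
          matrix_vector_mult_scaleR power2_eq_square algebra_simps del: transpose_matrix_vector)
    qed
    then have "2 * m * (a \<bullet> (P *v y)) - a \<bullet> (transpose V *v x) = 0" for a
      by (rule linear_coefficient_zero)
    then have "a \<bullet> (transpose V *v x - (2 * m) *\<^sub>R (P *v y)) = 0" for a
      by (simp add: inner_diff_right del: transpose_matrix_vector)
    then show ?thesis by (metis inner_eq_zero_iff right_minus_eq)
  qed
  have "0 = x \<bullet> (lyap H V *v y)" by (simp add: V)
  also have "\<dots> = (2 * m) * ((transpose H *v x) \<bullet> (P *v x) + (P *v y) \<bullet> (transpose H *v y))"
    unfolding lyap_bilinear Vx Vy by (simp add: algebra_simps del: transpose_matrix_vector)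
  also have "\<dots> = m * (x \<bullet> (lyap H P *v x) + y \<bullet> (lyap H P *v y))"
    unfolding lyap_quadratic[OF symP] by (simp add: inner_commute algebra_simps del: transpose_matrix_vector)
  finally have "m * (x \<bullet> (lyap H P *v x) + y \<bullet> (lyap H P *v y)) = 0" by simp
  moreover have neg: "a \<bullet> (lyap H P *v a) < 0" if "a \<noteq> 0" for a
    using P that by (simp add: lyap_stable_def)
  have "x \<bullet> (lyap H P *v x) + y \<bullet> (lyap H P *v y) < 0"
    using neg[of x] neg[of y] z0 xy by (cases "x = 0"; cases "y = 0") (auto simp: zero_prod_def)
  ultimately have "m = 0" by simp
  \<comment> \<open>For \<open>m = 0\<close> the bilinear form of \<open>V\<close> is nowhere
    positive; choosing its first argument as \<open>V *v b\<close> turns it into a squared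
    norm.\<close>
  then have le0: "a \<bullet> (V *v b) \<le> 0" for a b using le[of "(a, b)"] by (simp add: N_def)
  have "(V *v b) \<bullet> (V *v b) \<le> 0" for b by (rule le0)
  then have "V *v b = 0" for b by (metis inner_gt_zero_iff not_less)
  then have "V = 0" unfolding matrix_eq by simp
  then show False using \<open>V \<noteq> 0\<close> by simp
qed

text \<open>Let \<open>m\<close> be the least ratio of the form of \<open>V\<close> to that of
  \<open>P\<close>, attained at \<open>v\<close>. If \<open>m\<close> were negative,
  \<open>W = V - m P\<close> would be positive semidefinite with null vector \<open>v\<close>, so
  that its \<open>lyap\<close> form would vanish at \<open>v\<close>. By linearity this value is
  also the nonpositive form of \<open>lyap H V\<close> minus a positive number.\<close>

lemma lyap_nonneg:
  fixes H V :: "real ^ 'n ^ 'n"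
  assumes P: "lyap_stable H P" and sym: "transpose V = V" and V: "\<And>x. x \<bullet> (lyap H V *v x) \<le> 0"
  shows "0 \<le> x \<bullet> (V *v x)"
proof -
  have symP: "transpose P = P" and posP: "\<And>x. x \<noteq> 0 \<Longrightarrow> 0 < x \<bullet> (P *v x)"
    using P by (auto simp: lyap_stable_def posdef_def)
  have "continuous_on (sphere 0 1) (\<lambda>x. (x \<bullet> (V *v x)) / (x \<bullet> (P *v x)))"
  proof (intro continuous_intros ballI)
    fix x :: "real ^ 'n" assume "x \<in> sphere 0 1"
    then have "x \<noteq> 0" by auto
    from posP[OF this] show "x \<bullet> (P *v x) \<noteq> 0" by simp
  qed
  moreover have "sphere (0 :: real ^ 'n) 1 \<noteq> {}" by simp
  ultimately obtain v where v: "v \<in> sphere 0 1"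
    "\<And>y. y \<in> sphere 0 1 \<Longrightarrow> (v \<bullet> (V *v v)) / (v \<bullet> (P *v v)) \<le> (y \<bullet> (V *v y)) / (y \<bullet> (P *v y))"
    using continuous_attains_inf[OF compact_sphere, of 0 1 "\<lambda>x. (x \<bullet> (V *v x)) / (x \<bullet> (P *v x))"] by auto
  define m where "m = (v \<bullet> (V *v v)) / (v \<bullet> (P *v v))"
  have v0: "v \<noteq> 0" using v(1) by auto
  have le: "m * (y \<bullet> (P *v y)) \<le> y \<bullet> (V *v y)" for y
  proof (cases "y = 0")
    case False
    then have "m \<le> ((1 / norm y) *\<^sub>R y \<bullet> (V *v ((1 / norm y) *\<^sub>R y))) / ((1 / norm y) *\<^sub>R y \<bullet> (P *v ((1 / norm y) *\<^sub>R y)))"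
      unfolding m_def by (intro v(2)) simp
    then have "m \<le> (y \<bullet> (V *v y)) / (y \<bullet> (P *v y))" using False by (simp add: matrix_vector_mult_scaleR)
    then show ?thesis using posP[OF False] by (simp add: le_divide_eq)
  qed auto
  have "0 \<le> m"
  proof (rule ccontr)
    assume "\<not> 0 \<le> m"
    define W where "W = V + (- m) *\<^sub>R P"
    have Wx: "W *v y = V *v y - m *\<^sub>R (P *v y)" for y
      by (simp add: W_def matrix_vector_mult_diff_rdistrib matrix_vector_mult_add_rdistrib scaleR_matrix_vector_assoc[symmetric])
    have symW: "transpose W = W" using sym symP by (simp add: W_def transpose_diff transpose_add transpose_scalar)
    have "psd W" unfolding psd_def using le symW by (simp add: Wx inner_diff_right)
    moreover have "v \<bullet> (W *v v) = 0" using posP[OF v0] by (simp add: Wx inner_diff_right m_def)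
    ultimately have "W *v v = 0" by (rule psd_null)
    then have "v \<bullet> (lyap H W *v v) = 0" by (simp only: lyap_quadratic[OF symW] inner_zero_right mult_zero_right)
    moreover have "v \<bullet> (lyap H W *v v) = v \<bullet> (lyap H V *v v) - m * (v \<bullet> (lyap H P *v v))"
      unfolding W_def lyap_add lyap_scale
      by (simp add: matrix_vector_mult_diff_rdistrib matrix_vector_mult_add_rdistrib scaleR_matrix_vector_assoc[symmetric] inner_diff_right)
    moreover have "m * (v \<bullet> (lyap H P *v v)) > 0"
      using P v0 \<open>\<not> 0 \<le> m\<close> by (simp add: lyap_stable_def mult_neg_neg)
    ultimately show False using V[of v] by linarith
  qed
  then have "0 \<le> m * (x \<bullet> (P *v x))"
    using P by (intro mult_nonneg_nonneg posdef_nonneg) (simp_all add: lyap_stable_def)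
  then show ?thesis using le[of x] by linarith
qed

lemma posdef_of_lyap_neg:
  assumes "psd V" "\<And>x. x \<noteq> 0 \<Longrightarrow> x \<bullet> (lyap H V *v x) < 0"
  shows "posdef V"
  unfolding posdef_def
proof (intro conjI allI impI)
  show sym: "transpose V = V" using assms(1) by (simp add: psd_def)
  fix x :: "real ^ 'a" assume "x \<noteq> 0"
  show "0 < x \<bullet> (V *v x)"
  proof (rule ccontr)
    assume "\<not> ?thesis"
    then have "x \<bullet> (V *v x) = 0" using assms(1) by (simp add: psd_def order.antisym not_less)
    then have "V *v x = 0" using assms(1) psd_null by blast
    then have "x \<bullet> (lyap H V *v x) = 0" by (simp only: lyap_quadratic[OF sym] inner_zero_right mult_zero_right)
    then show False using assms(2)[OF \<open>x \<noteq> 0\<close>] by simp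
  qed
qed

lemma minus_mat1_vec: "(- mat 1 :: real ^ 'n ^ 'n) *v x = - x"
proof -
  have "(- mat 1 :: real ^ 'n ^ 'n) *v x = (0 - mat 1) *v x" by simp
  also have "\<dots> = - x" unfolding matrix_vector_mult_diff_rdistrib by simp
  finally show ?thesis .
qed

text \<open>In finite dimension the injectivity given by \<open>lyap_eq_0\<close> already yields a
  solution. It is symmetric by uniqueness, because its transpose solves the same equation.\<close>

lemma lyap_solution:
  fixes H :: "real ^ 'n ^ 'n"
  assumes P: "lyap_stable H P"
  obtains V where "lyap H V = - mat 1" "posdef V"
proof -
  have "inj (lyap H)"
    unfolding linear_injective_0[OF linear_lyap] using lyap_eq_0[OF P] by blast
  then have "surj (lyap H)"
    using linear_lyap linear_injective_imp_surjective by blast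
  then obtain V where V: "lyap H V = - mat 1" by (metis surjD)
  have "transpose (- mat 1 :: real ^ 'n ^ 'n) = - mat 1" by (simp add: transpose_def mat_def vec_eq_iff)
  then have "lyap H (transpose V - V) = 0"
    unfolding linear_diff[OF linear_lyap] lyap_transpose V by simp
  then have sym: "transpose V = V" using lyap_eq_0[OF P] by fastforce
  have q: "x \<bullet> (lyap H V *v x) = - (x \<bullet> x)" for x by (simp add: V minus_mat1_vec)
  have "0 \<le> x \<bullet> (V *v x)" for x
    by (rule lyap_nonneg[OF P sym]) (simp add: q)
  then have "psd V" using sym by (simp add: psd_def)
  then have "posdef V" by (rule posdef_of_lyap_neg[of _ H]) (simp add: q)
  with V that show ?thesis by blast
qed

section \<open>From the Hurwitz condition to a certificate, by continuation in a shift\<close>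

lemma symmetric_quadratic_sup:
  fixes A :: "real ^ 'n ^ 'n"
  assumes "transpose A = A"
  shows "\<exists>v l. v \<noteq> 0 \<and> v \<bullet> (A *v v) = l * (v \<bullet> v) \<and> (\<forall>x. x \<bullet> (A *v x) \<le> l * (x \<bullet> x))"
proof -
  have "axis undefined 1 \<noteq> (0 :: real ^ 'n)" by (simp add: axis_eq_0_iff)
  then have "UNIV \<noteq> {0 :: real ^ 'n}" by blast
  then obtain v l where "norm v = 1" "A *v v = l *\<^sub>R v" "\<And>x. x \<bullet> (A *v x) \<le> l * (x \<bullet> x)"
    using symmetric_max_eigenvector[OF assms subspace_UNIV] by auto
  then show ?thesis by (intro exI[of _ v] exI[of _ l]) auto
qed

text \<open>The starting point of the continuation: once the shift exceeds an operator bound of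
  \<open>transpose H\<close>, the identity matrix is a certificate.\<close>

lemma lyap_stable_large_shift:
  fixes H :: "real ^ 'n ^ 'n"
  shows "\<exists>s\<ge>0. lyap_stable (H - s *\<^sub>R mat 1) (mat 1)"
proof -
  obtain K where K: "0 < K" "\<And>x. norm (transpose H *v x) \<le> norm x * K"
    using bounded_linear.pos_bounded[OF matrix_vector_mul_bounded_linear[of "transpose H"]] by blast
  have "x \<bullet> (lyap (H - (K + 1) *\<^sub>R mat 1) (mat 1) *v x) < 0" if "x \<noteq> 0" for x :: "real ^ 'n"
  proof -
    have "x \<bullet> (lyap H (mat 1) *v x) = 2 * ((transpose H *v x) \<bullet> x)"
      by (subst lyap_quadratic) (simp_all del: transpose_matrix_vector)
    also have "(transpose H *v x) \<bullet> x \<le> norm (transpose H *v x) * norm x"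
      by (rule norm_cauchy_schwarz)
    also have "\<dots> \<le> (norm x * K) * norm x" by (intro mult_right_mono K) simp
    also have "\<dots> = K * (x \<bullet> x)" by (simp add: dot_square_norm power2_eq_square)
    finally have "x \<bullet> (lyap H (mat 1) *v x) \<le> 2 * K * (x \<bullet> x)" by simp
    moreover have "0 < x \<bullet> x" using that by simp
    moreover have "x \<bullet> (lyap (H - (K + 1) *\<^sub>R mat 1) (mat 1) *v x) =
        x \<bullet> (lyap H (mat 1) *v x) - 2 * (K + 1) * (x \<bullet> x)"
      unfolding lyap_shift by (simp add: matrix_vector_mult_diff_rdistrib inner_diff_right scaleR_matrix_vector_assoc[symmetric])
    moreover have "2 * (K + 1) * (x \<bullet> x) = 2 * K * (x \<bullet> x) + 2 * (x \<bullet> x)" by (simp add: algebra_simps)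
    ultimately show ?thesis by linarith
  qed
  then have "lyap_stable (H - (K + 1) *\<^sub>R mat 1) (mat 1)"
    by (simp add: lyap_stable_def posdef_def)
  then show ?thesis using K(1) by (intro exI[of _ "K + 1"]) simp
qed

text \<open>With \<open>P\<close> fixed, lowering the shift by \<open>e\<close> adds
  \<open>2 * e\<close> times the form of \<open>P\<close> to the negative definite form, which by
  compactness has a margin.\<close>

lemma lyap_stable_open:
  fixes H :: "real ^ 'n ^ 'n"
  assumes "lyap_stable (H - s *\<^sub>R mat 1) P"
  obtains d where "0 < d" "\<And>e. 0 \<le> e \<Longrightarrow> e \<le> d \<Longrightarrow> lyap_stable (H - (s - e) *\<^sub>R mat 1) P"
proof -
  let ?L = "lyap (H - s *\<^sub>R mat 1) P"
  have symP: "transpose P = P" using assms by (simp add: lyap_stable_def posdef_def)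
  then have symL: "transpose ?L = ?L" by (simp flip: lyap_transpose)
  obtain v l where v: "v \<noteq> 0" "v \<bullet> (?L *v v) = l * (v \<bullet> v)" "\<And>x. x \<bullet> (?L *v x) \<le> l * (x \<bullet> x)"
    using symmetric_quadratic_sup[OF symL] by blast
  obtain w m where m: "w \<noteq> 0" "w \<bullet> (P *v w) = m * (w \<bullet> w)" "\<And>x. x \<bullet> (P *v x) \<le> m * (x \<bullet> x)"
    using symmetric_quadratic_sup[OF symP] by blast
  have l: "l < 0"
  proof -
    have "v \<bullet> (?L *v v) < 0" using assms v(1) unfolding lyap_stable_def by blast
    then have "l * (v \<bullet> v) < 0" unfolding v(2) .
    then show ?thesis using inner_ge_zero[of v] by (auto simp: mult_less_0_iff)
  qed
  have m0: "0 < m"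
  proof -
    have "0 < w \<bullet> (P *v w)" using assms m(1) unfolding lyap_stable_def posdef_def by blast
    then have "0 < m * (w \<bullet> w)" unfolding m(2) .
    then show ?thesis using inner_ge_zero[of w] by (auto simp: zero_less_mult_iff)
  qed
  \<comment> \<open>Uses up half of the margin: \<open>2 * d * m = - l / 2\<close>.\<close>
  define d where "d = - l / (4 * m)"
  have "0 < d" using l m0 by (simp add: d_def divide_neg_pos)
  moreover have "lyap_stable (H - (s - e) *\<^sub>R mat 1) P" if e: "0 \<le> e" "e \<le> d" for e
    unfolding lyap_stable_def
  proof (intro conjI allI impI)
    show "posdef P" using assms by (simp add: lyap_stable_def)
    fix x :: "real ^ 'n" assume x: "x \<noteq> 0"
    have "x \<bullet> (lyap (H - (s - e) *\<^sub>R mat 1) P *v x) = x \<bullet> (?L *v x) + 2 * e * (x \<bullet> (P *v x))"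
      unfolding lyap_shift
      by (simp add: matrix_vector_mult_diff_rdistrib inner_diff_right scaleR_matrix_vector_assoc[symmetric] algebra_simps)
    also have "\<dots> \<le> l * (x \<bullet> x) + 2 * e * (m * (x \<bullet> x))"
      using e by (intro add_mono v(3) mult_left_mono m(3)) auto
    also have "\<dots> \<le> l * (x \<bullet> x) + 2 * d * (m * (x \<bullet> x))"
      using e m0 by (intro add_left_mono mult_right_mono) auto
    also have "\<dots> = (l / 2) * (x \<bullet> x)" using m0 by (simp add: d_def field_simps)
    also have "\<dots> < 0" using l x by (simp add: mult_neg_pos)
    finally show "x \<bullet> (lyap (H - (s - e) *\<^sub>R mat 1) P *v x) < 0" .
  qed
  ultimately show ?thesis by (rule that)
qed

abbreviation cmat :: "real ^ 'n ^ 'n \<Rightarrow> complex ^ 'n ^ 'n" where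
  "cmat A \<equiv> (\<chi> i j. complex_of_real (A $ i $ j))"

lemma cmat_vec: "(cmat A *v (\<chi> i. Complex (a $ i) (b $ i))) = (\<chi> i. Complex ((A *v a) $ i) ((A *v b) $ i))"
  by (simp add: vec_eq_iff matrix_vector_mult_def complex_eq_iff)

text \<open>On the range of \<open>W\<close> the matrix \<open>G\<close> is similar to a skew-symmetric one, so that it has a
  purely imaginary eigenvalue; maximising \<open>y\<^sup>T G W G\<^sup>T y / y\<^sup>T W y\<close> yields \<open>G\<^sup>2 u = - w\<^sup>2 u\<close>.\<close>
lemma lyap_null_imaginary_eigenvalue:
  fixes G W :: "real ^ 'n ^ 'n"
  assumes W: "psd W" "W \<noteq> 0" and G: "lyap G W = 0"
  shows "\<exists>w::real. mat_eigenvalue (cmat G) (Complex 0 w)"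
proof -
  have symW: "transpose W = W" and nnW: "\<And>x. 0 \<le> x \<bullet> (W *v x)" using W by (auto simp: psd_def)
  have comm: "G *v (W *v x) = - (W *v (transpose G *v x))" for x
  proof -
    have "lyap G W *v x = 0" by (simp add: G)
    then show ?thesis unfolding lyap_vec by (simp only: eq_neg_iff_add_eq_0)
  qed
  have Wab: "a \<bullet> (W *v b) = b \<bullet> (W *v a)" for a b
    using inner_matrix_vector_left[of W a b] symW by (simp add: inner_commute)
  define R where "R = range (\<lambda>x. W *v x)"
  have sub: "subspace R"
    unfolding R_def by (rule linear_subspace_image[OF matrix_vector_mul_linear subspace_UNIV])
  have posR: "0 < y \<bullet> (W *v y)" if y: "y \<in> R" "y \<noteq> 0" for y
  proof (rule ccontr)
    assume "\<not> ?thesis"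
    then have "y \<bullet> (W *v y) = 0" using nnW[of y] by linarith
    then have z: "W *v y = 0" using W(1) psd_null by blast
    obtain x where x: "y = W *v x" using y by (auto simp: R_def)
    have "y \<bullet> y = x \<bullet> (W *v y)" using Wab[of y x] by (simp add: x)
    then show False using z y by simp
  qed
  obtain x0 where "W *v x0 \<noteq> 0" using W(2) by (metis matrix_eq matrix_vector_mult_0)
  then have ne: "sphere 0 1 \<inter> R \<noteq> {}"
  proof -
    have "(1 / norm (W *v x0)) *\<^sub>R (W *v x0) \<in> R"
      by (rule subspace_scale[OF sub]) (simp add: R_def)
    moreover have "norm ((1 / norm (W *v x0)) *\<^sub>R (W *v x0)) = 1" using \<open>W *v x0 \<noteq> 0\<close> by simp
    ultimately show ?thesis by (auto simp del: norm_scaleR)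
  qed
  define N where "N y = (transpose G *v y) \<bullet> (W *v (transpose G *v y))" for y
  have "compact (sphere 0 1 \<inter> R)" using sub by (simp add: closed_subspace compact_Int_closed)
  moreover have "continuous_on (sphere 0 1 \<inter> R) (\<lambda>y. N y / (y \<bullet> (W *v y)))"
    unfolding N_def
  proof (intro continuous_intros bounded_linear.continuous_on[OF matrix_vector_mul_bounded_linear] ballI)
    fix y assume "y \<in> sphere 0 1 \<inter> R"
    then have "y \<in> R" "y \<noteq> 0" by auto
    from posR[OF this] show "y \<bullet> (W *v y) \<noteq> 0" by simp
  qed
  ultimately have "\<exists>v\<in>sphere 0 1 \<inter> R. \<forall>y\<in>sphere 0 1 \<inter> R. N y / (y \<bullet> (W *v y)) \<le> N v / (v \<bullet> (W *v v))"
    using ne by (intro continuous_attains_sup)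
  then obtain v where v: "v \<in> sphere 0 1 \<inter> R"
    "\<And>y. y \<in> sphere 0 1 \<inter> R \<Longrightarrow> N y / (y \<bullet> (W *v y)) \<le> N v / (v \<bullet> (W *v v))"
    by blast
  define m where "m = N v / (v \<bullet> (W *v v))"
  have v0: "v \<noteq> 0" "v \<in> R" using v(1) by auto
  have m0: "0 \<le> m" unfolding m_def N_def using nnW by (intro divide_nonneg_nonneg) auto
  have scale: "N (c *\<^sub>R y) = c\<^sup>2 * N y" for c y
    by (simp add: N_def matrix_vector_mult_scaleR power2_eq_square algebra_simps del: transpose_matrix_vector)
  have le: "N y \<le> m * (y \<bullet> (W *v y))" if "y \<in> R" for y
  proof (cases "y = 0")
    case True
    then show ?thesis by (simp add: N_def del: transpose_matrix_vector)
  next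
    case False
    have "(1 / norm y) *\<^sub>R y \<in> sphere 0 1 \<inter> R" using that False sub by (simp add: subspace_scale)
    from v(2)[OF this] have "N y / (y \<bullet> (W *v y)) \<le> m"
      using False unfolding scale by (simp add: m_def matrix_vector_mult_scaleR power2_eq_square)
    then show ?thesis using posR[OF that False] by (simp add: divide_le_eq)
  qed
  define B where "B = m *\<^sub>R W - G ** W ** transpose G"
  have Bx: "B *v y = m *\<^sub>R (W *v y) - G *v (W *v (transpose G *v y))" for y
    by (simp add: B_def matrix_vector_mult_diff_rdistrib matrix_vector_mul_assoc[symmetric]
      scaleR_matrix_vector_assoc[symmetric] del: transpose_matrix_vector)
  have yB: "y \<bullet> (B *v y) = m * (y \<bullet> (W *v y)) - N y" for y
  proof -
    have "N y = y \<bullet> (G *v (W *v (transpose G *v y)))"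
      unfolding N_def by (simp only: inner_matrix_vector_left transpose_transpose)
    then show ?thesis unfolding Bx inner_diff_right by simp
  qed
  have "transpose B = B"
    by (simp add: B_def transpose_diff transpose_scalar symW matrix_transpose_mul matrix_mul_assoc)
  moreover have "0 \<le> y \<bullet> (B *v y)" if "y \<in> R" for y using le[OF that] yB by simp
  moreover have "v \<bullet> (B *v v) = 0" using yB[of v] posR[OF v0(2,1)] by (simp add: m_def)
  \<comment> \<open>Moving \<open>G\<close> past \<open>W\<close> by \<open>comm\<close> shows that
    \<open>B *v v\<close> is again in the range of \<open>W\<close>, so that it may serve as its own
    test vector in \<open>psd_form_null\<close>.\<close>
  moreover have Bv: "B *v v = W *v (m *\<^sub>R v + transpose G *v (transpose G *v v))"
    unfolding Bx comm[of "transpose G *v v"] matrix_vector_right_distrib matrix_vector_mult_scaleR by simp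
  then have "B *v v \<in> R" by (auto simp: R_def simp del: transpose_matrix_vector)
  ultimately have "(B *v v) \<bullet> (B *v v) = 0"
    using psd_form_null[of B R v "B *v v"] sub v0(2) by blast
  then have B0: "B *v v = 0" by simp
  define u where "u = W *v v"
  have u0: "u \<noteq> 0" using posR[OF v0(2,1)] by (auto simp: u_def)
  have GGu: "G *v (G *v u) = - (m *\<^sub>R u)"
  proof -
    have "G *v (G *v u) = - (G *v (W *v (transpose G *v v)))"
      unfolding u_def comm[of v] by (simp add: vec.neg del: transpose_matrix_vector)
    also have "G *v (W *v (transpose G *v v)) = m *\<^sub>R u" using B0 unfolding Bx u_def by simp
    finally show ?thesis .
  qed
  define w where "w = sqrt m"
  have ww: "w * w = m" using m0 by (simp add: w_def)
  show ?thesis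
  \<comment> \<open>By \<open>GGu\<close> the vector with real part \<open>G *v u\<close> and
    imaginary part \<open>w *\<^sub>R u\<close> is mapped to \<open>i w\<close> times itself. It
    degenerates to 0 exactly if \<open>m = 0\<close> and \<open>G *v u = 0\<close>, and then
    \<open>u\<close> is an eigenvector for the eigenvalue 0.\<close>
  proof (cases "m = 0 \<and> G *v u = 0")
    case True
    define z :: "complex ^ 'n" where "z = (\<chi> i. Complex (u $ i) ((0 :: real ^ 'n) $ i))"
    have "z \<noteq> 0" using u0 by (auto simp: z_def vec_eq_iff complex_eq_iff)
    moreover have "cmat G *v z = Complex 0 0 *s z"
      unfolding z_def cmat_vec using True by (simp add: vec_eq_iff complex_eq_iff)
    ultimately show ?thesis unfolding mat_eigenvalue_def by blast
  next
    case False
    define z :: "complex ^ 'n" where "z = (\<chi> i. Complex ((G *v u) $ i) ((w *\<^sub>R u) $ i))"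
    have "z \<noteq> 0"
    proof
      assume z: "z = 0"
      then have "G *v u = 0" "w *\<^sub>R u = 0" by (auto simp: z_def vec_eq_iff complex_eq_iff)
      then show False using False u0 ww by auto
    qed
    moreover have "cmat G *v z = Complex 0 w *s z"
      unfolding z_def cmat_vec GGu matrix_vector_mult_scaleR
      by (simp add: vec_eq_iff complex_eq_iff ww[symmetric] mult.assoc)
    ultimately show ?thesis unfolding mat_eigenvalue_def by blast
  qed
qed

text \<open>If \<open>H\<close> had no certificate, the infimum \<open>s\<close> of the certified
  shifts would not be attained, because a certificate survives a small decrease of the shift.
  Normalised Lyapunov solutions for certified shifts tending to \<open>s\<close> accumulate at some
  \<open>Wl\<close> with right-hand side \<open>- (cl *\<^sub>R mat 1)\<close>. If \<open>cl\<close>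
  is positive, \<open>Wl\<close> certifies \<open>s\<close> itself. If \<open>cl = 0\<close>, then
  \<open>Wl\<close> is a nonzero positive semidefinite element of the kernel, which gives
  \<open>H\<close> an eigenvalue with real part \<open>s\<close>, and \<open>s\<close> is
  nonnegative.\<close>

lemma hurwitz_lyap_stable:
  fixes H :: "real ^ 'n ^ 'n"
  assumes H: "hurwitz H"
  shows "\<exists>P. lyap_stable H P"
proof (rule ccontr)
  assume neg: "\<not> ?thesis"
  define T where "T = {s. 0 \<le> s \<and> (\<exists>P. lyap_stable (H - s *\<^sub>R mat 1) P)}"
  have T0: "T \<noteq> {}" using lyap_stable_large_shift[of H] by (auto simp: T_def)
  have bdd: "bdd_below T" by (rule bdd_belowI[of _ 0]) (simp add: T_def)
  define s where "s = Inf T"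
  have s0: "0 \<le> s" unfolding s_def using T0 by (intro cInf_greatest) (auto simp: T_def)
  have sT: "s \<notin> T"
  proof
    assume "s \<in> T"
    then obtain P where P: "lyap_stable (H - s *\<^sub>R mat 1) P" by (auto simp: T_def)
    then have "s \<noteq> 0" using neg by auto
    obtain d where d: "0 < d" "\<And>e. 0 \<le> e \<Longrightarrow> e \<le> d \<Longrightarrow> lyap_stable (H - (s - e) *\<^sub>R mat 1) P"
      using lyap_stable_open[OF P] by blast
    \<comment> \<open>The cut at \<open>s\<close> keeps the new shift nonnegative, as
      \<open>T\<close> demands.\<close>
    define e where "e = min d s"
    have "s - e \<in> T" using d(2)[of e] d(1) s0 by (auto simp: T_def e_def)
    then have "s \<le> s - e" unfolding s_def using bdd by (intro cInf_lower)
    then show False using d(1) s0 \<open>s \<noteq> 0\<close> by (auto simp: e_def)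
  qed
  have "\<exists>t. t \<in> T \<and> t < s + inverse (real (Suc n))" for n
    using cInf_lessD[OF T0, of "s + inverse (real (Suc n))"] by (auto simp: s_def)
  then obtain t where t: "\<And>n. t n \<in> T" "\<And>n. t n < s + inverse (real (Suc n))" by metis
  have ts: "s \<le> t n" for n unfolding s_def using bdd t(1) by (intro cInf_lower)
  have tlim: "t \<longlonglongrightarrow> s"
  proof (rule real_tendsto_sandwich[of "\<lambda>_. s" _ _ "\<lambda>n. s + inverse (real (Suc n))"])
    show "(\<lambda>n. s + inverse (real (Suc n))) \<longlonglongrightarrow> s"
      using tendsto_add[OF tendsto_const LIMSEQ_inverse_real_of_nat, of s] by simp
  qed (use ts t(2) in \<open>auto intro!: always_eventually less_imp_le simp del: of_nat_Suc\<close>)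
  have "\<exists>V. lyap (H - t n *\<^sub>R mat 1) V = - mat 1 \<and> posdef V" for n
  proof -
    obtain P where P: "lyap_stable (H - t n *\<^sub>R mat 1) P" using t(1)[of n] by (auto simp: T_def)
    show ?thesis by (rule lyap_solution[OF P]) blast
  qed
  then obtain V where V: "\<And>n. lyap (H - t n *\<^sub>R mat 1) (V n) = - mat 1" "\<And>n. posdef (V n)" by metis
  have mat1: "mat 1 \<noteq> (0 :: real ^ 'n ^ 'n)" by (simp add: mat_def vec_eq_iff)
  have V0: "V n \<noteq> 0" for n
  proof
    assume "V n = 0"
    then have "lyap (H - t n *\<^sub>R mat 1) 0 = - mat 1" using V(1)[of n] by simp
    then have "- mat 1 = (0 :: real ^ 'n ^ 'n)" unfolding linear_0[OF linear_lyap] by simp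
    then show False using mat1 by simp
  qed
  \<comment> \<open>The solutions \<open>V n\<close> may blow up when the shifts approach
    \<open>s\<close>. After normalisation a blow-up shows as \<open>c n\<close> tending to 0 and
    costs no compactness.\<close>
  define c where "c n = 1 / norm (V n)" for n
  define W where "W n = c n *\<^sub>R V n" for n
  have c0: "0 < c n" for n using V0 by (simp add: c_def)
  have W1: "norm (W n) = 1" for n using V0 by (simp add: W_def c_def)
  have WH: "lyap H (W n) - (2 * t n) *\<^sub>R W n = - (c n *\<^sub>R mat 1)" for n
  proof -
    have "c n *\<^sub>R (lyap H (V n) - (2 * t n) *\<^sub>R V n) = c n *\<^sub>R (- mat 1)"
      using V(1)[of n] by (simp only: lyap_shift)
    then show ?thesis by (simp add: W_def lyap_scale scaleR_diff_right mult.commute)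
  qed
  obtain K where K: "\<And>X. norm (lyap H X) \<le> norm X * K"
    using bounded_linear.bounded[of "lyap H"] linear_lyap[of H] linear_conv_bounded_linear by blast
  \<comment> \<open>The normalised equation itself bounds \<open>c n\<close>, so that the pairs
    \<open>(W n, c n)\<close> have a convergent subsequence.\<close>
  have cb: "c n * norm (mat 1 :: real ^ 'n ^ 'n) \<le> K + 2 * (s + 1)" for n
  proof -
    have "c n * norm (mat 1 :: real ^ 'n ^ 'n) = norm (lyap H (W n) - (2 * t n) *\<^sub>R W n)"
      using c0[of n] by (simp add: WH)
    also have "\<dots> \<le> norm (lyap H (W n)) + norm ((2 * t n) *\<^sub>R W n)" by (rule norm_triangle_ineq4)
    also have "\<dots> \<le> K + 2 * t n" using K[of "W n"] ts[of n] s0 by (simp add: W1)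
    also have "t n \<le> s + 1" using t(2)[of n] by (smt (verit) inverse_le_1_iff of_nat_Suc of_nat_0_le_iff)
    finally show ?thesis by simp
  qed
  have "bounded (range (\<lambda>n. (W n, c n)))"
  proof (rule boundedI)
    fix z assume "z \<in> range (\<lambda>n. (W n, c n))"
    then obtain n where z: "z = (W n, c n)" by blast
    have "norm z \<le> norm (W n) + norm (c n)" unfolding z by (rule norm_Pair_le)
    also have "c n \<le> (K + 2 * (s + 1)) / norm (mat 1 :: real ^ 'n ^ 'n)"
      using cb[of n] mat1 by (simp add: le_divide_eq)
    then have "norm (c n) \<le> (K + 2 * (s + 1)) / norm (mat 1 :: real ^ 'n ^ 'n)" using c0[of n] by simp
    finally show "norm z \<le> 1 + (K + 2 * (s + 1)) / norm (mat 1 :: real ^ 'n ^ 'n)" by (simp add: W1)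
  qed
  then obtain l r where r: "strict_mono (r :: nat \<Rightarrow> nat)" "((\<lambda>n. (W n, c n)) \<circ> r) \<longlonglongrightarrow> l"
    using bounded_imp_convergent_subsequence by blast
  define Wl where "Wl = fst l"
  define cl where "cl = snd l"
  have Wlim: "(\<lambda>n. W (r n)) \<longlonglongrightarrow> Wl" using tendsto_fst[OF r(2)] by (simp add: Wl_def comp_def)
  have clim: "(\<lambda>n. c (r n)) \<longlonglongrightarrow> cl" using tendsto_snd[OF r(2)] by (simp add: cl_def comp_def)
  have trlim: "(\<lambda>n. t (r n)) \<longlonglongrightarrow> s" using LIMSEQ_subseq_LIMSEQ[OF tlim r(1)] by (simp add: comp_def)
  have eqlim: "lyap H Wl - (2 * s) *\<^sub>R Wl = - (cl *\<^sub>R mat 1)"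
  proof (rule LIMSEQ_unique)
    have "(\<lambda>n. lyap H (W (r n))) \<longlonglongrightarrow> lyap H Wl"
    proof -
      have bl: "bounded_linear (lyap H)" using linear_lyap[of H] linear_conv_bounded_linear by blast
      show ?thesis by (rule bounded_linear.tendsto[OF bl Wlim])
    qed
    then show "(\<lambda>n. lyap H (W (r n)) - (2 * t (r n)) *\<^sub>R W (r n)) \<longlonglongrightarrow> lyap H Wl - (2 * s) *\<^sub>R Wl"
      by (intro tendsto_intros Wlim trlim)
    show "(\<lambda>n. lyap H (W (r n)) - (2 * t (r n)) *\<^sub>R W (r n)) \<longlonglongrightarrow> - (cl *\<^sub>R mat 1)"
      unfolding WH by (intro tendsto_intros clim)
  qed
  have cl0: "0 \<le> cl" using clim c0 by (intro LIMSEQ_le_const[OF clim]) (auto intro: less_imp_le)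
  have Wl1: "norm Wl = 1" using LIMSEQ_unique[OF tendsto_norm[OF Wlim]] by (simp add: W1)
  have psdWl: "psd Wl"
    unfolding psd_def
  proof (intro conjI allI)
    have "Wl $ j $ i = Wl $ i $ j" for i j
    proof (rule LIMSEQ_unique)
      show "(\<lambda>n. W (r n) $ i $ j) \<longlonglongrightarrow> Wl $ i $ j" by (intro tendsto_intros Wlim)
      have "W n $ i $ j = W n $ j $ i" for n
      proof -
        have "transpose (W n) = W n" using V(2)[of n] by (simp add: W_def posdef_def transpose_scalar)
        then show ?thesis by (metis transpose_def vec_lambda_beta)
      qed
      then have "(\<lambda>n. W (r n) $ i $ j) = (\<lambda>n. W (r n) $ j $ i)" by blast
      then show "(\<lambda>n. W (r n) $ i $ j) \<longlonglongrightarrow> Wl $ j $ i" by (simp add: tendsto_vec_nth Wlim)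
    qed
    then show "transpose Wl = Wl" by (simp add: transpose_def vec_eq_iff)
    fix x
    have "(\<lambda>n. x \<bullet> (W (r n) *v x)) \<longlonglongrightarrow> x \<bullet> (Wl *v x)"
      unfolding matrix_vector_mult_def inner_vec_def vec_lambda_beta by (intro tendsto_intros Wlim)
    moreover have "0 \<le> x \<bullet> (W n *v x)" for n
      using posdef_nonneg[OF V(2), of x n] c0[of n]
      by (simp add: W_def scaleR_matrix_vector_assoc[symmetric] less_imp_le)
    ultimately show "0 \<le> x \<bullet> (Wl *v x)" by (intro LIMSEQ_le_const) auto
  qed
  have lyapWl: "lyap (H - s *\<^sub>R mat 1) Wl = - (cl *\<^sub>R mat 1)" unfolding lyap_shift eqlim ..
  show False
  proof (cases "cl = 0")
    case False
    have q: "x \<bullet> (lyap (H - s *\<^sub>R mat 1) Wl *v x) < 0" if "x \<noteq> 0" for x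
    proof -
      have "lyap (H - s *\<^sub>R mat 1) Wl *v x = cl *\<^sub>R ((- mat 1) *v x)"
        unfolding lyapWl scaleR_matrix_vector_assoc by simp
      then show ?thesis using that False cl0 by (simp add: minus_mat1_vec)
    qed
    then have "posdef Wl" using psdWl posdef_of_lyap_neg by blast
    then have "lyap_stable (H - s *\<^sub>R mat 1) Wl" using q by (simp add: lyap_stable_def)
    then show False using sT s0 by (auto simp: T_def)
  next
    case True
    have "Wl \<noteq> 0" using Wl1 by auto
    then have "\<exists>w. mat_eigenvalue (cmat (H - s *\<^sub>R mat 1)) (Complex 0 w)"
      using lyap_null_imaginary_eigenvalue[OF psdWl, of "H - s *\<^sub>R mat 1"] lyapWl True by fastforce
    then obtain w v where v: "v \<noteq> 0" "cmat (H - s *\<^sub>R mat 1) *v v = Complex 0 w *s v"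
      unfolding mat_eigenvalue_def by blast
    have "cmat (H - s *\<^sub>R mat 1) = cmat H - mat (of_real s)"
      by (auto simp: vec_eq_iff mat_def)
    moreover have "mat (of_real s) *v v = of_real s *s v"
      by (simp add: matrix_vector_mult_def mat_def vec_eq_iff if_distrib[of "\<lambda>c. c * _"] cong: if_cong)
    ultimately have "cmat H *v v - of_real s *s v = Complex 0 w *s v"
      using v(2) by (simp add: matrix_vector_mult_diff_rdistrib)
    then have "cmat H *v v = (of_real s + Complex 0 w) *s v"
      by (simp add: vector_sadd_rdistrib algebra_simps)
    then have "mat_eigenvalue (cmat H) (of_real s + Complex 0 w)"
      using v(1) unfolding mat_eigenvalue_def by blast
    then have "Re (of_real s + Complex 0 w) < 0" using H unfolding hurwitz_def by blast
    then show False using s0 by simp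
  qed
qed

text \<open>Makes the description behind \<open>lyapunov_sol\<close> usable: the certificate of
  \<open>hurwitz_lyap_stable\<close> gives both existence and uniqueness.\<close>

lemma lyapunov_sol:
  fixes H :: "real ^ 'n ^ 'n"
  assumes "hurwitz H"
  shows "lyap H (lyapunov_sol H) = - mat 1" "posdef (lyapunov_sol H)"
proof -
  obtain P where P: "lyap_stable H P" using hurwitz_lyap_stable[OF assms] by blast
  obtain V where V: "lyap H V = - mat 1" "posdef V" by (rule lyap_solution[OF P])
  have "lyapunov_sol H = V"
    unfolding lyapunov_sol_def lyap_def[symmetric]
  proof (rule the_equality)
    show "lyap H V + mat 1 = 0" using V by simp
    fix W assume "lyap H W + mat 1 = 0"
    then have "lyap H W = - mat 1" by (simp add: eq_neg_iff_add_eq_0)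
    then have "lyap H (W - V) = 0" using V linear_diff[OF linear_lyap, of H W V] by simp
    then show "W = V" using lyap_eq_0[OF P] by fastforce
  qed
  with V show "lyap H (lyapunov_sol H) = - mat 1" "posdef (lyapunov_sol H)" by auto
qed

section \<open>Determinants, traces and inverse square roots of positive matrices\<close>

lemma det_spectral:
  fixes Q :: "real ^ 'n ^ 'n"
  assumes "orthogonal_matrix Q"
  shows "det (Q ** diag_mat d ** transpose Q) = (\<Prod>i\<in>UNIV. d i)"
proof -
  have "det Q * det (transpose Q) = det (Q ** transpose Q)" by (rule det_mul[symmetric])
  also have "\<dots> = 1" using assms by (simp add: orthogonal_matrix_def)
  finally have "det Q * det (transpose Q) = 1" .
  moreover have "det (diag_mat d) = (\<Prod>i\<in>UNIV. d i)"
    by (subst det_diagonal) (auto simp: diag_mat_def)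
  ultimately show ?thesis by (simp add: det_mul algebra_simps)
qed

lemma trace_spectral:
  fixes Q :: "real ^ 'n ^ 'n"
  assumes "orthogonal_matrix Q"
  shows "trace (Q ** diag_mat d ** transpose Q) = (\<Sum>i\<in>UNIV. d i)"
proof -
  have "trace (Q ** diag_mat d ** transpose Q) = trace (transpose Q ** (Q ** diag_mat d))"
    by (rule trace_mul_sym)
  also have "transpose Q ** (Q ** diag_mat d) = diag_mat d"
    using assms by (simp add: matrix_mul_assoc orthogonal_matrix_def)
  finally show ?thesis by (simp add: trace_def diag_mat_def)
qed

lemma one_plus_sum_le_prod:
  fixes d :: "'i \<Rightarrow> real"
  assumes "finite I" "\<And>i. i \<in> I \<Longrightarrow> 0 \<le> d i"
  shows "1 + (\<Sum>i\<in>I. d i) \<le> (\<Prod>i\<in>I. 1 + d i)"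
  using assms
proof (induction I rule: finite_induct)
  case (insert j I)
  have "0 \<le> (\<Sum>i\<in>I. d i)" using insert by (intro sum_nonneg) auto
  then have "1 + (d j + (\<Sum>i\<in>I. d i)) \<le> (1 + d j) * (1 + (\<Sum>i\<in>I. d i))"
    using insert.prems[of j] by (simp add: algebra_simps)
  also have "\<dots> \<le> (1 + d j) * (\<Prod>i\<in>I. 1 + d i)"
    using insert by (intro mult_left_mono) auto
  finally show ?case using insert by simp
qed simp

lemma psd_spectral_theorem:
  fixes A :: "real ^ 'n ^ 'n"
  assumes "psd A"
  obtains Q d where "orthogonal_matrix Q" "A = Q ** diag_mat d ** transpose Q" "\<And>i. 0 \<le> d i"
proof -
  have "transpose A = A" using assms by (simp add: psd_def)
  then obtain Q d where Q: "orthogonal_matrix Q" "A = Q ** diag_mat d ** transpose Q"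
    by (rule spectral_theorem)
  show ?thesis using spectral_psd[OF Q assms] by (intro that[OF Q])
qed

lemma trace_psd_nonneg:
  fixes A :: "real ^ 'n ^ 'n"
  assumes "psd A"
  shows "0 \<le> trace A"
proof -
  obtain Q d where Q: "orthogonal_matrix Q" "A = Q ** diag_mat d ** transpose Q" "\<And>i. 0 \<le> d i"
    by (rule psd_spectral_theorem[OF assms]) blast
  show ?thesis unfolding Q(2) trace_spectral[OF Q(1)] using Q(3) by (rule sum_nonneg)
qed

lemma det_one_plus_psd:
  fixes M :: "real ^ 'n ^ 'n"
  assumes "psd M"
  shows "1 + trace M \<le> det (mat 1 + M)"
proof -
  obtain Q d where Q: "orthogonal_matrix Q" "M = Q ** diag_mat d ** transpose Q" "\<And>i. 0 \<le> d i"
    by (rule psd_spectral_theorem[OF assms]) blast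
  have "diag_mat (\<lambda>i. 1 + d i) = mat 1 + diag_mat d"
    by (simp add: diag_mat_def mat_def vec_eq_iff)
  then have "mat 1 + M = Q ** diag_mat (\<lambda>i. 1 + d i) ** transpose Q"
    using Q(1) by (simp add: Q(2) matrix_add_ldistrib matrix_add_rdistrib orthogonal_matrix_def)
  then have "det (mat 1 + M) = (\<Prod>i\<in>UNIV. 1 + d i)" by (simp add: det_spectral Q(1))
  moreover have "trace M = (\<Sum>i\<in>UNIV. d i)" unfolding Q(2) by (rule trace_spectral[OF Q(1)])
  ultimately show ?thesis using one_plus_sum_le_prod[of UNIV d] Q(3) by simp
qed

text \<open>Every eigenvalue is at most the trace. The crude bound suffices, since it is used only
  inside a logarithm.\<close>

lemma det_le_trace_power:
  fixes A :: "real ^ 'n ^ 'n"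
  assumes "psd A"
  shows "det A \<le> trace A ^ CARD('n)"
proof -
  obtain Q d where Q: "orthogonal_matrix Q" "A = Q ** diag_mat d ** transpose Q" "\<And>i. 0 \<le> d i"
    by (rule psd_spectral_theorem[OF assms]) blast
  have "(\<Prod>i\<in>UNIV. d i) \<le> (\<Prod>i\<in>(UNIV :: 'n set). \<Sum>i\<in>UNIV. d i)"
    using Q(3) by (intro prod_mono) (auto intro: member_le_sum)
  then show ?thesis by (simp add: Q(2) det_spectral trace_spectral Q(1))
qed

lemma psd_congruence:
  fixes A :: "real ^ 'n ^ 'n" and B :: "real ^ 'n ^ 'm"
  assumes "psd A"
  shows "psd (B ** A ** transpose B)"
  unfolding psd_def
proof (intro conjI allI)
  show "transpose (B ** A ** transpose B) = B ** A ** transpose B"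
    using assms by (simp add: psd_def matrix_transpose_mul matrix_mul_assoc)
  fix x
  have "x \<bullet> (B ** A ** transpose B *v x) = (transpose B *v x) \<bullet> (A *v (transpose B *v x))"
    by (simp only: inner_matrix_vector_left transpose_transpose matrix_vector_mul_assoc[symmetric])
  then show "0 \<le> x \<bullet> (B ** A ** transpose B *v x)" using assms by (simp add: psd_def del: transpose_matrix_vector)
qed

lemma posdef_sqrt_inverse:
  fixes G :: "real ^ 'n ^ 'n"
  assumes "posdef G"
  obtains W where "transpose W = W" "W ** mat_sqrt G = mat 1" "mat_sqrt G ** W = mat 1"
proof -
  let ?L = "mat_sqrt G"
  have "psd G" using assms posdef_nonneg[OF assms] by (simp add: psd_def posdef_def)
  note L = mat_sqrt[OF this]
  have "inj ((*v) ?L)"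
  proof (rule injI)
    fix x y assume "?L *v x = ?L *v y"
    then have "?L *v (?L *v (x - y)) = 0" by (simp add: matrix_vector_mult_diff_distrib)
    then have "G *v (x - y) = 0" by (simp add: matrix_vector_mul_assoc L)
    then have "(x - y) \<bullet> (G *v (x - y)) = 0" by simp
    then have "x - y = 0" using assms unfolding posdef_def by (metis less_irrefl)
    then show "x = y" by simp
  qed
  then obtain W where W: "W ** ?L = mat 1" using matrix_left_invertible_injective[of ?L] by blast
  then have W': "?L ** W = mat 1" using matrix_left_right_inverse by blast
  have "transpose (W ** ?L) = mat 1" by (simp add: W)
  then have "?L ** transpose W = mat 1" using L(1) by (simp add: matrix_transpose_mul psd_def)
  then have "transpose W = W" using W by (metis matrix_mul_assoc matrix_mul_lid matrix_mul_rid)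
  with W W' that show ?thesis by blast
qed

text \<open>With \<open>M = W ** A ** W\<close> one has
  \<open>det (G + A) = det G * det (mat 1 + M)\<close>, and the last factor is at least
  \<open>1 + trace M\<close>. The inequality \<open>s / (1 + s) \<le> ln (1 + s)\<close> controls
  only \<open>s / (1 + s)\<close>; the a priori bound \<open>k\<close> on the trace recovers
  \<open>s\<close> at the cost of the factor \<open>1 + k\<close>.\<close>

lemma trace_le_log_det_increment:
  fixes A G :: "real ^ 'n ^ 'n"
  assumes G: "posdef G" and W: "transpose W = W" "W ** mat_sqrt G = mat 1" "mat_sqrt G ** W = mat 1"
    and A: "psd A" and k: "trace (W ** A ** W) \<le> k"
  shows "trace (W ** A ** W) \<le> (1 + k) * (ln (det (G + A)) - ln (det G))"
proof -
  let ?L = "mat_sqrt G"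
  let ?M = "W ** A ** W"
  have "psd G" using G posdef_nonneg[OF G] by (simp add: psd_def posdef_def)
  note L = mat_sqrt[OF this]
  have M: "psd ?M" using psd_congruence[OF A, of W] W(1) by simp
  define s where "s = trace ?M"
  have s: "0 \<le> s" "s \<le> k" using trace_psd_nonneg[OF M] k by (auto simp: s_def)
  have "?L ** ?M ** ?L = (?L ** W) ** A ** (W ** ?L)" by (simp only: matrix_mul_assoc)
  then have "?L ** (mat 1 + ?M) ** ?L = G + A"
    by (simp add: W matrix_add_ldistrib matrix_add_rdistrib L)
  then have "det (G + A) = det ?L * det (mat 1 + ?M) * det ?L" by (metis det_mul)
  moreover have dG: "det G = det ?L * det ?L" using L by (metis det_mul)
  ultimately have d: "det (G + A) = det G * det (mat 1 + ?M)" by simp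
  have "det W * det ?L = 1" using W(2) by (metis det_mul det_I)
  then have G0: "0 < det G" unfolding dG by (metis mult_zero_right not_real_square_gt_zero zero_neq_one)
  have ge: "1 + s \<le> det (mat 1 + ?M)" unfolding s_def by (rule det_one_plus_psd[OF M])
  have "ln (inverse (1 + s)) \<le> inverse (1 + s) - 1" using s by (intro ln_le_minus_one) simp
  then have "1 - inverse (1 + s) \<le> ln (1 + s)" using s by (simp add: ln_inverse)
  then have "s / (1 + s) \<le> ln (1 + s)" using s by (simp add: field_simps)
  also have "\<dots> \<le> ln (det (mat 1 + ?M))" using ge s by simp
  also have "\<dots> = ln (det (G + A)) - ln (det G)"
    using G0 ge s by (simp add: d ln_mult)
  finally have le: "s / (1 + s) \<le> ln (det (G + A)) - ln (det G)" .
  have "s = (1 + s) * (s / (1 + s))" using s by simp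
  also have "\<dots> \<le> (1 + k) * (s / (1 + s))" using s by (intro mult_right_mono) auto
  also have "\<dots> \<le> (1 + k) * (ln (det (G + A)) - ln (det G))" using s le by (intro mult_left_mono) auto
  finally show ?thesis by (simp add: s_def)
qed

section \<open>Characteristic functions on Euclidean space\<close>

text \<open>The density is literally the one in \<open>standard_gaussian\<close>, so that the law of
  \<open>Z\<close> is \<open>gauss\<close>.\<close>

definition gauss :: "(real ^ 'n) measure" where
  "gauss = density lborel (\<lambda>x. ennreal (\<Prod>i\<in>UNIV. std_normal_density (x $ i)))"

lemma sets_gauss [simp, measurable_cong]: "sets gauss = sets borel"
  and space_gauss [simp]: "space gauss = UNIV"
  by (simp_all add: gauss_def)

text \<open>Lebesgue measure is an image of the product measure over \<open>Basis\<close>;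
  reindexing the basis by the vectors \<open>axis i 1\<close> turns this into a product over
  coordinates. Values in a normed field cover the real density and the complex exponentials at
  once.\<close>

lemma lborel_integral_vec_prod:
  fixes h :: "'n::finite \<Rightarrow> real \<Rightarrow> 'b::{real_normed_field,banach,second_countable_topology}"
  assumes int: "\<And>i. integrable lborel (h i)"
  shows "integrable lborel (\<lambda>x :: real ^ 'n. \<Prod>i\<in>UNIV. h i (x $ i))"
    and "(\<integral>x. (\<Prod>i\<in>UNIV. h i (x $ i)) \<partial>(lborel :: (real ^ 'n) measure)) = (\<Prod>i\<in>UNIV. \<integral>x. h i x \<partial>lborel)"
proof -
  define e :: "'n \<Rightarrow> real ^ 'n" where "e i = axis i 1" for i
  have inj: "inj e" by (auto simp: e_def inj_on_def axis_eq_axis)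
  have B: "(Basis :: (real ^ 'n) set) = range e" by (auto simp: e_def Basis_vec_def)
  define k where "k b = h (inv e b)" for b
  interpret product_sigma_finite "\<lambda>_ :: real ^ 'n. lborel :: real measure" ..
  have comp: "(\<Sum>b\<in>Basis. f b *\<^sub>R b) $ i = f (e i)" for f :: "real ^ 'n \<Rightarrow> real" and i
  proof -
    have "(\<Sum>b\<in>Basis. f b *\<^sub>R b) = (\<Sum>j\<in>UNIV. f (e j) *\<^sub>R e j)"
      unfolding B using inj by (simp add: sum.reindex)
    then have "(\<Sum>b\<in>Basis. f b *\<^sub>R b) $ i = (\<Sum>j\<in>UNIV. if j = i then f (e j) else 0)"
      by (simp add: e_def axis_def if_distrib cong: if_cong)
    then show ?thesis by simp
  qed
  have prod: "(\<Prod>b\<in>Basis. k b (f b)) = (\<Prod>i\<in>UNIV. h i (f (e i)))" for f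
    unfolding B using inj by (simp add: prod.reindex k_def)
  have m: "(\<lambda>f. \<Sum>b\<in>Basis. f b *\<^sub>R b) \<in> measurable (\<Pi>\<^sub>M b\<in>(Basis :: (real ^ 'n) set). lborel) (borel :: (real ^ 'n) measure)"
    by measurable
  have hm: "(\<lambda>x :: real ^ 'n. \<Prod>i\<in>UNIV. h i (x $ i)) \<in> borel_measurable borel"
    using int by (intro borel_measurable_prod) (auto intro!: measurable_compose[of "\<lambda>x :: real ^ 'n. x $ i" borel borel for i] dest: borel_measurable_integrable)
  have i: "integrable (\<Pi>\<^sub>M b\<in>(Basis :: (real ^ 'n) set). lborel) (\<lambda>f. \<Prod>b\<in>Basis. k b (f b))"
    using int by (intro product_integrable_prod) (auto simp: k_def)
  show "integrable lborel (\<lambda>x :: real ^ 'n. \<Prod>i\<in>UNIV. h i (x $ i))"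
    unfolding lborel_eq[where 'a="real ^ 'n"] integrable_distr_eq[OF m hm] comp
    using i unfolding prod .
  have "(\<integral>x. (\<Prod>i\<in>UNIV. h i (x $ i)) \<partial>(lborel :: (real ^ 'n) measure)) =
      (\<integral>f. (\<Prod>b\<in>Basis. k b (f b)) \<partial>(\<Pi>\<^sub>M b\<in>(Basis :: (real ^ 'n) set). lborel))"
    unfolding lborel_eq[where 'a="real ^ 'n"] integral_distr[OF m hm] comp prod ..
  also have "\<dots> = (\<Prod>b\<in>(Basis :: (real ^ 'n) set). \<integral>x. k b x \<partial>lborel)"
    using int by (intro product_integral_prod) (auto simp: k_def)
  also have "\<dots> = (\<Prod>i\<in>UNIV. \<integral>x. h i x \<partial>lborel)"
    unfolding B using inj by (simp add: prod.reindex k_def)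
  finally show "(\<integral>x. (\<Prod>i\<in>UNIV. h i (x $ i)) \<partial>(lborel :: (real ^ 'n) measure)) = (\<Prod>i\<in>UNIV. \<integral>x. h i x \<partial>lborel)" .
qed

lemma prob_space_gauss: "prob_space (gauss :: (real ^ 'n) measure)"
proof
  have "emeasure (gauss :: (real ^ 'n) measure) UNIV =
      (\<integral>\<^sup>+x. ennreal (\<Prod>i\<in>UNIV. std_normal_density (x $ i)) \<partial>(lborel :: (real ^ 'n) measure))"
    unfolding gauss_def by (subst emeasure_density) auto
  also have "\<dots> = ennreal (\<integral>x. (\<Prod>i\<in>UNIV. std_normal_density (x $ i)) \<partial>(lborel :: (real ^ 'n) measure))"
    by (intro nn_integral_eq_integral lborel_integral_vec_prod) (auto intro!: prod_nonneg)
  also have "(\<integral>x. (\<Prod>i\<in>UNIV. std_normal_density (x $ i)) \<partial>(lborel :: (real ^ 'n) measure)) = 1"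
    by (subst lborel_integral_vec_prod) auto
  finally show "emeasure (gauss :: (real ^ 'n) measure) (space gauss) = 1" by simp
qed

interpretation gauss: prob_space "gauss :: (real ^ 'n) measure"
  by (rule prob_space_gauss)

lemma char_gauss: "(\<integral>x. iexp (u \<bullet> x) \<partial>gauss) = complex_of_real (exp (- (u \<bullet> u) / 2))"
  for u :: "real ^ 'n"
proof -
  have std: "(\<integral>x. of_real (std_normal_density x) * iexp (t * x) \<partial>lborel) = complex_of_real (exp (- t\<^sup>2 / 2))" for t
  proof -
    have "char std_normal_distribution t = (\<integral>x. std_normal_density x *\<^sub>R iexp (t * x) \<partial>lborel)"
      unfolding char_def by (subst integral_density) auto
    then show ?thesis by (simp add: char_std_normal_distribution scaleR_conv_of_real)
  qed
  have "(\<integral>x. iexp (u \<bullet> x) \<partial>gauss) =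
      (\<integral>x. (\<Prod>i\<in>UNIV. std_normal_density (x $ i)) *\<^sub>R iexp (u \<bullet> x) \<partial>lborel)"
    unfolding gauss_def by (subst integral_density) (auto intro!: prod_nonneg)
  also have "\<dots> = (\<integral>x. (\<Prod>i\<in>UNIV. of_real (std_normal_density (x $ i)) * iexp (u $ i * x $ i)) \<partial>lborel)"
    by (intro Bochner_Integration.integral_cong)
      (auto simp: scaleR_conv_of_real prod.distrib inner_vec_def sum_distrib_left exp_sum)
  also have "\<dots> = (\<Prod>i\<in>UNIV. \<integral>x. of_real (std_normal_density x) * iexp (u $ i * x) \<partial>lborel)"
  proof (rule lborel_integral_vec_prod)
    fix i
    have "integrable lborel (\<lambda>x. complex_of_real (std_normal_density x))" by auto
    then show "integrable lborel (\<lambda>x. of_real (std_normal_density x) * iexp (u $ i * x))"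
      by (rule Bochner_Integration.integrable_bound) (auto simp: norm_mult)
  qed
  also have "\<dots> = complex_of_real (\<Prod>i\<in>UNIV. exp (- (u $ i)\<^sup>2 / 2))"
    by (simp only: std of_real_prod)
  also have "(\<Prod>i\<in>UNIV. exp (- (u $ i)\<^sup>2 / 2)) = exp (- (u \<bullet> u) / 2)"
    by (simp add: exp_sum[symmetric] inner_vec_def power2_eq_square sum_negf sum_divide_distrib)
  finally show ?thesis .
qed

lemma integrable_iexp_of:
  assumes "finite_measure M" "f \<in> borel_measurable M"
  shows "integrable M (\<lambda>x. iexp (f x))"
proof -
  interpret finite_measure M by fact
  show ?thesis using assms(2) by (intro integrable_const_bound[where B=1]) auto
qed

lemma gauss_density_norm:
  "(\<Prod>i\<in>UNIV. std_normal_density (x $ i)) = (1 / sqrt (2 * pi)) ^ CARD('n) * exp (- (norm x)\<^sup>2 / 2)"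
  for x :: "real ^ 'n"
proof -
  have "(\<Prod>i\<in>UNIV. std_normal_density (x $ i)) = (\<Prod>i\<in>(UNIV :: 'n set). 1 / sqrt (2 * pi)) * (\<Prod>i\<in>UNIV. exp (- (x $ i)\<^sup>2 / 2))"
    unfolding std_normal_density_def by (rule prod.distrib)
  also have "(\<Prod>i\<in>UNIV. exp (- (x $ i)\<^sup>2 / 2)) = exp (- (norm x)\<^sup>2 / 2)"
    unfolding power2_norm_eq_inner by (simp add: exp_sum[symmetric] inner_vec_def power2_eq_square sum_negf sum_divide_distrib)
  finally show ?thesis by simp
qed

text \<open>Convolving with \<open>N(0, e\<^sup>2 I)\<close> and writing the Gaussian kernel as a characteristic function
  expresses \<open>\<integral> f(x + e z)\<close> through the characteristic function of \<open>\<mu>\<close>.\<close>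
lemma char_eq_smoothed:
  fixes \<mu> \<nu> :: "(real ^ 'n) measure"
  assumes "prob_space \<mu>" "prob_space \<nu>" and sets: "sets \<mu> = sets borel" "sets \<nu> = sets borel"
    and char: "\<And>u. (\<integral>x. iexp (u \<bullet> x) \<partial>\<mu>) = (\<integral>x. iexp (u \<bullet> x) \<partial>\<nu>)"
    and e: "0 < e" and f [measurable]: "f \<in> borel_measurable borel"
  shows "(\<integral>\<^sup>+x. (\<integral>\<^sup>+z. ennreal (f (x + e *\<^sub>R z)) \<partial>gauss) \<partial>\<mu>) = (\<integral>\<^sup>+x. (\<integral>\<^sup>+z. ennreal (f (x + e *\<^sub>R z)) \<partial>gauss) \<partial>\<nu>)"
proof -
  let ?k = "\<lambda>x y :: real ^ 'n. exp (- (norm ((1 / e) *\<^sub>R (x - y)))\<^sup>2 / 2)"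
  \<comment> \<open>The kernel is the characteristic function of \<open>gauss\<close> at
    \<open>(x - y) / e\<close>. After Fubini, \<open>M\<close> enters only through its own
    characteristic function at \<open>z / e\<close>.\<close>
  have kern: "complex_of_real (\<integral>x. ?k x y \<partial>M) = (\<integral>z. (\<integral>x. iexp (((1 / e) *\<^sub>R z) \<bullet> x) \<partial>M) * iexp (- ((1 / e) *\<^sub>R z) \<bullet> y) \<partial>gauss)"
    if M: "prob_space M" "sets M = sets borel" for M y
  proof -
    interpret M: prob_space M by fact
    note [measurable_cong] = M(2)
    interpret P: pair_prob_space M "gauss :: (real ^ 'n) measure" ..
    have "complex_of_real (\<integral>x. ?k x y \<partial>M) = (\<integral>x. complex_of_real (?k x y) \<partial>M)"
      by simp
    also have "\<dots> = (\<integral>x. (\<integral>z. iexp (((1 / e) *\<^sub>R (x - y)) \<bullet> z) \<partial>gauss) \<partial>M)"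
      by (simp only: char_gauss power2_norm_eq_inner)
    also have "\<dots> = (\<integral>z. (\<integral>x. iexp (((1 / e) *\<^sub>R (x - y)) \<bullet> z) \<partial>M) \<partial>gauss)"
      by (rule P.Fubini_integral[symmetric], unfold case_prod_beta, rule integrable_iexp_of)
        (unfold_locales, measurable)
    also have "\<dots> = (\<integral>z. (\<integral>x. iexp (((1 / e) *\<^sub>R z) \<bullet> x) \<partial>M) * iexp (- ((1 / e) *\<^sub>R z) \<bullet> y) \<partial>gauss)"
    proof (rule Bochner_Integration.integral_cong[OF refl])
      fix z
      have "iexp (((1 / e) *\<^sub>R (x - y)) \<bullet> z) = iexp (((1 / e) *\<^sub>R z) \<bullet> x) * iexp (- ((1 / e) *\<^sub>R z) \<bullet> y)" for x
        by (simp add: exp_add[symmetric] inner_diff_left inner_commute algebra_simps diff_divide_distrib)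
      then show "(\<integral>x. iexp (((1 / e) *\<^sub>R (x - y)) \<bullet> z) \<partial>M) = (\<integral>x. iexp (((1 / e) *\<^sub>R z) \<bullet> x) \<partial>M) * iexp (- ((1 / e) *\<^sub>R z) \<bullet> y)"
        by (simp only: integral_mult_left_zero)
    qed
    finally show ?thesis .
  qed
  have keq: "(\<integral>x. ?k x y \<partial>\<mu>) = (\<integral>x. ?k x y \<partial>\<nu>)" for y
  proof -
    have "complex_of_real (\<integral>x. ?k x y \<partial>\<mu>) = complex_of_real (\<integral>x. ?k x y \<partial>\<nu>)"
      unfolding kern[OF assms(1) sets(1)] kern[OF assms(2) sets(2)] char ..
    then show ?thesis by (simp only: of_real_eq_iff)
  qed
  \<comment> \<open>The normalisation of the Gaussian density times the Jacobian of the substitution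
    \<open>y = x + e z\<close>.\<close>
  define c where "c = (1 / sqrt (2 * pi)) ^ CARD('n) * (1 / e) ^ CARD('n)"
  have c: "0 \<le> c" using e by (simp add: c_def)
  have smooth: "(\<integral>\<^sup>+x. (\<integral>\<^sup>+z. ennreal (f (x + e *\<^sub>R z)) \<partial>gauss) \<partial>M) = (\<integral>\<^sup>+y. ennreal c * (ennreal (f y) * ennreal (\<integral>x. ?k x y \<partial>M)) \<partial>lborel)"
    if M: "prob_space M" "sets M = sets borel" for M
  proof -
    interpret M: prob_space M by fact
    note [measurable_cong] = M(2)
    interpret P: pair_sigma_finite M "lborel :: (real ^ 'n) measure" ..
    have inner: "(\<integral>\<^sup>+z. ennreal (f (x + e *\<^sub>R z)) \<partial>gauss) = (\<integral>\<^sup>+y. ennreal c * (ennreal (f y) * ennreal (?k x y)) \<partial>lborel)" for x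
    proof -
      define g where "g y = ennreal c * (ennreal (f y) * ennreal (?k x y))" for y
      have [measurable]: "g \<in> borel_measurable borel" unfolding g_def by measurable
      have "(\<integral>\<^sup>+y. g y \<partial>lborel) = (\<integral>\<^sup>+y. g y \<partial>density (distr lborel borel (\<lambda>z. x + e *\<^sub>R z)) (\<lambda>_. ennreal (\<bar>e\<bar> ^ DIM(real ^ 'n))))"
        using lborel_affine[of e x] e by simp
      also have "\<dots> = (\<integral>\<^sup>+z. ennreal (e ^ CARD('n)) * g (x + e *\<^sub>R z) \<partial>lborel)"
        using e by (subst nn_integral_density) (auto simp: nn_integral_distr)
      also have "\<dots> = (\<integral>\<^sup>+z. ennreal (\<Prod>i\<in>UNIV. std_normal_density (z $ i)) * ennreal (f (x + e *\<^sub>R z)) \<partial>lborel)"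
      proof (rule nn_integral_cong)
        fix z :: "real ^ 'n"
        have "?k x (x + e *\<^sub>R z) = exp (- (norm z)\<^sup>2 / 2)" using e by simp
        moreover have "e ^ CARD('n) * (c * a) = (1 / sqrt (2 * pi)) ^ CARD('n) * a" for a
          using e by (simp add: c_def power_divide)
        ultimately have h: "ennreal (e ^ CARD('n)) * (ennreal c * ennreal (?k x (x + e *\<^sub>R z))) = ennreal (\<Prod>i\<in>UNIV. std_normal_density (z $ i))"
          unfolding gauss_density_norm using e c by (simp only: ennreal_mult'[symmetric] zero_le_power less_imp_le mult_nonneg_nonneg exp_ge_zero)
        show "ennreal (e ^ CARD('n)) * g (x + e *\<^sub>R z) = ennreal (\<Prod>i\<in>UNIV. std_normal_density (z $ i)) * ennreal (f (x + e *\<^sub>R z))"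
          unfolding g_def h[symmetric] by (simp only: mult_ac)
      qed
      also have "\<dots> = (\<integral>\<^sup>+z. ennreal (f (x + e *\<^sub>R z)) \<partial>gauss)"
        unfolding gauss_def by (subst nn_integral_density) auto
      finally show ?thesis unfolding g_def ..
    qed
    have "(\<integral>\<^sup>+x. (\<integral>\<^sup>+z. ennreal (f (x + e *\<^sub>R z)) \<partial>gauss) \<partial>M) = (\<integral>\<^sup>+y. (\<integral>\<^sup>+x. ennreal c * (ennreal (f y) * ennreal (?k x y)) \<partial>M) \<partial>lborel)"
      unfolding inner by (rule P.Fubini'[symmetric]) measurable
    also have "\<dots> = (\<integral>\<^sup>+y. ennreal c * (ennreal (f y) * ennreal (\<integral>x. ?k x y \<partial>M)) \<partial>lborel)"
    proof (rule nn_integral_cong)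
      fix y
      have "integrable M (\<lambda>x. ?k x y)"
        by (rule M.integrable_const_bound[where B=1]) auto
      then have "(\<integral>\<^sup>+x. ennreal (?k x y) \<partial>M) = ennreal (\<integral>x. ?k x y \<partial>M)"
        by (intro nn_integral_eq_integral) auto
      then show "(\<integral>\<^sup>+x. ennreal c * (ennreal (f y) * ennreal (?k x y)) \<partial>M) = ennreal c * (ennreal (f y) * ennreal (\<integral>x. ?k x y \<partial>M))"
        by ((subst nn_integral_cmult, measurable)+)
    qed
    finally show ?thesis .
  qed
  show ?thesis unfolding smooth[OF assms(1) sets(1)] smooth[OF assms(2) sets(2)] keq ..
qed

lemma smoothed_limit:
  fixes \<mu> :: "(real ^ 'n) measure" and f :: "real ^ 'n \<Rightarrow> real"
  assumes "prob_space \<mu>" and sets: "sets \<mu> = sets borel"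
    and f: "continuous_on UNIV f" "\<And>x. 0 \<le> f x" "\<And>x. f x \<le> 1"
  shows "(\<lambda>k. \<integral>\<^sup>+x. (\<integral>\<^sup>+z. ennreal (f (x + inverse (real (Suc k)) *\<^sub>R z)) \<partial>gauss) \<partial>\<mu>) \<longlonglongrightarrow> ennreal (\<integral>x. f x \<partial>\<mu>)"
proof -
  interpret M: prob_space \<mu> by fact
  note [measurable_cong] = sets
  interpret P: pair_prob_space \<mu> "gauss :: (real ^ 'n) measure" ..
  have [measurable]: "f \<in> borel_measurable borel" using f(1) by (rule borel_measurable_continuous_onI)
  have eq: "(\<integral>\<^sup>+x. (\<integral>\<^sup>+z. ennreal (f (x + e *\<^sub>R z)) \<partial>gauss) \<partial>\<mu>) = ennreal (\<integral>p. f (fst p + e *\<^sub>R snd p) \<partial>(\<mu> \<Otimes>\<^sub>M gauss))" for e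
  proof -
    have "integrable (\<mu> \<Otimes>\<^sub>M gauss) (\<lambda>p. f (fst p + e *\<^sub>R snd p))"
      by (rule P.integrable_const_bound[where B=1]) (use f in auto)
    then have "(\<integral>\<^sup>+p. ennreal (f (fst p + e *\<^sub>R snd p)) \<partial>(\<mu> \<Otimes>\<^sub>M gauss)) = ennreal (\<integral>p. f (fst p + e *\<^sub>R snd p) \<partial>(\<mu> \<Otimes>\<^sub>M gauss))"
      using f by (intro nn_integral_eq_integral) auto
    then show ?thesis by (subst (asm) gauss.nn_integral_fst[symmetric]) auto
  qed
  have "(\<lambda>k. \<integral>p. f (fst p + inverse (real (Suc k)) *\<^sub>R snd p) \<partial>(\<mu> \<Otimes>\<^sub>M gauss)) \<longlonglongrightarrow> (\<integral>p. f (fst p) \<partial>(\<mu> \<Otimes>\<^sub>M (gauss :: (real ^ 'n) measure)))"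
  proof (rule integral_dominated_convergence[where w="\<lambda>_ :: (real ^ 'n) \<times> (real ^ 'n). 1 :: real"
      and s="\<lambda>k p. f (fst p + inverse (real (Suc k)) *\<^sub>R snd p)"])
    show "AE p in \<mu> \<Otimes>\<^sub>M gauss. (\<lambda>k. f (fst p + inverse (real (Suc k)) *\<^sub>R snd p)) \<longlonglongrightarrow> f (fst p)"
    proof (rule AE_I2)
      fix p :: "(real ^ 'n) \<times> (real ^ 'n)"
      have "(\<lambda>k. fst p + inverse (real (Suc k)) *\<^sub>R snd p) \<longlonglongrightarrow> fst p + 0 *\<^sub>R snd p"
        by (intro tendsto_intros LIMSEQ_inverse_real_of_nat)
      then have lim: "(\<lambda>k. fst p + inverse (real (Suc k)) *\<^sub>R snd p) \<longlonglongrightarrow> fst p" by simp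
      have "isCont f (fst p)" using f(1) by (simp add: continuous_on_eq_continuous_at)
      then show "(\<lambda>k. f (fst p + inverse (real (Suc k)) *\<^sub>R snd p)) \<longlonglongrightarrow> f (fst p)"
        using lim by (rule isCont_tendsto_compose)
    qed
  qed (use f in auto)
  moreover have "(\<integral>p. f (fst p) \<partial>(\<mu> \<Otimes>\<^sub>M (gauss :: (real ^ 'n) measure))) = (\<integral>x. f x \<partial>\<mu>)"
  proof -
    have "integrable (\<mu> \<Otimes>\<^sub>M (gauss :: (real ^ 'n) measure)) (\<lambda>p. f (fst p))"
      by (rule P.integrable_const_bound[where B=1]) (use f in auto)
    then show ?thesis by (subst P.integral_fst'[symmetric]) (auto simp: gauss.prob_space[simplified])
  qed
  ultimately show ?thesis unfolding eq by simp
qed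

text \<open>Letting the smoothing tend to 0 shows that both measures integrate continuous functions
  with values in [0, 1] alike. Truncated distance functions carry this over to closed sets, which
  are stable under intersection and generate the Borel sets.\<close>

lemma char_eq_imp_measure_eq:
  fixes \<mu> \<nu> :: "(real ^ 'n) measure"
  assumes M: "prob_space \<mu>" "prob_space \<nu>" and sets: "sets \<mu> = sets borel" "sets \<nu> = sets borel"
    and char: "\<And>u. (\<integral>x. iexp (u \<bullet> x) \<partial>\<mu>) = (\<integral>x. iexp (u \<bullet> x) \<partial>\<nu>)"
  shows "\<mu> = \<nu>"
proof -
  interpret M: prob_space \<mu> by fact
  interpret N: prob_space \<nu> by fact
  have expect: "(\<integral>x. f x \<partial>\<mu>) = (\<integral>x. f x \<partial>\<nu>)"
    if f: "continuous_on UNIV f" "\<And>x. 0 \<le> f x" "\<And>x. f x \<le> 1" for f :: "real ^ 'n \<Rightarrow> real"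
  proof -
    have "f \<in> borel_measurable borel" using f(1) by (rule borel_measurable_continuous_onI)
    then have eq: "(\<integral>\<^sup>+x. (\<integral>\<^sup>+z. ennreal (f (x + inverse (real (Suc k)) *\<^sub>R z)) \<partial>gauss) \<partial>\<mu>) =
        (\<integral>\<^sup>+x. (\<integral>\<^sup>+z. ennreal (f (x + inverse (real (Suc k)) *\<^sub>R z)) \<partial>gauss) \<partial>\<nu>)" for k
      by (intro char_eq_smoothed[OF M sets char]) auto
    have "ennreal (\<integral>x. f x \<partial>\<mu>) = ennreal (\<integral>x. f x \<partial>\<nu>)"
      using LIMSEQ_unique[OF smoothed_limit[OF M(1) sets(1) f, unfolded eq] smoothed_limit[OF M(2) sets(2) f]] by blast
    moreover have "0 \<le> (\<integral>x. f x \<partial>\<mu>)" "0 \<le> (\<integral>x. f x \<partial>\<nu>)" using f(2) by auto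
    ultimately show ?thesis by simp
  qed
  have closed: "emeasure \<mu> F = emeasure \<nu> F" if F: "closed F" for F
  proof (cases "F = {}")
    case False
    define f where "f k x = max 0 (1 - real k * infdist x F)" for k x
    have f: "continuous_on UNIV (f k)" "0 \<le> f k x" "f k x \<le> 1" for k x
      unfolding f_def by (auto intro!: continuous_intros simp: infdist_nonneg)
    have lim: "(\<lambda>k. f k x) \<longlonglongrightarrow> indicator F x" for x
    proof (cases "x \<in> F")
      case True
      then show ?thesis by (simp add: f_def)
    next
      case False
      then have d: "0 < infdist x F" using F \<open>F \<noteq> {}\<close> by (simp add: infdist_pos_not_in_closed)
      obtain k0 :: nat where k0: "1 / infdist x F < real k0" using reals_Archimedean2 by blast
      have "f k x = 0" if "k0 \<le> k" for k
      proof -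
        have "1 / infdist x F \<le> real k" using k0 that by linarith
        then have "1 \<le> real k * infdist x F" using d by (simp add: divide_le_eq)
        then show ?thesis by (simp add: f_def)
      qed
      then have "\<forall>\<^sub>F k in sequentially. f k x = 0" by (auto simp: eventually_sequentially)
      then have "(\<lambda>k. f k x) \<longlonglongrightarrow> 0" by (rule tendsto_eventually)
      then show ?thesis using False by simp
    qed
    have mlim: "(\<lambda>k. \<integral>x. f k x \<partial>M) \<longlonglongrightarrow> measure M F" if P: "prob_space M" "sets M = sets borel" for M
    proof -
      interpret P: prob_space M by fact
      note [measurable_cong] = P(2)
      have [measurable]: "F \<in> sets borel" using F by simp
      have [measurable]: "f k \<in> borel_measurable borel" for k using f(1) by (rule borel_measurable_continuous_onI)
      have "(\<lambda>k. \<integral>x. f k x \<partial>M) \<longlonglongrightarrow> (\<integral>x. indicator F x \<partial>M)"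
        by (rule integral_dominated_convergence[where w="\<lambda>_. 1"]) (use lim f in auto)
      then show ?thesis using sets_eq_imp_space_eq[OF P(2)] by simp
    qed
    have "measure \<mu> F = measure \<nu> F"
      using LIMSEQ_unique[OF mlim[OF M(1) sets(1), unfolded expect[OF f]] mlim[OF M(2) sets(2)]] .
    then show ?thesis by (simp add: M.emeasure_eq_measure N.emeasure_eq_measure)
  qed simp
  have gen: "sets (borel :: (real ^ 'n) measure) = sigma_sets UNIV (Collect closed)"
    unfolding borel_eq_closed by simp
  show ?thesis
  proof (rule measure_eqI_generator_eq[where E="Collect closed" and \<Omega>=UNIV and A="\<lambda>_. UNIV"])
    show "Int_stable (Collect closed :: (real ^ 'n) set set)" by (auto simp: Int_stable_def)
  qed (use closed sets gen in \<open>auto simp: M.emeasure_eq_measure\<close>)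
qed

section \<open>Gaussian measures\<close>

text \<open>An image of \<open>gauss\<close> rather than a density, so that singular
  \<open>A\<close> is included.\<close>

definition gaussian :: "real ^ 'n ^ 'n \<Rightarrow> (real ^ 'n) measure" where
  "gaussian A = distr gauss borel (\<lambda>z. mat_sqrt A *v z)"

lemma matrix_vector_borel [measurable]:
  fixes A :: "real ^ 'm ^ 'n"
  shows "(\<lambda>x. A *v x) \<in> borel_measurable borel"
  by (intro borel_measurable_continuous_onI continuous_intros)

lemma sets_gaussian [simp, measurable_cong]: "sets (gaussian A) = sets borel"
  and space_gaussian [simp]: "space (gaussian A) = UNIV"
  by (simp_all add: gaussian_def)

lemma prob_space_gaussian: "prob_space (gaussian A)"
  unfolding gaussian_def by (rule gauss.prob_space_distr) (simp add: matrix_vector_borel)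

lemma char_linear_gauss:
  fixes L :: "real ^ 'm ^ 'n"
  shows "(\<integral>x. iexp (u \<bullet> x) \<partial>distr gauss borel (\<lambda>z. L *v z)) =
    complex_of_real (exp (- (u \<bullet> ((L ** transpose L) *v u)) / 2))"
proof -
  have "u \<bullet> (L *v z) = (transpose L *v u) \<bullet> z" for z
    using inner_matrix_vector_left[of "transpose L" u z] by (simp only: transpose_transpose)
  then have "(\<integral>x. iexp (u \<bullet> x) \<partial>distr gauss borel (\<lambda>z. L *v z)) = (\<integral>z. iexp ((transpose L *v u) \<bullet> z) \<partial>gauss)"
    by (subst integral_distr) (auto simp: matrix_vector_borel)
  also have "\<dots> = complex_of_real (exp (- ((transpose L *v u) \<bullet> (transpose L *v u)) / 2))"
    by (rule char_gauss)
  also have "(transpose L *v u) \<bullet> (transpose L *v u) = u \<bullet> ((L ** transpose L) *v u)"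
    by (simp only: inner_matrix_vector_left transpose_transpose matrix_vector_mul_assoc)
  finally show ?thesis .
qed

lemma char_gaussian:
  assumes "psd A"
  shows "(\<integral>x. iexp (u \<bullet> x) \<partial>gaussian A) = complex_of_real (exp (- (u \<bullet> (A *v u)) / 2))"
proof -
  have "mat_sqrt A ** transpose (mat_sqrt A) = A" using mat_sqrt[OF assms] by (simp add: psd_def)
  then show ?thesis unfolding gaussian_def char_linear_gauss by simp
qed

lemma psd_mult_transpose: "psd (L ** transpose L)" for L :: "real ^ 'm ^ 'n"
proof -
  have "psd (mat 1 :: real ^ 'm ^ 'm)" by (simp add: psd_def)
  from psd_congruence[OF this, of L] show ?thesis by simp
qed

text \<open>The characteristic function sees \<open>L\<close> only through
  \<open>L ** transpose L\<close>. Rectangular \<open>L\<close> is allowed, which lets two Gaussians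
  be read off from one vector of twice the dimension.\<close>

lemma distr_linear_gauss:
  fixes L :: "real ^ 'm ^ 'n"
  shows "distr gauss borel (\<lambda>z. L *v z) = gaussian (L ** transpose L)"
proof (rule char_eq_imp_measure_eq)
  show "prob_space (distr gauss borel (\<lambda>z. L *v z))"
    by (rule gauss.prob_space_distr) (simp add: matrix_vector_borel)
qed (auto simp: char_linear_gauss char_gaussian psd_mult_transpose prob_space_gaussian)

lemma integral_pair_iexp:
  fixes f :: "'a \<Rightarrow> real" and g :: "'b \<Rightarrow> real"
  assumes "prob_space M" "prob_space N" and [measurable]: "f \<in> borel_measurable M" "g \<in> borel_measurable N"
  shows "(\<integral>p. iexp (f (fst p) + g (snd p)) \<partial>(M \<Otimes>\<^sub>M N)) = (\<integral>x. iexp (f x) \<partial>M) * (\<integral>y. iexp (g y) \<partial>N)"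
proof -
  interpret M: prob_space M by fact
  interpret N: prob_space N by fact
  interpret P: pair_prob_space M N ..
  have "integrable (M \<Otimes>\<^sub>M N) (\<lambda>p. iexp (f (fst p) + g (snd p)))"
    by (rule integrable_iexp_of) (unfold_locales, measurable)
  then have "(\<integral>p. iexp (f (fst p) + g (snd p)) \<partial>(M \<Otimes>\<^sub>M N)) = (\<integral>x. \<integral>y. iexp (f x + g y) \<partial>N \<partial>M)"
    by (subst P.integral_fst'[symmetric]) auto
  also have "\<dots> = (\<integral>x. iexp (f x) * (\<integral>y. iexp (g y) \<partial>N) \<partial>M)"
  proof (rule Bochner_Integration.integral_cong[OF refl])
    fix x
    have "iexp (f x + g y) = iexp (f x) * iexp (g y)" for y
      by (simp add: exp_add[symmetric] algebra_simps)
    then show "(\<integral>y. iexp (f x + g y) \<partial>N) = iexp (f x) * (\<integral>y. iexp (g y) \<partial>N)"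
      by (simp only: integral_mult_right_zero)
  qed
  also have "\<dots> = (\<integral>x. iexp (f x) \<partial>M) * (\<integral>y. iexp (g y) \<partial>N)" by (rule integral_mult_left_zero)
  finally show ?thesis .
qed

lemma psd_add: "psd A \<Longrightarrow> psd B \<Longrightarrow> psd (A + B)"
  by (simp add: psd_def transpose_add matrix_vector_mult_add_rdistrib inner_add_right)

lemma gaussian_add:
  fixes A B :: "real ^ 'n ^ 'n"
  assumes "psd A" "psd B"
  shows "distr (gaussian A \<Otimes>\<^sub>M gaussian B) borel (\<lambda>p. fst p + snd p) = gaussian (A + B)"
proof -
  interpret A: prob_space "gaussian A" by (rule prob_space_gaussian)
  interpret B: prob_space "gaussian B" by (rule prob_space_gaussian)
  interpret P: pair_prob_space "gaussian A" "gaussian B" ..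
  have m: "(\<lambda>p. fst p + snd p) \<in> borel_measurable (gaussian A \<Otimes>\<^sub>M gaussian B)" by measurable
  show ?thesis
  proof (rule char_eq_imp_measure_eq)
    show "prob_space (distr (gaussian A \<Otimes>\<^sub>M gaussian B) borel (\<lambda>p. fst p + snd p))"
      by (rule P.prob_space_distr[OF m])
    fix u
    have "(\<integral>x. iexp (u \<bullet> x) \<partial>distr (gaussian A \<Otimes>\<^sub>M gaussian B) borel (\<lambda>p. fst p + snd p)) =
        (\<integral>p. iexp (u \<bullet> fst p + u \<bullet> snd p) \<partial>(gaussian A \<Otimes>\<^sub>M gaussian B))"
      by (subst integral_distr[OF m]) (auto simp: inner_add_right)
    also have "\<dots> = (\<integral>x. iexp (u \<bullet> x) \<partial>gaussian A) * (\<integral>x. iexp (u \<bullet> x) \<partial>gaussian B)"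
      by (rule integral_pair_iexp) (auto intro: prob_space_gaussian)
    also have "\<dots> = (\<integral>x. iexp (u \<bullet> x) \<partial>gaussian (A + B))"
      by (simp add: char_gaussian assms psd_add exp_add[symmetric] matrix_vector_mult_add_rdistrib inner_add_right
        of_real_mult[symmetric] add_divide_distrib diff_divide_distrib del: of_real_mult of_real_exp)
    finally show "(\<integral>x. iexp (u \<bullet> x) \<partial>distr (gaussian A \<Otimes>\<^sub>M gaussian B) borel (\<lambda>p. fst p + snd p)) =
        (\<integral>x. iexp (u \<bullet> x) \<partial>gaussian (A + B))" .
  qed (auto intro: prob_space_gaussian)
qed

section \<open>One-dimensional projections and moments of the standard Gaussian\<close>

abbreviation std_normal :: "real measure" where "std_normal \<equiv> std_normal_distribution"

lemma char_std_normal: "(\<integral>x. iexp (t * x) \<partial>std_normal) = complex_of_real (exp (- t\<^sup>2 / 2))"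
  using char_std_normal_distribution by (metis char_def)

interpretation std_normal: prob_space std_normal
  using real_dist_normal_dist by (rule real_distribution.axioms(1))

text \<open>Exchanging the component along a unit vector \<open>u\<close> for a fresh standard
  normal leaves the law unchanged. This reduces integrals over \<open>gauss\<close> to
  one-dimensional ones along the lines in direction \<open>u\<close>.\<close>

lemma gauss_split:
  fixes u :: "real ^ 'n"
  assumes u: "u \<bullet> u = 1"
  shows "distr (gauss \<Otimes>\<^sub>M std_normal) borel (\<lambda>p. fst p - (u \<bullet> fst p) *\<^sub>R u + snd p *\<^sub>R u) = gauss"
proof -
  interpret P: pair_prob_space "gauss :: (real ^ 'n) measure" std_normal ..
  have m: "(\<lambda>p. fst p - (u \<bullet> fst p) *\<^sub>R u + snd p *\<^sub>R u) \<in> borel_measurable (gauss \<Otimes>\<^sub>M std_normal)"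
    by measurable
  show ?thesis
  proof (rule char_eq_imp_measure_eq)
    show "prob_space (distr (gauss \<Otimes>\<^sub>M std_normal) borel (\<lambda>p. fst p - (u \<bullet> fst p) *\<^sub>R u + snd p *\<^sub>R u))"
      by (rule P.prob_space_distr[OF m])
    fix v
    define w where "w = v - (u \<bullet> v) *\<^sub>R u"
    have "v \<bullet> (x - (u \<bullet> x) *\<^sub>R u + s *\<^sub>R u) = w \<bullet> x + (u \<bullet> v) * s" for x s
      by (simp add: w_def inner_add_right inner_diff_right inner_diff_left inner_commute algebra_simps)
    then have "(\<integral>x. iexp (v \<bullet> x) \<partial>distr (gauss \<Otimes>\<^sub>M std_normal) borel (\<lambda>p. fst p - (u \<bullet> fst p) *\<^sub>R u + snd p *\<^sub>R u)) =
        (\<integral>p. iexp (w \<bullet> fst p + (u \<bullet> v) * snd p) \<partial>(gauss \<Otimes>\<^sub>M std_normal))"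
      by (subst integral_distr[OF m]) auto
    also have "\<dots> = (\<integral>x. iexp (w \<bullet> x) \<partial>gauss) * (\<integral>x. iexp ((u \<bullet> v) * x) \<partial>std_normal)"
      by (rule integral_pair_iexp) (auto intro: prob_space_gauss std_normal.prob_space_axioms)
    also have "\<dots> = complex_of_real (exp (- (w \<bullet> w) / 2) * exp (- (u \<bullet> v)\<^sup>2 / 2))"
      unfolding char_gauss char_std_normal by simp
    also have "exp (- (w \<bullet> w) / 2) * exp (- (u \<bullet> v)\<^sup>2 / 2) = exp (- (v \<bullet> v) / 2)"
    proof -
      have "w \<bullet> w = v \<bullet> v - (u \<bullet> v)\<^sup>2"
        using u by (simp add: w_def inner_diff_right inner_diff_left inner_commute power2_eq_square algebra_simps)
      then show ?thesis by (simp add: exp_add[symmetric] field_simps)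
    qed
    also have "complex_of_real (exp (- (v \<bullet> v) / 2)) = (\<integral>x. iexp (v \<bullet> x) \<partial>gauss)" by (rule char_gauss[symmetric])
    finally show "(\<integral>x. iexp (v \<bullet> x) \<partial>distr (gauss \<Otimes>\<^sub>M std_normal) borel (\<lambda>p. fst p - (u \<bullet> fst p) *\<^sub>R u + snd p *\<^sub>R u)) =
        (\<integral>x. iexp (v \<bullet> x) \<partial>gauss)" .
  qed (auto intro: prob_space_gauss)
qed

lemma gauss_marginal:
  fixes u :: "real ^ 'n"
  assumes u: "u \<bullet> u = 1"
  shows "distr gauss borel (\<lambda>x. u \<bullet> x) = std_normal"
proof (rule Levy_uniqueness)
  have m: "(\<lambda>x. u \<bullet> x) \<in> borel_measurable gauss" by measurable
  show "real_distribution (distr gauss borel (\<lambda>x. u \<bullet> x))"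
    using gauss.prob_space_distr[OF m] by (simp add: real_distribution_def real_distribution_axioms_def)
  show "real_distribution std_normal" by (rule real_dist_normal_dist)
  show "char (distr gauss borel (\<lambda>x. u \<bullet> x)) = char std_normal"
  proof
    fix t
    have "char (distr gauss borel (\<lambda>x. u \<bullet> x)) t = (\<integral>x. iexp ((t *\<^sub>R u) \<bullet> x) \<partial>gauss)"
      unfolding char_def by (subst integral_distr[OF m]) auto
    also have "\<dots> = complex_of_real (exp (- t\<^sup>2 / 2))"
      unfolding char_gauss using u by (simp add: power2_eq_square)
    finally show "char (distr gauss borel (\<lambda>x. u \<bullet> x)) t = char std_normal t"
      by (simp add: char_std_normal_distribution)
  qed
qed

lemma integrable_gauss_component_power: "integrable gauss (\<lambda>x :: real ^ 'n. \<bar>x $ i\<bar> ^ k)"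
proof -
  have "distr gauss borel (\<lambda>x :: real ^ 'n. axis i 1 \<bullet> x) = std_normal"
    by (rule gauss_marginal) (simp add: inner_axis_axis)
  then have d: "distr gauss borel (\<lambda>x :: real ^ 'n. x $ i) = std_normal" by (simp add: inner_axis')
  have "integrable std_normal (\<lambda>x. \<bar>x ^ k\<bar>)"
    by (intro integrable_abs integrable_std_normal_distribution_moment)
  then have "integrable (distr gauss borel (\<lambda>x :: real ^ 'n. x $ i)) (\<lambda>x. \<bar>x\<bar> ^ k)" by (simp add: d power_abs)
  then show ?thesis by (subst (asm) integrable_distr_eq) auto
qed

lemma norm_power_le_sum_components: "norm x ^ k \<le> real CARD('n) ^ k * (\<Sum>i\<in>UNIV. \<bar>x $ i\<bar> ^ k)" for x :: "real ^ 'n"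
proof -
  define m where "m = Max (range (\<lambda>i. \<bar>x $ i\<bar>))"
  have "m \<in> range (\<lambda>i. \<bar>x $ i\<bar>)" unfolding m_def by (intro Max_in) auto
  then obtain j where j: "m = \<bar>x $ j\<bar>" by blast
  have le: "\<bar>x $ i\<bar> \<le> m" for i unfolding m_def by (intro Max_ge) auto
  have "norm x \<le> (\<Sum>i\<in>UNIV. \<bar>x $ i\<bar>)" by (rule norm_le_l1_cart)
  also have "\<dots> \<le> real CARD('n) * m" using sum_bounded_above[of UNIV "\<lambda>i. \<bar>x $ i\<bar>" m] le by simp
  finally have "norm x ^ k \<le> (real CARD('n) * m) ^ k" by (intro power_mono) auto
  also have "\<dots> = real CARD('n) ^ k * \<bar>x $ j\<bar> ^ k" by (simp add: power_mult_distrib j)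
  also have "\<bar>x $ j\<bar> ^ k \<le> (\<Sum>i\<in>UNIV. \<bar>x $ i\<bar> ^ k)" by (rule member_le_sum) auto
  finally show ?thesis by (simp add: mult_left_mono)
qed

lemma integrable_gauss_norm_power: "integrable gauss (\<lambda>x :: real ^ 'n. norm x ^ k)"
proof (rule Bochner_Integration.integrable_bound)
  show "integrable gauss (\<lambda>x :: real ^ 'n. real CARD('n) ^ k * (\<Sum>i\<in>UNIV. \<bar>x $ i\<bar> ^ k))"
    by (intro integrable_mult_right Bochner_Integration.integrable_sum integrable_gauss_component_power)
  show "AE x :: real ^ 'n in gauss. norm (norm x ^ k) \<le> norm (real CARD('n) ^ k * (\<Sum>i\<in>UNIV. \<bar>x $ i\<bar> ^ k))"
    using norm_power_le_sum_components[of _ k] by (intro AE_I2) (auto simp: sum_nonneg)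
qed measurable

lemma integrable_gauss_poly_bound:
  fixes g :: "real ^ 'n \<Rightarrow> real"
  assumes [measurable]: "g \<in> borel_measurable borel" and le: "\<And>x. \<bar>g x\<bar> \<le> c * (1 + norm x) ^ k"
  shows "integrable gauss g"
proof (rule Bochner_Integration.integrable_bound)
  show "integrable gauss (\<lambda>x :: real ^ 'n. c * (\<Sum>j\<le>k. of_nat (k choose j) * norm x ^ j))"
    by (intro integrable_mult_right Bochner_Integration.integrable_sum integrable_gauss_norm_power)
  have eq: "(1 + norm x) ^ k = (\<Sum>j\<le>k. of_nat (k choose j) * norm x ^ j)" for x :: "real ^ 'n"
    using binomial_ring[of "norm x" 1 k] by (simp add: add.commute)
  show "AE x in gauss. norm (g x) \<le> norm (c * (\<Sum>j\<le>k. of_nat (k choose j) * norm x ^ j))"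
  proof (rule AE_I2)
    fix x
    have "norm (g x) \<le> \<bar>c * (1 + norm x) ^ k\<bar>" using le[of x] by simp
    then show "norm (g x) \<le> norm (c * (\<Sum>j\<le>k. of_nat (k choose j) * norm x ^ j))" unfolding eq by simp
  qed
qed measurable

lemma gauss_first_moment: "(\<integral>x. a \<bullet> x \<partial>gauss) = 0"
  and gauss_second_moment: "(\<integral>x. (a \<bullet> x)\<^sup>2 \<partial>gauss) = a \<bullet> a" for a :: "real ^ 'n"
proof -
  have "(\<integral>x. a \<bullet> x \<partial>gauss) = 0 \<and> (\<integral>x. (a \<bullet> x)\<^sup>2 \<partial>gauss) = a \<bullet> a"
  proof (cases "a = 0")
    case False
    define u where "u = (1 / norm a) *\<^sub>R a"
    have u: "u \<bullet> u = 1" using False by (simp add: u_def dot_square_norm power2_eq_square)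
    have a: "a \<bullet> x = norm a * (u \<bullet> x)" for x using False by (simp add: u_def)
    have "(\<integral>x. u \<bullet> x \<partial>gauss) = (\<integral>x. x ^ 1 \<partial>std_normal)" "(\<integral>x. (u \<bullet> x)\<^sup>2 \<partial>gauss) = (\<integral>x. x ^ (2 * 1) \<partial>std_normal)"
      unfolding gauss_marginal[OF u, symmetric] by (subst integral_distr; simp)+
    then have "(\<integral>x. u \<bullet> x \<partial>gauss) = 0" "(\<integral>x. (u \<bullet> x)\<^sup>2 \<partial>gauss) = 1"
      using integral_std_normal_distribution_moment_odd[of 1] std_normal_distribution_even_moments(1)[of 1]
      by (auto simp: fact_numeral)
    then show ?thesis by (simp add: a power_mult_distrib dot_square_norm)
  qed simp
  then show "(\<integral>x. a \<bullet> x \<partial>gauss) = 0" "(\<integral>x. (a \<bullet> x)\<^sup>2 \<partial>gauss) = a \<bullet> a" by auto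
qed

section \<open>Taylor expansion under a Gaussian shift\<close>

lemma borel_of_lipschitz:
  fixes f :: "'a::real_normed_vector \<Rightarrow> real"
  assumes "\<And>x y. \<bar>f x - f y\<bar> \<le> l * norm (x - y)"
  shows "f \<in> borel_measurable borel"
proof (rule borel_measurable_continuous_onI)
  have "dist (f x) (f y) \<le> \<bar>l\<bar> * dist x y" for x y
  proof -
    have "l * norm (x - y) \<le> \<bar>l\<bar> * norm (x - y)" by (rule mult_right_mono) auto
    then show ?thesis using assms[of x y] by (simp add: dist_norm)
  qed
  then have "\<bar>l\<bar>-lipschitz_on UNIV f" by (intro lipschitz_onI) auto
  then show "continuous_on UNIV f" by (rule lipschitz_on_continuous_on)
qed

text \<open>The integrand is the square of \<open>exp (\<bar>n\<bar> + 1)\<close>: one factor comes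
  from the remainder of the exponential series, the other absorbs the polynomial factors.\<close>

lemma integrable_std_normal_exp_abs: "integrable std_normal (\<lambda>n. exp (2 * \<bar>n\<bar> + 2))"
proof -
  have i: "integrable lborel (\<lambda>n. std_normal_density n * exp (t * n))" for t :: real
  proof -
    have "std_normal_density n * exp (t * n) = exp (t\<^sup>2 / 2) * normal_density t 1 n" for n
      by (simp add: normal_density_def exp_add[symmetric] power2_eq_square algebra_simps add_divide_distrib diff_divide_distrib)
    then show ?thesis by simp
  qed
  have "integrable lborel (\<lambda>n. exp 2 * (std_normal_density n * exp (2 * n) + std_normal_density n * exp (- 2 * n)))"
    by (intro integrable_mult_right Bochner_Integration.integrable_add i)
  then have "integrable lborel (\<lambda>n. std_normal_density n * exp (2 * \<bar>n\<bar> + 2))"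
  proof (rule Bochner_Integration.integrable_bound)
    show "AE n in lborel. norm (std_normal_density n * exp (2 * \<bar>n\<bar> + 2)) \<le>
        norm (exp 2 * (std_normal_density n * exp (2 * n) + std_normal_density n * exp (- 2 * n)))"
    proof (rule AE_I2)
      fix n :: real
      have "exp (2 * \<bar>n\<bar>) \<le> exp (2 * n) + exp (- 2 * n)"
        by (cases "0 \<le> n") auto
      then have "exp (2 * \<bar>n\<bar> + 2) \<le> exp 2 * (exp (2 * n) + exp (- 2 * n))"
        unfolding exp_add by (simp add: mult.commute)
      then have "std_normal_density n * exp (2 * \<bar>n\<bar> + 2) \<le> std_normal_density n * (exp 2 * (exp (2 * n) + exp (- 2 * n)))"
        by (intro mult_left_mono) auto
      then show "norm (std_normal_density n * exp (2 * \<bar>n\<bar> + 2)) \<le>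
        norm (exp 2 * (std_normal_density n * exp (2 * n) + std_normal_density n * exp (- 2 * n)))"
        by (simp add: abs_mult algebra_simps)
    qed
  qed measurable
  then show ?thesis by (subst integrable_density) auto
qed

lemma abs_exp_remainder_2: "\<bar>exp a - 1 - a - a\<^sup>2 / 2\<bar> \<le> \<bar>a\<bar> ^ 3 * exp \<bar>a\<bar>" for a :: real
proof -
  obtain t where t: "\<bar>t\<bar> \<le> \<bar>a\<bar>" "exp a = (\<Sum>m<3. a ^ m / fact m) + exp t / fact 3 * a ^ 3"
    using Maclaurin_exp_le[of a 3] by blast
  have "exp a - 1 - a - a\<^sup>2 / 2 = exp t / 6 * a ^ 3"
    unfolding t(2) by (simp add: eval_nat_numeral)
  then have "\<bar>exp a - 1 - a - a\<^sup>2 / 2\<bar> = \<bar>exp t / 6 * a ^ 3\<bar>" by (rule arg_cong)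
  also have "\<dots> = \<bar>a\<bar> ^ 3 * (exp t / 6)"
    by (simp add: abs_mult power_abs)
  also have "\<dots> \<le> \<bar>a\<bar> ^ 3 * exp \<bar>a\<bar>"
  proof (rule mult_left_mono)
    have "exp t / 6 \<le> exp t" by simp
    also have "\<dots> \<le> exp \<bar>a\<bar>" using t(1) by simp
    finally show "exp t / 6 \<le> exp \<bar>a\<bar>" .
  qed simp
  finally show ?thesis .
qed

lemma power_le_fact_exp: "x ^ k \<le> fact k * exp x" if "0 \<le> x" for x :: real
proof -
  have "x ^ k / fact k \<le> exp x"
  proof -
    have "(\<Sum>m\<in>{k}. x ^ m /\<^sub>R fact m) \<le> (\<Sum>m. x ^ m /\<^sub>R fact m)"
    proof (rule sum_le_suminf[OF summable_exp_generic])
      show "0 \<le> x ^ m /\<^sub>R fact m" for m using that by simp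
    qed simp
    also have "\<dots> = exp x" by (simp add: exp_def)
    finally show ?thesis by (simp add: divide_inverse mult.commute)
  qed
  then show ?thesis by (simp add: divide_le_eq mult.commute)
qed

text \<open>For \<open>a = s * n - s^2 / 2\<close> the sum \<open>1 + a + a^2 / 2\<close> agrees
  with the second-order polynomial in \<open>s\<close> up to \<open>s^4 / 8 - s^3 * n / 2\<close>.
  This and the cubic remainder of \<open>exp a\<close> are both of order
  \<open>\<bar>s\<bar>^3\<close>; the restriction on \<open>s\<close> gives
  \<open>\<bar>a\<bar> \<le> \<bar>n\<bar> + 1\<close> inside the exponential.\<close>

lemma gaussian_shift_kernel_bound:
  fixes s n :: real
  assumes s1: "\<bar>s\<bar> \<le> 1"
  shows "\<bar>exp (s * n - s\<^sup>2 / 2) - 1 - s * n - s\<^sup>2 / 2 * (n\<^sup>2 - 1)\<bar> \<le> \<bar>s\<bar> ^ 3 * (2 * (\<bar>n\<bar> + 1) ^ 3 * exp (\<bar>n\<bar> + 1))"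
proof -
  define a where "a = s * n - s\<^sup>2 / 2"
  have ab: "\<bar>a\<bar> \<le> \<bar>s\<bar> * (\<bar>n\<bar> + 1)"
  proof -
    have "\<bar>a\<bar> \<le> \<bar>s * n\<bar> + \<bar>s\<^sup>2 / 2\<bar>" unfolding a_def by (rule abs_triangle_ineq4)
    also have "\<bar>s\<^sup>2 / 2\<bar> \<le> \<bar>s\<bar> * 1"
      using s1 mult_left_mono[of "\<bar>s\<bar>" 1 "\<bar>s\<bar>"] by (simp add: power2_eq_square abs_mult)
    finally show ?thesis by (simp add: abs_mult algebra_simps)
  qed
  have ab1: "\<bar>a\<bar> \<le> \<bar>n\<bar> + 1"
    by (rule order_trans[OF ab]) (use s1 in \<open>simp add: mult_left_le_one_le\<close>)
  have "(exp (s * n - s\<^sup>2 / 2) - 1 - s * n - s\<^sup>2 / 2 * (n\<^sup>2 - 1)) = (exp a - 1 - a - a\<^sup>2 / 2) + (s ^ 4 / 8 - s ^ 3 * n / 2)"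
    by (simp add: a_def power2_eq_square field_simps eval_nat_numeral)
  then have "\<bar>(exp (s * n - s\<^sup>2 / 2) - 1 - s * n - s\<^sup>2 / 2 * (n\<^sup>2 - 1))\<bar> \<le> \<bar>exp a - 1 - a - a\<^sup>2 / 2\<bar> + (\<bar>s ^ 4 / 8\<bar> + \<bar>s ^ 3 * n / 2\<bar>)" by linarith
  also have "\<dots> \<le> \<bar>s\<bar> ^ 3 * ((\<bar>n\<bar> + 1) ^ 3 * exp (\<bar>n\<bar> + 1)) + \<bar>s\<bar> ^ 3 * ((\<bar>n\<bar> + 1) ^ 3 * exp (\<bar>n\<bar> + 1))"
  proof (rule add_mono)
    have "\<bar>exp a - 1 - a - a\<^sup>2 / 2\<bar> \<le> \<bar>a\<bar> ^ 3 * exp \<bar>a\<bar>" by (rule abs_exp_remainder_2)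
    also have "\<dots> \<le> (\<bar>s\<bar> * (\<bar>n\<bar> + 1)) ^ 3 * exp (\<bar>n\<bar> + 1)"
      using ab ab1 by (intro mult_mono power_mono) auto
    finally show "\<bar>exp a - 1 - a - a\<^sup>2 / 2\<bar> \<le> \<bar>s\<bar> ^ 3 * ((\<bar>n\<bar> + 1) ^ 3 * exp (\<bar>n\<bar> + 1))"
      by (simp add: power_mult_distrib mult.assoc)
    have "\<bar>s ^ 4 / 8\<bar> = \<bar>s\<bar> ^ 3 * (\<bar>s\<bar> / 8)" by (simp add: eval_nat_numeral abs_mult)
    also have "\<dots> \<le> \<bar>s\<bar> ^ 3 * 1" using s1 by (intro mult_left_mono) auto
    finally have "\<bar>s ^ 4 / 8\<bar> \<le> \<bar>s\<bar> ^ 3 * 1" .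
    moreover have "\<bar>s ^ 3 * n / 2\<bar> \<le> \<bar>s\<bar> ^ 3 * \<bar>n\<bar>" by (simp add: abs_mult power_abs)
    ultimately have "\<bar>s ^ 4 / 8\<bar> + \<bar>s ^ 3 * n / 2\<bar> \<le> \<bar>s\<bar> ^ 3 * (\<bar>n\<bar> + 1)" by (simp add: algebra_simps)
    also have "\<bar>n\<bar> + 1 \<le> (\<bar>n\<bar> + 1) ^ 3 * exp (\<bar>n\<bar> + 1)"
    proof -
      have "(\<bar>n\<bar> + 1) ^ 1 * 1 \<le> (\<bar>n\<bar> + 1) ^ 3 * exp (\<bar>n\<bar> + 1)"
        by (intro mult_mono power_increasing) auto
      then show ?thesis by simp
    qed
    finally show "\<bar>s ^ 4 / 8\<bar> + \<bar>s ^ 3 * n / 2\<bar> \<le> \<bar>s\<bar> ^ 3 * ((\<bar>n\<bar> + 1) ^ 3 * exp (\<bar>n\<bar> + 1))"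
      by (simp add: mult_left_mono)
  qed
  finally show ?thesis by (simp only: mult_ac mult_2[symmetric])
qed

text \<open>For \<open>|s| \<le> 1\<close> the shift is expressed through the density ratio \<open>exp (s n - s\<^sup>2/2)\<close>, whose
  second-order Taylor polynomial in \<open>s\<close> is \<open>1 + s n + s\<^sup>2 (n\<^sup>2 - 1)/2\<close>; only increments of
  \<open>\<phi>\<close> enter, since the remainder integrates to \<open>0\<close>.\<close>
lemma gaussian_shift_taylor_1d:
  fixes \<phi> :: "real \<Rightarrow> real"
  assumes lip: "\<And>x y. \<bar>\<phi> x - \<phi> y\<bar> \<le> l * \<bar>x - y\<bar>"
  shows "\<bar>\<integral>n. \<phi> (s + n) - \<phi> n - s * (\<phi> n * n) - s\<^sup>2 / 2 * (\<phi> n * (n\<^sup>2 - 1)) \<partial>std_normal\<bar>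
    \<le> 100 * (\<integral>n. exp (2 * \<bar>n\<bar> + 2) \<partial>std_normal) * l * \<bar>s\<bar> ^ 3"
proof -
  define J where "J n = exp (2 * \<bar>n\<bar> + 2)" for n :: real
  have J: "integrable std_normal J" "0 < J n" "J \<in> borel_measurable borel" for n
    using integrable_std_normal_exp_abs by (auto simp: J_def[abs_def])
  note [measurable] = J(3)
  have Jexp: "J n = exp (\<bar>n\<bar> + 1) * exp (\<bar>n\<bar> + 1)" for n by (simp add: J_def exp_add[symmetric])
  have l0: "0 \<le> l" using lip[of 0 1] by (simp add: order_trans[OF abs_ge_zero])
  \<comment> \<open>Since \<open>n\<close> and \<open>n^2 - 1\<close> have mean 0, subtracting
    \<open>\<phi> 0\<close> does not change the integral; it leaves a function bounded by
    \<open>l * \<bar>n\<bar>\<close>.\<close>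
  define \<psi> where "\<psi> n = \<phi> n - \<phi> 0" for n
  have psi: "\<bar>\<psi> n\<bar> \<le> l * \<bar>n\<bar>" "\<bar>\<psi> (s + n) - \<psi> n\<bar> \<le> l * \<bar>s\<bar>" for n s
    using lip[of n 0] lip[of "s + n" n] by (auto simp: \<psi>_def)
  have [measurable]: "\<phi> \<in> borel_measurable borel"
    by (rule borel_of_lipschitz[of _ l]) (use lip in auto)
  then have [measurable]: "\<psi> \<in> borel_measurable borel" unfolding \<psi>_def by measurable
  have intJ: "integrable std_normal g" if "g \<in> borel_measurable borel" "\<And>n. \<bar>g n\<bar> \<le> c * J n" for g c
    using integrable_mult_right[OF J(1), of c]
  proof (rule Bochner_Integration.integrable_bound)
    show "AE n in std_normal. norm (g n) \<le> norm (c * J n)"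
    proof (rule AE_I2)
      fix n show "norm (g n) \<le> norm (c * J n)" using that(2)[of n] by simp
    qed
  qed (use that in simp)
  have polyJ: "(\<bar>n\<bar> + 1) ^ 4 \<le> 24 * J n" for n
  proof -
    have "(\<bar>n\<bar> + 1) ^ 4 \<le> fact 4 * exp (\<bar>n\<bar> + 1)" by (rule power_le_fact_exp) simp
    also have "\<dots> \<le> 24 * J n" unfolding Jexp by (simp add: fact_numeral)
    finally show ?thesis .
  qed
  have pow: "(\<bar>n\<bar> + 1) ^ k \<le> 24 * J n" if "k \<le> 4" for k n
    using power_increasing[OF that, of "\<bar>n\<bar> + 1"] polyJ[of n] by simp
  have b1: "\<bar>n\<bar> \<le> 24 * J n" "\<bar>n\<bar> * \<bar>n\<bar> \<le> 24 * J n" "\<bar>n\<bar> * \<bar>n\<^sup>2 - 1\<bar> \<le> 24 * J n" "\<bar>n\<^sup>2 - 1\<bar> \<le> 24 * J n" "1 \<le> J n" for n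
  proof -
    have sq: "\<bar>n\<^sup>2 - 1\<bar> \<le> (\<bar>n\<bar> + 1) ^ 2"
    proof -
      have "\<bar>n\<^sup>2 - 1\<bar> \<le> \<bar>n\<bar>\<^sup>2 + 1" using abs_triangle_ineq4[of "n\<^sup>2" 1] by simp
      also have "\<dots> \<le> (\<bar>n\<bar> + 1) ^ 2" by (simp add: power2_eq_square algebra_simps)
      finally show ?thesis .
    qed
    show "\<bar>n\<bar> \<le> 24 * J n" using pow[of 1 n] by simp
    have "\<bar>n\<bar> * \<bar>n\<bar> \<le> (\<bar>n\<bar> + 1) ^ 2" by (simp add: power2_eq_square algebra_simps)
    then show "\<bar>n\<bar> * \<bar>n\<bar> \<le> 24 * J n" using pow[of 2 n] by simp
    have "\<bar>n\<bar> * \<bar>n\<^sup>2 - 1\<bar> \<le> (\<bar>n\<bar> + 1) * (\<bar>n\<bar> + 1) ^ 2" by (rule mult_mono[OF _ sq]) auto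
    also have "\<dots> = (\<bar>n\<bar> + 1) ^ 3" by (simp add: eval_nat_numeral)
    finally show "\<bar>n\<bar> * \<bar>n\<^sup>2 - 1\<bar> \<le> 24 * J n" using pow[of 3 n] by simp
    show "\<bar>n\<^sup>2 - 1\<bar> \<le> 24 * J n" using sq pow[of 2 n] by simp
    show "1 \<le> J n" by (simp add: J_def)
  qed
  define I where "I = (\<integral>n. J n \<partial>std_normal)"
  have I1: "1 \<le> I"
  proof -
    have "(\<integral>n. 1 \<partial>std_normal) \<le> I" unfolding I_def using J(1) b1(5) by (intro integral_mono) auto
    then show ?thesis using std_normal.prob_space by simp
  qed
  have i1: "integrable std_normal (\<lambda>n. n)" "integrable std_normal (\<lambda>n. n\<^sup>2 - 1)"
    by (rule intJ[where c=24]; use b1 in simp)+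
  have z1: "(\<integral>n. n \<partial>std_normal) = 0" "(\<integral>n. n\<^sup>2 - 1 \<partial>std_normal) = 0"
  proof -
    show "(\<integral>n. n \<partial>std_normal) = 0" using integral_std_normal_distribution_moment_odd[of 1] by simp
    have "integrable std_normal (\<lambda>n. n\<^sup>2)" "(\<integral>n. n\<^sup>2 \<partial>std_normal) = 1"
      using std_normal_distribution_even_moments[of 1] by (auto simp: fact_numeral)
    then show "(\<integral>n. n\<^sup>2 - 1 \<partial>std_normal) = 0" using std_normal.prob_space by simp
  qed
  have ip: "integrable std_normal (\<lambda>n. \<psi> n * n)" "integrable std_normal (\<lambda>n. \<psi> n * (n\<^sup>2 - 1))"
    "integrable std_normal (\<lambda>n. \<psi> n)" "integrable std_normal (\<lambda>n. \<psi> (s + n) - \<psi> n)"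
  proof -
    have "\<bar>\<psi> n * n\<bar> \<le> l * 24 * J n" for n
    proof -
      have "\<bar>\<psi> n * n\<bar> \<le> (l * \<bar>n\<bar>) * \<bar>n\<bar>" unfolding abs_mult by (rule mult_right_mono[OF psi(1)]) simp
      also have "\<dots> \<le> l * (24 * J n)" unfolding mult.assoc by (rule mult_left_mono[OF _ l0]) (use b1 in simp)
      finally show ?thesis by simp
    qed
    then show "integrable std_normal (\<lambda>n. \<psi> n * n)" by (rule intJ[rotated]) measurable
    have "\<bar>\<psi> n * (n\<^sup>2 - 1)\<bar> \<le> l * 24 * J n" for n
    proof -
      have "\<bar>\<psi> n * (n\<^sup>2 - 1)\<bar> \<le> (l * \<bar>n\<bar>) * \<bar>n\<^sup>2 - 1\<bar>" unfolding abs_mult by (rule mult_right_mono[OF psi(1)]) simp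
      also have "\<dots> \<le> l * (24 * J n)" unfolding mult.assoc by (rule mult_left_mono[OF _ l0]) (use b1 in simp)
      finally show ?thesis by simp
    qed
    then show "integrable std_normal (\<lambda>n. \<psi> n * (n\<^sup>2 - 1))" by (rule intJ[rotated]) measurable
    have "\<bar>\<psi> n\<bar> \<le> l * 24 * J n" for n
      using order_trans[OF psi(1) mult_left_mono[OF b1(1) l0]] by (simp add: mult.assoc)
    then show "integrable std_normal (\<lambda>n. \<psi> n)" by (rule intJ[rotated]) measurable
    have "\<bar>\<psi> (s + n) - \<psi> n\<bar> \<le> l * \<bar>s\<bar> * J n" for n
    proof -
      have "l * \<bar>s\<bar> * 1 \<le> l * \<bar>s\<bar> * J n" using b1(5)[of n] l0 by (intro mult_left_mono) auto
      then show ?thesis using psi(2)[of s n] by simp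
    qed
    then show "integrable std_normal (\<lambda>n. \<psi> (s + n) - \<psi> n)" by (rule intJ[rotated]) measurable
  qed
  let ?E = "\<lambda>n. \<phi> (s + n) - \<phi> n - s * (\<phi> n * n) - s\<^sup>2 / 2 * (\<phi> n * (n\<^sup>2 - 1))"
  let ?F = "\<lambda>n. \<psi> (s + n) - \<psi> n - s * (\<psi> n * n) - s\<^sup>2 / 2 * (\<psi> n * (n\<^sup>2 - 1))"
  have EF: "?E n = ?F n - s * \<phi> 0 * n - s\<^sup>2 / 2 * \<phi> 0 * (n\<^sup>2 - 1)" for n
    by (simp add: \<psi>_def algebra_simps add_divide_distrib diff_divide_distrib)
  have "(\<integral>n. ?E n \<partial>std_normal) = (\<integral>n. ?F n \<partial>std_normal)"
    unfolding EF using i1 ip z1 by simp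
  moreover have "\<bar>\<integral>n. ?F n \<partial>std_normal\<bar> \<le> 100 * I * l * \<bar>s\<bar> ^ 3"
  proof (cases "\<bar>s\<bar> \<le> 1")
    \<comment> \<open>For \<open>\<bar>s\<bar> > 1\<close> no cancellation is involved: each of the
      three terms is by itself at most of order \<open>\<bar>s\<bar>^3\<close>.\<close>
    case False
    then have s1: "1 \<le> \<bar>s\<bar>" by simp
    have s3: "\<bar>s\<bar> \<le> \<bar>s\<bar> ^ 3" "\<bar>s\<bar> ^ 2 \<le> \<bar>s\<bar> ^ 3"
      using power_increasing[of 1 3 "\<bar>s\<bar>"] power_increasing[of 2 3 "\<bar>s\<bar>"] s1 by auto
    have "\<bar>?F n\<bar> \<le> 100 * l * \<bar>s\<bar> ^ 3 * J n" for n
    proof -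
      have "\<bar>?F n\<bar> \<le> \<bar>\<psi> (s + n) - \<psi> n\<bar> + \<bar>s * (\<psi> n * n)\<bar> + \<bar>s\<^sup>2 / 2 * (\<psi> n * (n\<^sup>2 - 1))\<bar>" by linarith
      also have "\<dots> \<le> l * \<bar>s\<bar> ^ 3 * J n + l * \<bar>s\<bar> ^ 3 * (24 * J n) + l * \<bar>s\<bar> ^ 3 * (24 * J n)"
      proof (intro add_mono)
        have "\<bar>\<psi> (s + n) - \<psi> n\<bar> \<le> l * \<bar>s\<bar>" by (rule psi)
        also have "\<dots> \<le> l * \<bar>s\<bar> ^ 3 * 1" using s3 l0 by (simp add: mult_left_mono)
        also have "\<dots> \<le> l * \<bar>s\<bar> ^ 3 * J n" using b1(5)[of n] l0 by (intro mult_left_mono) auto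
        finally show "\<bar>\<psi> (s + n) - \<psi> n\<bar> \<le> l * \<bar>s\<bar> ^ 3 * J n" .
        have "\<bar>s * (\<psi> n * n)\<bar> \<le> \<bar>s\<bar> * ((l * \<bar>n\<bar>) * \<bar>n\<bar>)" unfolding abs_mult
          by (intro mult_left_mono mult_right_mono psi) auto
        also have "\<dots> = (l * \<bar>s\<bar>) * (\<bar>n\<bar> * \<bar>n\<bar>)" by simp
        also have "\<dots> \<le> (l * \<bar>s\<bar> ^ 3) * (24 * J n)"
          by (rule mult_mono[OF mult_left_mono[OF s3(1) l0] b1(2)]) (use l0 in auto)
        finally show "\<bar>s * (\<psi> n * n)\<bar> \<le> l * \<bar>s\<bar> ^ 3 * (24 * J n)" .
        have "\<bar>s\<^sup>2 / 2 * (\<psi> n * (n\<^sup>2 - 1))\<bar> \<le> (\<bar>s\<bar>\<^sup>2) * ((l * \<bar>n\<bar>) * \<bar>n\<^sup>2 - 1\<bar>)" unfolding abs_mult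
          by (intro mult_mono mult_right_mono psi) (use l0 in auto)
        also have "\<dots> = (l * \<bar>s\<bar>\<^sup>2) * (\<bar>n\<bar> * \<bar>n\<^sup>2 - 1\<bar>)" by simp
        also have "\<dots> \<le> (l * \<bar>s\<bar> ^ 3) * (24 * J n)"
          by (rule mult_mono[OF mult_left_mono[OF s3(2) l0] b1(3)]) (use l0 in auto)
        finally show "\<bar>s\<^sup>2 / 2 * (\<psi> n * (n\<^sup>2 - 1))\<bar> \<le> l * \<bar>s\<bar> ^ 3 * (24 * J n)" .
      qed
      also have "\<dots> \<le> 100 * l * \<bar>s\<bar> ^ 3 * J n" using l0 J(2)[of n] by simp
      finally show ?thesis .
    qed
    then have "\<bar>\<integral>n. ?F n \<partial>std_normal\<bar> \<le> (\<integral>n. 100 * l * \<bar>s\<bar> ^ 3 * J n \<partial>std_normal)"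
      using ip by (intro order_trans[OF integral_abs_bound] integral_mono integrable_abs integrable_mult_right J) auto
    then show ?thesis by (simp add: I_def algebra_simps)
  next
    case s1: True
    define r where "r n = exp (s * n - s\<^sup>2 / 2) - 1 - s * n - s\<^sup>2 / 2 * (n\<^sup>2 - 1)" for n
    \<comment> \<open>Translating the integration variable moves the shift from the argument of
      \<open>\<psi>\<close> to the density. From here on the expansion is one of a smooth kernel, so
      that \<open>\<psi>\<close> is never differentiated.\<close>
    have shift: "(\<integral>n. \<psi> (s + n) \<partial>std_normal) = (\<integral>n. \<psi> n * exp (s * n - s\<^sup>2 / 2) \<partial>std_normal)"
    proof -
      have "(\<integral>n. \<psi> n * exp (s * n - s\<^sup>2 / 2) \<partial>std_normal) = (\<integral>n. std_normal_density n * (\<psi> n * exp (s * n - s\<^sup>2 / 2)) \<partial>lborel)"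
        by (subst integral_density) auto
      also have "\<dots> = (\<integral>n. std_normal_density (s + 1 * n) * (\<psi> (s + 1 * n) * exp (s * (s + 1 * n) - s\<^sup>2 / 2)) \<partial>lborel)"
        by (subst lborel_integral_real_affine[where c=1 and t=s]) auto
      also have "\<dots> = (\<integral>n. std_normal_density n * \<psi> (s + n) \<partial>lborel)"
      proof (rule Bochner_Integration.integral_cong[OF refl])
        fix n
        have "std_normal_density (s + n) * exp (s * (s + n) - s\<^sup>2 / 2) = std_normal_density n"
          by (simp add: std_normal_density_def exp_add[symmetric] power2_eq_square algebra_simps add_divide_distrib diff_divide_distrib)
        then show "std_normal_density (s + 1 * n) * (\<psi> (s + 1 * n) * exp (s * (s + 1 * n) - s\<^sup>2 / 2)) = std_normal_density n * \<psi> (s + n)"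
          by (simp add: algebra_simps)
      qed
      also have "\<dots> = (\<integral>n. \<psi> (s + n) \<partial>std_normal)" by (subst integral_density) auto
      finally show ?thesis ..
    qed
    have rb: "\<bar>r n\<bar> \<le> \<bar>s\<bar> ^ 3 * (2 * (\<bar>n\<bar> + 1) ^ 3 * exp (\<bar>n\<bar> + 1))" for n
      unfolding r_def by (rule gaussian_shift_kernel_bound[OF s1])
    have pr: "\<bar>\<psi> n * r n\<bar> \<le> 48 * l * \<bar>s\<bar> ^ 3 * J n" for n
    proof -
      have "\<bar>\<psi> n * r n\<bar> \<le> (l * (\<bar>n\<bar> + 1)) * (\<bar>s\<bar> ^ 3 * (2 * (\<bar>n\<bar> + 1) ^ 3 * exp (\<bar>n\<bar> + 1)))"
        unfolding abs_mult
        by (intro mult_mono rb order_trans[OF psi(1)] mult_left_mono mult_nonneg_nonneg l0) auto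
      also have "\<dots> = 2 * l * \<bar>s\<bar> ^ 3 * ((\<bar>n\<bar> + 1) ^ 4 * exp (\<bar>n\<bar> + 1))" by (simp add: eval_nat_numeral)
      also have "(\<bar>n\<bar> + 1) ^ 4 * exp (\<bar>n\<bar> + 1) \<le> (24 * exp (\<bar>n\<bar> + 1)) * exp (\<bar>n\<bar> + 1)"
        using power_le_fact_exp[of "\<bar>n\<bar> + 1" 4] by (intro mult_right_mono) (auto simp: fact_numeral)
      finally show ?thesis using l0 by (simp add: Jexp mult_left_mono mult.assoc)
    qed
    have [measurable]: "r \<in> borel_measurable borel" unfolding r_def by measurable
    have intr: "integrable std_normal (\<lambda>n. \<psi> n * r n)"
      by (rule intJ[OF _ pr]) measurable
    have ips: "integrable std_normal (\<lambda>n. \<psi> (s + n))"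
      using Bochner_Integration.integrable_add[OF ip(4) ip(3)] by simp
    have "\<psi> n * exp (s * n - s\<^sup>2 / 2) = \<psi> n * r n + \<psi> n + s * (\<psi> n * n) + s\<^sup>2 / 2 * (\<psi> n * (n\<^sup>2 - 1))" for n
      by (simp add: r_def field_simps)
    then have "(\<integral>n. \<psi> (s + n) \<partial>std_normal) = (\<integral>n. \<psi> n * r n + \<psi> n + s * (\<psi> n * n) + s\<^sup>2 / 2 * (\<psi> n * (n\<^sup>2 - 1)) \<partial>std_normal)"
      unfolding shift by simp
    then have e1: "(\<integral>n. ?F n \<partial>std_normal) = (\<integral>n. \<psi> n * r n \<partial>std_normal)"
      using intr ip ips by simp
    have e2: "\<bar>\<integral>n. \<psi> n * r n \<partial>std_normal\<bar> \<le> (\<integral>n. 48 * l * \<bar>s\<bar> ^ 3 * J n \<partial>std_normal)"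
      using intr pr by (intro order_trans[OF integral_abs_bound] integral_mono integrable_abs integrable_mult_right J) auto
    have e3: "(\<integral>n. 48 * l * \<bar>s\<bar> ^ 3 * J n \<partial>std_normal) = 48 * l * \<bar>s\<bar> ^ 3 * I" by (simp add: I_def)
    have e4: "48 * l * \<bar>s\<bar> ^ 3 * I \<le> 100 * l * \<bar>s\<bar> ^ 3 * I"
      using l0 I1 by (intro mult_right_mono) auto
    have "\<bar>\<integral>n. \<psi> n * r n \<partial>std_normal\<bar> \<le> 100 * l * \<bar>s\<bar> ^ 3 * I" using e2 e3 e4 by linarith
    also have "\<dots> = 100 * I * l * \<bar>s\<bar> ^ 3" by simp
    finally show ?thesis unfolding e1 .
  qed
  ultimately show ?thesis by (simp add: I_def J_def)
qed

section \<open>Gaussian smoothing of Lipschitz functions in several dimensions\<close>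

definition shift_const :: real where
  "shift_const = 100 * (\<integral>n. exp (2 * \<bar>n\<bar> + 2) \<partial>std_normal)"

lemma shift_const_nonneg: "0 \<le> shift_const"
  unfolding shift_const_def by simp

definition smoothed :: "(real ^ 'n \<Rightarrow> real) \<Rightarrow> real ^ 'm ^ 'n \<Rightarrow> real ^ 'n \<Rightarrow> real" where
  "smoothed f L x = (\<integral>z. f (x + L *v z) \<partial>gauss)"

lemma measure_gauss_UNIV [simp]: "measure (gauss :: (real ^ 'n) measure) UNIV = 1"
  using prob_space.prob_space[OF prob_space_gauss] by simp

lemma matrix_vector_norm_le: "norm (A *v x) \<le> norm A * norm x" for A :: "real ^ 'm ^ 'n"
proof -
  have "(norm (A *v x))\<^sup>2 = (\<Sum>i\<in>UNIV. (A $ i \<bullet> x)\<^sup>2)"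
    unfolding power2_norm_eq_inner inner_vec_def[of "A *v x"] matrix_vector_mul_component
    by (simp add: power2_eq_square)
  also have "\<dots> \<le> (\<Sum>i\<in>UNIV. (norm (A $ i))\<^sup>2 * (norm x)\<^sup>2)"
    by (intro sum_mono) (metis Cauchy_Schwarz_ineq power2_norm_eq_inner)
  also have "\<dots> = (norm A * norm x)\<^sup>2"
    by (simp add: power_mult_distrib sum_distrib_right power2_norm_eq_inner inner_vec_def)
  finally show ?thesis by (rule power2_le_imp_le) simp
qed

lemma lipschitz_linear_growth:
  fixes f :: "real ^ 'n \<Rightarrow> real" and L :: "real ^ 'm ^ 'n"
  assumes lip: "\<And>x y. \<bar>f x - f y\<bar> \<le> norm (x - y)"
  obtains c where "0 \<le> c" "\<And>z. \<bar>f (x + L *v z)\<bar> \<le> c * (1 + norm z)"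
proof
  show "0 \<le> \<bar>f x\<bar> + norm L" by simp
  fix z
  have "\<bar>f (x + L *v z)\<bar> \<le> \<bar>f x\<bar> + norm (L *v z)" using lip[of "x + L *v z" x] by simp
  also have "\<dots> \<le> \<bar>f x\<bar> + norm L * norm z" using matrix_vector_norm_le[of L z] by simp
  also have "\<dots> \<le> (\<bar>f x\<bar> + norm L) * (1 + norm z)" by (simp add: algebra_simps)
  finally show "\<bar>f (x + L *v z)\<bar> \<le> (\<bar>f x\<bar> + norm L) * (1 + norm z)" .
qed

lemma smoothed_integrable:
  fixes f :: "real ^ 'n \<Rightarrow> real" and L :: "real ^ 'm ^ 'n"
  assumes lip: "\<And>x y. \<bar>f x - f y\<bar> \<le> norm (x - y)" and g: "g \<in> borel_measurable borel" "\<And>z. \<bar>g z\<bar> \<le> c * (1 + norm z) ^ k"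
  shows "integrable gauss (\<lambda>z. f (x + L *v z) * g z)"
proof -
  have [measurable]: "f \<in> borel_measurable borel" by (rule borel_of_lipschitz[of _ 1]) (use lip in simp)
  note [measurable] = g(1)
  obtain c' where c': "0 \<le> c'" "\<And>z. \<bar>f (x + L *v z)\<bar> \<le> c' * (1 + norm z)"
    using lipschitz_linear_growth[OF lip] by blast
  show ?thesis
  proof (rule integrable_gauss_poly_bound)
    fix z
    have "\<bar>f (x + L *v z) * g z\<bar> \<le> (c' * (1 + norm z)) * (c * (1 + norm z) ^ k)"
      unfolding abs_mult by (intro mult_mono c' g) (use c' in auto)
    then show "\<bar>f (x + L *v z) * g z\<bar> \<le> (c' * c) * (1 + norm z) ^ Suc k" by (simp add: mult_ac)
  qed measurable
qed

lemma gaussian_shift_integrable: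
  fixes f :: "real ^ 'n \<Rightarrow> real" and L :: "real ^ 'm ^ 'n"
  assumes lip: "\<And>x y. \<bar>f x - f y\<bar> \<le> norm (x - y)"
  shows "integrable gauss (\<lambda>z. f (x + L *v z))"
    and "integrable gauss (\<lambda>z. f (x + L *v (z + w)))"
    and "integrable gauss (\<lambda>z. f (x + L *v z) * (w \<bullet> z))"
    and "integrable gauss (\<lambda>z. f (x + L *v z) * ((w \<bullet> z)\<^sup>2 - w \<bullet> w))"
    and "integrable gauss (\<lambda>z. f (x + L *v z) * (z $ i))"
    and "integrable gauss (\<lambda>z. f (x + L *v z) * (z $ i * z $ j - d))"
proof -
  note i = smoothed_integrable[OF lip, of _ _ _ x L]
  show i1: "integrable gauss (\<lambda>z. f (x + L *v z))" for x
    using smoothed_integrable[OF lip, of "\<lambda>_. 1" 1 0 x L] by simp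
  show "integrable gauss (\<lambda>z. f (x + L *v (z + w)))"
    using i1[of "x + L *v w"] by (simp add: matrix_vector_right_distrib algebra_simps)
  show "integrable gauss (\<lambda>z. f (x + L *v z) * (w \<bullet> z))"
  proof (rule i)
    fix z
    have "\<bar>w \<bullet> z\<bar> \<le> norm w * norm z" by (rule Cauchy_Schwarz_ineq2)
    also have "\<dots> \<le> norm w * (1 + norm z) ^ 1" by (intro mult_left_mono) auto
    finally show "\<bar>w \<bullet> z\<bar> \<le> norm w * (1 + norm z) ^ 1" .
  qed measurable
  show "integrable gauss (\<lambda>z. f (x + L *v z) * ((w \<bullet> z)\<^sup>2 - w \<bullet> w))"
  proof (rule i)
    fix z
    have "\<bar>(w \<bullet> z)\<^sup>2 - w \<bullet> w\<bar> \<le> (w \<bullet> z)\<^sup>2 + w \<bullet> w" using abs_triangle_ineq4[of "(w \<bullet> z)\<^sup>2" "w \<bullet> w"] by simp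
    also have "\<dots> \<le> (w \<bullet> w) * (z \<bullet> z) + w \<bullet> w" using Cauchy_Schwarz_ineq[of w z] by simp
    also have "\<dots> \<le> (w \<bullet> w) * (1 + norm z) ^ 2"
      by (simp add: power2_eq_square dot_square_norm algebra_simps)
    finally show "\<bar>(w \<bullet> z)\<^sup>2 - w \<bullet> w\<bar> \<le> (w \<bullet> w) * (1 + norm z) ^ 2" .
  qed measurable
  show "integrable gauss (\<lambda>z. f (x + L *v z) * (z $ i))"
  proof (rule i)
    fix z :: "real ^ 'm"
    show "\<bar>z $ i\<bar> \<le> 1 * (1 + norm z) ^ 1" using component_le_norm_cart[of z i] by simp
  qed measurable
  show "integrable gauss (\<lambda>z. f (x + L *v z) * (z $ i * z $ j - d))"
  proof (rule i)
    fix z :: "real ^ 'm"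
    have "\<bar>z $ i * z $ j - d\<bar> \<le> \<bar>z $ i * z $ j\<bar> + \<bar>d\<bar>" by (rule abs_triangle_ineq4)
    also have "\<bar>z $ i * z $ j\<bar> \<le> norm z * norm z"
      unfolding abs_mult by (intro mult_mono component_le_norm_cart) auto
    also have "norm z * norm z + \<bar>d\<bar> \<le> (1 + \<bar>d\<bar>) * (1 + norm z) ^ 2"
      by (simp add: power2_eq_square algebra_simps)
    finally show "\<bar>z $ i * z $ j - d\<bar> \<le> (1 + \<bar>d\<bar>) * (1 + norm z) ^ 2" by simp
  qed measurable
qed

text \<open>Along \<open>u = w / norm w\<close> the function has Lipschitz constant
  \<open>norm (L *v u)\<close>, so the one-dimensional estimate gives
  \<open>norm (L *v u) * norm w ^ 3\<close>, which is the stated bound. One factor is thus measured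
  in the space of \<open>x\<close> and two in the coordinates of the smoothing Gaussian. This
  asymmetry is what later produces \<open>t\<close> times a trace.\<close>

lemma gaussian_shift_taylor:
  fixes f :: "real ^ 'n \<Rightarrow> real" and L :: "real ^ 'm ^ 'n"
  assumes lip: "\<And>x y. \<bar>f x - f y\<bar> \<le> norm (x - y)"
  shows "\<bar>\<integral>z. f (x + L *v (z + w)) - f (x + L *v z) - f (x + L *v z) * (w \<bullet> z)
      - f (x + L *v z) * ((w \<bullet> z)\<^sup>2 - w \<bullet> w) / 2 \<partial>gauss\<bar> \<le> shift_const * norm (L *v w) * (norm w)\<^sup>2"
proof (cases "w = 0")
  case False
  define s where "s = norm w"
  have s: "0 < s" using False by (simp add: s_def)
  define u where "u = (1 / s) *\<^sub>R w"
  have wu: "w = s *\<^sub>R u" using s by (simp add: u_def)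
  have u: "u \<bullet> u = 1" using False by (simp add: u_def s_def dot_square_norm power2_eq_square)
  have nu: "norm u = 1" using u by (simp add: norm_eq_sqrt_inner)
  have [measurable]: "f \<in> borel_measurable borel" by (rule borel_of_lipschitz[of _ 1]) (use lip in simp)
  define h where "h z = f (x + L *v (z + w)) - f (x + L *v z) - f (x + L *v z) * (w \<bullet> z)
      - f (x + L *v z) * ((w \<bullet> z)\<^sup>2 - w \<bullet> w) / 2" for z
  have hm [measurable]: "h \<in> borel_measurable borel" unfolding h_def by measurable
  have hi: "integrable gauss h"
    unfolding h_def by (intro Bochner_Integration.integrable_diff integrable_divide gaussian_shift_integrable lip)
  interpret P: pair_prob_space "gauss :: (real ^ 'm) measure" std_normal ..
  define T where "T p = fst p - (u \<bullet> fst p) *\<^sub>R u + snd p *\<^sub>R u" for p :: "(real ^ 'm) \<times> real"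
  have Tm: "T \<in> borel_measurable (gauss \<Otimes>\<^sub>M std_normal)" unfolding T_def by measurable
  have dT: "distr (gauss \<Otimes>\<^sub>M std_normal) borel T = gauss" unfolding T_def by (rule gauss_split[OF u])
  have hT: "integrable (gauss \<Otimes>\<^sub>M std_normal) (\<lambda>p. h (T p))"
    using hi integrable_distr_eq[OF Tm hm] unfolding dT by simp
  have eq: "(\<integral>z. h z \<partial>gauss) = (\<integral>z. (\<integral>n. h (T (z, n)) \<partial>std_normal) \<partial>gauss)"
  proof -
    have "(\<integral>z. h z \<partial>gauss) = (\<integral>p. h (T p) \<partial>(gauss \<Otimes>\<^sub>M std_normal))"
      using integral_distr[OF Tm hm] unfolding dT .
    then show ?thesis using P.integral_fst'[OF hT] by simp
  qed
  define B where "B = shift_const * norm (L *v w) * (norm w)\<^sup>2"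
  have inner: "\<bar>\<integral>n. h (T (z, n)) \<partial>std_normal\<bar> \<le> B" for z
  proof -
    \<comment> \<open>The base point of the line through \<open>x + L *v z\<close> in direction
      \<open>L *v u\<close>; the fresh normal \<open>n\<close> of \<open>gauss_split\<close> runs
      along this line.\<close>
    define y where "y = x + L *v (z - (u \<bullet> z) *\<^sub>R u)"
    define \<phi> where "\<phi> n = f (y + n *\<^sub>R (L *v u))" for n
    have "\<bar>\<phi> a - \<phi> b\<bar> \<le> norm (L *v u) * \<bar>a - b\<bar>" for a b
      using lip[of "y + a *\<^sub>R (L *v u)" "y + b *\<^sub>R (L *v u)"]
      by (simp add: \<phi>_def scaleR_diff_left[symmetric] mult.commute)
    then have "\<bar>\<integral>n. \<phi> (s + n) - \<phi> n - s * (\<phi> n * n) - s\<^sup>2 / 2 * (\<phi> n * (n\<^sup>2 - 1)) \<partial>std_normal\<bar>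
        \<le> shift_const * norm (L *v u) * \<bar>s\<bar> ^ 3"
      unfolding shift_const_def by (rule gaussian_shift_taylor_1d)
    moreover have "h (T (z, n)) = \<phi> (s + n) - \<phi> n - s * (\<phi> n * n) - s\<^sup>2 / 2 * (\<phi> n * (n\<^sup>2 - 1))" for n
    proof -
      have a: "x + L *v T (z, n) = y + n *\<^sub>R (L *v u)"
        by (simp add: T_def y_def matrix_vector_right_distrib matrix_vector_mult_scaleR algebra_simps)
      have b: "x + L *v (T (z, n) + w) = y + (s + n) *\<^sub>R (L *v u)"
        unfolding matrix_vector_right_distrib add.assoc[symmetric] a
        by (simp add: wu matrix_vector_mult_scaleR algebra_simps)
      have c: "w \<bullet> T (z, n) = s * n"
        using u by (simp add: wu T_def inner_add_right inner_diff_right)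
      have d: "w \<bullet> w = s\<^sup>2" using u by (simp add: wu power2_eq_square)
      show ?thesis unfolding h_def a b c d \<phi>_def by (simp add: power_mult_distrib field_simps)
    qed
    moreover have "norm (L *v u) * \<bar>s\<bar> ^ 3 = norm (L *v w) * (norm w)\<^sup>2"
      using s nu by (simp add: wu matrix_vector_mult_scaleR eval_nat_numeral)
    ultimately show ?thesis by (simp add: B_def mult.assoc)
  qed
  have "\<bar>\<integral>z. h z \<partial>gauss\<bar> \<le> (\<integral>z. B \<partial>(gauss :: (real ^ 'm) measure))"
    unfolding eq
  proof (rule order_trans[OF integral_abs_bound], rule integral_mono)
    show "integrable gauss (\<lambda>z. \<bar>\<integral>n. h (T (z, n)) \<partial>std_normal\<bar>)"
      using P.integrable_fst'[OF hT] by (rule integrable_abs)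
  qed (use inner in auto)
  then show ?thesis by (simp add: h_def B_def)
qed simp

lemma smoothed_lipschitz:
  fixes f :: "real ^ 'n \<Rightarrow> real" and L :: "real ^ 'm ^ 'n"
  assumes lip: "\<And>x y. \<bar>f x - f y\<bar> \<le> norm (x - y)"
  shows "\<bar>smoothed f L x - smoothed f L y\<bar> \<le> norm (x - y)"
proof -
  have i: "integrable gauss (\<lambda>z. f (x + L *v z))" for x by (rule gaussian_shift_integrable[OF lip])
  have "\<bar>smoothed f L x - smoothed f L y\<bar> = \<bar>\<integral>z. f (x + L *v z) - f (y + L *v z) \<partial>gauss\<bar>"
    unfolding smoothed_def using i by simp
  also have "\<dots> \<le> (\<integral>z. norm (x - y) \<partial>(gauss :: (real ^ 'm) measure))"
  proof (rule order_trans[OF integral_abs_bound], rule integral_mono)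
    show "\<bar>f (x + L *v z) - f (y + L *v z)\<bar> \<le> norm (x - y)" for z
      using lip[of "x + L *v z" "y + L *v z"] by simp
  qed (use i in auto)
  finally show ?thesis by simp
qed

section \<open>Expansion of the smoothed function under a law with finite third moment\<close>

locale third_moment_law = prob_space \<rho> for \<rho> :: "(real ^ 'n) measure" +
  assumes sets_law [measurable_cong]: "sets \<rho> = sets borel"
    and third_moment: "integrable \<rho> (\<lambda>y. norm y ^ 3)"
begin

lemma integrable_cubic_bound:
  fixes g :: "real ^ 'n \<Rightarrow> real"
  assumes [measurable]: "g \<in> borel_measurable borel" and "\<And>y. \<bar>g y\<bar> \<le> c * (1 + norm y ^ 3)"
  shows "integrable \<rho> g"
proof (rule Bochner_Integration.integrable_bound)
  show "integrable \<rho> (\<lambda>y. c * (1 + norm y ^ 3))" using third_moment by simp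
  show "AE y in \<rho>. norm (g y) \<le> norm (c * (1 + norm y ^ 3))"
  proof (rule AE_I2)
    fix y show "norm (g y) \<le> norm (c * (1 + norm y ^ 3))" using assms(2)[of y] by simp
  qed
qed measurable

lemma power_le_one_plus_cube: "t \<le> 1 + t ^ 3" "t ^ 2 \<le> 1 + t ^ 3" if "0 \<le> t" for t :: real
proof -
  have "t \<le> 1 + t ^ 3 \<and> t ^ 2 \<le> 1 + t ^ 3"
  proof (cases "t \<le> 1")
    case True
    then show ?thesis using that power_le_one[of t 2] zero_le_power[of t 3] by linarith
  next
    case False
    then have "t ^ 1 \<le> t ^ 3" "t ^ 2 \<le> t ^ 3" by (intro power_increasing; simp)+
    then show ?thesis unfolding power_one_right by linarith
  qed
  then show "t \<le> 1 + t ^ 3" "t ^ 2 \<le> 1 + t ^ 3" by auto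
qed

lemma integrable_component: "integrable \<rho> (\<lambda>y. y $ k)"
proof (rule integrable_cubic_bound[where c=1])
  fix y :: "real ^ 'n"
  show "\<bar>y $ k\<bar> \<le> 1 * (1 + norm y ^ 3)"
    using component_le_norm_cart[of y k] power_le_one_plus_cube(1)[of "norm y"] by simp
qed measurable

lemma integrable_norm: "integrable \<rho> (\<lambda>y. norm y)"
proof (rule integrable_cubic_bound[where c=1])
  fix y :: "real ^ 'n"
  show "\<bar>norm y\<bar> \<le> 1 * (1 + norm y ^ 3)" using power_le_one_plus_cube(1)[of "norm y"] by simp
qed measurable

lemma integrable_norm_sq: "integrable \<rho> (\<lambda>y. (norm y)\<^sup>2)"
proof (rule integrable_cubic_bound[where c=1])
  fix y :: "real ^ 'n"
  show "\<bar>(norm y)\<^sup>2\<bar> \<le> 1 * (1 + norm y ^ 3)" using power_le_one_plus_cube(2)[of "norm y"] by simp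
qed measurable

lemma integrable_mult_components: "integrable \<rho> (\<lambda>y. y $ k * y $ l)"
proof (rule integrable_cubic_bound[where c=1])
  fix y :: "real ^ 'n"
  have "\<bar>y $ k * y $ l\<bar> \<le> norm y * norm y"
    unfolding abs_mult by (intro mult_mono component_le_norm_cart) auto
  then show "\<bar>y $ k * y $ l\<bar> \<le> 1 * (1 + norm y ^ 3)"
    using power_le_one_plus_cube(2)[of "norm y"] by (simp add: power2_eq_square)
qed measurable

lemma integrable_inner_sq: "integrable \<rho> (\<lambda>y. (b \<bullet> y)\<^sup>2)"
proof (rule integrable_cubic_bound[where c="b \<bullet> b"])
  fix y
  have "(b \<bullet> y)\<^sup>2 \<le> (b \<bullet> b) * (norm y)\<^sup>2" using Cauchy_Schwarz_ineq[of b y] by (simp add: power2_norm_eq_inner)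
  also have "\<dots> \<le> (b \<bullet> b) * (1 + norm y ^ 3)" by (intro mult_left_mono power_le_one_plus_cube) auto
  finally show "\<bar>(b \<bullet> y)\<^sup>2\<bar> \<le> (b \<bullet> b) * (1 + norm y ^ 3)" by simp
qed measurable

lemma integrable_norm_inner_sq: "integrable \<rho> (\<lambda>y. norm y * (b \<bullet> y)\<^sup>2)"
proof (rule integrable_cubic_bound[where c="b \<bullet> b"])
  fix y
  have "norm y * (b \<bullet> y)\<^sup>2 \<le> norm y * ((b \<bullet> b) * (norm y)\<^sup>2)"
    using Cauchy_Schwarz_ineq[of b y] by (intro mult_left_mono) (auto simp: power2_norm_eq_inner)
  also have "\<dots> = (b \<bullet> b) * norm y ^ 3" by (simp add: eval_nat_numeral)
  also have "\<dots> \<le> (b \<bullet> b) * (1 + norm y ^ 3)" by (intro mult_left_mono) auto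
  finally show "\<bar>norm y * (b \<bullet> y)\<^sup>2\<bar> \<le> (b \<bullet> b) * (1 + norm y ^ 3)" by simp
qed measurable

end

text \<open>The first-order term of the expansion is linear in \<open>y\<close> and the second-order one quadratic, so that for a
  centred law \<open>\<rho>\<close> only its second moments enter.\<close>
lemma smoothed_expansion:
  fixes f :: "real ^ 'n \<Rightarrow> real" and L W :: "real ^ 'n ^ 'n"
  assumes lip: "\<And>x y. \<bar>f x - f y\<bar> \<le> norm (x - y)" and LW: "L ** W = mat 1"
  obtains K :: "real ^ 'n ^ 'n" where
    "\<And>\<rho>. third_moment_law \<rho> \<Longrightarrow> (\<And>i. (\<integral>y. y $ i \<partial>\<rho>) = 0) \<Longrightarrow>
      \<bar>(\<integral>y. smoothed f L (x + y) \<partial>\<rho>) - smoothed f L x - (\<Sum>k\<in>UNIV. \<Sum>l\<in>UNIV. K $ k $ l * (\<integral>y. y $ k * y $ l \<partial>\<rho>))\<bar>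
        \<le> shift_const * (\<integral>y. norm y * (norm (W *v y))\<^sup>2 \<partial>\<rho>)"
proof -
  \<comment> \<open>\<open>a\<close> is the gradient and \<open>S\<close> half the Hessian at
    \<open>w = 0\<close> of the map taking \<open>w\<close> to the integral of
    \<open>f (x + L *v (z + w))\<close>. Written with the derivatives on the Gaussian density, they
    make sense for a merely Lipschitz \<open>f\<close>. The substitution \<open>w = W *v y\<close>
    carries them over to \<open>b\<close> and \<open>K\<close>.\<close>
  define a :: "real ^ 'n" where "a = (\<chi> i. \<integral>z. f (x + L *v z) * (z $ i) \<partial>gauss)"
  define S :: "real ^ 'n ^ 'n" where
    "S = (\<chi> i j. (\<integral>z. f (x + L *v z) * (z $ i * z $ j - (if i = j then 1 else 0)) \<partial>gauss) / 2)"
  define b where "b = transpose W *v a"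
  define K where "K = transpose W ** S ** W"
  have lin: "(\<integral>z. f (x + L *v z) * (w \<bullet> z) \<partial>gauss) = w \<bullet> a" for w
  proof -
    have "f (x + L *v z) * (w \<bullet> z) = (\<Sum>i\<in>UNIV. w $ i * (f (x + L *v z) * (z $ i)))" for z
      by (simp add: inner_vec_def sum_distrib_left mult_ac)
    then have "(\<integral>z. f (x + L *v z) * (w \<bullet> z) \<partial>gauss) = (\<integral>z. (\<Sum>i\<in>UNIV. w $ i * (f (x + L *v z) * (z $ i))) \<partial>gauss)"
      by (simp only:)
    also have "\<dots> = (\<Sum>i\<in>UNIV. \<integral>z. w $ i * (f (x + L *v z) * (z $ i)) \<partial>gauss)"
      by (intro Bochner_Integration.integral_sum integrable_mult_right gaussian_shift_integrable(5)[OF lip])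
    finally show ?thesis by (simp add: a_def inner_vec_def)
  qed
  have quad: "(\<integral>z. f (x + L *v z) * ((w \<bullet> z)\<^sup>2 - w \<bullet> w) \<partial>gauss) / 2 = w \<bullet> (S *v w)" for w
  proof -
    have "(w \<bullet> z)\<^sup>2 - w \<bullet> w = (\<Sum>i\<in>UNIV. \<Sum>j\<in>UNIV. w $ i * w $ j * (z $ i * z $ j - (if i = j then 1 else 0)))" for z
    proof -
      have "(w \<bullet> z)\<^sup>2 = (\<Sum>i\<in>UNIV. \<Sum>j\<in>UNIV. w $ i * w $ j * (z $ i * z $ j))"
        by (simp add: power2_eq_square inner_vec_def sum_product mult_ac)
      moreover have "w \<bullet> w = (\<Sum>i\<in>UNIV. \<Sum>j\<in>UNIV. w $ i * w $ j * (if i = j then 1 else 0))"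
        by (simp add: inner_vec_def if_distrib cong: if_cong)
      ultimately show ?thesis by (simp add: sum_subtractf[symmetric] right_diff_distrib)
    qed
    then have "f (x + L *v z) * ((w \<bullet> z)\<^sup>2 - w \<bullet> w) =
        (\<Sum>i\<in>UNIV. \<Sum>j\<in>UNIV. w $ i * w $ j * (f (x + L *v z) * (z $ i * z $ j - (if i = j then 1 else 0))))" for z
      by (simp add: sum_distrib_left mult_ac)
    then have "(\<integral>z. f (x + L *v z) * ((w \<bullet> z)\<^sup>2 - w \<bullet> w) \<partial>gauss) =
        (\<integral>z. (\<Sum>i\<in>UNIV. \<Sum>j\<in>UNIV. w $ i * w $ j * (f (x + L *v z) * (z $ i * z $ j - (if i = j then 1 else 0)))) \<partial>gauss)"
      by (simp only:)
    also have "\<dots> = (\<Sum>i\<in>UNIV. \<integral>z. (\<Sum>j\<in>UNIV. w $ i * w $ j * (f (x + L *v z) * (z $ i * z $ j - (if i = j then 1 else 0)))) \<partial>gauss)"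
      by (intro Bochner_Integration.integral_sum Bochner_Integration.integrable_sum integrable_mult_right gaussian_shift_integrable(6)[OF lip])
    also have "\<dots> = (\<Sum>i\<in>UNIV. \<Sum>j\<in>UNIV. \<integral>z. w $ i * w $ j * (f (x + L *v z) * (z $ i * z $ j - (if i = j then 1 else 0))) \<partial>gauss)"
      by (intro sum.cong refl Bochner_Integration.integral_sum integrable_mult_right gaussian_shift_integrable(6)[OF lip])
    finally show ?thesis
      by (simp add: S_def inner_vec_def matrix_vector_mult_def sum_distrib_left sum_divide_distrib mult_ac)
  qed
  have rem: "\<bar>smoothed f L (x + y) - smoothed f L x - b \<bullet> y - y \<bullet> (K *v y)\<bar> \<le> shift_const * (norm y * (norm (W *v y))\<^sup>2)" for y
  proof -
    define w where "w = W *v y"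
    have Lw: "L *v w = y" by (simp add: w_def matrix_vector_mul_assoc LW)
    have "(\<integral>z. f (x + L *v (z + w)) - f (x + L *v z) - f (x + L *v z) * (w \<bullet> z)
      - f (x + L *v z) * ((w \<bullet> z)\<^sup>2 - w \<bullet> w) / 2 \<partial>gauss) =
      (\<integral>z. f (x + L *v (z + w)) \<partial>gauss) - (\<integral>z. f (x + L *v z) \<partial>gauss) - (\<integral>z. f (x + L *v z) * (w \<bullet> z) \<partial>gauss)
      - (\<integral>z. f (x + L *v z) * ((w \<bullet> z)\<^sup>2 - w \<bullet> w) \<partial>gauss) / 2"
      by (simp only: Bochner_Integration.integral_diff Bochner_Integration.integrable_diff integral_divide_zero integrable_divide gaussian_shift_integrable[OF lip])
    also have "(\<integral>z. f (x + L *v (z + w)) \<partial>gauss) = smoothed f L (x + y)"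
      unfolding smoothed_def by (simp add: matrix_vector_right_distrib Lw algebra_simps)
    also have "(\<integral>z. f (x + L *v z) \<partial>gauss) = smoothed f L x" by (simp add: smoothed_def)
    finally have e: "(\<integral>z. f (x + L *v (z + w)) - f (x + L *v z) - f (x + L *v z) * (w \<bullet> z)
      - f (x + L *v z) * ((w \<bullet> z)\<^sup>2 - w \<bullet> w) / 2 \<partial>gauss) = smoothed f L (x + y) - smoothed f L x - w \<bullet> a - w \<bullet> (S *v w)"
      unfolding lin quad .
    have wa: "w \<bullet> a = b \<bullet> y"
      using inner_matrix_vector_left[of W y a] by (simp add: w_def b_def inner_commute del: transpose_matrix_vector)
    have wS: "w \<bullet> (S *v w) = y \<bullet> (K *v y)"
      using inner_matrix_vector_left[of W y "S *v (W *v y)"]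
      by (simp add: w_def K_def matrix_vector_mul_assoc[symmetric] del: transpose_matrix_vector)
    show ?thesis
      using gaussian_shift_taylor[OF lip, of x L w] unfolding e wa wS Lw by (simp add: w_def mult.assoc)
  qed
  show ?thesis
  proof (rule that[of K])
    fix \<rho> :: "(real ^ 'n) measure"
    assume P: "third_moment_law \<rho>" and mean: "\<And>i. (\<integral>y. y $ i \<partial>\<rho>) = 0"
    interpret third_moment_law \<rho> by fact
    have sm [measurable]: "smoothed f L \<in> borel_measurable borel"
      by (rule borel_of_lipschitz[of _ 1]) (use smoothed_lipschitz[OF lip] in simp)
    have ig: "integrable \<rho> (\<lambda>y. smoothed f L (x + y))"
    proof (rule integrable_cubic_bound[where c="\<bar>smoothed f L x\<bar> + 1"])
      fix y
      have "\<bar>smoothed f L (x + y)\<bar> \<le> \<bar>smoothed f L x\<bar> + norm y"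
        using smoothed_lipschitz[OF lip, where L=L and x="x + y" and y=x] by simp
      also have "\<dots> \<le> \<bar>smoothed f L x\<bar> * (1 + norm y ^ 3) + 1 * (1 + norm y ^ 3)"
        using power_le_one_plus_cube(1)[of "norm y"] by (intro add_mono) (auto simp: algebra_simps)
      finally show "\<bar>smoothed f L (x + y)\<bar> \<le> (\<bar>smoothed f L x\<bar> + 1) * (1 + norm y ^ 3)"
        by (simp add: algebra_simps)
    qed measurable
    have iw: "integrable \<rho> (\<lambda>y. norm y * (norm (W *v y))\<^sup>2)"
    proof (rule integrable_cubic_bound[where c="(norm W)\<^sup>2"])
      fix y
      have "norm y * (norm (W *v y))\<^sup>2 \<le> norm y * (norm W * norm y)\<^sup>2"
        by (intro mult_left_mono power_mono matrix_vector_norm_le) auto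
      also have "\<dots> = (norm W)\<^sup>2 * norm y ^ 3" by (simp add: eval_nat_numeral)
      also have "\<dots> \<le> (norm W)\<^sup>2 * (1 + norm y ^ 3)" by (intro mult_left_mono) auto
      finally show "\<bar>norm y * (norm (W *v y))\<^sup>2\<bar> \<le> (norm W)\<^sup>2 * (1 + norm y ^ 3)" by simp
    qed measurable
    have eb: "integrable \<rho> (\<lambda>y. b \<bullet> y)" "(\<integral>y. b \<bullet> y \<partial>\<rho>) = 0"
      unfolding inner_vec_def using integrable_component mean
      by (auto simp: Bochner_Integration.integral_sum intro!: Bochner_Integration.integrable_sum integrable_mult_right)
    have Kq: "y \<bullet> (K *v y) = (\<Sum>k\<in>UNIV. \<Sum>l\<in>UNIV. K $ k $ l * (y $ k * y $ l))" for y
      by (simp add: inner_vec_def matrix_vector_mult_def sum_distrib_left mult_ac)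
    have eK: "integrable \<rho> (\<lambda>y. y \<bullet> (K *v y))"
      "(\<integral>y. y \<bullet> (K *v y) \<partial>\<rho>) = (\<Sum>k\<in>UNIV. \<Sum>l\<in>UNIV. K $ k $ l * (\<integral>y. y $ k * y $ l \<partial>\<rho>))"
      unfolding Kq using integrable_mult_components
      by (auto simp: Bochner_Integration.integral_sum intro!: Bochner_Integration.integrable_sum integrable_mult_right)
    let ?R = "\<lambda>y. smoothed f L (x + y) - smoothed f L x - b \<bullet> y - y \<bullet> (K *v y)"
    have "(\<integral>y. ?R y \<partial>\<rho>) = (\<integral>y. smoothed f L (x + y) \<partial>\<rho>) - smoothed f L x - (\<Sum>k\<in>UNIV. \<Sum>l\<in>UNIV. K $ k $ l * (\<integral>y. y $ k * y $ l \<partial>\<rho>))"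
      using ig eb eK prob_space by simp
    moreover have "\<bar>\<integral>y. ?R y \<partial>\<rho>\<bar> \<le> (\<integral>y. shift_const * (norm y * (norm (W *v y))\<^sup>2) \<partial>\<rho>)"
    proof (rule order_trans[OF integral_abs_bound], rule integral_mono)
      show "integrable \<rho> (\<lambda>y. \<bar>?R y\<bar>)" using ig eb(1) eK(1) by simp
      show "integrable \<rho> (\<lambda>y. shift_const * (norm y * (norm (W *v y))\<^sup>2))" using iw by simp
    qed (rule rem)
    ultimately show "\<bar>(\<integral>y. smoothed f L (x + y) \<partial>\<rho>) - smoothed f L x - (\<Sum>k\<in>UNIV. \<Sum>l\<in>UNIV. K $ k $ l * (\<integral>y. y $ k * y $ l \<partial>\<rho>))\<bar>
        \<le> shift_const * (\<integral>y. norm y * (norm (W *v y))\<^sup>2 \<partial>\<rho>)" by simp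
  qed
qed

section \<open>Third moments\<close>

definition second_moments :: "(real ^ 'n) measure \<Rightarrow> real ^ 'n ^ 'n" where
  "second_moments \<rho> = (\<chi> k l. \<integral>y. y $ k * y $ l \<partial>\<rho>)"

lemma congruence_component: "(B ** S ** transpose B) $ i $ j = B $ i \<bullet> (S *v B $ j)"
  for B :: "real ^ 'm ^ 'n"
proof -
  have "(B ** S ** transpose B) $ i $ j = (\<Sum>k\<in>UNIV. \<Sum>l\<in>UNIV. B $ i $ l * S $ l $ k * B $ j $ k)"
    by (simp add: matrix_matrix_mult_def transpose_def sum_distrib_right)
  also have "\<dots> = (\<Sum>l\<in>UNIV. \<Sum>k\<in>UNIV. B $ i $ l * S $ l $ k * B $ j $ k)" by (rule sum.swap)
  also have "\<dots> = B $ i \<bullet> (S *v B $ j)"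
    by (simp add: inner_vec_def matrix_vector_mult_def sum_distrib_left mult.assoc)
  finally show ?thesis .
qed

lemma trace_congruence: "trace (B ** S ** transpose B) = (\<Sum>i\<in>UNIV. B $ i \<bullet> (S *v B $ i))"
  for B :: "real ^ 'm ^ 'n"
  by (simp only: trace_def congruence_component)

lemma norm_sq_trace: "(norm B)\<^sup>2 = trace (B ** transpose B)" for B :: "real ^ 'm ^ 'n"
  using trace_congruence[of B "mat 1"] by (simp add: power2_norm_eq_inner inner_vec_def)

lemma norm_sq_matrix_vector: "(norm (B *v y))\<^sup>2 = (\<Sum>i\<in>UNIV. (B $ i \<bullet> y)\<^sup>2)" for B :: "real ^ 'm ^ 'n"
  unfolding power2_norm_eq_inner inner_vec_def[of "B *v y"] matrix_vector_mul_component
  by (simp add: power2_eq_square)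

context third_moment_law
begin

lemma second_moments_bilinear: "a \<bullet> (second_moments \<rho> *v b) = (\<integral>y. (a \<bullet> y) * (b \<bullet> y) \<partial>\<rho>)"
proof -
  have "(a \<bullet> y) * (b \<bullet> y) = (\<Sum>k\<in>UNIV. \<Sum>l\<in>UNIV. a $ k * b $ l * (y $ k * y $ l))" for y
    by (simp add: inner_vec_def sum_product mult_ac)
  then have "(\<integral>y. (a \<bullet> y) * (b \<bullet> y) \<partial>\<rho>) = (\<integral>y. (\<Sum>k\<in>UNIV. \<Sum>l\<in>UNIV. a $ k * b $ l * (y $ k * y $ l)) \<partial>\<rho>)"
    by (simp only:)
  also have "\<dots> = (\<Sum>k\<in>UNIV. \<integral>y. (\<Sum>l\<in>UNIV. a $ k * b $ l * (y $ k * y $ l)) \<partial>\<rho>)"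
    by (intro Bochner_Integration.integral_sum Bochner_Integration.integrable_sum integrable_mult_right integrable_mult_components)
  also have "\<dots> = (\<Sum>k\<in>UNIV. \<Sum>l\<in>UNIV. \<integral>y. a $ k * b $ l * (y $ k * y $ l) \<partial>\<rho>)"
    by (intro sum.cong refl Bochner_Integration.integral_sum integrable_mult_right integrable_mult_components)
  also have "\<dots> = (\<Sum>k\<in>UNIV. \<Sum>l\<in>UNIV. a $ k * b $ l * (\<integral>y. y $ k * y $ l \<partial>\<rho>))"
    by (simp only: integral_mult_right_zero)
  also have "\<dots> = a \<bullet> (second_moments \<rho> *v b)"
    by (simp add: second_moments_def inner_vec_def matrix_vector_mult_def sum_distrib_left mult_ac)
  finally show ?thesis ..
qed

lemma second_moments_quadratic: "b \<bullet> (second_moments \<rho> *v b) = (\<integral>y. (b \<bullet> y)\<^sup>2 \<partial>\<rho>)"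
  unfolding second_moments_bilinear power2_eq_square ..

lemma psd_second_moments: "psd (second_moments \<rho>)"
  unfolding psd_def second_moments_quadratic
  by (simp add: second_moments_def transpose_def vec_eq_iff mult.commute)

lemma trace_second_moments:
  fixes B :: "real ^ 'n ^ 'm"
  shows "trace (B ** second_moments \<rho> ** transpose B) = (\<integral>y. (norm (B *v y))\<^sup>2 \<partial>\<rho>)"
  unfolding trace_congruence second_moments_quadratic norm_sq_matrix_vector
  by (subst Bochner_Integration.integral_sum) (auto intro: integrable_inner_sq)

text \<open>In the eigenbasis of the second-moment matrix, directions with eigenvalue \<open>0\<close> are almost
  surely not seen by the law, so no nondegeneracy is needed.\<close>
lemma third_moment_dominated:
  obtains C where "0 \<le> C" "\<And>b. (\<integral>y. norm y * (b \<bullet> y)\<^sup>2 \<partial>\<rho>) \<le> C * (\<integral>y. (b \<bullet> y)\<^sup>2 \<partial>\<rho>)"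
proof -
  obtain Q d where Q: "orthogonal_matrix Q" "second_moments \<rho> = Q ** diag_mat d ** transpose Q" "\<And>i. 0 \<le> d i"
    by (rule psd_spectral_theorem[OF psd_second_moments]) blast
  define q where "q i = column i Q" for i
  have qd: "(\<integral>y. (q i \<bullet> y)\<^sup>2 \<partial>\<rho>) = d i" for i
    unfolding second_moments_quadratic[symmetric] q_def spectral_eigenvector[OF Q(1,2)]
    by (simp add: orthogonal_columns_inner[OF Q(1)])
  define m3 where "m3 = (\<integral>y. norm y ^ 3 \<partial>\<rho>)"
  have m3: "0 \<le> m3" by (simp add: m3_def)
  \<comment> \<open>The ratio of third moment to variance in the direction \<open>q i\<close>;
    directions without variance get 0, which is enough because the left-hand side vanishes
    there.\<close>
  define c where "c i = (if d i = 0 then 0 else m3 / d i)" for i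
  have c0: "0 \<le> c i" for i using Q(3) m3 by (simp add: c_def)
  have ci: "(\<integral>y. norm y * (q i \<bullet> y)\<^sup>2 \<partial>\<rho>) \<le> c i * d i" for i
  proof (cases "d i = 0")
    case True
    have "AE y in \<rho>. (q i \<bullet> y)\<^sup>2 = 0"
      using integral_nonneg_eq_0_iff_AE[OF integrable_inner_sq, of "q i"] qd[of i] True by simp
    then have "(\<integral>y. norm y * (q i \<bullet> y)\<^sup>2 \<partial>\<rho>) = (\<integral>y. 0 \<partial>\<rho>)"
      by (intro integral_cong_AE) (auto elim: eventually_mono)
    then show ?thesis using True by simp
  next
    case False
    have "(\<integral>y. norm y * (q i \<bullet> y)\<^sup>2 \<partial>\<rho>) \<le> m3"
      unfolding m3_def
    proof (intro integral_mono integrable_norm_inner_sq third_moment)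
      fix y
      have "(q i \<bullet> y)\<^sup>2 \<le> (q i \<bullet> q i) * (y \<bullet> y)" by (rule Cauchy_Schwarz_ineq)
      then have "(q i \<bullet> y)\<^sup>2 \<le> (norm y)\<^sup>2"
        by (simp add: q_def orthogonal_columns_inner[OF Q(1)] power2_norm_eq_inner)
      then have "norm y * (q i \<bullet> y)\<^sup>2 \<le> norm y * (norm y)\<^sup>2" by (intro mult_left_mono) auto
      then show "norm y * (q i \<bullet> y)\<^sup>2 \<le> norm y ^ 3" by (simp add: eval_nat_numeral)
    qed
    then show ?thesis using False by (simp add: c_def)
  qed
  \<comment> \<open>The dimension comes from Cauchy-Schwarz for the \<open>CARD('n)\<close> terms in
    the expansion of \<open>b \<bullet> y\<close>.\<close>
  define C where "C = real CARD('n) * (\<Sum>i\<in>UNIV. c i)"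
  have cC: "real CARD('n) * c i \<le> C" for i
    unfolding C_def by (intro mult_left_mono member_le_sum) (use c0 in auto)
  have C0: "0 \<le> C" unfolding C_def using c0 by (intro mult_nonneg_nonneg sum_nonneg) auto
  have "(\<integral>y. norm y * (b \<bullet> y)\<^sup>2 \<partial>\<rho>) \<le> C * (\<integral>y. (b \<bullet> y)\<^sup>2 \<partial>\<rho>)" for b
  proof -
    have dec: "b \<bullet> y = (\<Sum>i\<in>UNIV. (q i \<bullet> b) * (q i \<bullet> y))" for y
    proof -
      have "b \<bullet> y = b \<bullet> ((Q ** transpose Q) *v y)" using Q(1) by (simp add: orthogonal_matrix_def)
      also have "\<dots> = (transpose Q *v b) \<bullet> (transpose Q *v y)"
        by (simp only: inner_matrix_vector_left transpose_transpose matrix_vector_mul_assoc)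
      finally show ?thesis unfolding inner_vec_def[of "transpose Q *v b"] transpose_vec_component by (simp add: q_def)
    qed
    have sq: "(b \<bullet> y)\<^sup>2 \<le> (\<Sum>i\<in>UNIV. (q i \<bullet> b)\<^sup>2 * (q i \<bullet> y)\<^sup>2) * real CARD('n)" for y
      using sum_squared_le_sum_of_squares[of "\<lambda>i. (q i \<bullet> b) * (q i \<bullet> y)" UNIV] unfolding dec[symmetric]
      by (simp add: power_mult_distrib)
    have "(\<integral>y. norm y * (b \<bullet> y)\<^sup>2 \<partial>\<rho>) \<le> (\<integral>y. (\<Sum>i\<in>UNIV. (real CARD('n) * (q i \<bullet> b)\<^sup>2) * (norm y * (q i \<bullet> y)\<^sup>2)) \<partial>\<rho>)"
    proof (intro integral_mono Bochner_Integration.integrable_sum integrable_mult_right integrable_norm_inner_sq)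
      fix y
      have "norm y * (b \<bullet> y)\<^sup>2 \<le> norm y * ((\<Sum>i\<in>UNIV. (q i \<bullet> b)\<^sup>2 * (q i \<bullet> y)\<^sup>2) * real CARD('n))"
        by (intro mult_left_mono sq) auto
      then show "norm y * (b \<bullet> y)\<^sup>2 \<le> (\<Sum>i\<in>UNIV. (real CARD('n) * (q i \<bullet> b)\<^sup>2) * (norm y * (q i \<bullet> y)\<^sup>2))"
        by (simp add: sum_distrib_left sum_distrib_right mult_ac)
    qed
    also have "\<dots> = (\<Sum>i\<in>UNIV. (real CARD('n) * (q i \<bullet> b)\<^sup>2) * (\<integral>y. norm y * (q i \<bullet> y)\<^sup>2 \<partial>\<rho>))"
      by (subst Bochner_Integration.integral_sum) (auto intro!: integrable_mult_right integrable_norm_inner_sq)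
    also have "\<dots> \<le> (\<Sum>i\<in>UNIV. C * (d i * (q i \<bullet> b)\<^sup>2))"
    proof (rule sum_mono)
      fix i
      have "(real CARD('n) * (q i \<bullet> b)\<^sup>2) * (\<integral>y. norm y * (q i \<bullet> y)\<^sup>2 \<partial>\<rho>) \<le> (real CARD('n) * (q i \<bullet> b)\<^sup>2) * (c i * d i)"
        by (intro mult_left_mono ci) auto
      also have "\<dots> = (real CARD('n) * c i) * (d i * (q i \<bullet> b)\<^sup>2)" by (simp add: mult_ac)
      also have "\<dots> \<le> C * (d i * (q i \<bullet> b)\<^sup>2)" by (intro mult_right_mono cC) (use Q(3) in auto)
      finally show "(real CARD('n) * (q i \<bullet> b)\<^sup>2) * (\<integral>y. norm y * (q i \<bullet> y)\<^sup>2 \<partial>\<rho>) \<le> C * (d i * (q i \<bullet> b)\<^sup>2)" .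
    qed
    also have "\<dots> = C * (b \<bullet> (second_moments \<rho> *v b))"
      unfolding spectral_quadratic[OF Q(2)] q_def by (simp add: sum_distrib_left)
    finally show ?thesis by (simp only: second_moments_quadratic)
  qed
  with C0 show ?thesis by (rule that)
qed

text \<open>The bound for a single direction is applied to each row of \<open>B\<close>. The result
  is linear in the second moments, hence of the form that a log-determinant increment can pay
  for.\<close>

lemma third_moment_trace:
  obtains C where "0 \<le> C" "\<And>B :: real ^ 'n ^ 'm.
    (\<integral>y. norm y * (norm (B *v y))\<^sup>2 \<partial>\<rho>) \<le> C * trace (B ** second_moments \<rho> ** transpose B)"
proof -
  obtain C where C: "0 \<le> C" "\<And>b. (\<integral>y. norm y * (b \<bullet> y)\<^sup>2 \<partial>\<rho>) \<le> C * (\<integral>y. (b \<bullet> y)\<^sup>2 \<partial>\<rho>)"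
    by (rule third_moment_dominated) blast
  have "(\<integral>y. norm y * (norm (B *v y))\<^sup>2 \<partial>\<rho>) \<le> C * trace (B ** second_moments \<rho> ** transpose B)" for B :: "real ^ 'n ^ 'm"
  proof -
    have "(\<integral>y. norm y * (norm (B *v y))\<^sup>2 \<partial>\<rho>) = (\<Sum>i\<in>UNIV. \<integral>y. norm y * (B $ i \<bullet> y)\<^sup>2 \<partial>\<rho>)"
      unfolding norm_sq_matrix_vector sum_distrib_left
      by (intro Bochner_Integration.integral_sum integrable_norm_inner_sq)
    also have "\<dots> \<le> (\<Sum>i\<in>UNIV. C * (\<integral>y. (B $ i \<bullet> y)\<^sup>2 \<partial>\<rho>))" by (intro sum_mono C)
    also have "\<dots> = C * trace (B ** second_moments \<rho> ** transpose B)"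
      unfolding trace_congruence second_moments_quadratic by (simp add: sum_distrib_left)
    finally show ?thesis .
  qed
  with C(1) show ?thesis by (rule that)
qed

lemma trace_contraction:
  fixes B :: "real ^ 'n ^ 'm"
  assumes "\<And>y. norm (B *v y) \<le> c * norm y"
  shows "trace (B ** second_moments \<rho> ** transpose B) \<le> c\<^sup>2 * trace (second_moments \<rho>)"
proof -
  have tr: "trace (second_moments \<rho>) = (\<integral>y. (norm y)\<^sup>2 \<partial>\<rho>)"
    using trace_second_moments[of "mat 1"] by simp
  have "(\<integral>y. (norm (B *v y))\<^sup>2 \<partial>\<rho>) \<le> (\<integral>y. c\<^sup>2 * (norm y)\<^sup>2 \<partial>\<rho>)"
  proof (intro integral_mono integrable_mult_right integrable_norm_sq)
    show "integrable \<rho> (\<lambda>y. (norm (B *v y))\<^sup>2)"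
      unfolding norm_sq_matrix_vector by (intro Bochner_Integration.integrable_sum integrable_inner_sq)
    fix y
    have "(norm (B *v y))\<^sup>2 \<le> (c * norm y)\<^sup>2" by (intro power_mono assms) auto
    then show "(norm (B *v y))\<^sup>2 \<le> c\<^sup>2 * (norm y)\<^sup>2" by (simp add: power_mult_distrib)
  qed
  then show ?thesis by (simp add: trace_second_moments tr)
qed

end

section \<open>Moments of Gaussian measures and the convolution rule for smoothing\<close>

lemma gauss_third_moment_law: "third_moment_law (gauss :: (real ^ 'n) measure)"
  by unfold_locales (simp_all add: integrable_gauss_norm_power)

lemma gauss_covariance: "(\<integral>z. (a \<bullet> z) * (b \<bullet> z) \<partial>gauss) = a \<bullet> b" for a b :: "real ^ 'n"
proof -
  interpret g: third_moment_law "gauss :: (real ^ 'n) measure" by (rule gauss_third_moment_law)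
  have e: "(a \<bullet> z) * (b \<bullet> z) = (((a + b) \<bullet> z)\<^sup>2 - ((a - b) \<bullet> z)\<^sup>2) / 4" for z
    by (simp add: inner_add_left inner_diff_left power2_eq_square algebra_simps)
  have "(\<integral>z. (a \<bullet> z) * (b \<bullet> z) \<partial>gauss) = ((\<integral>z. ((a + b) \<bullet> z)\<^sup>2 \<partial>gauss) - (\<integral>z. ((a - b) \<bullet> z)\<^sup>2 \<partial>gauss)) / 4"
    unfolding e integral_divide_zero
    by (simp only: Bochner_Integration.integral_diff[OF g.integrable_inner_sq g.integrable_inner_sq])
  also have "\<dots> = a \<bullet> b"
    unfolding gauss_second_moment by (simp add: inner_add_left inner_add_right inner_diff_left inner_diff_right inner_commute)
  finally show ?thesis .
qed

lemma gaussian_moments: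
  fixes A :: "real ^ 'n ^ 'n"
  assumes "psd A"
  shows "third_moment_law (gaussian A)" "(\<integral>y. y $ i \<partial>gaussian A) = 0" "second_moments (gaussian A) = A"
proof -
  let ?S = "mat_sqrt A"
  note S = mat_sqrt[OF assms]
  have i: "integrable (gaussian A) (\<lambda>y. norm y ^ 3)"
    unfolding gaussian_def
  proof (subst integrable_distr_eq)
    show "integrable gauss (\<lambda>z. norm (?S *v z) ^ 3)"
    proof (rule integrable_gauss_poly_bound)
      fix z
      have "norm (?S *v z) ^ 3 \<le> (norm ?S * (1 + norm z)) ^ 3"
        by (intro power_mono order_trans[OF matrix_vector_norm_le] mult_left_mono) auto
      then show "\<bar>norm (?S *v z) ^ 3\<bar> \<le> norm ?S ^ 3 * (1 + norm z) ^ 3" by (simp add: power_mult_distrib)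
    qed measurable
  qed measurable
  show "third_moment_law (gaussian A)"
    using prob_space_gaussian[of A] i by (simp add: third_moment_law_def third_moment_law_axioms_def)
  show "(\<integral>y. y $ i \<partial>gaussian A) = 0"
    unfolding gaussian_def
    by (subst integral_distr, measurable) (simp add: matrix_vector_mul_component gauss_first_moment)
  have "(\<integral>y. y $ k * y $ l \<partial>gaussian A) = A $ k $ l" for k l
  proof -
    have "(\<integral>y. y $ k * y $ l \<partial>gaussian A) = ?S $ k \<bullet> ?S $ l"
      unfolding gaussian_def
      by (subst integral_distr, measurable) (simp add: matrix_vector_mul_component gauss_covariance)
    also have "\<dots> = (?S ** transpose ?S) $ k $ l"
      by (simp add: matrix_matrix_mult_def transpose_def inner_vec_def)
    also have "?S ** transpose ?S = A" using S by (simp add: psd_def)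
    finally show ?thesis .
  qed
  then show "second_moments (gaussian A) = A" by (simp add: second_moments_def vec_eq_iff)
qed

lemma smoothed_eq_gaussian:
  fixes f :: "real ^ 'n \<Rightarrow> real"
  assumes lip: "\<And>x y. \<bar>f x - f y\<bar> \<le> norm (x - y)"
  shows "smoothed f (mat_sqrt A) x = (\<integral>y. f (x + y) \<partial>gaussian A)"
proof -
  have [measurable]: "f \<in> borel_measurable borel" by (rule borel_of_lipschitz[of _ 1]) (use lip in simp)
  show ?thesis unfolding smoothed_def gaussian_def by (subst integral_distr) auto
qed

text \<open>Averaging over an independent Gaussian increment adds its covariance to the smoothing.
  This identifies the Gaussian side of one replacement with the next smoothed function, so that the
  replacements telescope.\<close>

lemma smoothed_gaussian_add:
  fixes f :: "real ^ 'n \<Rightarrow> real"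
  assumes lip: "\<And>x y. \<bar>f x - f y\<bar> \<le> norm (x - y)" and A: "psd A" and G: "psd G"
  shows "(\<integral>y. smoothed f (mat_sqrt G) (x + y) \<partial>gaussian A) = smoothed f (mat_sqrt (G + A)) x"
proof -
  have [measurable]: "f \<in> borel_measurable borel" by (rule borel_of_lipschitz[of _ 1]) (use lip in simp)
  interpret A: third_moment_law "gaussian A" by (rule gaussian_moments[OF A])
  interpret G: third_moment_law "gaussian G" by (rule gaussian_moments[OF G])
  interpret P: pair_prob_space "gaussian A" "gaussian G" ..
  have m: "(\<lambda>p. fst p + snd p) \<in> borel_measurable (gaussian A \<Otimes>\<^sub>M gaussian G)" by measurable
  have dist: "distr (gaussian A \<Otimes>\<^sub>M gaussian G) borel (\<lambda>p. fst p + snd p) = gaussian (G + A)"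
    using gaussian_add[OF A G] by (simp add: add.commute)
  interpret GA: third_moment_law "gaussian (G + A)" by (rule gaussian_moments[OF psd_add[OF G A]])
  have i: "integrable (gaussian (G + A)) (\<lambda>y. f (x + y))"
  proof (rule GA.integrable_cubic_bound[where c="\<bar>f x\<bar> + 1"])
    fix y
    have "\<bar>f (x + y)\<bar> \<le> \<bar>f x\<bar> + norm y" using lip[of "x + y" x] by simp
    also have "\<dots> \<le> \<bar>f x\<bar> * (1 + norm y ^ 3) + 1 * (1 + norm y ^ 3)"
      using GA.power_le_one_plus_cube(1)[of "norm y"] by (intro add_mono) (auto simp: algebra_simps)
    finally show "\<bar>f (x + y)\<bar> \<le> (\<bar>f x\<bar> + 1) * (1 + norm y ^ 3)" by (simp add: algebra_simps)
  qed measurable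
  have fm: "(\<lambda>y. f (x + y)) \<in> borel_measurable borel" by measurable
  have i2: "integrable (gaussian A \<Otimes>\<^sub>M gaussian G) (\<lambda>p. f (x + (fst p + snd p)))"
    using i unfolding dist[symmetric] integrable_distr_eq[OF m fm] .
  have "smoothed f (mat_sqrt (G + A)) x = (\<integral>y. f (x + y) \<partial>gaussian (G + A))" by (rule smoothed_eq_gaussian[OF lip])
  also have "\<dots> = (\<integral>p. f (x + (fst p + snd p)) \<partial>(gaussian A \<Otimes>\<^sub>M gaussian G))"
    unfolding dist[symmetric] integral_distr[OF m fm] ..
  also have "\<dots> = (\<integral>y. (\<integral>z. f (x + (y + z)) \<partial>gaussian G) \<partial>gaussian A)"
    using P.integral_fst'[OF i2] by simp
  finally show ?thesis unfolding smoothed_eq_gaussian[OF lip] by (simp add: add.assoc)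
qed

section \<open>Lindeberg replacement\<close>

lemma mat_sqrt_scaled_identity:
  assumes "0 \<le> t"
  shows "mat_sqrt (t\<^sup>2 *\<^sub>R mat 1) = t *\<^sub>R (mat 1 :: real ^ 'n ^ 'n)"
proof (rule psd_sqrt_unique)
  have psd: "psd (c *\<^sub>R (mat 1 :: real ^ 'n ^ 'n))" if "0 \<le> c" for c
    using that by (simp add: psd_def transpose_scalar scaleR_matrix_vector_assoc[symmetric])
  show "psd (t *\<^sub>R (mat 1 :: real ^ 'n ^ 'n))" using assms by (rule psd)
  have p: "psd (t\<^sup>2 *\<^sub>R (mat 1 :: real ^ 'n ^ 'n))" by (rule psd) simp
  show "psd (mat_sqrt (t\<^sup>2 *\<^sub>R (mat 1 :: real ^ 'n ^ 'n)))" by (rule mat_sqrt(1)[OF p])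
  show "mat_sqrt (t\<^sup>2 *\<^sub>R (mat 1 :: real ^ 'n ^ 'n)) ** mat_sqrt (t\<^sup>2 *\<^sub>R mat 1) = t *\<^sub>R mat 1 ** t *\<^sub>R mat 1"
    unfolding mat_sqrt(2)[OF p] by (simp add: matrix_scaleR_left matrix_scaleR_right power2_eq_square)
qed

lemma smoothing_error:
  fixes f :: "real ^ 'n \<Rightarrow> real"
  assumes lip: "\<And>x y. \<bar>f x - f y\<bar> \<le> norm (x - y)" and t: "0 \<le> t"
  shows "\<bar>smoothed f (mat_sqrt (t\<^sup>2 *\<^sub>R mat 1)) x - f x\<bar> \<le> t * (\<integral>z. norm z \<partial>(gauss :: (real ^ 'n) measure))"
proof -
  interpret g: third_moment_law "gauss :: (real ^ 'n) measure" by (rule gauss_third_moment_law)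
  have i: "integrable gauss (\<lambda>z. f (x + (t *\<^sub>R mat 1) *v z))" by (rule gaussian_shift_integrable(1)[OF lip])
  have "\<bar>smoothed f (mat_sqrt (t\<^sup>2 *\<^sub>R mat 1)) x - f x\<bar> = \<bar>\<integral>z. f (x + (t *\<^sub>R mat 1) *v z) - f x \<partial>gauss\<bar>"
    unfolding smoothed_def mat_sqrt_scaled_identity[OF t] using i by simp
  also have "\<dots> \<le> (\<integral>z. t * norm z \<partial>(gauss :: (real ^ 'n) measure))"
  proof (rule order_trans[OF integral_abs_bound], rule integral_mono)
    show "integrable gauss (\<lambda>z. \<bar>f (x + (t *\<^sub>R mat 1) *v z) - f x\<bar>)" using i by simp
    show "integrable gauss (\<lambda>z :: real ^ 'n. t * norm z)" using g.integrable_norm by simp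
    show "\<bar>f (x + (t *\<^sub>R mat 1) *v z) - f x\<bar> \<le> t * norm z" for z
      using lip[of "x + (t *\<^sub>R mat 1) *v z" x] t by (simp add: scaleR_matrix_vector_assoc[symmetric])
  qed
  finally show ?thesis by simp
qed

locale centered_law = third_moment_law \<rho> for \<rho> :: "(real ^ 'n) measure" +
  assumes centered: "\<And>i. (\<integral>y. y $ i \<partial>\<rho>) = 0"
begin

lemma linear_image_law:
  fixes B :: "real ^ 'n ^ 'n"
  shows "third_moment_law (distr \<rho> borel (\<lambda>y. B *v y))"
    and "(\<integral>y. y $ i \<partial>distr \<rho> borel (\<lambda>y. B *v y)) = 0"
    and "second_moments (distr \<rho> borel (\<lambda>y. B *v y)) = B ** second_moments \<rho> ** transpose B"
proof -
  have m [measurable]: "(\<lambda>y. B *v y) \<in> borel_measurable \<rho>" by measurable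
  have "integrable \<rho> (\<lambda>y. norm (B *v y) ^ 3)"
  proof (rule integrable_cubic_bound)
    fix y
    have "norm (B *v y) ^ 3 \<le> (norm B * norm y) ^ 3" by (intro power_mono matrix_vector_norm_le) auto
    also have "\<dots> \<le> norm B ^ 3 * (1 + norm y ^ 3)" unfolding power_mult_distrib by (intro mult_left_mono) auto
    finally show "\<bar>norm (B *v y) ^ 3\<bar> \<le> norm B ^ 3 * (1 + norm y ^ 3)" by simp
  qed measurable
  then have "integrable (distr \<rho> borel (\<lambda>y. B *v y)) (\<lambda>y. norm y ^ 3)" by (subst integrable_distr_eq) auto
  then show "third_moment_law (distr \<rho> borel (\<lambda>y. B *v y))"
    using prob_space_distr[OF m] by (simp add: third_moment_law_def third_moment_law_axioms_def)
  have "(\<integral>y. (B *v y) $ i \<partial>\<rho>) = 0"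
    unfolding matrix_vector_mul_component inner_vec_def
    by (subst Bochner_Integration.integral_sum) (auto simp: centered intro: integrable_component)
  then show "(\<integral>y. y $ i \<partial>distr \<rho> borel (\<lambda>y. B *v y)) = 0" by (subst integral_distr) auto
  have "(\<integral>y. y $ k * y $ l \<partial>distr \<rho> borel (\<lambda>y. B *v y)) = (B ** second_moments \<rho> ** transpose B) $ k $ l" for k l
    unfolding congruence_component second_moments_bilinear matrix_vector_mul_component[symmetric]
    by (subst integral_distr) auto
  then show "second_moments (distr \<rho> borel (\<lambda>y. B *v y)) = B ** second_moments \<rho> ** transpose B"
    by (simp add: second_moments_def vec_eq_iff)
qed

text \<open>The image of the noise under \<open>B\<close> and the Gaussian with the same covariance
  share the quadratic expansion of the smoothed function, so only two remainders survive, each of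
  order \<open>t * trace (W ** A ** W)\<close> with \<open>W\<close> the inverse square root of
  \<open>G\<close>. The lower bound on \<open>G\<close> and the bound on \<open>B\<close> make
  \<open>W ** B\<close> a contraction; this keeps the trace below that of the noise covariance, as
  the comparison with the log-determinant requires. The constant depends on the law alone.\<close>

lemma lindeberg_step:
  obtains K where "0 \<le> K" "\<And>f G (B :: real ^ 'n ^ 'n) t x. (\<And>x y. \<bar>f x - f y\<bar> \<le> norm (x - y)) \<Longrightarrow> psd G \<Longrightarrow> 0 < t \<Longrightarrow>
    (\<And>y. t\<^sup>2 * (y \<bullet> y) \<le> y \<bullet> (G *v y)) \<Longrightarrow> (\<And>y. norm (B *v y) \<le> t * norm y) \<Longrightarrow>
    \<bar>(\<integral>y. smoothed f (mat_sqrt G) (x + B *v y) \<partial>\<rho>) - smoothed f (mat_sqrt (G + B ** second_moments \<rho> ** transpose B)) x\<bar>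
      \<le> K * t * (ln (det (G + B ** second_moments \<rho> ** transpose B)) - ln (det G))"
proof -
  interpret g: third_moment_law "gauss :: (real ^ 'n) measure" by (rule gauss_third_moment_law)
  let ?S = "second_moments \<rho>"
  define k where "k = trace ?S"
  have k0: "0 \<le> k" unfolding k_def by (rule trace_psd_nonneg[OF psd_second_moments])
  obtain C where C: "0 \<le> C" "\<And>B :: real ^ 'n ^ 'n.
    (\<integral>y. norm y * (norm (B *v y))\<^sup>2 \<partial>\<rho>) \<le> C * trace (B ** ?S ** transpose B)"
    by (rule third_moment_trace) blast
  obtain D where D: "0 \<le> D" "\<And>B :: real ^ 'n ^ 'n.
    (\<integral>y. norm y * (norm (B *v y))\<^sup>2 \<partial>gauss) \<le> D * trace (B ** second_moments gauss ** transpose B)"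
    by (rule g.third_moment_trace) blast
  have gI: "second_moments (gauss :: (real ^ 'n) measure) = mat 1"
  proof -
    have "(\<integral>z. z $ a * z $ b \<partial>(gauss :: (real ^ 'n) measure)) = (if a = b then 1 else 0)" for a b
      using gauss_covariance[of "axis a 1" "axis b 1"] by (simp add: inner_axis') (simp add: axis_def)
    then show ?thesis by (simp add: second_moments_def mat_def vec_eq_iff)
  qed
  define K where "K = shift_const * (C + sqrt k * D) * (1 + k)"
  have K0: "0 \<le> K" unfolding K_def using C D k0 shift_const_nonneg by simp
  have "\<bar>(\<integral>y. smoothed f (mat_sqrt G) (x + B *v y) \<partial>\<rho>) - smoothed f (mat_sqrt (G + B ** ?S ** transpose B)) x\<bar>
      \<le> K * t * (ln (det (G + B ** ?S ** transpose B)) - ln (det G))"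
    if lip: "\<And>x y. \<bar>f x - f y\<bar> \<le> norm (x - y)" and G: "psd G" and t: "0 < t"
      and Gt: "\<And>y. t\<^sup>2 * (y \<bullet> y) \<le> y \<bullet> (G *v y)" and Bt: "\<And>y. norm (B *v y) \<le> t * norm y" for f G t x and B :: "real ^ 'n ^ 'n"
  proof -
    define A where "A = B ** ?S ** transpose B"
    have A: "psd A" unfolding A_def by (rule psd_congruence[OF psd_second_moments])
    have "0 < y \<bullet> (G *v y)" if "y \<noteq> 0" for y
    proof -
      have "0 < t\<^sup>2 * (y \<bullet> y)" using t that by simp
      then show ?thesis using Gt[of y] by linarith
    qed
    then have posG: "posdef G" using G by (simp add: posdef_def psd_def)
    define L where "L = mat_sqrt G"
    have L: "psd L" "L ** L = G" unfolding L_def using mat_sqrt[OF G] by auto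
    obtain W where W: "transpose W = W" "W ** L = mat 1" "L ** W = mat 1"
      unfolding L_def by (rule posdef_sqrt_inverse[OF posG])
    have Wn: "norm (W *v y) \<le> norm y / t" for y
    proof -
      have "y = L *v (W *v y)" by (simp add: matrix_vector_mul_assoc W)
      have "t\<^sup>2 * (norm (W *v y))\<^sup>2 \<le> (W *v y) \<bullet> (G *v (W *v y))"
        using Gt[of "W *v y"] by (simp add: power2_norm_eq_inner)
      also have "\<dots> = (L *v (W *v y)) \<bullet> (L *v (W *v y))"
      proof -
        have "(L *v w) \<bullet> (L *v w) = w \<bullet> (G *v w)" for w
          using inner_matrix_vector_left[of L w "L *v w"] L by (simp add: psd_def matrix_vector_mul_assoc)
        from this[of "W *v y"] show ?thesis by (rule sym)
      qed
      also have "\<dots> = (norm y)\<^sup>2" using \<open>y = L *v (W *v y)\<close> by (simp add: power2_norm_eq_inner)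
      finally have "(t * norm (W *v y))\<^sup>2 \<le> (norm y)\<^sup>2" by (simp add: power_mult_distrib)
      then have "t * norm (W *v y) \<le> norm y" by (rule power2_le_imp_le) simp
      then show ?thesis using t by (simp add: field_simps)
    qed
    define T where "T = trace (W ** A ** W)"
    have TB: "T = trace ((W ** B) ** ?S ** transpose (W ** B))"
      unfolding T_def A_def matrix_transpose_mul W(1) by (simp add: matrix_mul_assoc)
    have WBn: "norm ((W ** B) *v y) \<le> 1 * norm y" for y
    proof -
      have "norm ((W ** B) *v y) \<le> norm (B *v y) / t"
        using Wn[of "B *v y"] by (simp add: matrix_vector_mul_assoc)
      also have "\<dots> \<le> norm y" using Bt[of y] t by (simp add: field_simps)
      finally show ?thesis by simp
    qed
    have Tk: "T \<le> k" using trace_contraction[OF WBn] unfolding TB k_def by simp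
    have T0: "0 \<le> T" unfolding TB by (rule trace_psd_nonneg[OF psd_congruence[OF psd_second_moments]])
    have Tlog: "T \<le> (1 + k) * (ln (det (G + A)) - ln (det G))"
      unfolding T_def using Tk W unfolding L_def T_def by (intro trace_le_log_det_increment[OF posG _ _ _ A])
    obtain Q :: "real ^ 'n ^ 'n" where Q: "\<And>\<rho>. third_moment_law \<rho> \<Longrightarrow> (\<And>i. (\<integral>y. y $ i \<partial>\<rho>) = 0) \<Longrightarrow>
      \<bar>(\<integral>y. smoothed f L (x + y) \<partial>\<rho>) - smoothed f L x - (\<Sum>k\<in>UNIV. \<Sum>l\<in>UNIV. Q $ k $ l * (\<integral>y. y $ k * y $ l \<partial>\<rho>))\<bar>
        \<le> shift_const * (\<integral>y. norm y * (norm (W *v y))\<^sup>2 \<partial>\<rho>)"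
      by (rule smoothed_expansion[OF lip W(3)]) blast
    \<comment> \<open>The common quadratic term of both expansions, which cancels in their
      difference.\<close>
    define q where "q = (\<Sum>k\<in>UNIV. \<Sum>l\<in>UNIV. Q $ k $ l * A $ k $ l)"
    let ?\<rho> = "distr \<rho> borel (\<lambda>y. B *v y)"
    have mom: "(\<integral>y. y $ k * y $ l \<partial>\<mu>) = second_moments \<mu> $ k $ l" for \<mu> :: "(real ^ 'n) measure" and k l
      by (simp add: second_moments_def)
    have sm [measurable]: "smoothed f L \<in> borel_measurable borel"
      by (rule borel_of_lipschitz[of _ 1]) (use smoothed_lipschitz[OF lip] in simp)
    have "\<bar>(\<integral>y. smoothed f L (x + y) \<partial>?\<rho>) - smoothed f L x - q\<bar> \<le> shift_const * (\<integral>y. norm y * (norm (W *v y))\<^sup>2 \<partial>?\<rho>)"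
      using Q[OF linear_image_law(1,2), of B] unfolding mom linear_image_law(3) q_def A_def .
    moreover have "(\<integral>y. smoothed f L (x + y) \<partial>?\<rho>) = (\<integral>y. smoothed f L (x + B *v y) \<partial>\<rho>)"
      by (subst integral_distr) auto
    moreover have "(\<integral>y. norm y * (norm (W *v y))\<^sup>2 \<partial>?\<rho>) \<le> t * (C * T)"
    proof -
      have iB: "integrable \<rho> (\<lambda>y. norm y * (norm ((W ** B) *v y))\<^sup>2)"
        unfolding norm_sq_matrix_vector sum_distrib_left
        by (intro Bochner_Integration.integrable_sum integrable_norm_inner_sq)
      have le: "norm (B *v y) * (norm (W *v (B *v y)))\<^sup>2 \<le> t * (norm y * (norm ((W ** B) *v y))\<^sup>2)" for y
        using mult_right_mono[OF Bt[of y], of "(norm ((W ** B) *v y))\<^sup>2"] by (simp add: matrix_vector_mul_assoc mult.assoc)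
      have "(\<integral>y. norm y * (norm (W *v y))\<^sup>2 \<partial>?\<rho>) = (\<integral>y. norm (B *v y) * (norm (W *v (B *v y)))\<^sup>2 \<partial>\<rho>)"
        by (subst integral_distr) auto
      also have "\<dots> \<le> (\<integral>y. t * (norm y * (norm ((W ** B) *v y))\<^sup>2) \<partial>\<rho>)"
      proof (rule integral_mono)
        show "integrable \<rho> (\<lambda>y. t * (norm y * (norm ((W ** B) *v y))\<^sup>2))" using iB by simp
        then show "integrable \<rho> (\<lambda>y. norm (B *v y) * (norm (W *v (B *v y)))\<^sup>2)"
        proof (rule Bochner_Integration.integrable_bound)
          show "AE y in \<rho>. norm (norm (B *v y) * (norm (W *v (B *v y)))\<^sup>2) \<le> norm (t * (norm y * (norm ((W ** B) *v y))\<^sup>2))"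
          proof (rule AE_I2)
            fix y show "norm (norm (B *v y) * (norm (W *v (B *v y)))\<^sup>2) \<le> norm (t * (norm y * (norm ((W ** B) *v y))\<^sup>2))"
              using le[of y] t by simp
          qed
        qed measurable
      qed (rule le)
      also have "\<dots> \<le> t * (C * T)" using C(2)[of "W ** B"] t unfolding TB by simp
      finally show ?thesis .
    qed
    ultimately have e1: "\<bar>(\<integral>y. smoothed f L (x + B *v y) \<partial>\<rho>) - smoothed f L x - q\<bar> \<le> shift_const * (t * (C * T))"
      using shift_const_nonneg by (smt (verit) mult_left_mono)
    let ?R = "mat_sqrt A"
    note R = mat_sqrt[OF A]
    have "\<bar>(\<integral>y. smoothed f L (x + y) \<partial>gaussian A) - smoothed f L x - q\<bar> \<le> shift_const * (\<integral>y. norm y * (norm (W *v y))\<^sup>2 \<partial>gaussian A)"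
      using Q[OF gaussian_moments(1,2)[OF A]] unfolding mom gaussian_moments(3)[OF A] q_def .
    moreover have "(\<integral>y. smoothed f L (x + y) \<partial>gaussian A) = smoothed f (mat_sqrt (G + A)) x"
      unfolding L_def by (rule smoothed_gaussian_add[OF lip A G])
    moreover have "(\<integral>y. norm y * (norm (W *v y))\<^sup>2 \<partial>gaussian A) \<le> t * (sqrt k * D * T)"
    proof -
      \<comment> \<open>The counterpart of \<open>Bt\<close> for the Gaussian, whose factor
        \<open>mat_sqrt A\<close> is controlled only through its Frobenius norm: the square of that
        norm is \<open>trace A\<close>.\<close>
      have Rn: "norm ?R \<le> t * sqrt k"
      proof -
        have "(norm ?R)\<^sup>2 = trace A" using R by (simp add: norm_sq_trace psd_def)
        also have "\<dots> \<le> t\<^sup>2 * k" unfolding A_def k_def by (rule trace_contraction[OF Bt])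
        also have "\<dots> = (t * sqrt k)\<^sup>2" using k0 by (simp add: power_mult_distrib)
        finally show ?thesis by (rule power2_le_imp_le) (use t k0 in simp)
      qed
      have TR: "trace ((W ** ?R) ** second_moments gauss ** transpose (W ** ?R)) = T"
      proof -
        have "(W ** ?R) ** mat 1 ** transpose (W ** ?R) = W ** (?R ** ?R) ** W"
          using R(1) W(1) by (simp add: matrix_transpose_mul psd_def matrix_mul_assoc)
        then show ?thesis unfolding gI T_def R(2) by simp
      qed
      have iB: "integrable gauss (\<lambda>y. norm y * (norm ((W ** ?R) *v y))\<^sup>2)"
        unfolding norm_sq_matrix_vector sum_distrib_left
        by (intro Bochner_Integration.integrable_sum g.integrable_norm_inner_sq)
      have le: "norm (?R *v y) * (norm (W *v (?R *v y)))\<^sup>2 \<le> (t * sqrt k) * (norm y * (norm ((W ** ?R) *v y))\<^sup>2)" for y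
      proof -
        have "norm (?R *v y) \<le> (t * sqrt k) * norm y"
          using matrix_vector_norm_le[of ?R y] mult_right_mono[OF Rn, of "norm y"] by simp
        from mult_right_mono[OF this, of "(norm ((W ** ?R) *v y))\<^sup>2"] show ?thesis
          by (simp add: matrix_vector_mul_assoc mult.assoc)
      qed
      have "(\<integral>y. norm y * (norm (W *v y))\<^sup>2 \<partial>gaussian A) = (\<integral>y. norm (?R *v y) * (norm (W *v (?R *v y)))\<^sup>2 \<partial>gauss)"
        unfolding gaussian_def by (subst integral_distr) auto
      also have "\<dots> \<le> (\<integral>y. (t * sqrt k) * (norm y * (norm ((W ** ?R) *v y))\<^sup>2) \<partial>gauss)"
      proof (rule integral_mono)
        show "integrable gauss (\<lambda>y. (t * sqrt k) * (norm y * (norm ((W ** ?R) *v y))\<^sup>2))" using iB by simp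
        then show "integrable gauss (\<lambda>y. norm (?R *v y) * (norm (W *v (?R *v y)))\<^sup>2)"
        proof (rule Bochner_Integration.integrable_bound)
          show "AE y in gauss. norm (norm (?R *v y) * (norm (W *v (?R *v y)))\<^sup>2) \<le> norm ((t * sqrt k) * (norm y * (norm ((W ** ?R) *v y))\<^sup>2))"
          proof (rule AE_I2)
            fix y show "norm (norm (?R *v y) * (norm (W *v (?R *v y)))\<^sup>2) \<le> norm ((t * sqrt k) * (norm y * (norm ((W ** ?R) *v y))\<^sup>2))"
              using le[of y] t k0 by simp
          qed
        qed measurable
      qed (rule le)
      also have "\<dots> = (t * sqrt k) * (\<integral>y. norm y * (norm ((W ** ?R) *v y))\<^sup>2 \<partial>gauss)" by (rule integral_mult_right_zero)
      also have "\<dots> \<le> (t * sqrt k) * (D * T)"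
        using D(2)[of "W ** ?R"] t k0 unfolding TR by (intro mult_left_mono) auto
      finally show ?thesis by (simp add: mult_ac)
    qed
    ultimately have e2: "\<bar>smoothed f (mat_sqrt (G + A)) x - smoothed f L x - q\<bar> \<le> shift_const * (t * (sqrt k * D * T))"
      using shift_const_nonneg by (smt (verit) mult_left_mono)
    have "\<bar>(\<integral>y. smoothed f L (x + B *v y) \<partial>\<rho>) - smoothed f (mat_sqrt (G + A)) x\<bar> \<le>
        shift_const * (t * (C * T)) + shift_const * (t * (sqrt k * D * T))" using e1 e2 by linarith
    also have "\<dots> = (shift_const * (C + sqrt k * D)) * t * T" by (simp add: algebra_simps)
    also have "\<dots> \<le> (shift_const * (C + sqrt k * D)) * t * ((1 + k) * (ln (det (G + A)) - ln (det G)))"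
      using C(1) D(1) k0 t shift_const_nonneg by (intro mult_left_mono Tlog) auto
    also have "\<dots> = K * t * (ln (det (G + A)) - ln (det G))" by (simp add: K_def)
    finally show ?thesis unfolding L_def A_def .
  qed
  with K0 show ?thesis by (rule that)
qed

end

section \<open>Independence and the telescoping sum of replacements\<close>

lemma (in prob_space) indep_var_linear_sum:
  fixes noise :: "nat \<Rightarrow> 'a \<Rightarrow> real ^ 'n" and B :: "nat \<Rightarrow> real ^ 'n ^ 'n"
  assumes indep: "indep_vars (\<lambda>_. borel) noise UNIV"
  shows "indep_var borel (\<lambda>\<omega>. \<Sum>i<j. B i *v noise i \<omega>) borel (noise j)"
proof -
  have "indep_var
    borel ((\<lambda>f. \<Sum>i<j. B i *v f i) \<circ> (\<lambda>\<omega>. restrict (\<lambda>i. noise i \<omega>) {..<j}))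
    borel ((\<lambda>f. f j) \<circ> (\<lambda>\<omega>. restrict (\<lambda>i. noise i \<omega>) {j}))"
  proof (rule indep_var_compose[OF indep_var_restrict[OF indep]])
    show "(\<lambda>f. \<Sum>i<j. B i *v f i) \<in> borel_measurable (Pi\<^sub>M {..<j} (\<lambda>_. borel))"
      by (intro borel_measurable_sum measurable_compose[OF _ matrix_vector_borel]) auto
  qed auto
  moreover have "(\<lambda>f. \<Sum>i<j. B i *v f i) \<circ> (\<lambda>\<omega>. restrict (\<lambda>i. noise i \<omega>) {..<j}) = (\<lambda>\<omega>. \<Sum>i<j. B i *v noise i \<omega>)"
    by (rule ext) (auto intro: sum.cong)
  moreover have "(\<lambda>f. f j) \<circ> (\<lambda>\<omega>. restrict (\<lambda>i. noise i \<omega>) {j}) = noise j" by (rule ext) simp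
  ultimately show ?thesis by simp
qed

text \<open>Fubini for independent vectors: the new noise is integrated first, with the partial sum
  frozen, so that a bound uniform in \<open>x\<close> applies.\<close>

lemma (in prob_space) expectation_indep_sum:
  fixes X Y :: "'a \<Rightarrow> real ^ 'n" and h :: "real ^ 'n \<Rightarrow> real" and B :: "real ^ 'n ^ 'n"
  assumes indep: "indep_var borel X borel Y" and [measurable]: "h \<in> borel_measurable borel"
    and int: "integrable M (\<lambda>\<omega>. h (X \<omega> + B *v Y \<omega>))"
  shows "integrable (distr M borel X) (\<lambda>x. \<integral>y. h (x + B *v y) \<partial>distr M borel Y)"
    and "(\<integral>\<omega>. h (X \<omega> + B *v Y \<omega>) \<partial>M) = (\<integral>x. (\<integral>y. h (x + B *v y) \<partial>distr M borel Y) \<partial>distr M borel X)"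
proof -
  have [measurable]: "X \<in> borel_measurable M" "Y \<in> borel_measurable M"
    using indep by (auto dest: indep_var_rv1 indep_var_rv2)
  interpret X: prob_space "distr M borel X" by (rule prob_space_distr) simp
  interpret Y: prob_space "distr M borel Y" by (rule prob_space_distr) simp
  interpret P: pair_prob_space "distr M borel X" "distr M borel Y" ..
  have joint: "distr M borel X \<Otimes>\<^sub>M distr M borel Y = distr M (borel \<Otimes>\<^sub>M borel) (\<lambda>\<omega>. (X \<omega>, Y \<omega>))"
    using indep indep_var_distribution_eq by blast
  have m: "(\<lambda>\<omega>. (X \<omega>, Y \<omega>)) \<in> measurable M (borel \<Otimes>\<^sub>M borel)" by measurable
  have hm: "(\<lambda>p. h (fst p + B *v snd p)) \<in> borel_measurable (borel \<Otimes>\<^sub>M borel)" by measurable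
  have i: "integrable (distr M borel X \<Otimes>\<^sub>M distr M borel Y) (\<lambda>p. h (fst p + B *v snd p))"
    unfolding joint integrable_distr_eq[OF m hm] using int by simp
  show "integrable (distr M borel X) (\<lambda>x. \<integral>y. h (x + B *v y) \<partial>distr M borel Y)"
    using P.integrable_fst'[OF i] by simp
  have "(\<integral>\<omega>. h (X \<omega> + B *v Y \<omega>) \<partial>M) = (\<integral>p. h (fst p + B *v snd p) \<partial>(distr M borel X \<Otimes>\<^sub>M distr M borel Y))"
    unfolding joint integral_distr[OF m hm] by simp
  then show "(\<integral>\<omega>. h (X \<omega> + B *v Y \<omega>) \<partial>M) = (\<integral>x. (\<integral>y. h (x + B *v y) \<partial>distr M borel Y) \<partial>distr M borel X)"
    using P.integral_fst'[OF i] by simp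
qed

lemma lipschitz_integrable:
  fixes f :: "'b::euclidean_space \<Rightarrow> real"
  assumes "finite_measure M" and lip: "\<And>x y. \<bar>f x - f y\<bar> \<le> norm (x - y)" and X: "integrable M X"
  shows "integrable M (\<lambda>\<omega>. f (X \<omega>))"
proof -
  interpret finite_measure M by fact
  have [measurable]: "f \<in> borel_measurable borel" by (rule borel_of_lipschitz[of _ 1]) (use lip in simp)
  have [measurable]: "X \<in> borel_measurable M" using X by simp
  show ?thesis
  proof (rule Bochner_Integration.integrable_bound)
    show "integrable M (\<lambda>\<omega>. \<bar>f 0\<bar> + norm (X \<omega>))" using X by simp
    show "AE \<omega> in M. norm (f (X \<omega>)) \<le> norm (\<bar>f 0\<bar> + norm (X \<omega>))"
    proof (rule AE_I2)
      fix \<omega> show "norm (f (X \<omega>)) \<le> norm (\<bar>f 0\<bar> + norm (X \<omega>))" using lip[of "X \<omega>" 0] by simp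
    qed
  qed measurable
qed

lemma det_scaled_identity: "det (c *\<^sub>R mat 1 :: real ^ 'n ^ 'n) = c ^ CARD('n)"
  by (subst det_diagonal) (auto simp: mat_def)

lemma det_posdef_pos:
  assumes "posdef G"
  shows "0 < det G"
proof -
  have G: "psd G" using assms posdef_nonneg[OF assms] by (simp add: posdef_def psd_def)
  obtain W where W: "W ** mat_sqrt G = mat 1" by (rule posdef_sqrt_inverse[OF assms])
  have "det W * det (mat_sqrt G) = 1" using W by (metis det_mul det_I)
  then have "det (mat_sqrt G) \<noteq> 0" by auto
  moreover have "det G = det (mat_sqrt G) * det (mat_sqrt G)"
    using mat_sqrt(2)[OF G] by (metis det_mul)
  ultimately show ?thesis by (auto simp: zero_less_mult_iff linorder_neq_iff)
qed

lemma psd_scaled_identity: "0 \<le> c \<Longrightarrow> psd (c *\<^sub>R (mat 1 :: real ^ 'n ^ 'n))"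
  by (simp add: psd_def transpose_scalar scaleR_matrix_vector_assoc[symmetric])

lemma psd_sum:
  assumes "\<And>i. i \<in> I \<Longrightarrow> psd (A i)"
  shows "psd (\<Sum>i\<in>I. A i)"
proof -
  have "psd (0 :: real ^ 'b ^ 'b)" by (simp add: psd_def transpose_def vec_eq_iff)
  then show ?thesis using assms by (induction I rule: infinite_finite_induct) (simp_all add: psd_add)
qed

lemma trace_sum: "trace (\<Sum>i\<in>I. A i) = (\<Sum>i\<in>I. trace (A i))" for A :: "'i \<Rightarrow> real ^ 'n ^ 'n"
  unfolding trace_def sum_component by (rule sum.swap)

text \<open>Lindeberg replacement, smoothed by the Gaussians already put in and by an additional
  \<open>N(0, t\<^sup>2 I)\<close>. The errors telescope in the logarithm of the determinant of the
  smoothing covariance, which is the source of the logarithm.\<close>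
lemma (in centered_law) lindeberg_clt:
  obtains C where "0 \<le> C" "\<And>(M :: 'w measure) noise (B :: nat \<Rightarrow> real ^ 'n ^ 'n) t k f.
    prob_space M \<Longrightarrow> prob_space.indep_vars M (\<lambda>_. borel) noise UNIV \<Longrightarrow> (\<And>i. distr M borel (noise i) = \<rho>) \<Longrightarrow> 0 < t \<Longrightarrow>
    (\<And>i y. i < k \<Longrightarrow> norm (B i *v y) \<le> t * norm y) \<Longrightarrow> (\<And>x y. \<bar>f x - f y\<bar> \<le> norm (x - y)) \<Longrightarrow>
    \<bar>(\<integral>\<omega>. f (\<Sum>i<k. B i *v noise i \<omega>) \<partial>M) - (\<integral>y. f y \<partial>gaussian (\<Sum>i<k. B i ** second_moments \<rho> ** transpose (B i)))\<bar>
      \<le> C * t * (1 + ln (real CARD('n) + (\<Sum>i<k. trace (B i ** second_moments \<rho> ** transpose (B i))) / t\<^sup>2))"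
proof -
  obtain K where K: "0 \<le> K" "\<And>f G (B :: real ^ 'n ^ 'n) t x. (\<And>x y. \<bar>f x - f y\<bar> \<le> norm (x - y)) \<Longrightarrow> psd G \<Longrightarrow> 0 < t \<Longrightarrow>
    (\<And>y. t\<^sup>2 * (y \<bullet> y) \<le> y \<bullet> (G *v y)) \<Longrightarrow> (\<And>y. norm (B *v y) \<le> t * norm y) \<Longrightarrow>
    \<bar>(\<integral>y. smoothed f (mat_sqrt G) (x + B *v y) \<partial>\<rho>) - smoothed f (mat_sqrt (G + B ** second_moments \<rho> ** transpose B)) x\<bar>
      \<le> K * t * (ln (det (G + B ** second_moments \<rho> ** transpose B)) - ln (det G))"
    by (rule lindeberg_step) blast
  define m1 where "m1 = (\<integral>z. norm z \<partial>(gauss :: (real ^ 'n) measure))"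
  have m1: "0 \<le> m1" by (simp add: m1_def)
  define N where "N = real CARD('n)"
  have N1: "1 \<le> N" by (simp add: N_def Suc_leI)
  define C where "C = 2 * m1 + K * N"
  have C0: "0 \<le> C" using m1 K N1 by (simp add: C_def)
  have "\<bar>(\<integral>\<omega>. f (\<Sum>i<k. B i *v noise i \<omega>) \<partial>M) - (\<integral>y. f y \<partial>gaussian (\<Sum>i<k. B i ** second_moments \<rho> ** transpose (B i)))\<bar>
      \<le> C * t * (1 + ln (N + (\<Sum>i<k. trace (B i ** second_moments \<rho> ** transpose (B i))) / t\<^sup>2))"
    if M: "prob_space M" and ind: "prob_space.indep_vars M (\<lambda>_. borel) noise UNIV" and law: "\<And>i. distr M borel (noise i) = \<rho>"
      and t: "0 < t" and Bt: "\<And>i y. i < k \<Longrightarrow> norm (B i *v y) \<le> t * norm y" and lip: "\<And>x y. \<bar>f x - f y\<bar> \<le> norm (x - y)"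
    for M :: "'w measure" and noise t k f and B :: "nat \<Rightarrow> real ^ 'n ^ 'n"
  proof -
    interpret M: prob_space M by fact
    have chim [measurable]: "noise i \<in> borel_measurable M" for i
      using ind unfolding M.indep_vars_def by auto
    have chii: "integrable M (noise i)" for i
    proof -
      have "integrable (distr M borel (noise i)) (\<lambda>y. y)"
        unfolding law using integrable_norm integrable_norm_iff[of "\<lambda>y. y" \<rho>] by simp
      then show ?thesis by (subst (asm) integrable_distr_eq) auto
    qed
    define A where "A i = B i ** second_moments \<rho> ** transpose (B i)" for i
    have A: "psd (A i)" for i unfolding A_def by (rule psd_congruence[OF psd_second_moments])
    \<comment> \<open>The smoothing used together with the first \<open>j\<close> original noises:
      the noises \<open>j\<close>, ..., \<open>k - 1\<close> have become Gaussian, and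
      \<open>t^2\<close> times the identity is always present. Thus \<open>a 0\<close> below is the
      fully Gaussian expectation and \<open>a k\<close> the original one up to smoothing of size
      \<open>t\<close>.\<close>
    define G where "G j = t\<^sup>2 *\<^sub>R mat 1 + (\<Sum>i=j..<k. A i)" for j
    have psdA: "psd (\<Sum>i\<in>I. A i)" for I by (rule psd_sum[OF A])
    have G: "psd (G j)" for j unfolding G_def by (intro psd_add psd_scaled_identity psdA) simp
    have Gt: "t\<^sup>2 * (y \<bullet> y) \<le> y \<bullet> (G j *v y)" for j y
    proof -
      have "y \<bullet> (G j *v y) = t\<^sup>2 * (y \<bullet> y) + y \<bullet> ((\<Sum>i=j..<k. A i) *v y)"
        by (simp add: G_def matrix_vector_mult_add_rdistrib inner_add_right scaleR_matrix_vector_assoc[symmetric])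
      then show ?thesis using psdA[of "{j..<k}"] by (simp add: psd_def)
    qed
    have GS: "G j = G (Suc j) + A j" if "j < k" for j
      using that by (simp add: G_def sum.atLeast_Suc_lessThan add_ac)
    have Gk: "G k = t\<^sup>2 *\<^sub>R mat 1" by (simp add: G_def)
    have G0: "G 0 = t\<^sup>2 *\<^sub>R mat 1 + (\<Sum>i<k. A i)" by (simp add: G_def atLeast0LessThan)
    define S where "S j \<omega> = (\<Sum>i<j. B i *v noise i \<omega>)" for j \<omega>
    have iS: "integrable M (S j)" for j
      unfolding S_def by (intro Bochner_Integration.integrable_sum integrable_bounded_linear[OF matrix_vector_mul_bounded_linear] chii)
    have [measurable]: "S j \<in> borel_measurable M" for j using iS by auto
    define h where "h j = smoothed f (mat_sqrt (G j))" for j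
    have hlip: "\<bar>h j x - h j y\<bar> \<le> norm (x - y)" for j x y unfolding h_def by (rule smoothed_lipschitz[OF lip])
    have [measurable]: "h j \<in> borel_measurable borel" for j
      by (rule borel_of_lipschitz[of _ 1]) (use hlip in simp)
    have ih: "integrable M (\<lambda>\<omega>. h j (S i \<omega>))" for i j
      by (rule lipschitz_integrable[OF M.finite_measure_axioms hlip iS])
    define a where "a j = (\<integral>\<omega>. h j (S j \<omega>) \<partial>M)" for j
    have step: "\<bar>a (Suc j) - a j\<bar> \<le> K * t * (ln (det (G j)) - ln (det (G (Suc j))))" if j: "j < k" for j
    proof -
      define D where "D = K * t * (ln (det (G j)) - ln (det (G (Suc j))))"
      have bound: "\<bar>(\<integral>y. h (Suc j) (x + B j *v y) \<partial>\<rho>) - h j x\<bar> \<le> D" for x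
        using K(2)[OF lip G[of "Suc j"] t Gt Bt[OF j], of x] unfolding h_def D_def GS[OF j] A_def .
      have Ssuc: "S (Suc j) \<omega> = S j \<omega> + B j *v noise j \<omega>" for \<omega> by (simp add: S_def)
      have ind': "M.indep_var borel (S j) borel (noise j)"
        unfolding S_def by (rule M.indep_var_linear_sum[OF ind])
      have i': "integrable M (\<lambda>\<omega>. h (Suc j) (S j \<omega> + B j *v noise j \<omega>))" using ih[of "Suc j" "Suc j"] by (simp add: Ssuc)
      note E = M.expectation_indep_sum[OF ind' _ i', unfolded law]
      interpret D: prob_space "distr M borel (S j)" by (rule M.prob_space_distr) simp
      have i2: "integrable (distr M borel (S j)) (h j)" using ih[of j j] by (subst integrable_distr_eq) auto
      have i1: "integrable (distr M borel (S j)) (\<lambda>x. \<integral>y. h (Suc j) (x + B j *v y) \<partial>\<rho>)" by (rule E) simp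
      have "a (Suc j) = (\<integral>x. (\<integral>y. h (Suc j) (x + B j *v y) \<partial>\<rho>) \<partial>distr M borel (S j))"
        unfolding a_def Ssuc by (rule E) simp
      moreover have "a j = (\<integral>x. h j x \<partial>distr M borel (S j))"
        unfolding a_def by (subst integral_distr) auto
      ultimately have "\<bar>a (Suc j) - a j\<bar> = \<bar>\<integral>x. (\<integral>y. h (Suc j) (x + B j *v y) \<partial>\<rho>) - h j x \<partial>distr M borel (S j)\<bar>"
        by (simp add: Bochner_Integration.integral_diff[OF i1 i2])
      also have "\<dots> \<le> (\<integral>x. D \<partial>distr M borel (S j))"
      proof (rule order_trans[OF integral_abs_bound], rule integral_mono)
        show "integrable (distr M borel (S j)) (\<lambda>x. \<bar>(\<integral>y. h (Suc j) (x + B j *v y) \<partial>\<rho>) - h j x\<bar>)"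
          by (intro integrable_abs Bochner_Integration.integrable_diff i1 i2)
      qed (use bound in auto)
      also have "\<dots> = D" using D.prob_space by simp
      finally show ?thesis unfolding D_def .
    qed
    have tele: "\<bar>a j - a 0\<bar> \<le> K * t * (ln (det (G 0)) - ln (det (G j)))" if "j \<le> k" for j
      using that
    proof (induction j)
      case (Suc j)
      have "\<bar>a (Suc j) - a 0\<bar> \<le> \<bar>a (Suc j) - a j\<bar> + \<bar>a j - a 0\<bar>" by linarith
      also have "\<dots> \<le> K * t * (ln (det (G j)) - ln (det (G (Suc j)))) + K * t * (ln (det (G 0)) - ln (det (G j)))"
        using Suc step[of j] by (intro add_mono) auto
      also have "\<dots> = K * t * (ln (det (G 0)) - ln (det (G (Suc j))))" by (simp add: algebra_simps)
      finally show ?case .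
    qed simp
    have end1: "\<bar>a k - (\<integral>\<omega>. f (S k \<omega>) \<partial>M)\<bar> \<le> t * m1"
    proof -
      have iff: "integrable M (\<lambda>\<omega>. f (S k \<omega>))" by (rule lipschitz_integrable[OF M.finite_measure_axioms lip iS])
      have "\<bar>a k - (\<integral>\<omega>. f (S k \<omega>) \<partial>M)\<bar> = \<bar>\<integral>\<omega>. h k (S k \<omega>) - f (S k \<omega>) \<partial>M\<bar>"
        unfolding a_def by (simp add: Bochner_Integration.integral_diff[OF ih iff])
      also have "\<dots> \<le> (\<integral>\<omega>. t * m1 \<partial>M)"
      proof (rule order_trans[OF integral_abs_bound], rule integral_mono)
        show "integrable M (\<lambda>\<omega>. \<bar>h k (S k \<omega>) - f (S k \<omega>)\<bar>)"
          by (intro integrable_abs Bochner_Integration.integrable_diff ih iff)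
        show "\<bar>h k (S k \<omega>) - f (S k \<omega>)\<bar> \<le> t * m1" for \<omega>
          unfolding h_def Gk m1_def using t by (intro smoothing_error[OF lip]) simp
      qed auto
      finally show ?thesis using M.prob_space by simp
    qed
    have end0: "\<bar>a 0 - (\<integral>y. f y \<partial>gaussian (\<Sum>i<k. A i))\<bar> \<le> t * m1"
    proof -
      define T where "T = (\<Sum>i<k. A i)"
      have T: "psd T" unfolding T_def by (rule psdA)
      interpret T: third_moment_law "gaussian T" by (rule gaussian_moments[OF T])
      have iy: "integrable (gaussian T) (\<lambda>y. y)"
        using T.integrable_norm integrable_norm_iff[of "\<lambda>y. y" "gaussian T"] by simp
      define g where "g = smoothed f (mat_sqrt (t\<^sup>2 *\<^sub>R mat 1))"
      have glip: "\<bar>g x - g y\<bar> \<le> norm (x - y)" for x y unfolding g_def by (rule smoothed_lipschitz[OF lip])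
      have i1: "integrable (gaussian T) g" by (rule lipschitz_integrable[OF T.finite_measure_axioms glip iy])
      have i2: "integrable (gaussian T) f" by (rule lipschitz_integrable[OF T.finite_measure_axioms lip iy])
      have "a 0 = h 0 0" unfolding a_def S_def using M.prob_space by simp
      also have "\<dots> = (\<integral>y. g (0 + y) \<partial>gaussian T)"
        unfolding h_def G0 g_def T_def[symmetric] using t
        by (intro smoothed_gaussian_add[OF lip T, symmetric] psd_scaled_identity) simp
      finally have "\<bar>a 0 - (\<integral>y. f y \<partial>gaussian T)\<bar> = \<bar>\<integral>y. g y - f y \<partial>gaussian T\<bar>"
        by (simp add: Bochner_Integration.integral_diff[OF i1 i2])
      also have "\<dots> \<le> (\<integral>y. t * m1 \<partial>gaussian T)"
      proof (rule order_trans[OF integral_abs_bound], rule integral_mono)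
        show "integrable (gaussian T) (\<lambda>y. \<bar>g y - f y\<bar>)" using i1 i2 by (intro integrable_abs Bochner_Integration.integrable_diff)
        show "\<bar>g y - f y\<bar> \<le> t * m1" for y
          unfolding g_def m1_def using t by (intro smoothing_error[OF lip]) simp
      qed auto
      finally show ?thesis using T.prob_space unfolding T_def by simp
    qed
    define s where "s = (\<Sum>i<k. trace (A i))"
    have s0: "0 \<le> s" unfolding s_def by (intro sum_nonneg trace_psd_nonneg A)
    have t2: "0 < t\<^sup>2" using t by simp
    \<comment> \<open>The telescoped logarithms are those at the two ends: \<open>det (G k)\<close>
      is a power of \<open>t^2\<close>, and \<open>det (G 0)\<close> is bounded by a power of its
      trace.\<close>
    have ld: "ln (det (G 0)) - ln (det (G k)) \<le> N * ln (N + s / t\<^sup>2)"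
    proof -
      have tr: "trace (G 0) = N * t\<^sup>2 + s"
        unfolding G0 trace_add trace_sum s_def N_def by (simp add: trace_def mat_def)
      have "0 < trace (G 0)" unfolding tr using t2 s0 N1 by (simp add: add_pos_nonneg)
      have detk: "det (G k) = (t\<^sup>2) ^ CARD('n)" unfolding Gk by (rule det_scaled_identity)
      have "posdef (G 0)"
      proof -
        have "0 < y \<bullet> (G 0 *v y)" if "y \<noteq> 0" for y
        proof -
          have "0 < t\<^sup>2 * (y \<bullet> y)" using t2 that by simp
          then show ?thesis using Gt[of y 0] by linarith
        qed
        then show ?thesis using G[of 0] by (simp add: posdef_def psd_def)
      qed
      then have "0 < det (G 0)" by (rule det_posdef_pos)
      then have "ln (det (G 0)) \<le> ln (trace (G 0) ^ CARD('n))"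
        using det_le_trace_power[OF G[of 0]] by simp
      then have "ln (det (G 0)) - ln (det (G k)) \<le> N * ln (trace (G 0)) - N * ln (t\<^sup>2)"
        unfolding detk using \<open>0 < trace (G 0)\<close> t2 by (simp add: ln_realpow N_def)
      also have "\<dots> = N * ln (trace (G 0) / t\<^sup>2)" using \<open>0 < trace (G 0)\<close> t2 by (simp add: ln_div right_diff_distrib)
      also have "trace (G 0) / t\<^sup>2 = N + s / t\<^sup>2" unfolding tr using t2 by (simp add: field_simps)
      finally show ?thesis .
    qed
    have lnn: "0 \<le> ln (N + s / t\<^sup>2)" using N1 s0 t2 by (intro ln_ge_zero) (simp add: add_increasing2)
    have "\<bar>(\<integral>\<omega>. f (S k \<omega>) \<partial>M) - (\<integral>y. f y \<partial>gaussian (\<Sum>i<k. A i))\<bar> \<le> t * m1 + K * t * (ln (det (G 0)) - ln (det (G k))) + t * m1"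
      using end1 end0 tele[of k] by linarith
    also have "\<dots> \<le> t * m1 + K * t * (N * ln (N + s / t\<^sup>2)) + t * m1"
      using K(1) t by (intro add_right_mono add_left_mono mult_left_mono ld) auto
    also have "\<dots> = (2 * m1) * t * 1 + (K * N) * t * ln (N + s / t\<^sup>2)" by (simp add: algebra_simps)
    also have "\<dots> \<le> (2 * m1) * t * (1 + ln (N + s / t\<^sup>2)) + (K * N) * t * (1 + ln (N + s / t\<^sup>2))"
      using lnn m1 t K(1) N1 by (intro add_mono mult_left_mono) auto
    also have "\<dots> = C * t * (1 + ln (N + s / t\<^sup>2))" by (simp add: C_def algebra_simps)
    finally show ?thesis unfolding S_def A_def s_def .
  qed
  with C0 show ?thesis unfolding N_def by (rule that)
qed

section \<open>Gaussian comparison\<close>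

text \<open>The bound is the nonnegativity of the variance of \<open>\<bar>h\<bar>\<close>;
  integrability follows from \<open>\<bar>h\<bar> \<le> 1 + h^2\<close>.\<close>

lemma (in prob_space) expectation_abs_le_L2:
  fixes h :: "'a \<Rightarrow> real"
  assumes [measurable]: "h \<in> borel_measurable M" and sq: "integrable M (\<lambda>\<omega>. (h \<omega>)\<^sup>2)"
  shows "integrable M h" "(\<integral>\<omega>. \<bar>h \<omega>\<bar> \<partial>M) \<le> sqrt (\<integral>\<omega>. (h \<omega>)\<^sup>2 \<partial>M)"
proof -
  show i: "integrable M h"
  proof (rule Bochner_Integration.integrable_bound)
    show "integrable M (\<lambda>\<omega>. 1 + (h \<omega>)\<^sup>2)" using sq by simp
    show "AE \<omega> in M. norm (h \<omega>) \<le> norm (1 + (h \<omega>)\<^sup>2)"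
    proof (rule AE_I2)
      fix \<omega>
      have "0 \<le> (\<bar>h \<omega>\<bar> - 1)\<^sup>2" by simp
      then have "2 * \<bar>h \<omega>\<bar> \<le> (h \<omega>)\<^sup>2 + 1" by (simp add: power2_diff)
      then show "norm (h \<omega>) \<le> norm (1 + (h \<omega>)\<^sup>2)" by simp
    qed
  qed measurable
  have "0 \<le> variance (\<lambda>\<omega>. \<bar>h \<omega>\<bar>)" by simp
  also have "\<dots> = (\<integral>\<omega>. \<bar>h \<omega>\<bar>\<^sup>2 \<partial>M) - (\<integral>\<omega>. \<bar>h \<omega>\<bar> \<partial>M)\<^sup>2"
    using i sq by (intro variance_eq) auto
  finally show "(\<integral>\<omega>. \<bar>h \<omega>\<bar> \<partial>M) \<le> sqrt (\<integral>\<omega>. (h \<omega>)\<^sup>2 \<partial>M)"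
    by (intro real_le_rsqrt) simp
qed

lemma integrable_mult_L2:
  fixes f g :: "'a \<Rightarrow> real"
  assumes [measurable]: "f \<in> borel_measurable M" "g \<in> borel_measurable M"
    and "integrable M (\<lambda>\<omega>. (f \<omega>)\<^sup>2)" "integrable M (\<lambda>\<omega>. (g \<omega>)\<^sup>2)"
  shows "integrable M (\<lambda>\<omega>. f \<omega> * g \<omega>)"
proof (rule Bochner_Integration.integrable_bound)
  show "integrable M (\<lambda>\<omega>. (f \<omega>)\<^sup>2 + (g \<omega>)\<^sup>2)" using assms by simp
  show "AE \<omega> in M. norm (f \<omega> * g \<omega>) \<le> norm ((f \<omega>)\<^sup>2 + (g \<omega>)\<^sup>2)"
  proof (rule AE_I2)
    fix \<omega>
    have "0 \<le> (\<bar>f \<omega>\<bar> - \<bar>g \<omega>\<bar>)\<^sup>2" by simp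
    then have "2 * (\<bar>f \<omega>\<bar> * \<bar>g \<omega>\<bar>) \<le> (f \<omega>)\<^sup>2 + (g \<omega>)\<^sup>2" by (simp add: power2_diff)
    moreover have "0 \<le> \<bar>f \<omega>\<bar> * \<bar>g \<omega>\<bar>" by simp
    ultimately have "\<bar>f \<omega>\<bar> * \<bar>g \<omega>\<bar> \<le> (f \<omega>)\<^sup>2 + (g \<omega>)\<^sup>2" by linarith
    then show "norm (f \<omega> * g \<omega>) \<le> norm ((f \<omega>)\<^sup>2 + (g \<omega>)\<^sup>2)" by (simp add: abs_mult)
  qed
qed measurable

text \<open>The form at \<open>x\<close> is the mean square of the linear combination of the
  \<open>V i\<close> with coefficients \<open>x $ i\<close>.\<close>

lemma psd_moment_matrix:
  fixes V :: "'n::finite \<Rightarrow> 'w \<Rightarrow> real"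
  assumes m: "\<And>i. V i \<in> borel_measurable M" and sq: "\<And>i. integrable M (\<lambda>\<omega>. (V i \<omega>)\<^sup>2)"
  shows "psd (\<chi> i j. \<integral>\<omega>. V i \<omega> * V j \<omega> \<partial>M)"
  unfolding psd_def
proof (intro conjI allI)
  show "transpose (\<chi> i j. \<integral>\<omega>. V i \<omega> * V j \<omega> \<partial>M) = (\<chi> i j. \<integral>\<omega>. V i \<omega> * V j \<omega> \<partial>M)"
    by (simp add: transpose_def vec_eq_iff mult.commute)
  fix x :: "real ^ 'n"
  note ij = integrable_mult_L2[OF m m sq sq]
  have "x \<bullet> ((\<chi> i j. \<integral>\<omega>. V i \<omega> * V j \<omega> \<partial>M) *v x) = (\<Sum>i\<in>UNIV. \<Sum>j\<in>UNIV. x $ i * x $ j * (\<integral>\<omega>. V i \<omega> * V j \<omega> \<partial>M))"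
    by (simp add: inner_vec_def matrix_vector_mult_def sum_distrib_left mult_ac)
  also have "\<dots> = (\<Sum>i\<in>UNIV. \<Sum>j\<in>UNIV. (\<integral>\<omega>. x $ i * x $ j * (V i \<omega> * V j \<omega>) \<partial>M))"
    by (simp only: integral_mult_right_zero)
  also have "\<dots> = (\<Sum>i\<in>UNIV. (\<integral>\<omega>. (\<Sum>j\<in>UNIV. x $ i * x $ j * (V i \<omega> * V j \<omega>)) \<partial>M))"
    by (intro sum.cong refl Bochner_Integration.integral_sum[symmetric] integrable_mult_right ij)
  also have "\<dots> = (\<integral>\<omega>. (\<Sum>i\<in>UNIV. \<Sum>j\<in>UNIV. x $ i * x $ j * (V i \<omega> * V j \<omega>)) \<partial>M)"
    by (intro Bochner_Integration.integral_sum[symmetric] Bochner_Integration.integrable_sum integrable_mult_right ij)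
  also have "\<dots> = (\<integral>\<omega>. (\<Sum>i\<in>UNIV. x $ i * V i \<omega>)\<^sup>2 \<partial>M)"
    by (simp add: power2_eq_square sum_product mult_ac)
  also have "0 \<le> \<dots>" by simp
  finally show "0 \<le> x \<bullet> ((\<chi> i j. \<integral>\<omega>. V i \<omega> * V j \<omega> \<partial>M) *v x)" .
qed

text \<open>The joint covariance of \<open>(X, Y)\<close> has a square root, whose two block rows couple the two
  Gaussians with the same mean square distance as \<open>X\<close> and \<open>Y\<close>.\<close>
lemma gaussian_lipschitz_le_L2:
  fixes X Y :: "'w \<Rightarrow> real ^ 'n" and f :: "real ^ 'n \<Rightarrow> real"
  assumes "prob_space M" and m [measurable]: "X \<in> borel_measurable M" "Y \<in> borel_measurable M"
    and sq: "\<And>i. integrable M (\<lambda>\<omega>. (X \<omega> $ i)\<^sup>2)" "\<And>i. integrable M (\<lambda>\<omega>. (Y \<omega> $ i)\<^sup>2)"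
    and lip: "\<And>x y. \<bar>f x - f y\<bar> \<le> norm (x - y)"
  shows "\<bar>(\<integral>y. f y \<partial>gaussian (\<chi> i j. \<integral>\<omega>. X \<omega> $ i * X \<omega> $ j \<partial>M)) - (\<integral>y. f y \<partial>gaussian (\<chi> i j. \<integral>\<omega>. Y \<omega> $ i * Y \<omega> $ j \<partial>M))\<bar>
    \<le> sqrt (\<integral>\<omega>. (norm (X \<omega> - Y \<omega>))\<^sup>2 \<partial>M)"
proof -
  interpret prob_space M by fact
  have fm [measurable]: "f \<in> borel_measurable borel" by (rule borel_of_lipschitz[of _ 1]) (use lip in simp)
  \<comment> \<open>The index type \<open>'n + 'n\<close> stacks \<open>X\<close> on
    \<open>Y\<close>, so that one \<open>mat_sqrt\<close> holds both covariances and the cross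
    terms; its two block rows become \<open>P1\<close> and \<open>P2\<close>.\<close>
  define U :: "'n + 'n \<Rightarrow> 'w \<Rightarrow> real" where
    "U i \<omega> = (case i of Inl a \<Rightarrow> X \<omega> $ a | Inr b \<Rightarrow> Y \<omega> $ b)" for i \<omega>
  have Um: "U i \<in> borel_measurable M" for i
  proof -
    have "(\<lambda>x :: real ^ 'n. x $ a) \<in> borel_measurable borel" for a by measurable
    from measurable_compose[OF m(1) this] measurable_compose[OF m(2) this]
    show ?thesis unfolding U_def[abs_def] by (cases i) simp_all
  qed
  have Usq: "integrable M (\<lambda>\<omega>. (U i \<omega>)\<^sup>2)" for i
    unfolding U_def[abs_def] using sq by (cases i) simp_all
  define J where "J = (\<chi> i j. \<integral>\<omega>. U i \<omega> * U j \<omega> \<partial>M)"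
  have J: "psd J" unfolding J_def by (rule psd_moment_matrix[OF Um Usq])
  define R where "R = mat_sqrt J"
  have RR: "R $ i \<bullet> R $ j = (\<integral>\<omega>. U i \<omega> * U j \<omega> \<partial>M)" for i j
  proof -
    have "R ** transpose R = J" using mat_sqrt[OF J] by (simp add: R_def psd_def)
    then have "(R ** transpose R) $ i $ j = J $ i $ j" by simp
    then show ?thesis by (simp add: matrix_matrix_mult_def transpose_def inner_vec_def J_def)
  qed
  define P1 :: "real ^ ('n + 'n) ^ 'n" where "P1 = (\<chi> a. R $ Inl a)"
  define P2 :: "real ^ ('n + 'n) ^ 'n" where "P2 = (\<chi> a. R $ Inr a)"
  have "P1 ** transpose P1 = (\<chi> i j. \<integral>\<omega>. X \<omega> $ i * X \<omega> $ j \<partial>M)"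
    using RR[of "Inl _" "Inl _"]
    by (simp add: vec_eq_iff matrix_matrix_mult_def transpose_def inner_vec_def P1_def U_def)
  then have d1: "gaussian (\<chi> i j. \<integral>\<omega>. X \<omega> $ i * X \<omega> $ j \<partial>M) = distr gauss borel (\<lambda>z. P1 *v z)"
    by (simp add: distr_linear_gauss)
  have "P2 ** transpose P2 = (\<chi> i j. \<integral>\<omega>. Y \<omega> $ i * Y \<omega> $ j \<partial>M)"
    using RR[of "Inr _" "Inr _"]
    by (simp add: vec_eq_iff matrix_matrix_mult_def transpose_def inner_vec_def P2_def U_def)
  then have d2: "gaussian (\<chi> i j. \<integral>\<omega>. Y \<omega> $ i * Y \<omega> $ j \<partial>M) = distr gauss borel (\<lambda>z. P2 *v z)"
    by (simp add: distr_linear_gauss)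
  have i: "integrable gauss (\<lambda>z. f (P *v z))" for P :: "real ^ ('n + 'n) ^ 'n"
    using gaussian_shift_integrable(1)[OF lip, of 0 P] by simp
  interpret g: third_moment_law "gauss :: (real ^ ('n + 'n)) measure" by (rule gauss_third_moment_law)
  have isq: "integrable gauss (\<lambda>z. (norm ((P1 - P2) *v z))\<^sup>2)"
    unfolding norm_sq_matrix_vector by (intro Bochner_Integration.integrable_sum g.integrable_inner_sq)
  have "\<bar>(\<integral>z. f (P1 *v z) \<partial>gauss) - (\<integral>z. f (P2 *v z) \<partial>gauss)\<bar> = \<bar>\<integral>z. f (P1 *v z) - f (P2 *v z) \<partial>gauss\<bar>"
    by (simp add: Bochner_Integration.integral_diff[OF i i])
  also have "\<dots> \<le> (\<integral>z. \<bar>norm ((P1 - P2) *v z)\<bar> \<partial>gauss)"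
  proof (rule order_trans[OF integral_abs_bound], rule integral_mono)
    show "integrable gauss (\<lambda>z. \<bar>f (P1 *v z) - f (P2 *v z)\<bar>)" by (intro integrable_abs Bochner_Integration.integrable_diff i)
    show "integrable gauss (\<lambda>z. \<bar>norm ((P1 - P2) *v z)\<bar>)"
      by (rule integrable_abs, rule prob_space.expectation_abs_le_L2(1)[OF prob_space_gauss _ isq]) measurable
    show "\<bar>f (P1 *v z) - f (P2 *v z)\<bar> \<le> \<bar>norm ((P1 - P2) *v z)\<bar>" for z
      using lip[of "P1 *v z" "P2 *v z"] by (simp add: matrix_vector_mult_diff_rdistrib)
  qed
  also have "\<dots> \<le> sqrt (\<integral>z. (norm ((P1 - P2) *v z))\<^sup>2 \<partial>gauss)"
    by (rule prob_space.expectation_abs_le_L2(2)[OF prob_space_gauss _ isq]) measurable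
  also have "(\<integral>z. (norm ((P1 - P2) *v z))\<^sup>2 \<partial>gauss) = (\<Sum>a\<in>UNIV. (P1 - P2) $ a \<bullet> (P1 - P2) $ a)"
    unfolding norm_sq_matrix_vector
    by (subst Bochner_Integration.integral_sum) (auto intro: g.integrable_inner_sq simp: gauss_second_moment)
  also have "\<dots> = (\<Sum>a\<in>UNIV. \<integral>\<omega>. (X \<omega> $ a - Y \<omega> $ a)\<^sup>2 \<partial>M)"
  proof (rule sum.cong[OF refl])
    fix a
    note ij = integrable_mult_L2[OF Um Um Usq Usq]
    have "(P1 - P2) $ a \<bullet> (P1 - P2) $ a = R $ Inl a \<bullet> R $ Inl a - 2 * (R $ Inl a \<bullet> R $ Inr a) + R $ Inr a \<bullet> R $ Inr a"
      by (simp add: P1_def P2_def inner_diff_left inner_diff_right inner_commute)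
    also have "\<dots> = (\<integral>\<omega>. U (Inl a) \<omega> * U (Inl a) \<omega> \<partial>M) - 2 * (\<integral>\<omega>. U (Inl a) \<omega> * U (Inr a) \<omega> \<partial>M) + (\<integral>\<omega>. U (Inr a) \<omega> * U (Inr a) \<omega> \<partial>M)"
      by (simp only: RR)
    also have "\<dots> = (\<integral>\<omega>. U (Inl a) \<omega> * U (Inl a) \<omega> - 2 * (U (Inl a) \<omega> * U (Inr a) \<omega>) + U (Inr a) \<omega> * U (Inr a) \<omega> \<partial>M)"
      using ij by simp
    also have "\<dots> = (\<integral>\<omega>. (X \<omega> $ a - Y \<omega> $ a)\<^sup>2 \<partial>M)"
      by (intro Bochner_Integration.integral_cong refl) (simp add: U_def power2_eq_square algebra_simps)
    finally show "(P1 - P2) $ a \<bullet> (P1 - P2) $ a = (\<integral>\<omega>. (X \<omega> $ a - Y \<omega> $ a)\<^sup>2 \<partial>M)" .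
  qed
  also have "\<dots> = (\<integral>\<omega>. (\<Sum>a\<in>UNIV. (X \<omega> $ a - Y \<omega> $ a)\<^sup>2) \<partial>M)"
  proof (rule Bochner_Integration.integral_sum[symmetric])
    fix a
    note ij = integrable_mult_L2[OF Um Um Usq Usq]
    have "integrable M (\<lambda>\<omega>. U (Inl a) \<omega> * U (Inl a) \<omega> - 2 * (U (Inl a) \<omega> * U (Inr a) \<omega>) + U (Inr a) \<omega> * U (Inr a) \<omega>)"
      using ij by simp
    then show "integrable M (\<lambda>\<omega>. (X \<omega> $ a - Y \<omega> $ a)\<^sup>2)"
      by (simp add: U_def power2_eq_square algebra_simps)
  qed
  also have "\<dots> = (\<integral>\<omega>. (norm (X \<omega> - Y \<omega>))\<^sup>2 \<partial>M)"
    unfolding power2_norm_eq_inner inner_vec_def by (simp add: power2_eq_square)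
  finally show ?thesis
    unfolding d1 d2 by (subst (1 2) integral_distr) (simp_all add: matrix_vector_borel)
qed

section \<open>The recursion\<close>

text \<open>The norm is \<open>x \<mapsto> norm (V\<^sub>H\<^sup>-\<^sup>1\<^sup>/\<^sup>2 x)\<close>: in the coordinates \<open>y = W x\<close> the matrix \<open>H\<close> becomes
  \<open>K = W H L\<close> with \<open>K + K\<^sup>T = - W\<^sup>2 \<le> - 1 / \<lambda>\<^sub>m\<^sub>a\<^sub>x\<close>.\<close>
lemma hurwitz_contraction:
  fixes H :: "real ^ 'n ^ 'n"
  assumes "hurwitz H"
  obtains W L :: "real ^ 'n ^ 'n" and c where "0 \<le> c" "0 < iota H" "L ** W = mat 1"
    "\<And>a b x. 0 \<le> a \<Longrightarrow> 0 \<le> b \<Longrightarrow>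
      norm (W *v ((mat 1 + a *\<^sub>R (H + b *\<^sub>R mat 1)) *v x)) \<le> (1 - 2 * iota H * a + c * a\<^sup>2 + a * b) * norm (W *v x)"
proof -
  define V where "V = lyapunov_sol H"
  have V: "lyap H V = - mat 1" "posdef V" unfolding V_def by (rule lyapunov_sol[OF assms])+
  have psdV: "psd V" using V(2) posdef_nonneg[OF V(2)] by (simp add: psd_def posdef_def)
  define L where "L = mat_sqrt V"
  have L: "psd L" "L ** L = V" unfolding L_def using mat_sqrt[OF psdV] by auto
  have symL: "transpose L = L" using L by (simp add: psd_def)
  obtain W where W: "transpose W = W" "W ** L = mat 1" "L ** W = mat 1"
    unfolding L_def by (rule posdef_sqrt_inverse[OF V(2)])
  define l where "l = lambda_max V"
  have le: "x \<bullet> (V *v x) \<le> l * (x \<bullet> x)" for x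
    unfolding l_def by (rule lambda_max_bound) (use psdV in \<open>simp add: psd_def\<close>)
  have l0: "0 < l"
  proof -
    have "axis undefined 1 \<noteq> (0 :: real ^ 'n)" by (simp add: axis_eq_0_iff)
    then have "0 < axis undefined 1 \<bullet> (V *v axis undefined 1)" using V(2) unfolding posdef_def by blast
    also have "\<dots> \<le> l * (axis undefined 1 \<bullet> (axis undefined 1 :: real ^ 'n))" by (rule le)
    finally show ?thesis by (simp add: inner_axis_axis)
  qed
  have io: "iota H = 1 / (4 * l)" by (simp add: iota_def l_def V_def)
  define K where "K = W ** H ** L"
  have KK: "K + transpose K = - (W ** W)"
  proof -
    have "K = W ** H ** V ** W" unfolding K_def L(2)[symmetric] by (metis matrix_mul_assoc matrix_mul_rid W(3))
    moreover have "transpose K = W ** V ** transpose H ** W"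
    proof -
      have "transpose K = L ** transpose H ** W" unfolding K_def by (simp add: matrix_transpose_mul symL W(1) matrix_mul_assoc)
      also have "\<dots> = (W ** L) ** L ** transpose H ** W" by (simp add: W(2))
      finally show ?thesis unfolding L(2)[symmetric] by (simp add: matrix_mul_assoc)
    qed
    ultimately have "K + transpose K = W ** lyap H V ** W"
      unfolding lyap_def by (simp add: matrix_add_ldistrib matrix_add_rdistrib matrix_mul_assoc)
    also have "lyap H V = (- 1) *\<^sub>R mat 1" by (simp add: V(1))
    also have "W ** ((- 1) *\<^sub>R mat 1) ** W = - (W ** W)" by (simp only: matrix_scaleR_left matrix_scaleR_right) simp
    finally show ?thesis .
  qed
  have Wy: "y \<bullet> y \<le> l * (norm (W *v y))\<^sup>2" for y
  proof -
    have "y = L *v (W *v y)" by (simp add: matrix_vector_mul_assoc W)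
    then have "y \<bullet> y = (L *v (W *v y)) \<bullet> (L *v (W *v y))" by simp
    also have "\<dots> = (W *v y) \<bullet> (V *v (W *v y))"
      unfolding inner_matrix_vector_left symL matrix_vector_mul_assoc[of L L] L(2) ..
    also have "\<dots> \<le> l * ((W *v y) \<bullet> (W *v y))" by (rule le)
    finally show ?thesis by (simp add: power2_norm_eq_inner)
  qed
  obtain \<kappa> where k: "0 < \<kappa>" "\<And>y. norm (K *v y) \<le> norm y * \<kappa>"
    using bounded_linear.pos_bounded[OF matrix_vector_mul_bounded_linear[of K]] by blast
  define c where "c = \<kappa>\<^sup>2 / 2"
  have main: "norm (y + a *\<^sub>R (K *v y)) \<le> (1 - 2 * iota H * a + c * a\<^sup>2) * norm y" if a: "0 \<le> a" for a y
  proof (cases "y = 0")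
    case False
    define u where "u = - a / l + \<kappa>\<^sup>2 * a\<^sup>2"
    have Kq: "2 * (y \<bullet> (K *v y)) = - (norm (W *v y))\<^sup>2"
    proof -
      have "y \<bullet> (K *v y) = y \<bullet> (transpose K *v y)"
        using inner_matrix_vector_left[of K y y] by (simp add: inner_commute del: transpose_matrix_vector)
      then have "2 * (y \<bullet> (K *v y)) = y \<bullet> ((K + transpose K) *v y)"
        by (simp add: matrix_vector_mult_add_rdistrib inner_add_right del: transpose_matrix_vector)
      also have "\<dots> = - (y \<bullet> ((W ** W) *v y))"
        using matrix_vector_mult_diff_rdistrib[of 0 "W ** W" y] by (simp add: KK)
      also have "y \<bullet> ((W ** W) *v y) = (norm (W *v y))\<^sup>2"
        using inner_matrix_vector_left[of W y "W *v y"] W(1)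
        by (simp add: matrix_vector_mul_assoc power2_norm_eq_inner)
      finally show ?thesis .
    qed
    have "(norm (y + a *\<^sub>R (K *v y)))\<^sup>2 = (norm y)\<^sup>2 + a * (2 * (y \<bullet> (K *v y))) + a\<^sup>2 * (norm (K *v y))\<^sup>2"
      unfolding power2_norm_eq_inner
      by (simp add: inner_add_left inner_add_right inner_commute power2_eq_square algebra_simps)
    also have "\<dots> \<le> (norm y)\<^sup>2 + a * (- ((norm y)\<^sup>2 / l)) + a\<^sup>2 * (norm y * \<kappa>)\<^sup>2"
    proof (intro add_mono mult_left_mono power_mono k)
      show "2 * (y \<bullet> (K *v y)) \<le> - ((norm y)\<^sup>2 / l)"
        using Wy[of y] l0 unfolding Kq by (simp add: power2_norm_eq_inner divide_le_eq mult.commute)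
    qed (use a in auto)
    also have "\<dots> = (1 + u) * (norm y)\<^sup>2" by (simp add: u_def algebra_simps)
    finally have sq: "(norm (y + a *\<^sub>R (K *v y)))\<^sup>2 \<le> (1 + u) * (norm y)\<^sup>2" .
    have "0 \<le> (1 + u) * (norm y)\<^sup>2" using order_trans[OF zero_le_power2 sq] .
    then have u1: "0 \<le> 1 + u" using False by (simp add: zero_le_mult_iff)
    \<comment> \<open>Passing from squared norms to norms halves the exponent: \<open>u / 2\<close>
      starts with \<open>- a / (2 * l)\<close>, which is \<open>- 2 * iota H * a\<close>. The
      quadratic part leaves \<open>c = \<kappa>^2 / 2\<close>.\<close>
    have "1 + u \<le> (1 + u / 2)\<^sup>2" by (simp add: power2_sum power_divide)
    then have "(norm (y + a *\<^sub>R (K *v y)))\<^sup>2 \<le> ((1 + u / 2) * norm y)\<^sup>2"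
      unfolding power_mult_distrib by (intro order_trans[OF sq] mult_right_mono) auto
    then have "norm (y + a *\<^sub>R (K *v y)) \<le> (1 + u / 2) * norm y"
      by (rule power2_le_imp_le) (use u1 in simp)
    also have "1 + u / 2 = 1 - 2 * iota H * a + c * a\<^sup>2" using l0 by (simp add: u_def io c_def field_simps)
    finally show ?thesis .
  qed simp
  show ?thesis
  proof (rule that[of c L W])
    show "0 \<le> c" by (simp add: c_def)
    show "0 < iota H" using l0 by (simp add: io)
    show "L ** W = mat 1" by (rule W(3))
    fix a b :: real and x assume ab: "0 \<le> a" "0 \<le> b"
    define y where "y = W *v x"
    have xy: "x = L *v y" by (simp add: y_def matrix_vector_mul_assoc W)
    have "W *v ((mat 1 + a *\<^sub>R (H + b *\<^sub>R mat 1)) *v x) = (y + a *\<^sub>R (K *v y)) + (a * b) *\<^sub>R y"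
    proof -
      have "W *v (H *v x) = K *v y" by (simp add: xy K_def matrix_vector_mul_assoc matrix_mul_assoc)
      then show ?thesis
        by (simp add: matrix_vector_mult_add_rdistrib matrix_vector_right_distrib scaleR_matrix_vector_assoc[symmetric]
          matrix_vector_mult_scaleR y_def scaleR_add_right)
    qed
    then have "norm (W *v ((mat 1 + a *\<^sub>R (H + b *\<^sub>R mat 1)) *v x)) \<le> norm (y + a *\<^sub>R (K *v y)) + norm ((a * b) *\<^sub>R y)"
      by (simp only: norm_triangle_ineq)
    also have "\<dots> \<le> (1 - 2 * iota H * a + c * a\<^sup>2) * norm y + a * b * norm y"
      using main[OF ab(1), of y] ab by simp
    finally show "norm (W *v ((mat 1 + a *\<^sub>R (H + b *\<^sub>R mat 1)) *v x)) \<le> (1 - 2 * iota H * a + c * a\<^sup>2 + a * b) * norm (W *v x)"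
      by (simp add: y_def algebra_simps)
  qed
qed

section \<open>Propagators and the weights of past noises\<close>

primrec propagator :: "(nat \<Rightarrow> real ^ 'n ^ 'n) \<Rightarrow> nat \<Rightarrow> nat \<Rightarrow> real ^ 'n ^ 'n" where
  "propagator A j 0 = mat 1"
| "propagator A j (Suc k) = (if j \<le> k then A k ** propagator A j k else mat 1)"

text \<open>\<open>propagator A j k\<close> is the product of the factors \<open>A (k - 1)\<close>,
  ..., \<open>A j\<close>, and the identity for \<open>k \<le> j\<close>. The noise of step
  \<open>j\<close> is added after \<open>A j\<close> has acted, so its product starts at
  \<open>Suc j\<close>.\<close>

lemma iterate_eq_propagator:
  fixes H :: "real ^ 'n ^ 'n" and \<alpha> K \<xi> :: real
  defines "A \<equiv> \<lambda>k. mat 1 + stepsize \<alpha> K \<xi> k *\<^sub>R drift H \<alpha> K \<xi> k"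
  shows "iterate H \<alpha> K \<xi> noise z0 k \<omega> = propagator A 0 k *v z0 \<omega>
    + (\<Sum>j<k. (sqrt (stepsize \<alpha> K \<xi> j) *\<^sub>R propagator A (Suc j) k) *v noise j \<omega>)"
proof (induction k)
  case (Suc k)
  have "(\<Sum>j<k. (sqrt (stepsize \<alpha> K \<xi> j) *\<^sub>R propagator A (Suc j) (Suc k)) *v noise j \<omega>) =
      A k *v (\<Sum>j<k. (sqrt (stepsize \<alpha> K \<xi> j) *\<^sub>R propagator A (Suc j) k) *v noise j \<omega>)"
    unfolding linear_sum[OF matrix_vector_mul_linear]
    by (intro sum.cong) (auto simp: matrix_vector_mul_assoc matrix_scaleR_right)
  moreover have "iterate H \<alpha> K \<xi> noise z0 (Suc k) \<omega> =
      A k *v iterate H \<alpha> K \<xi> noise z0 k \<omega> + sqrt (stepsize \<alpha> K \<xi> k) *\<^sub>R noise k \<omega>"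
    by (simp add: A_def)
  moreover have "(sqrt (stepsize \<alpha> K \<xi> k) *\<^sub>R propagator A (Suc k) (Suc k)) *v noise k \<omega> = sqrt (stepsize \<alpha> K \<xi> k) *\<^sub>R noise k \<omega>"
    by (simp add: scaleR_matrix_vector_assoc[symmetric])
  moreover have "propagator A 0 (Suc k) *v z0 \<omega> = A k *v (propagator A 0 k *v z0 \<omega>)"
    by (simp add: matrix_vector_mul_assoc)
  ultimately show ?case
    unfolding sum.lessThan_Suc Suc matrix_vector_right_distrib by (simp only: add.assoc)
qed simp

lemma propagator_norm:
  fixes A :: "nat \<Rightarrow> real ^ 'n ^ 'n"
  assumes "\<And>k x. norm (W *v (A k *v x)) \<le> r k * norm (W *v x)" "\<And>k. 0 \<le> r k"
  shows "norm (W *v (propagator A j k *v x)) \<le> (\<Prod>i=j..<k. r i) * norm (W *v x)"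
proof (induction k)
  case (Suc k)
  show ?case
  proof (cases "j \<le> k")
    case True
    have "norm (W *v (propagator A j (Suc k) *v x)) \<le> r k * norm (W *v (propagator A j k *v x))"
      using assms(1)[of k "propagator A j k *v x"] True by (simp add: matrix_vector_mul_assoc)
    also have "\<dots> \<le> r k * ((\<Prod>i=j..<k. r i) * norm (W *v x))"
      using Suc assms(2) by (intro mult_left_mono) auto
    finally show ?thesis using True by (simp add: prod.atLeastLessThan_Suc mult_ac)
  qed simp
qed simp

text \<open>By \<open>slow\<close>, each contraction factor turns the square root of one step size
  into at most that of the next, so the product telescopes. It starts at \<open>Suc j\<close> and
  therefore lacks \<open>r j\<close>; the factor \<open>sqrt 2\<close> from \<open>half\<close>
  replaces this first move.\<close>

lemma step_weight_bound:
  fixes a r :: "nat \<Rightarrow> real"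
  assumes a: "\<And>j. 0 < a j" and r: "\<And>j. 0 \<le> r j"
    and slow: "\<And>j. r j * sqrt (a j) \<le> sqrt (a (Suc j))" and half: "\<And>j. a j \<le> 2 * a (Suc j)" and "j < k"
  shows "sqrt (a j) * (\<Prod>i=Suc j..<k. r i) \<le> sqrt 2 * sqrt (a k)"
  using \<open>j < k\<close>
proof (induction k)
  case (Suc k)
  show ?case
  proof (cases "j = k")
    case True
    then show ?thesis using half[of k] by (simp add: real_sqrt_mult[symmetric])
  next
    case False
    then have jk: "j < k" using Suc by simp
    have "sqrt (a j) * (\<Prod>i=Suc j..<Suc k. r i) = r k * (sqrt (a j) * (\<Prod>i=Suc j..<k. r i))"
      using jk by (simp add: prod.atLeastLessThan_Suc mult_ac)
    also have "\<dots> \<le> r k * (sqrt 2 * sqrt (a k))" using Suc.IH[OF jk] r by (intro mult_left_mono) auto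
    also have "\<dots> = sqrt 2 * (r k * sqrt (a k))" by simp
    also have "\<dots> \<le> sqrt 2 * sqrt (a (Suc k))" by (intro mult_left_mono slow) auto
    finally show ?thesis .
  qed
qed simp

text \<open>The sum obeys the recursion that multiplies by the square of \<open>1 - c * a k\<close>
  and adds \<open>a k\<close>. Bounding that square by its base makes \<open>1 / c\<close> a fixed
  point.\<close>

lemma step_weight_sum:
  fixes a :: "nat \<Rightarrow> real"
  assumes a: "\<And>j. 0 < a j" and c: "0 < c" "\<And>j. c * a j \<le> 1"
  shows "(\<Sum>j<k. (sqrt (a j) * (\<Prod>i=Suc j..<k. 1 - c * a i))\<^sup>2) \<le> 1 / c"
proof (induction k)
  case (Suc k)
  define r where "r j = 1 - c * a j" for j
  have r: "0 \<le> r k" "r k \<le> 1" using c a[of k] by (auto simp: r_def)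
  have "(\<Sum>j<k. (sqrt (a j) * (\<Prod>i=Suc j..<Suc k. r i))\<^sup>2) = (\<Sum>j<k. (r k)\<^sup>2 * (sqrt (a j) * (\<Prod>i=Suc j..<k. r i))\<^sup>2)"
    by (intro sum.cong) (auto simp: prod.atLeastLessThan_Suc power_mult_distrib mult_ac)
  also have "\<dots> = (r k)\<^sup>2 * (\<Sum>j<k. (sqrt (a j) * (\<Prod>i=Suc j..<k. r i))\<^sup>2)" by (rule sum_distrib_left[symmetric])
  also have "\<dots> \<le> (r k)\<^sup>2 * (1 / c)" using Suc unfolding r_def by (intro mult_left_mono) auto
  also have "\<dots> \<le> r k * (1 / c)"
    using r c mult_left_mono[of "r k" 1 "r k"] by (intro mult_right_mono) (auto simp: power2_eq_square)
  finally have "(\<Sum>j<Suc k. (sqrt (a j) * (\<Prod>i=Suc j..<Suc k. r i))\<^sup>2) \<le> r k * (1 / c) + a k"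
    using a[of k] by simp
  also have "\<dots> = 1 / c" using c by (simp add: r_def field_simps)
  finally show ?case by (simp add: r_def)
qed (use c in simp)

lemma prod_le_exp_sum:
  fixes a :: "nat \<Rightarrow> real"
  assumes "\<And>j. c * a j \<le> 1"
  shows "(\<Prod>i=0..<k. 1 - c * a i) \<le> exp (- (c * (\<Sum>i<k. a i)))"
proof -
  have "(\<Prod>i=0..<k. 1 - c * a i) \<le> (\<Prod>i=0..<k. exp (- (c * a i)))"
    using assms exp_ge_add_one_self[of "- (c * a i)" for i] by (intro prod_mono) (simp add: algebra_simps)
  also have "\<dots> = exp (- (c * (\<Sum>i<k. a i)))"
    by (simp add: exp_sum[symmetric] sum_negf sum_distrib_left atLeast0LessThan)
  finally show ?thesis .
qed

section \<open>Kantorovich duality\<close>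

text \<open>Bartl's algebraic argument: if the last functional is needed, eliminate it along a
  vector on which the conclusion fails for the others.\<close>
lemma farkas:
  fixes A :: "'i \<Rightarrow> 'p \<Rightarrow> real" and c :: "'p \<Rightarrow> real"
  assumes "finite I" "finite P"
    and "\<And>x. (\<forall>i\<in>I. (\<Sum>p\<in>P. A i p * x p) \<le> 0) \<Longrightarrow> (\<Sum>p\<in>P. c p * x p) \<le> 0"
  shows "\<exists>l. (\<forall>i\<in>I. 0 \<le> l i) \<and> (\<forall>p\<in>P. c p = (\<Sum>i\<in>I. l i * A i p))"
  using assms(1,3)
proof (induction I arbitrary: A c rule: finite_induct)
  case empty
  have "(\<Sum>p\<in>P. c p * c p) \<le> 0"
    using empty by blast
  then have "(\<Sum>p\<in>P. c p * c p) = 0"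
    by (intro antisym sum_nonneg) auto
  then show ?case
    using assms(2) by (auto simp: sum_nonneg_eq_0_iff)
next
  case (insert j I)
  let ?ev = "\<lambda>f x. \<Sum>p\<in>P. f p * x p :: real"
  show ?case
  proof (cases "\<forall>x. (\<forall>i\<in>I. ?ev (A i) x \<le> 0) \<longrightarrow> ?ev c x \<le> 0")
    case True
    then obtain l where l: "\<forall>i\<in>I. 0 \<le> l i" "\<forall>p\<in>P. c p = (\<Sum>i\<in>I. l i * A i p)"
      using insert.IH[of A c] by blast
    have "(\<Sum>i\<in>I. (l(j := 0)) i * A i p) = (\<Sum>i\<in>I. l i * A i p)" for p
      using insert.hyps by (intro sum.cong) auto
    then show ?thesis
      using l insert.hyps by (intro exI[of _ "l(j := 0)"]) auto
  next
    case False
    then obtain x0 where x0: "\<forall>i\<in>I. ?ev (A i) x0 \<le> 0" "?ev c x0 > 0"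
      by (auto simp: not_le)
    define s where "s = ?ev (A j) x0"
    have s: "s > 0"
      using x0 insert.prems[of x0] unfolding s_def by (force simp: not_le)
    define A' where "A' i p = A i p - ?ev (A i) x0 / s * A j p" for i p
    define c' where "c' p = c p - ?ev c x0 / s * A j p" for p
    have red: "?ev (\<lambda>p. f p - ?ev f x0 / s * A j p) x = ?ev f (\<lambda>p. x p - ?ev (A j) x / s * x0 p)" for f x
    proof -
      have "?ev (\<lambda>p. f p - ?ev f x0 / s * A j p) x = ?ev f x - ?ev f x0 / s * ?ev (A j) x"
      proof -
        have "?ev (\<lambda>p. f p - k * A j p) x = ?ev f x - k * ?ev (A j) x" for k
          by (simp add: algebra_simps sum_subtractf sum_distrib_left)
        then show ?thesis by blast
      qed
      moreover have "?ev f (\<lambda>p. x p - ?ev (A j) x / s * x0 p) = ?ev f x - ?ev (A j) x / s * ?ev f x0"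
      proof -
        have "?ev f (\<lambda>p. x p - k * x0 p) = ?ev f x - k * ?ev f x0" for k
          by (simp add: algebra_simps sum_subtractf sum_distrib_left)
        then show ?thesis by blast
      qed
      ultimately show ?thesis by simp
    qed
    have "?ev c' x \<le> 0" if "\<forall>i\<in>I. ?ev (A' i) x \<le> 0" for x
    proof -
      define y where "y = (\<lambda>p. x p - ?ev (A j) x / s * x0 p)"
      have "?ev (A j) y = ?ev (A j) x - ?ev (A j) x / s * s"
      proof -
        have "?ev (A j) (\<lambda>p. x p - k * x0 p) = ?ev (A j) x - k * s" for k
          by (simp add: s_def algebra_simps sum_subtractf sum_distrib_left)
        then show ?thesis unfolding y_def by blast
      qed
      then have "?ev (A j) y \<le> 0" using s by simp
      moreover have "\<forall>i\<in>I. ?ev (A i) y \<le> 0"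
        using that red unfolding A'_def y_def by simp
      ultimately have "?ev c y \<le> 0"
        using insert.prems[of y] by blast
      then show ?thesis using red[of c x] unfolding c'_def y_def by simp
    qed
    then obtain l where l: "\<forall>i\<in>I. 0 \<le> l i" "\<forall>p\<in>P. c' p = (\<Sum>i\<in>I. l i * A' i p)"
      using insert.IH[of A' c'] by blast
    \<comment> \<open>The multiplier that makes the representation of \<open>c\<close> correct along
      \<open>x0\<close>, the direction lost in the elimination. It is nonnegative because
      \<open>c\<close> is positive at \<open>x0\<close> and the functionals from \<open>I\<close>
      are not.\<close>
    define lj where "lj = (?ev c x0 - (\<Sum>i\<in>I. l i * ?ev (A i) x0)) / s"
    have "(\<Sum>i\<in>I. l i * ?ev (A i) x0) \<le> 0"
      using l x0 by (intro sum_nonpos) (simp add: mult_nonneg_nonpos)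
    then have "lj \<ge> 0" using x0 s by (simp add: lj_def)
    moreover have "c p = lj * A j p + (\<Sum>i\<in>I. l i * A i p)" if "p \<in> P" for p
    proof -
      have "(\<Sum>i\<in>I. l i * A' i p) = (\<Sum>i\<in>I. l i * A i p) - (\<Sum>i\<in>I. l i * ?ev (A i) x0) / s * A j p"
      proof -
        have "(\<Sum>i\<in>I. l i * (A i p - e i / s * k)) = (\<Sum>i\<in>I. l i * A i p) - (\<Sum>i\<in>I. l i * e i) / s * k" for e k
          by (simp add: right_diff_distrib sum_subtractf sum_distrib_right sum_divide_distrib mult.assoc)
        from this[of "\<lambda>i. ?ev (A i) x0" "A j p"] show ?thesis unfolding A'_def .
      qed
      moreover have "c' p = (\<Sum>i\<in>I. l i * A' i p)" using l(2) that by blast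
      ultimately have "c p = ?ev c x0 / s * A j p + (\<Sum>i\<in>I. l i * A i p) - (\<Sum>i\<in>I. l i * ?ev (A i) x0) / s * A j p"
        using c'_def[of p] by linarith
      then show ?thesis
        unfolding lj_def by (simp add: diff_divide_distrib left_diff_distrib)
    qed
    moreover have "(\<Sum>i\<in>I. (l(j := lj)) i * A i p) = (\<Sum>i\<in>I. l i * A i p)" for p
      using insert.hyps by (intro sum.cong) auto
    ultimately show ?thesis
      using l insert.hyps by (intro exI[of _ "l(j := lj)"]) auto
  qed
qed

text \<open>Farkas applied to the linear program of the plan. The row \<open>None\<close> of
  \<open>P\<close> carries the cost constraint, so that a test vector is a triple
  \<open>(u, v, t)\<close>; the multiplier of \<open>None\<close> in \<open>I\<close> is the slack
  in the cost, and the remaining multipliers are the plan. For positive \<open>t\<close> the triple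
  is rescaled to \<open>t = 1\<close>, where \<open>dual\<close> applies.\<close>

lemma finite_transport_duality:
  fixes p :: "'a \<Rightarrow> real" and q :: "'b \<Rightarrow> real"
  assumes fin: "finite S" "finite T"
    and p: "\<And>a. a \<in> S \<Longrightarrow> 0 \<le> p a" "sum p S = 1"
    and q: "\<And>b. b \<in> T \<Longrightarrow> 0 \<le> q b" "sum q T = 1"
    and dual: "\<And>u v. (\<And>a b. a \<in> S \<Longrightarrow> b \<in> T \<Longrightarrow> u a + v b \<le> c a b) \<Longrightarrow>
      (\<Sum>a\<in>S. p a * u a) + (\<Sum>b\<in>T. q b * v b) \<le> D"
  shows "\<exists>l. (\<forall>a\<in>S. \<forall>b\<in>T. 0 \<le> l a b) \<and> (\<forall>a\<in>S. (\<Sum>b\<in>T. l a b) = p a) \<and>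
    (\<forall>b\<in>T. (\<Sum>a\<in>S. l a b) = q b) \<and> (\<Sum>a\<in>S. \<Sum>b\<in>T. l a b * c a b) \<le> D"
proof -
  define P where "P = insert None (Some ` (S <+> T))"
  define I where "I = insert None (Some ` (S \<times> T))"
  define A :: "('a \<times> 'b) option \<Rightarrow> ('a + 'b) option \<Rightarrow> real" where
    "A i x = (case i of None \<Rightarrow> (case x of None \<Rightarrow> -1 | Some _ \<Rightarrow> 0)
       | Some (a, b) \<Rightarrow> (case x of None \<Rightarrow> - c a b | Some (Inl a') \<Rightarrow> of_bool (a' = a)
           | Some (Inr b') \<Rightarrow> of_bool (b' = b)))" for i x
  define g :: "('a + 'b) option \<Rightarrow> real" where
    "g x = (case x of None \<Rightarrow> - D | Some (Inl a) \<Rightarrow> p a | Some (Inr b) \<Rightarrow> q b)" for x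
  have sumP: "(\<Sum>x\<in>P. f x) = f None + (\<Sum>a\<in>S. f (Some (Inl a))) + (\<Sum>b\<in>T. f (Some (Inr b)))" for f :: "_ \<Rightarrow> real"
    unfolding P_def using fin
    by (subst sum.insert) (auto simp: sum.reindex sum.Plus)
  have sumI: "(\<Sum>x\<in>I. f x) = f None + (\<Sum>a\<in>S. \<Sum>b\<in>T. f (Some (a, b)))" for f :: "_ \<Rightarrow> real"
    unfolding I_def using fin
    by (subst sum.insert) (auto simp: sum.reindex sum.cartesian_product)
  have "\<exists>l. (\<forall>i\<in>I. 0 \<le> l i) \<and> (\<forall>x\<in>P. g x = (\<Sum>i\<in>I. l i * A i x))"
  proof (rule farkas)
    show "finite I" "finite P" using fin by (auto simp: I_def P_def)
    fix x :: "('a + 'b) option \<Rightarrow> real"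
    assume x: "\<forall>i\<in>I. (\<Sum>y\<in>P. A i y * x y) \<le> 0"
    define t where "t = x None"
    define u where "u a = x (Some (Inl a))" for a
    define v where "v b = x (Some (Inr b))" for b
    have t: "0 \<le> t"
    proof -
      have "(\<Sum>y\<in>P. A None y * x y) \<le> 0" using x by (auto simp: I_def)
      then show ?thesis by (simp add: sumP A_def t_def)
    qed
    have uv: "u a + v b \<le> c a b * t" if ab: "a \<in> S" "b \<in> T" for a b
    proof -
      have "(\<Sum>y\<in>P. A (Some (a, b)) y * x y) \<le> 0" using x ab by (auto simp: I_def)
      moreover have "(\<Sum>x\<in>S. of_bool (x = a) * f x) = f a" "(\<Sum>x\<in>T. of_bool (x = b) * h x) = h b"
        for f :: "'a \<Rightarrow> real" and h :: "'b \<Rightarrow> real"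
        using ab fin by (auto simp: of_bool_def if_distrib[of "\<lambda>c. c * _"] cong: if_cong)
      ultimately show ?thesis by (simp add: sumP A_def t_def u_def v_def)
    qed
    have "(\<Sum>a\<in>S. p a * u a) + (\<Sum>b\<in>T. q b * v b) \<le> D * t"
    proof (cases "t = 0")
      \<comment> \<open>For \<open>t = 0\<close> the pair \<open>(u, v)\<close> satisfies
        \<open>u a + v b \<le> 0\<close>; summing against the product of \<open>p\<close> and
        \<open>q\<close> gives the claim.\<close>
      case True
      have "(\<Sum>a\<in>S. p a * u a) + (\<Sum>b\<in>T. q b * v b) = 
            (\<Sum>a\<in>S. p a * u a) * sum q T + sum p S * (\<Sum>b\<in>T. q b * v b)"
        using p q by simp
      also have "\<dots> = (\<Sum>a\<in>S. \<Sum>b\<in>T. p a * q b * (u a + v b))"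
      proof -
        have "(\<Sum>a\<in>S. p a * u a) * sum q T = (\<Sum>a\<in>S. \<Sum>b\<in>T. p a * u a * q b)"
          by (rule sum_product)
        moreover have "sum p S * (\<Sum>b\<in>T. q b * v b) = (\<Sum>a\<in>S. \<Sum>b\<in>T. p a * (q b * v b))"
          by (rule sum_product)
        ultimately show ?thesis by (simp add: sum.distrib[symmetric] algebra_simps)
      qed
      also have "\<dots> \<le> 0"
        using p q uv True by (intro sum_nonpos) (simp add: mult_nonneg_nonpos)
      finally show ?thesis using True by simp
    next
      case False
      with t have t: "t > 0" by simp
      have "(\<Sum>a\<in>S. p a * (u a / t)) + (\<Sum>b\<in>T. q b * (v b / t)) \<le> D"
        using uv t by (intro dual) (simp add: add_divide_distrib[symmetric] divide_le_eq)
      then have "((\<Sum>a\<in>S. p a * u a) + (\<Sum>b\<in>T. q b * v b)) / t \<le> D"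
        by (simp add: add_divide_distrib sum_divide_distrib)
      then show ?thesis using t by (simp add: divide_le_eq)
    qed
    then show "(\<Sum>y\<in>P. g y * x y) \<le> 0"
      by (simp add: sumP g_def t_def u_def v_def)
  qed
  then obtain l where l: "\<forall>i\<in>I. 0 \<le> l i" "\<forall>x\<in>P. g x = (\<Sum>i\<in>I. l i * A i x)" by blast
  have l0: "l None \<ge> 0" "\<And>a b. a \<in> S \<Longrightarrow> b \<in> T \<Longrightarrow> l (Some (a, b)) \<ge> 0"
    using l(1) by (auto simp: I_def)
  have "(\<Sum>b\<in>T. l (Some (a, b))) = p a" if "a \<in> S" for a
  proof -
    have "g (Some (Inl a)) = (\<Sum>i\<in>I. l i * A i (Some (Inl a)))" using l(2) that by (auto simp: P_def)
    then have "p a = (\<Sum>a'\<in>S. of_bool (a = a') * (\<Sum>b\<in>T. l (Some (a', b))))"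
      by (simp add: sumI g_def A_def sum_distrib_left mult_ac)
    then show ?thesis using that fin by (simp add: of_bool_def if_distrib[of "\<lambda>c. c * _"] cong: if_cong)
  qed
  moreover have "(\<Sum>a\<in>S. l (Some (a, b))) = q b" if "b \<in> T" for b
  proof -
    have "g (Some (Inr b)) = (\<Sum>i\<in>I. l i * A i (Some (Inr b)))" using l(2) that by (auto simp: P_def)
    then have "q b = (\<Sum>a'\<in>S. \<Sum>b'\<in>T. of_bool (b = b') * l (Some (a', b')))"
      by (simp add: sumI g_def A_def mult_ac)
    then show ?thesis using that fin by (simp add: of_bool_def if_distrib[of "\<lambda>c. c * _"] cong: if_cong)
  qed
  moreover have "(\<Sum>a\<in>S. \<Sum>b\<in>T. l (Some (a, b)) * c a b) \<le> D"
  proof -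
    have "g None = (\<Sum>i\<in>I. l i * A i None)" using l(2) by (auto simp: P_def)
    then have "D = l None + (\<Sum>a\<in>S. \<Sum>b\<in>T. l (Some (a, b)) * c a b)"
      by (simp add: sumI g_def A_def sum_negf)
    then show ?thesis using l0 by simp
  qed
  ultimately show ?thesis
    using l0 by (intro exI[of _ "\<lambda>a b. l (Some (a, b))"]) auto
qed

lemma simple_function_expectation:
  fixes h :: "'b \<Rightarrow> real"
  assumes "prob_space M" "simple_function M F" "F ` space M \<subseteq> S" "finite S"
  shows "integrable M (\<lambda>x. h (F x))"
    and "(\<integral>x. h (F x) \<partial>M) = (\<Sum>a\<in>S. h a * measure M (F -` {a} \<inter> space M))"
    and "(\<And>a. a \<in> S \<Longrightarrow> 0 \<le> h a) \<Longrightarrow>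
      (\<integral>\<^sup>+x. ennreal (h (F x)) \<partial>M) = ennreal (\<Sum>a\<in>S. h a * measure M (F -` {a} \<inter> space M))"
proof -
  interpret prob_space M by fact
  have m: "F -` {a} \<inter> space M \<in> sets M" for a
    using assms(2) by (rule simple_functionD(2))
  have eq: "h (F x) = (\<Sum>a\<in>S. h a * indicator (F -` {a} \<inter> space M) x)" if "x \<in> space M" for x
  proof -
    have "(\<Sum>a\<in>S. h a * indicator (F -` {a} \<inter> space M) x) = (\<Sum>a\<in>S. if a = F x then h a else 0)"
      using that by (intro sum.cong) (auto simp: indicator_def)
    then show ?thesis using that assms(3,4) by (auto simp: image_subset_iff)
  qed
  have i: "integrable M (\<lambda>x. \<Sum>a\<in>S. h a * indicator (F -` {a} \<inter> space M) x)"
    using m by (intro Bochner_Integration.integrable_sum integrable_mult_right integrable_real_indicator)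
      (auto simp: emeasure_eq_measure)
  show int: "integrable M (\<lambda>x. h (F x))"
    using i by (subst Bochner_Integration.integrable_cong[OF refl eq]) auto
  have "(\<integral>x. h (F x) \<partial>M) = (\<integral>x. (\<Sum>a\<in>S. h a * indicator (F -` {a} \<inter> space M) x) \<partial>M)"
    by (intro Bochner_Integration.integral_cong refl eq)
  also have "\<dots> = (\<Sum>a\<in>S. h a * measure M (F -` {a} \<inter> space M))"
    using m by (subst Bochner_Integration.integral_sum)
      (auto intro!: integrable_real_indicator simp: emeasure_eq_measure)
  finally show e: "(\<integral>x. h (F x) \<partial>M) = (\<Sum>a\<in>S. h a * measure M (F -` {a} \<inter> space M))" .
  assume "\<And>a. a \<in> S \<Longrightarrow> 0 \<le> h a"
  then have "(\<integral>\<^sup>+x. ennreal (h (F x)) \<partial>M) = ennreal (\<integral>x. h (F x) \<partial>M)"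
    using assms(3) by (intro nn_integral_eq_integral int AE_I2) auto
  then show "(\<integral>\<^sup>+x. ennreal (h (F x)) \<partial>M) = ennreal (\<Sum>a\<in>S. h a * measure M (F -` {a} \<inter> space M))"
    using e by simp
qed

text \<open>Both measures are discretised by one simple function \<open>q\<close> close to the
  identity, the finite problem is solved by duality, and its plan is spread over the cells of
  \<open>q\<close> by a density with respect to the product measure. The slack \<open>e\<close> pays
  for the discretisation.\<close>

lemma kantorovich_rubinstein:
  fixes \<mu> \<nu> :: "'a::euclidean_space measure"
  assumes "prob_space \<mu>" "prob_space \<nu>" and sets: "sets \<mu> = sets borel" "sets \<nu> = sets borel"
    and int: "integrable \<mu> norm" "integrable \<nu> norm"
    and dual: "\<And>f :: 'a \<Rightarrow> real. (\<And>x y. \<bar>f x - f y\<bar> \<le> norm (x - y)) \<Longrightarrow> (\<integral>x. f x \<partial>\<mu>) - (\<integral>x. f x \<partial>\<nu>) \<le> D"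
    and "0 < e"
  shows "\<exists>\<pi>\<in>couplings \<mu> \<nu>. (\<integral>\<^sup>+z. ennreal (norm (fst z - snd z)) \<partial>\<pi>) \<le> ennreal (D + e)"
proof -
  interpret M: prob_space \<mu> by fact
  interpret N: prob_space \<nu> by fact
  interpret MN: pair_prob_space \<mu> \<nu> ..
  note [measurable_cong] = sets
  have space: "space \<mu> = UNIV" "space \<nu> = UNIV"
    using sets_eq_imp_space_eq[OF sets(1)] sets_eq_imp_space_eq[OF sets(2)] by auto
  obtain F :: "nat \<Rightarrow> 'a \<Rightarrow> 'a" where F: "\<And>i. simple_function borel (F i)"
      "\<And>x. (\<lambda>i. F i x) \<longlonglongrightarrow> x" "\<And>i x. norm (F i x) \<le> 2 * norm x"
    using borel_measurable_implies_sequence_metric[of "\<lambda>x::'a. x" borel 0] by auto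
  have [measurable]: "F i \<in> borel_measurable borel" for i
    using F(1) by (rule borel_measurable_simple_function)
  have conv: "(\<lambda>i. \<integral>x. norm (x - F i x) \<partial>M) \<longlonglongrightarrow> 0"
    if "integrable M norm" "sets M = sets borel" for M :: "'a measure"
  proof -
    note [measurable_cong] = that(2)
    have "(\<lambda>i. \<integral>x. norm (x - F i x) \<partial>M) \<longlonglongrightarrow> (\<integral>x. 0 \<partial>M)"
    proof (rule integral_dominated_convergence[where w = "\<lambda>x. 3 * norm x"])
      show "AE x in M. (\<lambda>i. norm (x - F i x)) \<longlonglongrightarrow> 0"
      proof (rule AE_I2)
        fix x
        have "(\<lambda>i. norm (x - F i x)) \<longlonglongrightarrow> norm (x - x)"
          by (intro tendsto_intros F(2))
        then show "(\<lambda>i. norm (x - F i x)) \<longlonglongrightarrow> 0" by simp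
      qed
      show "AE x in M. norm (norm (x - F i x)) \<le> 3 * norm x" for i
      proof (rule AE_I2)
        fix x show "norm (norm (x - F i x)) \<le> 3 * norm x"
          using norm_triangle_ineq4[of x "F i x"] F(3)[of i x] by simp
      qed
    qed (use that in auto)
    then show ?thesis by simp
  qed
  \<comment> \<open>A quarter of the slack each for moving mass from a point to its cell
    representative, once per marginal, and the remaining half for discretising the dual problem,
    again once per marginal.\<close>
  define d where "d = e / 4"
  have d: "d > 0" using \<open>0 < e\<close> by (simp add: d_def)
  have "\<forall>\<^sub>F i in sequentially. (\<integral>x. norm (x - F i x) \<partial>\<mu>) < d \<and> (\<integral>x. norm (x - F i x) \<partial>\<nu>) < d"
    using order_tendstoD(2)[OF conv[OF int(1) sets(1)] d] order_tendstoD(2)[OF conv[OF int(2) sets(2)] d]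
    by eventually_elim simp
  then obtain i where i: "(\<integral>x. norm (x - F i x) \<partial>\<mu>) < d" "(\<integral>x. norm (x - F i x) \<partial>\<nu>) < d"
    by (auto dest: eventually_happens)
  define q where "q = F i"
  have sq: "simple_function borel q" and [measurable]: "q \<in> borel_measurable borel"
    and qn: "norm (q x) \<le> 2 * norm x" for x
    using F by (auto simp: q_def)
  have sq': "simple_function \<mu> q" "simple_function \<nu> q"
    using sq sets by (auto simp: simple_function_def space)
  define S where "S = range q"
  have S: "finite S" "S \<noteq> {}" using sq by (auto simp: S_def simple_function_def)
  define p where "p a = measure \<mu> (q -` {a})" for a
  define r where "r b = measure \<nu> (q -` {b})" for b
  note eM = simple_function_expectation[OF M.prob_space_axioms sq'(1), of S, unfolded space, simplified, folded p_def]
  note eN = simple_function_expectation[OF N.prob_space_axioms sq'(2), of S, unfolded space, simplified, folded r_def]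
  have intd: "integrable \<mu> (\<lambda>x. norm (x - q x))" "integrable \<nu> (\<lambda>x. norm (x - q x))"
  proof -
    have le: "norm (norm (x - q x)) \<le> norm (3 * norm x)" for x
      using norm_triangle_ineq4[of x "q x"] qn[of x] by simp
    show "integrable \<mu> (\<lambda>x. norm (x - q x))"
      by (rule Bochner_Integration.integrable_bound[OF integrable_mult_right[OF int(1), of 3]]) (use le in auto)
    show "integrable \<nu> (\<lambda>x. norm (x - q x))"
      by (rule Bochner_Integration.integrable_bound[OF integrable_mult_right[OF int(2), of 3]]) (use le in auto)
  qed
  have nnd: "(\<integral>\<^sup>+x. ennreal (norm (x - q x)) \<partial>\<mu>) \<le> ennreal d" "(\<integral>\<^sup>+x. ennreal (norm (x - q x)) \<partial>\<nu>) \<le> ennreal d"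
    using i by (auto simp: nn_integral_eq_integral intd q_def[symmetric] ennreal_leI)
  have pS: "sum p S = 1" and rS: "sum r S = 1"
    using eM(2)[of "\<lambda>_. 1"] eN(2)[of "\<lambda>_. 1"] S by (auto simp: S_def M.prob_space N.prob_space)
  have "\<exists>l. (\<forall>a\<in>S. \<forall>b\<in>S. 0 \<le> l a b) \<and> (\<forall>a\<in>S. (\<Sum>b\<in>S. l a b) = p a) \<and>
    (\<forall>b\<in>S. (\<Sum>a\<in>S. l a b) = r b) \<and> (\<Sum>a\<in>S. \<Sum>b\<in>S. l a b * norm (a - b)) \<le> D + 2 * d"
  proof (rule finite_transport_duality)
    fix u v :: "'a \<Rightarrow> real"
    assume uv: "\<And>a b. a \<in> S \<Longrightarrow> b \<in> S \<Longrightarrow> u a + v b \<le> norm (a - b)"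
    \<comment> \<open>The c-transform of \<open>u\<close>: a minimum of 1-Lipschitz functions, hence
      1-Lipschitz, and on \<open>S\<close> it lies above \<open>v\<close> and below the negative of
      \<open>u\<close>. This single function replaces the dual pair.\<close>
    define g where "g x = Min ((\<lambda>a. norm (x - a) - u a) ` S)" for x
    have gl: "g x - g y \<le> norm (x - y)" for x y
    proof -
      have "g y \<in> (\<lambda>a. norm (y - a) - u a) ` S"
        unfolding g_def using S by (intro Min_in) auto
      then obtain a where a: "a \<in> S" "g y = norm (y - a) - u a" by blast
      have "g x \<le> norm (x - a) - u a"
        unfolding g_def using S a by (intro Min_le) auto
      then show ?thesis using a norm_triangle_ineq[of "x - y" "y - a"] by simp
    qed
    have glip: "\<bar>g x - g y\<bar> \<le> norm (x - y)" for x y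
      using gl[of x y] gl[of y x] by (simp add: norm_minus_commute abs_le_iff)
    have g1: "g a \<le> - u a" if "a \<in> S" for a
    proof -
      have "g a \<le> norm (a - a) - u a" unfolding g_def using S that by (intro Min_le finite_imageI imageI)
      then show ?thesis by simp
    qed
    have g2: "v b \<le> g b" if "b \<in> S" for b
      unfolding g_def using S that uv by (auto intro!: Min.boundedI simp: norm_minus_commute algebra_simps)
    have [measurable]: "g \<in> borel_measurable borel"
      by (rule borel_of_lipschitz[of _ 1]) (use glip in simp)
    have intg: "integrable M g" "\<bar>(\<integral>x. g (q x) \<partial>M) - (\<integral>x. g x \<partial>M)\<bar> \<le> d"
      if "prob_space M" "sets M = sets borel" "integrable M norm" "integrable M (\<lambda>x. g (q x))"
        "integrable M (\<lambda>x. norm (x - q x))" "(\<integral>x. norm (x - q x) \<partial>M) < d" for M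
    proof -
      interpret P: prob_space M by fact
      note [measurable_cong] = that(2)
      have gle: "norm (g x) \<le> norm (norm x + \<bar>g 0\<bar>)" for x using glip[of x 0] by simp
      have "integrable M (\<lambda>x. norm x + \<bar>g 0\<bar>)" using that(3) by simp
      then show ig: "integrable M g"
        by (rule Bochner_Integration.integrable_bound[OF _ _ AE_I2[OF gle]]) measurable
      have "\<bar>(\<integral>x. g (q x) \<partial>M) - (\<integral>x. g x \<partial>M)\<bar> = \<bar>\<integral>x. g (q x) - g x \<partial>M\<bar>"
        using Bochner_Integration.integral_diff[OF that(4) ig] by simp
      also have "\<dots> \<le> (\<integral>x. \<bar>g (q x) - g x\<bar> \<partial>M)" by (rule integral_abs_bound)
      also have "\<dots> \<le> (\<integral>x. norm (x - q x) \<partial>M)"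
        by (intro integral_mono integrable_abs Bochner_Integration.integrable_diff that ig)
          (metis glip norm_minus_commute)
      finally show "\<bar>(\<integral>x. g (q x) \<partial>M) - (\<integral>x. g x \<partial>M)\<bar> \<le> d" using that by simp
    qed
    have "(\<Sum>a\<in>S. p a * u a) + (\<Sum>b\<in>S. r b * v b) \<le> (\<Sum>a\<in>S. p a * (- g a)) + (\<Sum>b\<in>S. r b * g b)"
      using g1 g2 by (intro add_mono sum_mono mult_left_mono) (auto simp: p_def r_def le_minus_iff)
    also have "\<dots> = (\<integral>x. g (q x) \<partial>\<nu>) - (\<integral>x. g (q x) \<partial>\<mu>)"
      using eM(2)[of g] eN(2)[of g] S by (simp add: S_def sum_negf mult.commute)
    also have "\<dots> \<le> (\<integral>x. - g x \<partial>\<mu>) - (\<integral>x. - g x \<partial>\<nu>) + 2 * d"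
      using intg(2)[OF M.prob_space_axioms sets(1) int(1) _ intd(1)] intg(2)[OF N.prob_space_axioms sets(2) int(2) _ intd(2)]
        eM(1)[of g] eN(1)[of g] i S by (simp add: S_def q_def[symmetric])
    also have "\<dots> \<le> D + 2 * d"
      using dual[of "\<lambda>x. - g x"] glip by (simp add: abs_minus_commute)
    finally show "(\<Sum>a\<in>S. p a * u a) + (\<Sum>b\<in>S. r b * v b) \<le> D + 2 * d" .
  qed (use S pS rS in \<open>auto simp: p_def r_def\<close>)
  then obtain l where l: "\<And>a b. a \<in> S \<Longrightarrow> b \<in> S \<Longrightarrow> 0 \<le> l a b" "\<And>a. a \<in> S \<Longrightarrow> (\<Sum>b\<in>S. l a b) = p a"
    "\<And>b. b \<in> S \<Longrightarrow> (\<Sum>a\<in>S. l a b) = r b" "(\<Sum>a\<in>S. \<Sum>b\<in>S. l a b * norm (a - b)) \<le> D + 2 * d"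
    by blast
  \<comment> \<open>The plan puts no mass on cells of mass 0. This matches the convention
    \<open>x / 0 = 0\<close> in the density \<open>w\<close> below.\<close>
  have lp: "l a b = 0" if "a \<in> S" "b \<in> S" "p a = 0" for a b
    using l(2)[of a] that S l(1)[of a] by (auto simp: sum_nonneg_eq_0_iff)
  have lr: "l a b = 0" if "a \<in> S" "b \<in> S" "r b = 0" for a b
    using l(3)[of b] that S l(1)[of _ b] by (auto simp: sum_nonneg_eq_0_iff)
  have pnn: "0 \<le> p a" "0 \<le> r a" for a by (auto simp: p_def r_def)
  define w where "w z = l (q (fst z)) (q (snd z)) / (p (q (fst z)) * r (q (snd z)))" for z
  have w: "0 \<le> w z" for z using l(1) pnn by (auto simp: w_def S_def)
  have wm [measurable]: "w \<in> borel_measurable (\<mu> \<Otimes>\<^sub>M \<nu>)"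
  proof -
    have "simple_function (\<mu> \<Otimes>\<^sub>M \<nu>) (\<lambda>z. (q (fst z), q (snd z)))"
    proof (rule simple_function_Pair)
      show "simple_function (\<mu> \<Otimes>\<^sub>M \<nu>) (\<lambda>z. q (fst z))"
        by (rule simple_function_borel_measurable, measurable) (rule finite_subset[OF _ S(1)], auto simp: S_def)
      show "simple_function (\<mu> \<Otimes>\<^sub>M \<nu>) (\<lambda>z. q (snd z))"
        by (rule simple_function_borel_measurable, measurable) (rule finite_subset[OF _ S(1)], auto simp: S_def)
    qed
    from simple_function_compose[OF this, of "\<lambda>(a, b). l a b / (p a * r b)"]
    have "simple_function (\<mu> \<Otimes>\<^sub>M \<nu>) w" by (simp add: comp_def w_def[abs_def])
    then show ?thesis by (rule borel_measurable_simple_function)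
  qed
  define \<pi> where "\<pi> = density (\<mu> \<Otimes>\<^sub>M \<nu>) (\<lambda>z. ennreal (w z))"
  have pi_sets [measurable_cong]: "sets \<pi> = sets (\<mu> \<Otimes>\<^sub>M \<nu>)" by (simp add: \<pi>_def)
  have inY: "(\<integral>\<^sup>+y. ennreal (w (x, y) * h (q y)) \<partial>\<nu>) = ennreal ((\<Sum>b\<in>S. l (q x) b * h b) / p (q x))"
    if "\<And>b. b \<in> S \<Longrightarrow> 0 \<le> h b" for x h
  proof -
    have "(\<integral>\<^sup>+y. ennreal (w (x, y) * h (q y)) \<partial>\<nu>) = (\<integral>\<^sup>+y. ennreal ((\<lambda>b. l (q x) b / (p (q x) * r b) * h b) (q y)) \<partial>\<nu>)"
      by (simp add: w_def)
    also have "\<dots> = ennreal (\<Sum>b\<in>S. l (q x) b / (p (q x) * r b) * h b * r b)"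
      using l(1) pnn S that by (subst eN(3)) (auto simp: S_def)
    also have "(\<Sum>b\<in>S. l (q x) b / (p (q x) * r b) * h b * r b) = (\<Sum>b\<in>S. l (q x) b * h b / p (q x))"
      using lr[of "q x"] by (intro sum.cong) (auto simp: S_def)
    finally show ?thesis by (simp add: sum_divide_distrib)
  qed
  have inX: "(\<integral>\<^sup>+x. ennreal (w (x, y)) \<partial>\<mu>) = ennreal ((\<Sum>a\<in>S. l a (q y)) / r (q y))" for y
  proof -
    have "(\<integral>\<^sup>+x. ennreal (w (x, y)) \<partial>\<mu>) = (\<integral>\<^sup>+x. ennreal ((\<lambda>a. l a (q y) / (p a * r (q y))) (q x)) \<partial>\<mu>)"
      by (simp add: w_def)
    also have "\<dots> = ennreal (\<Sum>a\<in>S. l a (q y) / (p a * r (q y)) * p a)"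
      using l(1) pnn S by (subst eM(3)) (auto simp: S_def)
    also have "(\<Sum>a\<in>S. l a (q y) / (p a * r (q y)) * p a) = (\<Sum>a\<in>S. l a (q y) / r (q y))"
      using lp[of _ "q y"] by (intro sum.cong) (auto simp: S_def)
    finally show ?thesis by (simp add: sum_divide_distrib)
  qed
  \<comment> \<open>On cells of mass 0 the density \<open>w\<close> vanishes, so integrating it over
    the second variable gives 1 only almost everywhere.\<close>
  have AEp: "AE x in \<mu>. p (q x) \<noteq> 0"
  proof -
    have "{x. p (q x) = 0} = (\<Union>a\<in>{a\<in>S. p a = 0}. q -` {a})" by (auto simp: S_def)
    moreover have "\<dots> \<in> null_sets \<mu>"
      using S simple_functionD(2)[OF sq'(1)]
      by (intro null_sets_UN') (auto intro!: null_setsI simp: p_def M.emeasure_eq_measure space countable_finite)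
    ultimately show ?thesis by (intro AE_I'[of "{x. p (q x) = 0}"]) auto
  qed
  have AEr: "AE x in \<nu>. r (q x) \<noteq> 0"
  proof -
    have "{x. r (q x) = 0} = (\<Union>a\<in>{a\<in>S. r a = 0}. q -` {a})" by (auto simp: S_def)
    moreover have "\<dots> \<in> null_sets \<nu>"
      using S simple_functionD(2)[OF sq'(2)]
      by (intro null_sets_UN') (auto intro!: null_setsI simp: r_def N.emeasure_eq_measure space countable_finite)
    ultimately show ?thesis by (intro AE_I'[of "{x. r (q x) = 0}"]) auto
  qed
  have mX: "distr \<pi> \<mu> fst = \<mu>"
  proof (rule measure_eqI)
    fix A assume "A \<in> sets (distr \<pi> \<mu> fst)"
    then have [measurable]: "A \<in> sets \<mu>" by simp
    have "emeasure (distr \<pi> \<mu> fst) A = (\<integral>\<^sup>+z. indicator A (fst z) \<partial>\<pi>)"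
      by (subst nn_integral_indicator[symmetric], simp, subst nn_integral_distr) (auto simp: \<pi>_def)
    also have "\<dots> = (\<integral>\<^sup>+z. ennreal (w z) * indicator A (fst z) \<partial>(\<mu> \<Otimes>\<^sub>M \<nu>))"
      unfolding \<pi>_def by (subst nn_integral_density) auto
    also have "\<dots> = (\<integral>\<^sup>+x. \<integral>\<^sup>+y. ennreal (w (x, y)) * indicator A x \<partial>\<nu> \<partial>\<mu>)"
      by (subst N.nn_integral_fst[symmetric]) auto
    also have "\<dots> = (\<integral>\<^sup>+x. indicator A x \<partial>\<mu>)"
    proof (rule nn_integral_cong_AE)
      show "AE x in \<mu>. (\<integral>\<^sup>+y. ennreal (w (x, y)) * indicator A x \<partial>\<nu>) = indicator A x"
        using AEp
      proof eventually_elim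
        case (elim x)
        have "(\<integral>\<^sup>+y. ennreal (w (x, y)) \<partial>\<nu>) = 1"
          using inY[of "\<lambda>_. 1" x] l(2)[of "q x"] elim by (simp add: S_def)
        moreover have "(\<lambda>y. w (x, y)) \<in> borel_measurable \<nu>"
          by (rule measurable_Pair2[OF wm]) (simp add: space)
        ultimately show ?case by (subst nn_integral_multc) auto
      qed
    qed
    finally show "emeasure (distr \<pi> \<mu> fst) A = emeasure \<mu> A" by simp
  qed simp
  have mY: "distr \<pi> \<nu> snd = \<nu>"
  proof (rule measure_eqI)
    fix A assume "A \<in> sets (distr \<pi> \<nu> snd)"
    then have [measurable]: "A \<in> sets \<nu>" by simp
    have "emeasure (distr \<pi> \<nu> snd) A = (\<integral>\<^sup>+z. indicator A (snd z) \<partial>\<pi>)"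
      by (subst nn_integral_indicator[symmetric], simp, subst nn_integral_distr) (auto simp: \<pi>_def)
    also have "\<dots> = (\<integral>\<^sup>+z. ennreal (w z) * indicator A (snd z) \<partial>(\<mu> \<Otimes>\<^sub>M \<nu>))"
      unfolding \<pi>_def by (subst nn_integral_density) auto
    also have "\<dots> = (\<integral>\<^sup>+y. \<integral>\<^sup>+x. ennreal (w (x, y)) * indicator A y \<partial>\<mu> \<partial>\<nu>)"
      by (subst MN.nn_integral_snd[symmetric]) auto
    also have "\<dots> = (\<integral>\<^sup>+x. indicator A x \<partial>\<nu>)"
    proof (rule nn_integral_cong_AE)
      show "AE y in \<nu>. (\<integral>\<^sup>+x. ennreal (w (x, y)) * indicator A y \<partial>\<mu>) = indicator A y"
        using AEr
      proof eventually_elim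
        case (elim y)
        have "(\<integral>\<^sup>+x. ennreal (w (x, y)) \<partial>\<mu>) = 1"
          using inX[of y] l(3)[of "q y"] elim by (simp add: S_def)
        moreover have "(\<lambda>x. w (x, y)) \<in> borel_measurable \<mu>"
          by (rule measurable_Pair1[OF wm]) (simp add: space)
        ultimately show ?case by (subst nn_integral_multc) auto
      qed
    qed
    finally show "emeasure (distr \<pi> \<nu> snd) A = emeasure \<nu> A" by simp
  qed simp
  have cost: "(\<integral>\<^sup>+z. ennreal (norm (q (fst z) - q (snd z))) \<partial>\<pi>) \<le> ennreal (D + 2 * d)"
  proof -
    have "(\<integral>\<^sup>+z. ennreal (norm (q (fst z) - q (snd z))) \<partial>\<pi>) = (\<integral>\<^sup>+z. ennreal (w z) * ennreal (norm (q (fst z) - q (snd z))) \<partial>(\<mu> \<Otimes>\<^sub>M \<nu>))"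
      unfolding \<pi>_def by (subst nn_integral_density) auto
    also have "\<dots> = (\<integral>\<^sup>+x. \<integral>\<^sup>+y. ennreal (w (x, y) * norm (q x - q y)) \<partial>\<nu> \<partial>\<mu>)"
      by (subst N.nn_integral_fst[symmetric]) (auto simp: ennreal_mult w)
    also have "\<dots> = (\<integral>\<^sup>+x. ennreal ((\<lambda>a. (\<Sum>b\<in>S. l a b * norm (a - b)) / p a) (q x)) \<partial>\<mu>)"
      by (intro nn_integral_cong) (simp add: inY[of "\<lambda>b. norm (q x - b)" for x])
    also have "\<dots> = ennreal (\<Sum>a\<in>S. (\<Sum>b\<in>S. l a b * norm (a - b)) / p a * p a)"
      using l(1) pnn S by (subst eM(3)) (auto simp: S_def intro!: divide_nonneg_nonneg sum_nonneg)
    also have "(\<Sum>a\<in>S. (\<Sum>b\<in>S. l a b * norm (a - b)) / p a * p a) = (\<Sum>a\<in>S. \<Sum>b\<in>S. l a b * norm (a - b))"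
      using lp by (intro sum.cong) auto
    finally show ?thesis using l(4) by (simp add: ennreal_leI)
  qed
  have "0 \<le> D + 2 * d"
    by (rule order_trans[OF _ l(4)], intro sum_nonneg mult_nonneg_nonneg l(1)) auto
  have "(\<integral>\<^sup>+z. ennreal (norm (fst z - snd z)) \<partial>\<pi>) \<le> (\<integral>\<^sup>+z. ennreal (norm (fst z - q (fst z))) +
      (ennreal (norm (q (fst z) - q (snd z))) + ennreal (norm (snd z - q (snd z)))) \<partial>\<pi>)"
  proof (intro nn_integral_mono)
    fix z :: "'a \<times> 'a"
    have "norm (fst z - snd z) \<le> norm (fst z - q (fst z)) + (norm (q (fst z) - q (snd z)) + norm (snd z - q (snd z)))"
      using norm_triangle_ineq4[of "(fst z - q (fst z)) + (q (fst z) - q (snd z))" "snd z - q (snd z)"]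
        norm_triangle_ineq[of "fst z - q (fst z)" "q (fst z) - q (snd z)"] by simp
    then show "ennreal (norm (fst z - snd z)) \<le> ennreal (norm (fst z - q (fst z))) +
      (ennreal (norm (q (fst z) - q (snd z))) + ennreal (norm (snd z - q (snd z))))"
      by (simp add: ennreal_leI flip: ennreal_plus)
  qed
  also have "\<dots> = (\<integral>\<^sup>+z. ennreal (norm (fst z - q (fst z))) \<partial>\<pi>) + ((\<integral>\<^sup>+z. ennreal (norm (q (fst z) - q (snd z))) \<partial>\<pi>)
      + (\<integral>\<^sup>+z. ennreal (norm (snd z - q (snd z))) \<partial>\<pi>))"
    by (subst nn_integral_add; (subst nn_integral_add)?) auto
  also have "(\<integral>\<^sup>+z. ennreal (norm (fst z - q (fst z))) \<partial>\<pi>) = (\<integral>\<^sup>+x. ennreal (norm (x - q x)) \<partial>\<mu>)"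
    using nn_integral_distr[of fst \<pi> \<mu> "\<lambda>x. ennreal (norm (x - q x))"] by (simp add: mX)
  also have "(\<integral>\<^sup>+z. ennreal (norm (snd z - q (snd z))) \<partial>\<pi>) = (\<integral>\<^sup>+x. ennreal (norm (x - q x)) \<partial>\<nu>)"
    using nn_integral_distr[of snd \<pi> \<nu> "\<lambda>x. ennreal (norm (x - q x))"] by (simp add: mY)
  also have "(\<integral>\<^sup>+x. ennreal (norm (x - q x)) \<partial>\<mu>) + ((\<integral>\<^sup>+z. ennreal (norm (q (fst z) - q (snd z))) \<partial>\<pi>)
      + (\<integral>\<^sup>+x. ennreal (norm (x - q x)) \<partial>\<nu>)) \<le> ennreal d + (ennreal (D + 2 * d) + ennreal d)"
    using nnd cost by (intro add_mono)
  also have "\<dots> = ennreal (D + e)"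
    using d \<open>0 \<le> D + 2 * d\<close> by (simp add: d_def flip: ennreal_plus)
  finally have "(\<integral>\<^sup>+z. ennreal (norm (fst z - snd z)) \<partial>\<pi>) \<le> ennreal (D + e)" .
  moreover have "\<pi> \<in> couplings \<mu> \<nu>"
    using mX mY pi_sets by (simp add: couplings_def)
  ultimately show ?thesis by blast
qed

text \<open>Duality yields a coupling of cost at most \<open>D + e\<close> for every positive
  \<open>e\<close>, and \<open>wasserstein1\<close> is an infimum over couplings. A bound on the
  signed difference is enough, since the test functions are closed under negation.\<close>

lemma wasserstein1_le:
  fixes X :: "'w \<Rightarrow> real ^ 'n" and Y :: "'v \<Rightarrow> real ^ 'n"
  assumes "prob_space M" "prob_space N" and X: "integrable M X" and Y: "integrable N Y"
    and "\<And>f :: real ^ 'n \<Rightarrow> real. (\<And>x y. \<bar>f x - f y\<bar> \<le> norm (x - y)) \<Longrightarrow>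
      (\<integral>\<omega>. f (X \<omega>) \<partial>M) - (\<integral>\<omega>. f (Y \<omega>) \<partial>N) \<le> D"
  shows "wasserstein1 M X N Y \<le> ennreal D"
proof (rule ennreal_le_epsilon)
  fix e :: real assume e: "0 < e"
  have [measurable]: "X \<in> borel_measurable M" "Y \<in> borel_measurable N" using X Y by auto
  have lipm: "f \<in> borel_measurable borel" if "\<And>x y. \<bar>f x - f y\<bar> \<le> norm (x - y)" for f :: "real ^ 'n \<Rightarrow> real"
    by (rule borel_of_lipschitz[of _ 1]) (use that in simp)
  have "\<exists>\<pi>\<in>couplings (distr M borel X) (distr N borel Y).
    (\<integral>\<^sup>+z. ennreal (norm (fst z - snd z)) \<partial>\<pi>) \<le> ennreal (D + e)"
  proof (rule kantorovich_rubinstein[OF _ _ _ _ _ _ _ e])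
    show "prob_space (distr M borel X)" "prob_space (distr N borel Y)"
      using assms(1,2) by (auto intro: prob_space.prob_space_distr)
    show "integrable (distr M borel X) norm" "integrable (distr N borel Y) norm"
      using X Y by (auto simp: integrable_distr_eq)
    fix f :: "real ^ 'n \<Rightarrow> real" assume "\<And>x y. \<bar>f x - f y\<bar> \<le> norm (x - y)"
    then show "(\<integral>x. f x \<partial>distr M borel X) - (\<integral>x. f x \<partial>distr N borel Y) \<le> D"
      using assms(5)[of f] lipm[of f] by (simp add: integral_distr)
  qed auto
  then have "wasserstein1 M X N Y \<le> ennreal (D + e)"
    unfolding wasserstein1_def by (auto intro: INF_lower2)
  also have "\<dots> \<le> ennreal D + ennreal e" using e by (cases "0 \<le> D") (auto simp: ennreal_plus ennreal_neg intro!: ennreal_leI)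
  finally show "wasserstein1 M X N Y \<le> ennreal D + ennreal e" .
qed

section \<open>Gaussian approximation in the Wasserstein distance\<close>

lemma borel_measurable_component [measurable (raw)]:
  fixes X :: "'w \<Rightarrow> real ^ 'n"
  assumes "X \<in> borel_measurable M"
  shows "(\<lambda>\<omega>. X \<omega> $ i) \<in> borel_measurable M"
  by (rule measurable_compose[OF assms]) (intro borel_measurable_continuous_onI continuous_intros)

lemma standard_gaussian_integral:
  fixes Z :: "'v \<Rightarrow> real ^ 'n" and f :: "real ^ 'n \<Rightarrow> real"
  assumes Z: "standard_gaussian N Z" and [measurable]: "f \<in> borel_measurable borel"
  shows "Z \<in> borel_measurable N" "(\<integral>\<eta>. f (Z \<eta>) \<partial>N) = (\<integral>z. f z \<partial>gauss)"
    "integrable N (\<lambda>\<eta>. f (Z \<eta>)) \<longleftrightarrow> integrable gauss f"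
proof -
  have d: "distributed N lborel Z (\<lambda>x. ennreal (\<Prod>i\<in>UNIV. std_normal_density (x $ i)))"
    using Z by (simp add: standard_gaussian_def)
  show m [measurable]: "Z \<in> borel_measurable N" using d by (auto simp: distributed_def)
  have "distr N borel Z = distr N lborel Z" by (rule distr_cong) auto
  also have "\<dots> = gauss" using d by (simp add: distributed_def gauss_def)
  finally have e: "distr N borel Z = gauss" .
  show "(\<integral>\<eta>. f (Z \<eta>) \<partial>N) = (\<integral>z. f z \<partial>gauss)" unfolding e[symmetric] by (subst integral_distr) auto
  show "integrable N (\<lambda>\<eta>. f (Z \<eta>)) \<longleftrightarrow> integrable gauss f" unfolding e[symmetric] by (subst integrable_distr_eq) auto
qed

lemma square_integrableD:
  fixes X :: "'w \<Rightarrow> real ^ 'n"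
  assumes "prob_space M" "square_integrable M X"
  shows "X \<in> borel_measurable M" "integrable M (\<lambda>\<omega>. (norm (X \<omega>))\<^sup>2)" "integrable M (\<lambda>\<omega>. norm (X \<omega>))" "integrable M X"
    "integrable M (\<lambda>\<omega>. X \<omega> $ i)" "integrable M (\<lambda>\<omega>. (X \<omega> $ i)\<^sup>2)"
    "(\<integral>\<omega>. norm (X \<omega>) \<partial>M) \<le> sqrt (second_moment M X)"
proof -
  interpret prob_space M by fact
  show m [measurable]: "X \<in> borel_measurable M" and sq: "integrable M (\<lambda>\<omega>. (norm (X \<omega>))\<^sup>2)"
    using assms(2) by (auto simp: square_integrable_def)
  have nm: "(\<lambda>\<omega>. norm (X \<omega>)) \<in> borel_measurable M" by measurable
  note L = expectation_abs_le_L2[OF nm sq]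
  show "integrable M (\<lambda>\<omega>. norm (X \<omega>))" by (rule L)
  then show i: "integrable M X" using integrable_norm_iff[OF m] by simp
  show "integrable M (\<lambda>\<omega>. X \<omega> $ i)" by (rule integrable_bounded_linear[OF bounded_linear_vec_nth i])
  show "integrable M (\<lambda>\<omega>. (X \<omega> $ i)\<^sup>2)"
  proof (rule Bochner_Integration.integrable_bound[OF sq])
    have "(\<lambda>x :: real ^ 'n. x $ i) \<in> borel_measurable borel" by measurable
    from measurable_compose[OF m this] show "(\<lambda>\<omega>. (X \<omega> $ i)\<^sup>2) \<in> borel_measurable M" by measurable
    show "AE \<omega> in M. norm ((X \<omega> $ i)\<^sup>2) \<le> norm ((norm (X \<omega>))\<^sup>2)"
    proof (rule AE_I2)
      fix \<omega>
      have "\<bar>X \<omega> $ i\<bar>\<^sup>2 \<le> (norm (X \<omega>))\<^sup>2" by (intro power_mono component_le_norm_cart) auto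
      then show "norm ((X \<omega> $ i)\<^sup>2) \<le> norm ((norm (X \<omega>))\<^sup>2)" by simp
    qed
  qed
  show "(\<integral>\<omega>. norm (X \<omega>) \<partial>M) \<le> sqrt (second_moment M X)" using L(2) by (simp add: second_moment_def)
qed

lemma square_integrable_add:
  assumes "square_integrable M X" "square_integrable M Y"
  shows "square_integrable M (\<lambda>\<omega>. X \<omega> + Y \<omega>)"
  unfolding square_integrable_def
proof
  have [measurable]: "X \<in> borel_measurable M" "Y \<in> borel_measurable M" using assms by (auto simp: square_integrable_def)
  show "(\<lambda>\<omega>. X \<omega> + Y \<omega>) \<in> borel_measurable M" by measurable
  show "integrable M (\<lambda>\<omega>. (norm (X \<omega> + Y \<omega>))\<^sup>2)"
  proof (rule Bochner_Integration.integrable_bound)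
    show "integrable M (\<lambda>\<omega>. 2 * (norm (X \<omega>))\<^sup>2 + 2 * (norm (Y \<omega>))\<^sup>2)"
      using assms by (simp add: square_integrable_def)
    show "AE \<omega> in M. norm ((norm (X \<omega> + Y \<omega>))\<^sup>2) \<le> norm (2 * (norm (X \<omega>))\<^sup>2 + 2 * (norm (Y \<omega>))\<^sup>2)"
    proof (rule AE_I2)
      fix \<omega>
      have "(norm (X \<omega> + Y \<omega>))\<^sup>2 \<le> (norm (X \<omega>) + norm (Y \<omega>))\<^sup>2" by (intro power_mono norm_triangle_ineq) auto
      also have "\<dots> \<le> 2 * (norm (X \<omega>))\<^sup>2 + 2 * (norm (Y \<omega>))\<^sup>2"
        using zero_le_power2[of "norm (X \<omega>) - norm (Y \<omega>)"] by (simp add: power2_diff power2_sum)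
      finally show "norm ((norm (X \<omega> + Y \<omega>))\<^sup>2) \<le> norm (2 * (norm (X \<omega>))\<^sup>2 + 2 * (norm (Y \<omega>))\<^sup>2)" by simp
    qed
  qed measurable
qed

lemma square_integrable_matrix:
  fixes X :: "'w \<Rightarrow> real ^ 'm" and B :: "real ^ 'm ^ 'n"
  assumes X: "square_integrable M X" and B: "\<And>x. norm (B *v x) \<le> b * norm x"
  shows "square_integrable M (\<lambda>\<omega>. B *v X \<omega>)" "second_moment M (\<lambda>\<omega>. B *v X \<omega>) \<le> b\<^sup>2 * second_moment M X"
proof -
  have [measurable]: "X \<in> borel_measurable M" and sq: "integrable M (\<lambda>\<omega>. (norm (X \<omega>))\<^sup>2)"
    using X by (auto simp: square_integrable_def)
  have le: "(norm (B *v x))\<^sup>2 \<le> b\<^sup>2 * (norm x)\<^sup>2" for x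
    unfolding power_mult_distrib[symmetric] by (intro power_mono B) auto
  have m: "(\<lambda>\<omega>. B *v X \<omega>) \<in> borel_measurable M" by measurable
  have i: "integrable M (\<lambda>\<omega>. (norm (B *v X \<omega>))\<^sup>2)"
  proof (rule Bochner_Integration.integrable_bound)
    show "integrable M (\<lambda>\<omega>. b\<^sup>2 * (norm (X \<omega>))\<^sup>2)" using sq by simp
    show "AE \<omega> in M. norm ((norm (B *v X \<omega>))\<^sup>2) \<le> norm (b\<^sup>2 * (norm (X \<omega>))\<^sup>2)" using le by (intro AE_I2) simp
  qed measurable
  show "square_integrable M (\<lambda>\<omega>. B *v X \<omega>)" using m i by (simp add: square_integrable_def)
  have "(\<integral>\<omega>. (norm (B *v X \<omega>))\<^sup>2 \<partial>M) \<le> (\<integral>\<omega>. b\<^sup>2 * (norm (X \<omega>))\<^sup>2 \<partial>M)"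
    using i sq le by (intro integral_mono) auto
  then show "second_moment M (\<lambda>\<omega>. B *v X \<omega>) \<le> b\<^sup>2 * second_moment M X" by (simp add: second_moment_def)
qed

lemma square_integrable_const: "prob_space M \<Longrightarrow> square_integrable M (\<lambda>_. c)"
proof -
  assume "prob_space M"
  then interpret prob_space M .
  show ?thesis by (simp add: square_integrable_def)
qed

lemma square_integrable_sum:
  assumes "prob_space M" "\<And>i. i \<in> I \<Longrightarrow> square_integrable M (X i)"
  shows "square_integrable M (\<lambda>\<omega>. \<Sum>i\<in>I. X i \<omega>)"
  using assms(2)
  by (induction I rule: infinite_finite_induct) (auto intro: square_integrable_add square_integrable_const[OF assms(1)])

text \<open>Cross terms vanish by independence and zero mean. This identifies the covariance of the
  noise part with the matrix that \<open>lindeberg_clt\<close> compares to.\<close>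

lemma (in centered_law) moments_linear_sum:
  fixes noise :: "nat \<Rightarrow> 'w \<Rightarrow> real ^ 'n" and B :: "nat \<Rightarrow> real ^ 'n ^ 'n"
  assumes M: "prob_space M" and ind: "prob_space.indep_vars M (\<lambda>_. borel) noise UNIV" and law: "\<And>i. distr M borel (noise i) = \<rho>"
  shows "\<And>i. square_integrable M (noise i)" "square_integrable M (\<lambda>\<omega>. \<Sum>i<k. B i *v noise i \<omega>)"
    "(\<integral>\<omega>. (\<Sum>i<k. B i *v noise i \<omega>) $ a \<partial>M) = 0"
    "(\<chi> a b. \<integral>\<omega>. (\<Sum>i<k. B i *v noise i \<omega>) $ a * (\<Sum>i<k. B i *v noise i \<omega>) $ b \<partial>M) =
      (\<Sum>i<k. B i ** second_moments \<rho> ** transpose (B i))"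
proof -
  interpret M: prob_space M by fact
  have nm [measurable]: "noise i \<in> borel_measurable M" for i using ind unfolding M.indep_vars_def by auto
  show n2: "square_integrable M (noise i)" for i
  proof -
    have "integrable (distr M borel (noise i)) (\<lambda>y. (norm y)\<^sup>2)" unfolding law by (rule integrable_norm_sq)
    then have "integrable M (\<lambda>\<omega>. (norm (noise i \<omega>))\<^sup>2)" by (subst (asm) integrable_distr_eq) auto
    then show ?thesis by (simp add: square_integrable_def)
  qed
  define S where "S k \<omega> = (\<Sum>i<k. B i *v noise i \<omega>)" for k \<omega>
  have Bn2: "square_integrable M (\<lambda>\<omega>. B i *v noise i \<omega>)" for i
    by (rule square_integrable_matrix[OF n2 matrix_vector_norm_le])
  have S2: "square_integrable M (S k)" for k
    unfolding S_def by (rule square_integrable_sum[OF M Bn2])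
  then show "square_integrable M (\<lambda>\<omega>. \<Sum>i<k. B i *v noise i \<omega>)" unfolding S_def by blast
  have Bmean: "(\<integral>\<omega>. (B i *v noise i \<omega>) $ a \<partial>M) = 0" for i a
  proof -
    have "(\<integral>y. (B i *v y) $ a \<partial>distr M borel (noise i)) = (\<integral>\<omega>. (B i *v noise i \<omega>) $ a \<partial>M)"
      by (subst integral_distr) auto
    moreover have "(\<integral>y. (B i *v y) $ a \<partial>\<rho>) = 0"
      using linear_image_law(2)[where i=a and B="B i"] by (subst (asm) integral_distr) auto
    ultimately show ?thesis unfolding law by simp
  qed
  have "(\<integral>\<omega>. S k \<omega> $ a \<partial>M) = (\<Sum>i<k. \<integral>\<omega>. (B i *v noise i \<omega>) $ a \<partial>M)"
    unfolding S_def sum_component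
    by (intro Bochner_Integration.integral_sum square_integrableD(5)[OF M Bn2])
  then show "(\<integral>\<omega>. (\<Sum>i<k. B i *v noise i \<omega>) $ a \<partial>M) = 0"
    unfolding S_def Bmean by simp
  have "(\<integral>\<omega>. S k \<omega> $ a * S k \<omega> $ b \<partial>M) = (\<Sum>i<k. B i ** second_moments \<rho> ** transpose (B i)) $ a $ b" for a b k
  proof (induction k)
    case 0
    then show ?case by (simp add: S_def)
  next
    case (Suc k)
    define Y where "Y \<omega> = B k *v noise k \<omega>" for \<omega>
    have Y2: "square_integrable M Y" unfolding Y_def by (rule Bn2)
    have cm: "(\<lambda>x :: real ^ 'n. x $ c) \<in> borel_measurable borel" "(\<lambda>x. (B k *v x) $ c) \<in> borel_measurable borel" for c
      by measurable
    have indS: "M.indep_var borel (S k) borel (noise k)" unfolding S_def by (rule M.indep_var_linear_sum[OF ind])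
    have cross: "integrable M (\<lambda>\<omega>. S k \<omega> $ c * Y \<omega> $ d)" "(\<integral>\<omega>. S k \<omega> $ c * Y \<omega> $ d \<partial>M) = 0" for c d
    proof -
      have iv: "M.indep_var borel (\<lambda>\<omega>. S k \<omega> $ c) borel (\<lambda>\<omega>. Y \<omega> $ d)"
        using M.indep_var_compose[OF indS cm(1)[of c] cm(2)[of d]] by (simp add: comp_def Y_def)
      note i = square_integrableD(5)[OF M S2] square_integrableD(5)[OF M Y2]
      show "integrable M (\<lambda>\<omega>. S k \<omega> $ c * Y \<omega> $ d)" by (rule M.indep_var_integrable[OF iv i])
      show "(\<integral>\<omega>. S k \<omega> $ c * Y \<omega> $ d \<partial>M) = 0"
        using M.indep_var_lebesgue_integral[OF iv i] Bmean by (simp add: Y_def)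
    qed
    have ms: "(\<lambda>\<omega>. X \<omega> $ c) \<in> borel_measurable M" if "square_integrable M X" for X :: "'w \<Rightarrow> real ^ 'n" and c
      using square_integrableD(5)[OF M that] by auto
    have SS: "integrable M (\<lambda>\<omega>. S k \<omega> $ a * S k \<omega> $ b)"
      by (intro integrable_mult_L2 ms S2 square_integrableD(6)[OF M S2])
    have YY: "integrable M (\<lambda>\<omega>. Y \<omega> $ a * Y \<omega> $ b)"
      by (intro integrable_mult_L2 ms Y2 square_integrableD(6)[OF M Y2])
    have YYv: "(\<integral>\<omega>. Y \<omega> $ a * Y \<omega> $ b \<partial>M) = (B k ** second_moments \<rho> ** transpose (B k)) $ a $ b"
    proof -
      have "(\<integral>y. (B k *v y) $ a * (B k *v y) $ b \<partial>distr M borel (noise k)) = (\<integral>\<omega>. Y \<omega> $ a * Y \<omega> $ b \<partial>M)"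
        unfolding Y_def by (subst integral_distr) auto
      then show ?thesis unfolding law congruence_component second_moments_bilinear matrix_vector_mul_component by simp
    qed
    have "S (Suc k) \<omega> $ a * S (Suc k) \<omega> $ b =
        S k \<omega> $ a * S k \<omega> $ b + S k \<omega> $ a * Y \<omega> $ b + S k \<omega> $ b * Y \<omega> $ a + Y \<omega> $ a * Y \<omega> $ b" for \<omega>
      by (simp add: S_def Y_def algebra_simps)
    then have "(\<integral>\<omega>. S (Suc k) \<omega> $ a * S (Suc k) \<omega> $ b \<partial>M) =
        (\<integral>\<omega>. S k \<omega> $ a * S k \<omega> $ b + S k \<omega> $ a * Y \<omega> $ b + S k \<omega> $ b * Y \<omega> $ a + Y \<omega> $ a * Y \<omega> $ b \<partial>M)"
      by (simp only:)
    also have "\<dots> = (\<integral>\<omega>. S k \<omega> $ a * S k \<omega> $ b \<partial>M) + (\<integral>\<omega>. Y \<omega> $ a * Y \<omega> $ b \<partial>M)"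
      using SS YY cross by simp
    finally show ?case unfolding YYv Suc by simp
  qed
  then show "(\<chi> a b. \<integral>\<omega>. (\<Sum>i<k. B i *v noise i \<omega>) $ a * (\<Sum>i<k. B i *v noise i \<omega>) $ b \<partial>M) =
      (\<Sum>i<k. B i ** second_moments \<rho> ** transpose (B i))"
    by (simp add: S_def vec_eq_iff)
qed

text \<open>No independence of \<open>X\<close> and \<open>S\<close> is needed: both the laws and the Gaussians with their
  covariances are compared through the mean square distance of \<open>X\<close> and \<open>S\<close>.\<close>
lemma wasserstein1_gaussian_perturbation:
  fixes S R :: "'w \<Rightarrow> real ^ 'n"
  assumes M: "prob_space M" and N: "prob_space N" and Z: "standard_gaussian N Z"
    and S: "square_integrable M S" "\<And>i. (\<integral>\<omega>. S \<omega> $ i \<partial>M) = 0" and R: "square_integrable M R"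
    and X: "X = (\<lambda>\<omega>. R \<omega> + S \<omega>)"
    and clt: "\<And>f :: real ^ 'n \<Rightarrow> real. (\<And>x y. \<bar>f x - f y\<bar> \<le> norm (x - y)) \<Longrightarrow>
      \<bar>(\<integral>\<omega>. f (S \<omega>) \<partial>M) - (\<integral>y. f y \<partial>gaussian (\<chi> i j. \<integral>\<omega>. S \<omega> $ i * S \<omega> $ j \<partial>M))\<bar> \<le> D"
  shows "wasserstein1 M X N (\<lambda>\<eta>. mat_sqrt (covariance M X) *v Z \<eta>) \<le> ennreal (D + 3 * sqrt (second_moment M R))"
proof -
  interpret M: prob_space M by fact
  have X2: "square_integrable M X" unfolding X by (rule square_integrable_add[OF R S(1)])
  note XD = square_integrableD[OF M X2] and SD = square_integrableD[OF M S(1)] and RD = square_integrableD[OF M R]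
  \<comment> \<open>\<open>covariance\<close> subtracts the mean, so the Gaussian belongs to the
    centred vector \<open>Y\<close>. As \<open>S\<close> is centred, the mean of \<open>X\<close> is
    that of \<open>R\<close>, bounded by the root mean square of \<open>R\<close>.\<close>
  define m :: "real ^ 'n" where "m = (\<chi> i. \<integral>\<omega>. X \<omega> $ i \<partial>M)"
  define Y where "Y \<omega> = X \<omega> + (- m)" for \<omega>
  have Y2: "square_integrable M Y" unfolding Y_def by (rule square_integrable_add[OF X2 square_integrable_const[OF M]])
  note YD = square_integrableD[OF M Y2]
  have Ymeas: "(\<lambda>\<omega>. Y \<omega> $ i) \<in> borel_measurable M" for i using YD(5) by auto
  have cov: "covariance M X = (\<chi> i j. \<integral>\<omega>. Y \<omega> $ i * Y \<omega> $ j \<partial>M)"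
    by (simp add: covariance_def Y_def m_def)
  have psd: "psd (covariance M X)" unfolding cov by (rule psd_moment_matrix[OF Ymeas YD(6)])
  have r: "(\<integral>\<omega>. norm (R \<omega>) \<partial>M) \<le> sqrt (second_moment M R)" by (rule RD)
  have r0: "0 \<le> second_moment M R" by (simp add: second_moment_def)
  have mR: "m = (\<integral>\<omega>. R \<omega> \<partial>M)"
  proof -
    have "m $ i = (\<integral>\<omega>. R \<omega> \<partial>M) $ i" for i
    proof -
      have "(\<integral>\<omega>. X \<omega> $ i \<partial>M) = (\<integral>\<omega>. R \<omega> $ i \<partial>M)" using RD(5)[of i] SD(5)[of i] S(2)[of i] by (simp add: X)
      then show ?thesis using integral_bounded_linear[OF bounded_linear_vec_nth RD(4), of i] by (simp add: m_def)
    qed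
    then show ?thesis by (simp add: vec_eq_iff)
  qed
  have mn: "norm m \<le> sqrt (second_moment M R)"
    unfolding mR by (rule order_trans[OF integral_norm_bound r])
  \<comment> \<open>Squaring \<open>norm (R \<omega>) + norm m\<close> crudely gives four times the
    second moment of \<open>R\<close>, hence the factor 2; comparing \<open>X\<close> with
    \<open>S\<close> adds one more to the final 3.\<close>
  have YS: "sqrt (\<integral>\<omega>. (norm (Y \<omega> - S \<omega>))\<^sup>2 \<partial>M) \<le> 2 * sqrt (second_moment M R)"
  proof -
    have "(\<integral>\<omega>. (norm (Y \<omega> - S \<omega>))\<^sup>2 \<partial>M) \<le> (\<integral>\<omega>. 2 * (norm (R \<omega>))\<^sup>2 + 2 * second_moment M R \<partial>M)"
    proof (rule integral_mono)
      have "square_integrable M (\<lambda>\<omega>. R \<omega> + (- m))" by (rule square_integrable_add[OF R square_integrable_const[OF M]])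
      moreover have e: "Y \<omega> - S \<omega> = R \<omega> + (- m)" for \<omega> by (simp add: Y_def X)
      ultimately show "integrable M (\<lambda>\<omega>. (norm (Y \<omega> - S \<omega>))\<^sup>2)" unfolding e by (simp add: square_integrable_def)
      show "integrable M (\<lambda>\<omega>. 2 * (norm (R \<omega>))\<^sup>2 + 2 * second_moment M R)" using RD(2) by simp
      fix \<omega>
      have "(norm (Y \<omega> - S \<omega>))\<^sup>2 \<le> (norm (R \<omega>) + norm m)\<^sup>2"
        unfolding e using norm_triangle_ineq[of "R \<omega>" "- m"] by (intro power_mono) auto
      also have "\<dots> \<le> 2 * (norm (R \<omega>))\<^sup>2 + 2 * (norm m)\<^sup>2"
        using zero_le_power2[of "norm (R \<omega>) - norm m"] by (simp add: power2_diff power2_sum)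
      also have "(norm m)\<^sup>2 \<le> second_moment M R"
        using power_mono[OF mn, of 2] r0 by simp
      finally show "(norm (Y \<omega> - S \<omega>))\<^sup>2 \<le> 2 * (norm (R \<omega>))\<^sup>2 + 2 * second_moment M R" by simp
    qed
    also have "\<dots> = 4 * second_moment M R" using RD(2) M.prob_space by (simp add: second_moment_def)
    finally have "sqrt (\<integral>\<omega>. (norm (Y \<omega> - S \<omega>))\<^sup>2 \<partial>M) \<le> sqrt (4 * second_moment M R)" by simp
    then show ?thesis by (simp add: real_sqrt_mult)
  qed
  show ?thesis
  proof (rule wasserstein1_le[OF M N])
    show "integrable M X" by (rule XD)
    have Zm: "Z \<in> borel_measurable N" by (rule standard_gaussian_integral(1)[OF Z, of "\<lambda>_. 0"]) simp
    have "integrable N (\<lambda>\<eta>. norm (mat_sqrt (covariance M X) *v Z \<eta>))"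
    proof (subst standard_gaussian_integral(3)[OF Z, of "\<lambda>z. norm (mat_sqrt (covariance M X) *v z)"])
      show "integrable gauss (\<lambda>z. norm (mat_sqrt (covariance M X) *v z))"
      proof (rule integrable_gauss_poly_bound)
        fix z
        have "norm (mat_sqrt (covariance M X) *v z) \<le> norm (mat_sqrt (covariance M X)) * norm z" by (rule matrix_vector_norm_le)
        also have "\<dots> \<le> norm (mat_sqrt (covariance M X)) * (1 + norm z) ^ 1" by (intro mult_left_mono) auto
        finally show "\<bar>norm (mat_sqrt (covariance M X) *v z)\<bar> \<le> norm (mat_sqrt (covariance M X)) * (1 + norm z) ^ 1" by simp
      qed measurable
    qed measurable
    moreover have "(\<lambda>\<eta>. mat_sqrt (covariance M X) *v Z \<eta>) \<in> borel_measurable N"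
      using measurable_compose[OF Zm matrix_vector_borel] .
    ultimately show "integrable N (\<lambda>\<eta>. mat_sqrt (covariance M X) *v Z \<eta>)" using integrable_norm_iff by blast
    fix f :: "real ^ 'n \<Rightarrow> real" assume lip: "\<And>x y. \<bar>f x - f y\<bar> \<le> norm (x - y)"
    have fm [measurable]: "f \<in> borel_measurable borel" by (rule borel_of_lipschitz[of _ 1]) (use lip in simp)
    have ff: "(\<integral>\<eta>. f (mat_sqrt (covariance M X) *v Z \<eta>) \<partial>N) = (\<integral>y. f y \<partial>gaussian (covariance M X))"
    proof -
      have "(\<integral>\<eta>. f (mat_sqrt (covariance M X) *v Z \<eta>) \<partial>N) = (\<integral>z. f (mat_sqrt (covariance M X) *v z) \<partial>gauss)"
        by (rule standard_gaussian_integral(2)[OF Z, of "\<lambda>z. f (mat_sqrt (covariance M X) *v z)"]) measurable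
      also have "\<dots> = (\<integral>y. f y \<partial>gaussian (covariance M X))"
        unfolding gaussian_def by (subst integral_distr) auto
      finally show ?thesis .
    qed
    have fX: "integrable M (\<lambda>\<omega>. f (X \<omega>))" by (rule lipschitz_integrable[OF M.finite_measure_axioms lip XD(4)])
    have fS: "integrable M (\<lambda>\<omega>. f (S \<omega>))" by (rule lipschitz_integrable[OF M.finite_measure_axioms lip SD(4)])
    have "(\<integral>\<omega>. f (X \<omega>) \<partial>M) - (\<integral>\<omega>. f (S \<omega>) \<partial>M) = (\<integral>\<omega>. f (X \<omega>) - f (S \<omega>) \<partial>M)" using fX fS by simp
    also have "\<dots> \<le> (\<integral>\<omega>. norm (R \<omega>) \<partial>M)"
    proof (rule integral_mono)
      show "integrable M (\<lambda>\<omega>. f (X \<omega>) - f (S \<omega>))" using fX fS by simp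
      show "integrable M (\<lambda>\<omega>. norm (R \<omega>))" by (rule RD)
      show "f (X \<omega>) - f (S \<omega>) \<le> norm (R \<omega>)" for \<omega> using lip[of "X \<omega>" "S \<omega>"] by (simp add: X)
    qed
    finally have 1: "(\<integral>\<omega>. f (X \<omega>) \<partial>M) - (\<integral>\<omega>. f (S \<omega>) \<partial>M) \<le> sqrt (second_moment M R)" using r by linarith
    have 2: "\<bar>(\<integral>y. f y \<partial>gaussian (covariance M X)) - (\<integral>y. f y \<partial>gaussian (\<chi> i j. \<integral>\<omega>. S \<omega> $ i * S \<omega> $ j \<partial>M))\<bar>
        \<le> 2 * sqrt (second_moment M R)"
      unfolding cov
      by (rule order_trans[OF gaussian_lipschitz_le_L2[OF M YD(1) SD(1) YD(6) SD(6) lip] YS])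
    show "(\<integral>\<omega>. f (X \<omega>) \<partial>M) - (\<integral>\<eta>. f (mat_sqrt (covariance M X) *v Z \<eta>) \<partial>N) \<le> D + 3 * sqrt (second_moment M R)"
      unfolding ff using 1 2 clt[OF lip] by linarith
  qed
qed

section \<open>The approximation bound under abstract step-size conditions\<close>

lemma stepsize_pos: "0 < \<alpha> \<Longrightarrow> 0 < K \<Longrightarrow> 0 < stepsize \<alpha> K \<xi> j"
  by (simp add: stepsize_def)

text \<open>The four step-size conditions are all that the three regimes have to supply: the first
  lets half of the contraction absorb the error terms, the second keeps the factor
  \<open>1 - iota H * a j\<close> nonnegative, and the last two feed
  \<open>step_weight_bound\<close>. The constants \<open>C\<close> and \<open>c\<close> are fixed
  before \<alpha>, \<open>K\<close>, \<xi>, \<open>z0\<close> and \<open>k\<close>, so that each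
  regime may choose its own threshold from them.\<close>

lemma iterate_gaussian_approximation:
  fixes M :: "'w measure" and N :: "'v measure" and H :: "real ^ 'n ^ 'n"
    and noise :: "nat \<Rightarrow> 'w \<Rightarrow> real ^ 'n" and Z :: "'v \<Rightarrow> real ^ 'n"
  assumes M: "prob_space M" and H: "hurwitz H"
    and ind: "prob_space.indep_vars M (\<lambda>_. borel) noise UNIV"
    and ident: "\<And>k. distr M borel (noise k) = distr M borel (noise 0)"
    and third: "\<And>k. integrable M (\<lambda>\<omega>. norm (noise k \<omega>) ^ 3)"
    and mean: "\<And>k. (\<integral>\<omega>. noise k \<omega> \<partial>M) = 0"
    and N: "prob_space N" and Z: "standard_gaussian N Z"
  obtains C c where "1 \<le> C" "0 \<le> c" "0 < iota H"
    "\<And>\<alpha> K \<xi> z0 k. 0 < \<alpha> \<Longrightarrow> 0 < K \<Longrightarrow> 0 \<le> \<xi> \<Longrightarrow>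
      (\<And>j. c * stepsize \<alpha> K \<xi> j + \<xi> / (2 * \<alpha> * (real j + K) powr (1 - \<xi>)) \<le> iota H) \<Longrightarrow>
      (\<And>j. iota H * stepsize \<alpha> K \<xi> j \<le> 1) \<Longrightarrow>
      (\<And>j. (1 - iota H * stepsize \<alpha> K \<xi> j) * sqrt (stepsize \<alpha> K \<xi> j) \<le> sqrt (stepsize \<alpha> K \<xi> (Suc j))) \<Longrightarrow>
      (\<And>j. stepsize \<alpha> K \<xi> j \<le> 2 * stepsize \<alpha> K \<xi> (Suc j)) \<Longrightarrow> square_integrable M z0 \<Longrightarrow>
      wasserstein1 M (iterate H \<alpha> K \<xi> noise z0 k) N
          (\<lambda>\<eta>. mat_sqrt (covariance M (iterate H \<alpha> K \<xi> noise z0 k)) *v Z \<eta>)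
        \<le> ennreal (C * sqrt (stepsize \<alpha> K \<xi> k) * (1 + ln (C + C / stepsize \<alpha> K \<xi> k))
          + C * (exp (- (iota H * (\<Sum>j<k. stepsize \<alpha> K \<xi> j))) * sqrt (second_moment M z0)))"
proof -
  interpret M: prob_space M by fact
  define \<rho> where "\<rho> = distr M borel (noise 0)"
  have law: "distr M borel (noise i) = \<rho>" for i using ident[of i] by (simp add: \<rho>_def)
  have nm [measurable]: "noise i \<in> borel_measurable M" for i using ind unfolding M.indep_vars_def by auto
  have ni: "integrable M (noise 0)"
  proof -
    have "integrable M (\<lambda>\<omega>. norm (noise 0 \<omega>))"
    proof (rule Bochner_Integration.integrable_bound)
      show "integrable M (\<lambda>\<omega>. 1 + norm (noise 0 \<omega>) ^ 3)" using third by simp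
      show "AE \<omega> in M. norm (norm (noise 0 \<omega>)) \<le> norm (1 + norm (noise 0 \<omega>) ^ 3)"
      proof (rule AE_I2)
        fix \<omega>
        let ?t = "norm (noise 0 \<omega>)"
        have "?t \<le> 1 + ?t ^ 3"
        proof (cases "?t \<le> 1")
          case True
          then show ?thesis by (simp add: add_increasing2)
        next
          case False
          then have "?t ^ 1 \<le> ?t ^ 3" by (intro power_increasing) auto
          then show ?thesis by simp
        qed
        then show "norm ?t \<le> norm (1 + ?t ^ 3)" by simp
      qed
    qed measurable
    then show ?thesis using integrable_norm_iff nm by blast
  qed
  interpret centered_law \<rho>
  proof -
    have p: "prob_space \<rho>" unfolding \<rho>_def by (rule M.prob_space_distr) simp
    have i3: "integrable \<rho> (\<lambda>y. norm y ^ 3)" unfolding \<rho>_def using third[of 0] by (subst integrable_distr_eq) auto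
    have c: "(\<integral>y. y $ i \<partial>\<rho>) = 0" for i
    proof -
      have "(\<integral>y. y $ i \<partial>\<rho>) = (\<integral>\<omega>. noise 0 \<omega> $ i \<partial>M)" unfolding \<rho>_def by (subst integral_distr) auto
      also have "\<dots> = 0" using integral_bounded_linear[OF bounded_linear_vec_nth ni, of i] mean[of 0] by simp
      finally show ?thesis .
    qed
    show "centered_law \<rho>"
      using p i3 c by (simp add: centered_law_def centered_law_axioms_def third_moment_law_def third_moment_law_axioms_def \<rho>_def)
  qed
  obtain C0 where C0: "0 \<le> C0" "\<And>(M :: 'w measure) noise (B :: nat \<Rightarrow> real ^ 'n ^ 'n) t k f.
    prob_space M \<Longrightarrow> prob_space.indep_vars M (\<lambda>_. borel) noise UNIV \<Longrightarrow> (\<And>i. distr M borel (noise i) = \<rho>) \<Longrightarrow> 0 < t \<Longrightarrow>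
    (\<And>i y. i < k \<Longrightarrow> norm (B i *v y) \<le> t * norm y) \<Longrightarrow> (\<And>x y. \<bar>f x - f y\<bar> \<le> norm (x - y)) \<Longrightarrow>
    \<bar>(\<integral>\<omega>. f (\<Sum>i<k. B i *v noise i \<omega>) \<partial>M) - (\<integral>y. f y \<partial>gaussian (\<Sum>i<k. B i ** second_moments \<rho> ** transpose (B i)))\<bar>
      \<le> C0 * t * (1 + ln (real CARD('n) + (\<Sum>i<k. trace (B i ** second_moments \<rho> ** transpose (B i))) / t\<^sup>2))"
    by (rule lindeberg_clt) blast
  obtain W L :: "real ^ 'n ^ 'n" and c where W: "0 \<le> c" "0 < iota H" "L ** W = mat 1"
    "\<And>a b x. 0 \<le> a \<Longrightarrow> 0 \<le> b \<Longrightarrow>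
      norm (W *v ((mat 1 + a *\<^sub>R (H + b *\<^sub>R mat 1)) *v x)) \<le> (1 - 2 * iota H * a + c * a\<^sup>2 + a * b) * norm (W *v x)"
    by (rule hurwitz_contraction[OF H]) blast
  \<comment> \<open>The cost of passing to the weighted norm by \<open>W\<close> and back by
    \<open>L\<close>; adding 1 secures \<open>1 \<le> c0\<close>.\<close>
  define c0 where "c0 = norm L * norm W + 1"
  have c0: "1 \<le> c0" by (simp add: c0_def)
  define S0 where "S0 = trace (second_moments \<rho>)"
  have S0: "0 \<le> S0" unfolding S0_def by (rule trace_psd_nonneg[OF psd_second_moments])
  define q where "q = sqrt 2 * c0"
  have q: "1 \<le> q" "0 < q"
  proof -
    have "1 * 1 \<le> sqrt 2 * c0" using c0 by (intro mult_mono) auto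
    then show "1 \<le> q" "0 < q" by (auto simp: q_def)
  qed
  \<comment> \<open>One constant for all uses: the factor of the replacement bound, the dimension
    and the total covariance inside the logarithm, and the factor \<open>3 * c0\<close> of the
    initial term.\<close>
  define C where "C = C0 * q + real CARD('n) + c0\<^sup>2 * S0 / iota H + 3 * c0"
  have Cge: "C0 * q \<le> C" "real CARD('n) \<le> C" "c0\<^sup>2 * S0 / iota H \<le> C" "3 * c0 \<le> C" "1 \<le> C"
    using C0(1) q c0 S0 W(2) by (auto simp: C_def add_increasing add_increasing2)
  show ?thesis
  proof (rule that[of C c])
    show "1 \<le> C" "0 \<le> c" "0 < iota H" by (fact Cge W)+
    fix \<alpha> K \<xi> :: real and z0 :: "'w \<Rightarrow> real ^ 'n" and k :: nat
    assume \<alpha>: "0 < \<alpha>" and K: "0 < K" and \<xi>: "0 \<le> \<xi>"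
      and c1: "\<And>j. c * stepsize \<alpha> K \<xi> j + \<xi> / (2 * \<alpha> * (real j + K) powr (1 - \<xi>)) \<le> iota H"
      and c2: "\<And>j. iota H * stepsize \<alpha> K \<xi> j \<le> 1"
      and c3: "\<And>j. (1 - iota H * stepsize \<alpha> K \<xi> j) * sqrt (stepsize \<alpha> K \<xi> j) \<le> sqrt (stepsize \<alpha> K \<xi> (Suc j))"
      and c4: "\<And>j. stepsize \<alpha> K \<xi> j \<le> 2 * stepsize \<alpha> K \<xi> (Suc j)" and z0: "square_integrable M z0"
    define a where "a = stepsize \<alpha> K \<xi>"
    have a: "0 < a j" for j unfolding a_def by (rule stepsize_pos[OF \<alpha> K])
    define b where "b j = \<xi> / (2 * \<alpha> * (real j + K) powr (1 - \<xi>))" for j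
    have b: "0 \<le> b j" for j unfolding b_def using \<alpha> \<xi> by simp
    define A where "A j = mat 1 + a j *\<^sub>R drift H \<alpha> K \<xi> j" for j
    define r where "r j = 1 - iota H * a j" for j
    have r: "0 \<le> r j" for j using c2[of j] by (simp add: r_def a_def)
    have Wr: "norm (W *v (A j *v x)) \<le> r j * norm (W *v x)" for j x
    proof -
      have "norm (W *v (A j *v x)) \<le> (1 - 2 * iota H * a j + c * (a j)\<^sup>2 + a j * b j) * norm (W *v x)"
        using W(4)[of "a j" "b j" x] a[of j] b[of j] by (simp add: A_def drift_def b_def)
      also have "\<dots> \<le> r j * norm (W *v x)"
      proof (rule mult_right_mono)
        \<comment> \<open>Here one of the two units of \<open>iota H\<close> is spent on the
          quadratic term and on the correction \<open>b j\<close> of the drift.\<close>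
        have "a j * (c * a j + b j) \<le> a j * iota H"
          using c1[of j] a[of j] by (intro mult_left_mono) (auto simp: a_def b_def)
        then show "1 - 2 * iota H * a j + c * (a j)\<^sup>2 + a j * b j \<le> r j"
          by (simp add: r_def power2_eq_square algebra_simps)
      qed simp
      finally show ?thesis .
    qed
    have P: "norm (propagator A j m *v x) \<le> c0 * (\<Prod>i=j..<m. r i) * norm x" for j m x
    proof -
      let ?y = "propagator A j m *v x"
      have pr: "0 \<le> (\<Prod>i=j..<m. r i)" using r by (intro prod_nonneg) auto
      have "?y = L *v (W *v ?y)" by (simp add: matrix_vector_mul_assoc matrix_mul_assoc W(3))
      then have "norm ?y \<le> norm L * norm (W *v ?y)" using matrix_vector_norm_le[of L "W *v ?y"] by simp
      also have "\<dots> \<le> norm L * ((\<Prod>i=j..<m. r i) * norm (W *v x))"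
        by (intro mult_left_mono propagator_norm Wr r) auto
      also have "\<dots> \<le> norm L * ((\<Prod>i=j..<m. r i) * (norm W * norm x))"
        by (intro mult_left_mono matrix_vector_norm_le pr) auto
      also have "\<dots> = (norm L * norm W) * ((\<Prod>i=j..<m. r i) * norm x)" by simp
      also have "\<dots> \<le> c0 * ((\<Prod>i=j..<m. r i) * norm x)" using pr by (intro mult_right_mono) (auto simp: c0_def)
      finally show ?thesis by simp
    qed
    define B where "B j = sqrt (a j) *\<^sub>R propagator A (Suc j) k" for j
    define \<beta> where "\<beta> j = sqrt (a j) * (\<Prod>i=Suc j..<k. r i)" for j
    have B: "norm (B j *v y) \<le> (c0 * \<beta> j) * norm y" for j y
    proof -
      have "norm (B j *v y) = sqrt (a j) * norm (propagator A (Suc j) k *v y)"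
        using a[of j] by (simp add: B_def scaleR_matrix_vector_assoc[symmetric])
      also have "\<dots> \<le> sqrt (a j) * (c0 * (\<Prod>i=Suc j..<k. r i) * norm y)"
        using a[of j] by (intro mult_left_mono P) auto
      finally show ?thesis by (simp add: \<beta>_def mult_ac)
    qed
    \<comment> \<open>The smoothing scale is the uniform bound on the weights: \<open>sqrt 2\<close>
      from \<open>step_weight_bound\<close>, \<open>c0\<close> from the change of norm.\<close>
    define t where "t = q * sqrt (a k)"
    have t: "0 < t" using q a[of k] by (simp add: t_def)
    have Bt: "norm (B j *v y) \<le> t * norm y" if "j < k" for j y
    proof -
      have "\<beta> j \<le> sqrt 2 * sqrt (a k)"
        unfolding \<beta>_def using c3 c4 by (intro step_weight_bound a r that) (simp_all add: r_def a_def)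
      then have "c0 * \<beta> j \<le> t" using c0 mult_left_mono[of "\<beta> j" "sqrt 2 * sqrt (a k)" c0] by (simp add: t_def q_def mult_ac)
      then show ?thesis using B[of j y] mult_right_mono[of "c0 * \<beta> j" t "norm y"] by simp
    qed
    define s where "s = (\<Sum>i<k. trace (B i ** second_moments \<rho> ** transpose (B i)))"
    have s: "s \<le> c0\<^sup>2 * S0 / iota H"
    proof -
      have "s \<le> (\<Sum>i<k. (c0 * \<beta> i)\<^sup>2 * S0)" unfolding s_def S0_def by (intro sum_mono trace_contraction B)
      also have "\<dots> = (c0\<^sup>2 * S0) * (\<Sum>i<k. (\<beta> i)\<^sup>2)" by (simp add: power_mult_distrib sum_distrib_left mult_ac)
      also have "(\<Sum>i<k. (\<beta> i)\<^sup>2) \<le> 1 / iota H"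
        unfolding \<beta>_def r_def using c2 by (intro step_weight_sum a W) (simp add: a_def)
      finally show ?thesis using S0 by (simp add: mult_left_mono)
    qed
    have s0: "0 \<le> s" unfolding s_def by (intro sum_nonneg trace_psd_nonneg psd_congruence psd_second_moments)
    define D where "D = C * sqrt (a k) * (1 + ln (C + C / a k))"
    have D: "C0 * t * (1 + ln (real CARD('n) + s / t\<^sup>2)) \<le> D"
    proof -
      have st: "s / t\<^sup>2 \<le> C / a k"
      proof -
        have "a k \<le> t\<^sup>2"
        proof -
          have "1 * a k \<le> q\<^sup>2 * a k" using q a[of k] by (intro mult_right_mono) (auto simp: one_le_power)
          then show ?thesis using a[of k] by (simp add: t_def power_mult_distrib)
        qed
        then have "s / t\<^sup>2 \<le> s / a k" using a[of k] s0 t by (intro divide_left_mono) auto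
        also have "\<dots> \<le> C / a k" using s Cge(3) a[of k] by (intro divide_right_mono) auto
        finally show ?thesis .
      qed
      have N1: "1 \<le> real CARD('n)" by (simp add: Suc_leI)
      have p0: "0 \<le> s / t\<^sup>2" using s0 by simp
      have l0: "0 \<le> ln (real CARD('n) + s / t\<^sup>2)" using N1 p0 by (intro ln_ge_zero) linarith
      have "ln (real CARD('n) + s / t\<^sup>2) \<le> ln (C + C / a k)"
      proof -
        have "real CARD('n) + s / t\<^sup>2 \<le> C + C / a k" using st Cge(2) by linarith
        moreover have "0 < real CARD('n) + s / t\<^sup>2" using N1 p0 by linarith
        ultimately show ?thesis by simp
      qed
      then have "C0 * t * (1 + ln (real CARD('n) + s / t\<^sup>2)) \<le> C0 * t * (1 + ln (C + C / a k))"
        using C0(1) t by (intro mult_left_mono) auto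
      also have "\<dots> = (C0 * q) * (sqrt (a k) * (1 + ln (C + C / a k)))" by (simp add: t_def)
      also have "\<dots> \<le> C * (sqrt (a k) * (1 + ln (C + C / a k)))"
        using l0 \<open>ln (real CARD('n) + s / t\<^sup>2) \<le> ln (C + C / a k)\<close> a[of k]
        by (intro mult_right_mono Cge mult_nonneg_nonneg) auto
      finally show ?thesis by (simp add: D_def mult.assoc)
    qed
    define S where "S \<omega> = (\<Sum>i<k. B i *v noise i \<omega>)" for \<omega>
    define R where "R \<omega> = propagator A 0 k *v z0 \<omega>" for \<omega>
    define p where "p = c0 * exp (- (iota H * (\<Sum>j<k. a j)))"
    have Pp: "norm (propagator A 0 k *v x) \<le> p * norm x" for x
    proof -
      have "(\<Prod>i=0..<k. r i) \<le> exp (- (iota H * (\<Sum>j<k. a j)))"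
        unfolding r_def using c2 by (intro prod_le_exp_sum) (simp add: a_def)
      then have "c0 * (\<Prod>i=0..<k. r i) * norm x \<le> p * norm x"
        using c0 unfolding p_def by (intro mult_right_mono mult_left_mono) auto
      then show ?thesis using P[of 0 k x] by linarith
    qed
    have p0: "0 \<le> p" using c0 by (simp add: p_def)
    have R2: "square_integrable M R" unfolding R_def by (rule square_integrable_matrix(1)[OF z0 Pp])
    have Rm: "second_moment M R \<le> p\<^sup>2 * second_moment M z0" unfolding R_def by (rule square_integrable_matrix(2)[OF z0 Pp])
    have X: "iterate H \<alpha> K \<xi> noise z0 k = (\<lambda>\<omega>. R \<omega> + S \<omega>)"
    proof
      fix \<omega>
      have "A = (\<lambda>k. mat 1 + stepsize \<alpha> K \<xi> k *\<^sub>R drift H \<alpha> K \<xi> k)" by (rule ext) (simp add: A_def a_def)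
      then show "iterate H \<alpha> K \<xi> noise z0 k \<omega> = R \<omega> + S \<omega>"
        unfolding iterate_eq_propagator R_def S_def B_def a_def by simp
    qed
    have "wasserstein1 M (iterate H \<alpha> K \<xi> noise z0 k) N (\<lambda>\<eta>. mat_sqrt (covariance M (iterate H \<alpha> K \<xi> noise z0 k)) *v Z \<eta>)
        \<le> ennreal (D + 3 * sqrt (second_moment M R))"
    proof (rule wasserstein1_gaussian_perturbation[OF M N Z _ _ R2 X])
      show "square_integrable M S" unfolding S_def by (rule moments_linear_sum[OF M ind law])
      show "(\<integral>\<omega>. S \<omega> $ i \<partial>M) = 0" for i unfolding S_def by (rule moments_linear_sum[OF M ind law])
      fix f :: "real ^ 'n \<Rightarrow> real" assume lip: "\<And>x y. \<bar>f x - f y\<bar> \<le> norm (x - y)"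
      have "\<bar>(\<integral>\<omega>. f (S \<omega>) \<partial>M) - (\<integral>y. f y \<partial>gaussian (\<chi> i j. \<integral>\<omega>. S \<omega> $ i * S \<omega> $ j \<partial>M))\<bar>
          \<le> C0 * t * (1 + ln (real CARD('n) + s / t\<^sup>2))"
        unfolding S_def moments_linear_sum(4)[OF M ind law] s_def by (rule C0(2)[OF M ind law t Bt lip])
      then show "\<bar>(\<integral>\<omega>. f (S \<omega>) \<partial>M) - (\<integral>y. f y \<partial>gaussian (\<chi> i j. \<integral>\<omega>. S \<omega> $ i * S \<omega> $ j \<partial>M))\<bar> \<le> D"
        using D by linarith
    qed
    also have "\<dots> \<le> ennreal (D + C * (exp (- (iota H * (\<Sum>j<k. a j))) * sqrt (second_moment M z0)))"
    proof (intro ennreal_leI add_left_mono)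
      have E0: "0 \<le> second_moment M z0" by (simp add: second_moment_def)
      have "sqrt (second_moment M R) \<le> sqrt (p\<^sup>2 * second_moment M z0)" using Rm by simp
      also have "\<dots> = p * sqrt (second_moment M z0)" using p0 by (simp add: real_sqrt_mult)
      finally have "3 * sqrt (second_moment M R) \<le> 3 * (p * sqrt (second_moment M z0))" by simp
      also have "\<dots> = (3 * c0) * (exp (- (iota H * (\<Sum>j<k. a j))) * sqrt (second_moment M z0))" by (simp add: p_def)
      also have "\<dots> \<le> C * (exp (- (iota H * (\<Sum>j<k. a j))) * sqrt (second_moment M z0))"
        using E0 by (intro mult_right_mono Cge) auto
      finally show "3 * sqrt (second_moment M R) \<le> C * (exp (- (iota H * (\<Sum>j<k. a j))) * sqrt (second_moment M z0))" .
    qed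
    finally show "wasserstein1 M (iterate H \<alpha> K \<xi> noise z0 k) N
          (\<lambda>\<eta>. mat_sqrt (covariance M (iterate H \<alpha> K \<xi> noise z0 k)) *v Z \<eta>)
        \<le> ennreal (C * sqrt (stepsize \<alpha> K \<xi> k) * (1 + ln (C + C / stepsize \<alpha> K \<xi> k))
          + C * (exp (- (iota H * (\<Sum>j<k. stepsize \<alpha> K \<xi> j))) * sqrt (second_moment M z0)))"
      by (simp add: D_def a_def)
  qed
qed

section \<open>The three step-size regimes\<close>

text \<open>Bernoulli's inequality for exponents in [0, 1], obtained as the weighted
  arithmetic-geometric mean inequality for \<open>1 + 1 / x\<close> and 1.\<close>

lemma powr_plus_one_le:
  fixes x p :: real
  assumes "0 < x" "0 \<le> p" "p \<le> 1"
  shows "(x + 1) powr p \<le> x powr p * (1 + p / x)"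
proof -
  have "(1 + 1 / x) powr p * 1 powr (1 - p) \<le> p * (1 + 1 / x) + (1 - p) * 1"
    using assms by (intro Youngs_inequality_0) (auto simp: add_pos_nonneg)
  then have "(1 + 1 / x) powr p \<le> 1 + p / x" by (simp add: algebra_simps)
  moreover have "x + 1 = x * (1 + 1 / x)" using assms by (simp add: field_simps)
  ultimately show ?thesis using assms(1) by (simp add: powr_mult)
qed

text \<open>Consecutive step sizes have a ratio of at least \<open>1 / (1 + \<xi> / n)\<close> with
  \<open>n = j + K\<close>. For \<open>x = l * a\<close> the hypothesis \<open>lower\<close> on the
  drift correction says that \<open>\<xi> / n \<le> 2 * x\<close>, and
  \<open>(1 - x)^2 * (1 + 2 * x) \<le> 1\<close> then lets one contraction factor make up for the
  decrease of the step size.\<close>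

lemma stepsize_decay:
  fixes \<alpha> K \<xi> l :: real
  assumes \<alpha>: "0 < \<alpha>" and K: "1 \<le> K" and \<xi>: "0 < \<xi>" "\<xi> \<le> 1"
    and lower: "\<xi> / (2 * \<alpha> * (real j + K) powr (1 - \<xi>)) \<le> l" and upper: "l * stepsize \<alpha> K \<xi> j \<le> 1"
  shows "stepsize \<alpha> K \<xi> j \<le> 2 * stepsize \<alpha> K \<xi> (Suc j)"
    and "(1 - l * stepsize \<alpha> K \<xi> j) * sqrt (stepsize \<alpha> K \<xi> j) \<le> sqrt (stepsize \<alpha> K \<xi> (Suc j))"
proof -
  define n where "n = real j + K"
  have n: "1 \<le> n" using K by (simp add: n_def)
  define a where "a = stepsize \<alpha> K \<xi> j"
  have a: "a = \<alpha> / n powr \<xi>" "0 < a" using n \<alpha> by (auto simp: a_def stepsize_def n_def)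
  have S: "stepsize \<alpha> K \<xi> (Suc j) = \<alpha> / (n + 1) powr \<xi>" by (simp add: stepsize_def n_def add_ac)
  have b: "a / (1 + \<xi> / n) \<le> stepsize \<alpha> K \<xi> (Suc j)"
  proof -
    have "\<alpha> / (n powr \<xi> * (1 + \<xi> / n)) \<le> \<alpha> / (n + 1) powr \<xi>"
      using n \<alpha> \<xi> by (intro divide_left_mono powr_plus_one_le) (auto simp: add_pos_nonneg)
    then show ?thesis by (simp add: S a)
  qed
  have "a / 2 \<le> a / (1 + \<xi> / n)"
    using n \<xi> a(2) by (intro divide_left_mono) (auto simp: add_pos_nonneg field_simps)
  with b have "a / 2 \<le> stepsize \<alpha> K \<xi> (Suc j)" by linarith
  then show "stepsize \<alpha> K \<xi> j \<le> 2 * stepsize \<alpha> K \<xi> (Suc j)" by (simp add: a_def)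
  define x where "x = l * a"
  have x1: "x \<le> 1" using upper by (simp add: x_def a_def)
  have x0: "\<xi> / (2 * n) \<le> x"
  proof -
    have "\<xi> / (2 * n) = \<xi> / (2 * \<alpha> * n powr (1 - \<xi>)) * a"
      using n \<alpha> by (simp add: a powr_diff)
    also have "\<dots> \<le> x" unfolding x_def using lower a(2) by (intro mult_right_mono) (auto simp: n_def)
    finally show ?thesis .
  qed
  have xp: "0 \<le> x" using x0 n \<xi> by (smt (verit) divide_nonneg_nonneg)
  have "(1 - x)\<^sup>2 * (1 + \<xi> / n) \<le> (1 - x)\<^sup>2 * (1 + 2 * x)"
    using x0 by (intro mult_left_mono) auto
  also have "\<dots> = 1 - x\<^sup>2 * (1 + 2 * (1 - x))" by (simp add: power2_eq_square algebra_simps)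
  also have "\<dots> \<le> 1" using x1 by simp
  finally have "(1 - x)\<^sup>2 \<le> 1 / (1 + \<xi> / n)" using n \<xi> by (simp add: pos_le_divide_eq add_pos_nonneg)
  from mult_right_mono[OF this, of a] have "(1 - x)\<^sup>2 * a \<le> stepsize \<alpha> K \<xi> (Suc j)" using b a(2) by simp
  then have "sqrt ((1 - x)\<^sup>2 * a) \<le> sqrt (stepsize \<alpha> K \<xi> (Suc j))" by simp
  then show "(1 - l * stepsize \<alpha> K \<xi> j) * sqrt (stepsize \<alpha> K \<xi> j) \<le> sqrt (stepsize \<alpha> K \<xi> (Suc j))"
    using x1 by (simp add: real_sqrt_mult x_def a_def)
qed

text \<open>All terms tend to 0, except that for \<open>\<xi> = 1\<close> the drift correction is
  the constant \<open>1 / (2 * \<alpha>)\<close>; \<open>crit\<close> states that it lies strictly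
  below \<open>l\<close>. Stating the claim in the real variable \<open>x = j + K\<close> makes one
  threshold for \<open>K\<close> serve all \<open>j\<close>.\<close>

lemma eventually_stepsize_small:
  fixes \<alpha> \<xi> l c :: real
  assumes \<alpha>: "0 < \<alpha>" and \<xi>: "0 < \<xi>" "\<xi> \<le> 1" and l: "0 < l" and crit: "\<xi> = 1 \<Longrightarrow> 1 / 2 < l * \<alpha>"
  shows "eventually (\<lambda>x. c * (\<alpha> / x powr \<xi>) + \<xi> / (2 * \<alpha> * x powr (1 - \<xi>)) \<le> l \<and> l * (\<alpha> / x powr \<xi>) \<le> 1) at_top"
proof -
  have p: "((\<lambda>x::real. x powr - s) \<longlongrightarrow> 0) at_top" if "0 < s" for s
    using that tendsto_neg_powr[OF _ filterlim_ident, of "- s"] by simp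
  have "((\<lambda>x::real. l * (\<alpha> * x powr - \<xi>)) \<longlongrightarrow> l * (\<alpha> * 0)) at_top"
    by (intro tendsto_intros p \<xi>)
  then have e2: "eventually (\<lambda>x. l * (\<alpha> / x powr \<xi>) < 1) at_top"
    by (intro order_tendstoD(2)[of _ 0]) (simp_all add: powr_minus_divide)
  define m where "m = (if \<xi> = 1 then 1 / (2 * \<alpha>) else 0)"
  have m: "m < l" using l crit \<alpha> by (simp add: m_def field_simps)
  have q: "((\<lambda>x::real. \<xi> / (2 * \<alpha>) * x powr - (1 - \<xi>)) \<longlongrightarrow> m) at_top"
  proof (cases "\<xi> = 1")
    case True
    have "eventually (\<lambda>x::real. \<xi> / (2 * \<alpha>) * x powr - (1 - \<xi>) = m) at_top"
      using eventually_gt_at_top[of 0] by eventually_elim (simp add: True m_def)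
    then show ?thesis by (rule tendsto_eventually)
  next
    case False
    have "((\<lambda>x::real. \<xi> / (2 * \<alpha>) * x powr - (1 - \<xi>)) \<longlongrightarrow> \<xi> / (2 * \<alpha>) * 0) at_top"
      using False \<xi> by (intro tendsto_intros p) auto
    then show ?thesis using False by (simp add: m_def)
  qed
  have "((\<lambda>x::real. c * (\<alpha> * x powr - \<xi>) + \<xi> / (2 * \<alpha>) * x powr - (1 - \<xi>)) \<longlongrightarrow> c * (\<alpha> * 0) + m) at_top"
    by (intro tendsto_intros p \<xi> q)
  then have "eventually (\<lambda>x::real. c * (\<alpha> * x powr - \<xi>) + \<xi> / (2 * \<alpha>) * x powr - (1 - \<xi>) < l) at_top"
    using m by (intro order_tendstoD) simp_all
  with e2 show ?thesis
    by eventually_elim (simp add: powr_minus_divide del: minus_diff_eq)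
qed

text \<open>Comparison of the sum with an integral, done by telescoping: concavity bounds each
  increment of the power by the corresponding step size.\<close>

lemma stepsize_sum_powr:
  fixes \<alpha> K \<xi> :: real
  assumes "0 < \<alpha>" "0 < K" "0 < \<xi>" "\<xi> < 1"
  shows "\<alpha> / (1 - \<xi>) * ((real k + K) powr (1 - \<xi>) - K powr (1 - \<xi>)) \<le> (\<Sum>j<k. stepsize \<alpha> K \<xi> j)"
proof (induction k)
  case (Suc k)
  define n where "n = real k + K"
  have n: "0 < n" using assms by (simp add: n_def)
  have "(n + 1) powr (1 - \<xi>) \<le> n powr (1 - \<xi>) * (1 + (1 - \<xi>) / n)"
    using assms n by (intro powr_plus_one_le) auto
  also have "\<dots> = n powr (1 - \<xi>) + (1 - \<xi>) / n powr \<xi>" using n by (simp add: powr_diff field_simps)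
  finally have "\<alpha> / (1 - \<xi>) * (n + 1) powr (1 - \<xi>) \<le> \<alpha> / (1 - \<xi>) * (n powr (1 - \<xi>) + (1 - \<xi>) / n powr \<xi>)"
    using assms by (intro mult_left_mono) auto
  also have "\<dots> = \<alpha> / (1 - \<xi>) * n powr (1 - \<xi>) + stepsize \<alpha> K \<xi> k"
    using assms by (simp add: stepsize_def n_def distrib_left)
  finally show ?case using Suc by (simp add: n_def right_diff_distrib add_ac)
qed simp

lemma stepsize_sum_ln:
  fixes \<alpha> K :: real
  assumes "0 < \<alpha>" "0 < K"
  shows "\<alpha> * (ln (real k + K) - ln K) \<le> (\<Sum>j<k. stepsize \<alpha> K 1 j)"
proof (induction k)
  case (Suc k)
  define n where "n = real k + K"
  have n: "0 < n" using assms by (simp add: n_def)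
  have "ln (1 + 1 / n) \<le> 1 / n" using n by (intro ln_add_one_self_le_self) simp
  moreover have "ln (1 + 1 / n) = ln (n + 1) - ln n"
    using n ln_div[of "n + 1" n] by (simp add: add_divide_distrib)
  ultimately have "\<alpha> * (ln (n + 1) - ln n) \<le> \<alpha> * (1 / n)" using assms by (intro mult_left_mono) auto
  also have "\<dots> = stepsize \<alpha> K 1 k" using n by (simp add: stepsize_def n_def)
  finally show ?case using Suc by (simp add: n_def right_diff_distrib add_ac)
qed simp

lemma stepsize_rate:
  fixes C \<alpha> K \<xi> :: real
  assumes C: "1 \<le> C" and \<alpha>: "0 < \<alpha>" and K: "2 \<le> K" and \<xi>: "0 < \<xi>" "\<xi> \<le> 1" and k: "1 \<le> k"
  shows "C * sqrt (stepsize \<alpha> K \<xi> k) * (1 + ln (C + C / stepsize \<alpha> K \<xi> k))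
    \<le> C * sqrt \<alpha> * (2 + \<bar>ln (C * (1 + 1 / \<alpha>))\<bar>) * (ln (real k + K) / (real k + K) powr (\<xi> / 2))"
proof -
  define x where "x = real k + K"
  \<comment> \<open>From \<open>1 \<le> k\<close> and \<open>2 \<le> K\<close>; since 3 exceeds
    \<open>exp 1\<close>, the logarithm of \<open>x\<close> is at least 1 and can absorb the
    additive constants.\<close>
  have x: "3 \<le> x" using K k by (simp add: x_def)
  have a: "stepsize \<alpha> K \<xi> k = \<alpha> / x powr \<xi>" by (simp add: stepsize_def x_def)
  have "sqrt (x powr \<xi>) = x powr (\<xi> / 2)"
    using x by (intro real_sqrt_unique) (auto simp: power2_eq_square powr_add[symmetric])
  then have s: "sqrt (stepsize \<alpha> K \<xi> k) = sqrt \<alpha> / x powr (\<xi> / 2)" by (simp add: a real_sqrt_divide)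
  have l1: "1 \<le> ln x" using x exp_le by (subst ln_ge_iff) auto
  define Q where "Q = C * (1 + 1 / \<alpha>)"
  have Q: "0 < Q" using C \<alpha> by (simp add: Q_def add_pos_nonneg)
  have "x powr \<xi> \<le> x powr 1" using x \<xi> by (intro powr_mono) auto
  then have "C * x powr \<xi> / \<alpha> \<le> C * x / \<alpha>" using x C \<alpha> by (intro divide_right_mono mult_left_mono) auto
  moreover have "C * 1 \<le> C * x" using x C by (intro mult_left_mono) auto
  ultimately have "C + C / stepsize \<alpha> K \<xi> k \<le> Q * x" by (simp add: a Q_def algebra_simps)
  moreover have "0 < C + C / stepsize \<alpha> K \<xi> k" using C \<alpha> x by (simp add: a add_pos_nonneg)
  ultimately have "ln (C + C / stepsize \<alpha> K \<xi> k) \<le> ln (Q * x)" by simp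
  also have "\<dots> = ln Q + ln x" using Q x by (simp add: ln_mult)
  finally have "1 + ln (C + C / stepsize \<alpha> K \<xi> k) \<le> (2 + \<bar>ln Q\<bar>) * ln x"
    using l1 mult_left_mono[OF l1, of "\<bar>ln Q\<bar>"] by (simp add: distrib_right)
  then have "C * sqrt (stepsize \<alpha> K \<xi> k) * (1 + ln (C + C / stepsize \<alpha> K \<xi> k))
      \<le> C * sqrt (stepsize \<alpha> K \<xi> k) * ((2 + \<bar>ln Q\<bar>) * ln x)"
    using C \<alpha> x by (intro mult_left_mono) (auto simp: a)
  then show ?thesis by (simp add: s Q_def x_def)
qed

text \<open>For \<open>\<alpha> < 1 / 2\<close> the factor \<open>ln (1 / \<alpha>)\<close> stays
  above \<open>1 / 2\<close>, so additive constants can be absorbed into a multiple of it.\<close>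

lemma constant_step_rate:
  fixes C \<alpha> :: real
  assumes C: "1 \<le> C" and \<alpha>: "0 < \<alpha>" "\<alpha> < 1 / 2"
  shows "C * sqrt \<alpha> * (1 + ln (C + C / \<alpha>)) \<le> C * (1 + 2 * (1 + \<bar>ln (2 * C)\<bar>)) * (sqrt \<alpha> * ln (1 / \<alpha>))"
proof -
  have "ln 2 \<le> ln (1 / \<alpha>)" using \<alpha> by (simp add: field_simps)
  moreover have "(1 / 2 :: real) \<le> ln 2" by (rule ln2_ge_two_thirds[THEN order_trans[rotated]]) simp
  ultimately have l: "1 \<le> 2 * ln (1 / \<alpha>)" by simp
  have "C + C / \<alpha> \<le> 2 * C * (1 / \<alpha>)"
    using C \<alpha> by (simp add: field_simps)
  moreover have "0 < C + C / \<alpha>" using C \<alpha> by (simp add: add_pos_nonneg)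
  ultimately have "ln (C + C / \<alpha>) \<le> ln (2 * C * (1 / \<alpha>))" by simp
  also have "\<dots> = ln (2 * C) + ln (1 / \<alpha>)" using C \<alpha> by (subst ln_mult) auto
  finally have "1 + ln (C + C / \<alpha>) \<le> (1 + 2 * (1 + \<bar>ln (2 * C)\<bar>)) * ln (1 / \<alpha>)"
    using mult_left_mono[OF l, of "1 + \<bar>ln (2 * C)\<bar>"] by (simp add: algebra_simps)
  from mult_left_mono[OF this, of "C * sqrt \<alpha>"] show ?thesis using C \<alpha> by (simp add: mult_ac)
qed

text \<open>The mean square comparison yields \<open>sqrt E\<close>, while the final bound is linear
  in \<open>E\<close>. The former is dominated by a multiple of the latter only if nonzero values of
  \<open>E\<close> stay away from 0.\<close>

lemma sqrt_le_of_gap: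
  fixes E \<epsilon> :: real
  assumes "0 < \<epsilon>" "E = 0 \<or> \<epsilon> \<le> E"
  shows "sqrt E \<le> E / sqrt \<epsilon>"
proof -
  have E: "0 \<le> E" using assms by auto
  have "sqrt \<epsilon> * sqrt E \<le> sqrt E * sqrt E"
    using assms E by (cases "E = 0") (auto simp del: real_sqrt_mult_self intro: mult_right_mono)
  then show ?thesis using assms E by (simp add: pos_le_divide_eq mult.commute)
qed

text \<open>The order of the quantifiers records what the hidden constants depend on.
  \<open>C1\<close> precedes \<epsilon> and \<open>z0\<close> in all parts. \<open>C2\<close>
  follows \<epsilon>, from which it takes the factor \<open>1 / sqrt \<epsilon>\<close>; in the last
  two parts it also follows \<open>K\<close>, because the sum of the step sizes starts at
  \<open>K\<close> and the corresponding factor is moved into it.\<close>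

theorem theorem6p1:
  fixes M :: "'w measure" and N :: "'v measure"
    and H :: "real ^ 'n ^ 'n"
    and noise :: "nat \<Rightarrow> 'w \<Rightarrow> real ^ 'n"
    and Z :: "'v \<Rightarrow> real ^ 'n"
  assumes "prob_space M"
    and "hurwitz H"
    and noise_indep: "prob_space.indep_vars M (\<lambda>_. borel) noise UNIV"
    and noise_ident: "\<And>k. distr M borel (noise k) = distr M borel (noise 0)"
    and noise_third_moment: "\<And>k. integrable M (\<lambda>\<omega>. norm (noise k \<omega>) ^ 3)"
    and noise_mean_zero: "\<And>k. (\<integral>\<omega>. noise k \<omega> \<partial>M) = 0"
    and "prob_space N"
    and "standard_gaussian N Z"
  shows
    "(\<exists>\<alpha>0>0. \<exists>C1>0. \<forall>\<epsilon>>0. \<exists>C2>0. \<forall>\<alpha> K z0 k.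
        0 < \<alpha> \<and> \<alpha> < \<alpha>0 \<and> 2 \<le> K \<and> (\<forall>j. stepsize \<alpha> K 0 j \<le> 1) \<and>
        square_integrable M z0 \<and> (second_moment M z0 = 0 \<or> \<epsilon> \<le> second_moment M z0) \<and> 1 \<le> k \<longrightarrow>
        (let z = iterate H \<alpha> K 0 noise z0 in
         wasserstein1 M (z k) N (\<lambda>\<eta>. mat_sqrt (covariance M (z k)) *v Z \<eta>)
         \<le> ennreal (C1 * (sqrt \<alpha> * ln (1 / \<alpha>))
                   + C2 * (second_moment M z0 * exp (- (iota H * \<alpha> * real k))))))
     \<and>
     (\<forall>\<xi> \<alpha>. 0 < \<xi> \<and> \<xi> < 1 \<and> 0 < \<alpha> \<longrightarrow>
      (\<exists>K0\<ge>2. \<exists>C1>0. \<forall>K\<ge>K0. \<forall>\<epsilon>>0. \<exists>C2>0. \<forall>z0 k.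
        (\<forall>j. stepsize \<alpha> K \<xi> j \<le> 1) \<and>
        square_integrable M z0 \<and> (second_moment M z0 = 0 \<or> \<epsilon> \<le> second_moment M z0) \<and> 1 \<le> k \<longrightarrow>
        (let z = iterate H \<alpha> K \<xi> noise z0 in
         wasserstein1 M (z k) N (\<lambda>\<eta>. mat_sqrt (covariance M (z k)) *v Z \<eta>)
         \<le> ennreal (C1 * (ln (real k + K) / (real k + K) powr (\<xi> / 2))
                   + C2 * (second_moment M z0
                           * exp (- (iota H * \<alpha> / (1 - \<xi>) * (real k + K) powr (1 - \<xi>))))))))
     \<and>
     (\<forall>\<alpha>. 0 < \<alpha> \<and> iota H * \<alpha> > 1 / 2 \<longrightarrow>
      (\<exists>K0\<ge>2. \<exists>C1>0. \<forall>K\<ge>K0. \<forall>\<epsilon>>0. \<exists>C2>0. \<forall>z0 k.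
        (\<forall>j. stepsize \<alpha> K 1 j \<le> 1) \<and>
        square_integrable M z0 \<and> (second_moment M z0 = 0 \<or> \<epsilon> \<le> second_moment M z0) \<and> 1 \<le> k \<longrightarrow>
        (let z = iterate H \<alpha> K 1 noise z0 in
         wasserstein1 M (z k) N (\<lambda>\<eta>. mat_sqrt (covariance M (z k)) *v Z \<eta>)
         \<le> ennreal (C1 * (ln (real k + K) / sqrt (real k + K))
                   + C2 * (second_moment M z0 / (real k + K) powr (iota H * \<alpha>))))))"
proof -
  note M = \<open>prob_space M\<close> and N = \<open>prob_space N\<close>
  obtain C c where C: "1 \<le> C" "0 \<le> c" "0 < iota H"
    and main: "\<And>\<alpha> K \<xi> z0 k. 0 < \<alpha> \<Longrightarrow> 0 < K \<Longrightarrow> 0 \<le> \<xi> \<Longrightarrow>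
      (\<And>j. c * stepsize \<alpha> K \<xi> j + \<xi> / (2 * \<alpha> * (real j + K) powr (1 - \<xi>)) \<le> iota H) \<Longrightarrow>
      (\<And>j. iota H * stepsize \<alpha> K \<xi> j \<le> 1) \<Longrightarrow>
      (\<And>j. (1 - iota H * stepsize \<alpha> K \<xi> j) * sqrt (stepsize \<alpha> K \<xi> j) \<le> sqrt (stepsize \<alpha> K \<xi> (Suc j))) \<Longrightarrow>
      (\<And>j. stepsize \<alpha> K \<xi> j \<le> 2 * stepsize \<alpha> K \<xi> (Suc j)) \<Longrightarrow> square_integrable M z0 \<Longrightarrow>
      wasserstein1 M (iterate H \<alpha> K \<xi> noise z0 k) N
          (\<lambda>\<eta>. mat_sqrt (covariance M (iterate H \<alpha> K \<xi> noise z0 k)) *v Z \<eta>)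
        \<le> ennreal (C * sqrt (stepsize \<alpha> K \<xi> k) * (1 + ln (C + C / stepsize \<alpha> K \<xi> k))
          + C * (exp (- (iota H * (\<Sum>j<k. stepsize \<alpha> K \<xi> j))) * sqrt (second_moment M z0)))"
    using iterate_gaussian_approximation[OF M \<open>hurwitz H\<close> noise_indep noise_ident noise_third_moment
      noise_mean_zero N \<open>standard_gaussian N Z\<close>] by blast
  define W where "W \<alpha> K \<xi> z0 k = wasserstein1 M (iterate H \<alpha> K \<xi> noise z0 k) N
    (\<lambda>\<eta>. mat_sqrt (covariance M (iterate H \<alpha> K \<xi> noise z0 k)) *v Z \<eta>)" for \<alpha> K \<xi> z0 k
  have part1: "\<exists>\<alpha>0>0. \<exists>C1>0. \<forall>\<epsilon>>0. \<exists>C2>0. \<forall>\<alpha> K z0 k.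
      0 < \<alpha> \<and> \<alpha> < \<alpha>0 \<and> 2 \<le> K \<and> (\<forall>j. stepsize \<alpha> K 0 j \<le> 1) \<and>
      square_integrable M z0 \<and> (second_moment M z0 = 0 \<or> \<epsilon> \<le> second_moment M z0) \<and> 1 \<le> k \<longrightarrow>
      W \<alpha> K 0 z0 k \<le> ennreal (C1 * (sqrt \<alpha> * ln (1 / \<alpha>))
        + C2 * (second_moment M z0 * exp (- (iota H * \<alpha> * real k))))"
  proof (intro exI conjI allI impI)
    \<comment> \<open>The three thresholds serve the absorption of constants into
      \<open>ln (1 / \<alpha>)\<close>, the inequality \<open>c * \<alpha> \<le> iota H\<close>, and
      a nonnegative contraction factor.\<close>
    show "0 < min (1 / 2) (min (iota H / (c + 1)) (1 / iota H))" using C by auto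
    show "0 < C * (1 + 2 * (1 + \<bar>ln (2 * C)\<bar>))" using C by (intro mult_pos_pos add_pos_nonneg) auto
    show "0 < C / sqrt \<epsilon>" if "0 < \<epsilon>" for \<epsilon> :: real using that C by simp
    fix \<epsilon> \<alpha> K :: real and z0 :: "'w \<Rightarrow> real ^ 'n" and k :: nat
    assume \<epsilon>: "0 < \<epsilon>"
      and h: "0 < \<alpha> \<and> \<alpha> < min (1 / 2) (min (iota H / (c + 1)) (1 / iota H)) \<and> 2 \<le> K \<and>
        (\<forall>j. stepsize \<alpha> K 0 j \<le> 1) \<and> square_integrable M z0 \<and>
        (second_moment M z0 = 0 \<or> \<epsilon> \<le> second_moment M z0) \<and> 1 \<le> k"
    then have \<alpha>: "0 < \<alpha>" "\<alpha> < 1 / 2" "\<alpha> < iota H / (c + 1)" "\<alpha> < 1 / iota H" and K: "2 \<le> K" by auto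
    have a: "stepsize \<alpha> K 0 j = \<alpha>" for j using K by (simp add: stepsize_def)
    have "\<alpha> * (c + 1) < iota H" using \<alpha>(3) C by (simp add: pos_less_divide_eq)
    then have c1: "c * \<alpha> \<le> iota H" using \<alpha>(1) by (simp add: algebra_simps)
    have c2: "iota H * \<alpha> \<le> 1" using \<alpha>(4) C by (simp add: pos_less_divide_eq mult.commute)
    have c3: "(1 - iota H * \<alpha>) * sqrt \<alpha> \<le> sqrt \<alpha>" using C \<alpha>(1) by (intro mult_left_le_one_le) (auto intro: c2)
    have "W \<alpha> K 0 z0 k \<le> ennreal (C * sqrt \<alpha> * (1 + ln (C + C / \<alpha>))
          + C * (exp (- (iota H * (\<Sum>j<k. \<alpha>))) * sqrt (second_moment M z0)))"
      using main[of \<alpha> K 0 z0 k] \<alpha> K c1 c2 c3 h unfolding W_def a by simp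
    also have "\<dots> \<le> ennreal (C * (1 + 2 * (1 + \<bar>ln (2 * C)\<bar>)) * (sqrt \<alpha> * ln (1 / \<alpha>))
        + C / sqrt \<epsilon> * (second_moment M z0 * exp (- (iota H * \<alpha> * real k))))"
    proof (intro ennreal_leI add_mono constant_step_rate C \<alpha>)
      have "sqrt (second_moment M z0) \<le> second_moment M z0 / sqrt \<epsilon>" using h by (intro sqrt_le_of_gap \<epsilon>) auto
      then have "C * (exp (- (iota H * \<alpha> * real k)) * sqrt (second_moment M z0))
          \<le> C * (exp (- (iota H * \<alpha> * real k)) * (second_moment M z0 / sqrt \<epsilon>))"
        using C by (intro mult_left_mono) auto
      then show "C * (exp (- (iota H * (\<Sum>j<k. \<alpha>))) * sqrt (second_moment M z0))
          \<le> C / sqrt \<epsilon> * (second_moment M z0 * exp (- (iota H * \<alpha> * real k)))"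
        by (simp add: mult_ac)
    qed
    finally show "W \<alpha> K 0 z0 k \<le> ennreal (C * (1 + 2 * (1 + \<bar>ln (2 * C)\<bar>)) * (sqrt \<alpha> * ln (1 / \<alpha>))
        + C / sqrt \<epsilon> * (second_moment M z0 * exp (- (iota H * \<alpha> * real k))))" .
  qed
  \<comment> \<open>Both regimes with decreasing steps at once: \<open>e\<close> is the decay to be
    reached and \<open>d\<close> the factor lost by starting the sum at \<open>K\<close>. The
    assumption \<open>crit\<close> has content for \<open>\<xi> = 1\<close> only.\<close>
  have decreasing: "\<exists>K0\<ge>2. \<exists>C1>0. \<forall>K\<ge>K0. \<forall>\<epsilon>>0. \<exists>C2>0. \<forall>z0 k.
      (\<forall>j. stepsize \<alpha> K \<xi> j \<le> 1) \<and>
      square_integrable M z0 \<and> (second_moment M z0 = 0 \<or> \<epsilon> \<le> second_moment M z0) \<and> 1 \<le> k \<longrightarrow>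
      W \<alpha> K \<xi> z0 k \<le> ennreal (C1 * (ln (real k + K) / (real k + K) powr (\<xi> / 2)) + C2 * (second_moment M z0 * e k K))"
    if \<alpha>: "0 < \<alpha>" and \<xi>: "0 < \<xi>" "\<xi> \<le> 1" and crit: "\<xi> = 1 \<Longrightarrow> 1 / 2 < iota H * \<alpha>"
      and d: "\<And>K. 2 \<le> K \<Longrightarrow> 0 < d K"
      and e: "\<And>K k. 2 \<le> K \<Longrightarrow> exp (- (iota H * (\<Sum>j<k. stepsize \<alpha> K \<xi> j))) \<le> d K * e k K"
    for \<alpha> \<xi> :: real and d :: "real \<Rightarrow> real" and e :: "nat \<Rightarrow> real \<Rightarrow> real"
  proof -
    obtain K1 where K1: "\<And>x. K1 \<le> x \<Longrightarrow>
        c * (\<alpha> / x powr \<xi>) + \<xi> / (2 * \<alpha> * x powr (1 - \<xi>)) \<le> iota H \<and> iota H * (\<alpha> / x powr \<xi>) \<le> 1"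
      using eventually_stepsize_small[OF \<alpha> \<xi> C(3) crit, of c] unfolding eventually_at_top_linorder by blast
    define C1 where "C1 = C * sqrt \<alpha> * (2 + \<bar>ln (C * (1 + 1 / \<alpha>))\<bar>)"
    show ?thesis
    proof (intro exI conjI allI impI)
      show "2 \<le> max 2 K1" by simp
      show "0 < C1" unfolding C1_def using C \<alpha> by (intro mult_pos_pos) auto
      fix K assume K: "max 2 K1 \<le> K"
      show "0 < C * d K / sqrt \<epsilon>" if "0 < \<epsilon>" for \<epsilon> :: real using that C d[of K] K by simp
      fix \<epsilon> :: real and z0 :: "'w \<Rightarrow> real ^ 'n" and k :: nat
      assume \<epsilon>: "0 < \<epsilon>" and h: "(\<forall>j. stepsize \<alpha> K \<xi> j \<le> 1) \<and> square_integrable M z0 \<and>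
        (second_moment M z0 = 0 \<or> \<epsilon> \<le> second_moment M z0) \<and> 1 \<le> k"
      have small: "c * stepsize \<alpha> K \<xi> j + \<xi> / (2 * \<alpha> * (real j + K) powr (1 - \<xi>)) \<le> iota H"
        "iota H * stepsize \<alpha> K \<xi> j \<le> 1" for j
        using K1[of "real j + K"] K by (auto simp: stepsize_def)
      have "0 \<le> c * stepsize \<alpha> K \<xi> j" for j using C \<alpha> by (simp add: stepsize_def)
      then have lower: "\<xi> / (2 * \<alpha> * (real j + K) powr (1 - \<xi>)) \<le> iota H" for j
        using small(1)[of j] by (smt (verit))
      have K2: "2 \<le> K" "1 \<le> K" "0 < K" using K by auto
      note decay = stepsize_decay[OF \<alpha> K2(2) \<xi> lower small(2)]
      have "W \<alpha> K \<xi> z0 k \<le> ennreal (C * sqrt (stepsize \<alpha> K \<xi> k) * (1 + ln (C + C / stepsize \<alpha> K \<xi> k))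
          + C * (exp (- (iota H * (\<Sum>j<k. stepsize \<alpha> K \<xi> j))) * sqrt (second_moment M z0)))"
        unfolding W_def using h \<xi> by (intro main \<alpha> K2 small decay) auto
      also have "\<dots> \<le> ennreal (C1 * (ln (real k + K) / (real k + K) powr (\<xi> / 2))
          + C * d K / sqrt \<epsilon> * (second_moment M z0 * e k K))"
      proof (intro ennreal_leI add_mono)
        show "C * sqrt (stepsize \<alpha> K \<xi> k) * (1 + ln (C + C / stepsize \<alpha> K \<xi> k))
          \<le> C1 * (ln (real k + K) / (real k + K) powr (\<xi> / 2))"
          unfolding C1_def using h by (intro stepsize_rate C \<alpha> K2 \<xi>) auto
        have E: "0 \<le> second_moment M z0" using h \<epsilon> by auto
        have "exp (- (iota H * (\<Sum>j<k. stepsize \<alpha> K \<xi> j))) * sqrt (second_moment M z0)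
            \<le> (d K * e k K) * (second_moment M z0 / sqrt \<epsilon>)"
          using h E order_trans[OF exp_ge_zero e[OF K2(1), of k]]
          by (intro mult_mono e K2 sqrt_le_of_gap \<epsilon>) auto
        from mult_left_mono[OF this, of C]
        show "C * (exp (- (iota H * (\<Sum>j<k. stepsize \<alpha> K \<xi> j))) * sqrt (second_moment M z0))
            \<le> C * d K / sqrt \<epsilon> * (second_moment M z0 * e k K)"
          using C by (simp add: mult_ac)
      qed
      finally show "W \<alpha> K \<xi> z0 k \<le> ennreal (C1 * (ln (real k + K) / (real k + K) powr (\<xi> / 2))
          + C * d K / sqrt \<epsilon> * (second_moment M z0 * e k K))" .
    qed
  qed
  have part2: "\<exists>K0\<ge>2. \<exists>C1>0. \<forall>K\<ge>K0. \<forall>\<epsilon>>0. \<exists>C2>0. \<forall>z0 k.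
      (\<forall>j. stepsize \<alpha> K \<xi> j \<le> 1) \<and>
      square_integrable M z0 \<and> (second_moment M z0 = 0 \<or> \<epsilon> \<le> second_moment M z0) \<and> 1 \<le> k \<longrightarrow>
      W \<alpha> K \<xi> z0 k \<le> ennreal (C1 * (ln (real k + K) / (real k + K) powr (\<xi> / 2))
        + C2 * (second_moment M z0 * exp (- (iota H * \<alpha> / (1 - \<xi>) * (real k + K) powr (1 - \<xi>)))))"
    if \<xi>: "0 < \<xi> \<and> \<xi> < 1 \<and> 0 < \<alpha>" for \<xi> \<alpha> :: real
  proof (rule decreasing)
    \<comment> \<open>The lower limit of the comparison integral contributes a factor that depends
      on \<open>K\<close> alone, and this choice of \<open>d\<close> hides it in
      \<open>C2\<close>.\<close>
    show "0 < exp (iota H * \<alpha> / (1 - \<xi>) * K powr (1 - \<xi>))" for K :: real by simp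
    fix K :: real and k :: nat assume K: "2 \<le> K"
    have "iota H * (\<alpha> / (1 - \<xi>) * ((real k + K) powr (1 - \<xi>) - K powr (1 - \<xi>))) \<le> iota H * (\<Sum>j<k. stepsize \<alpha> K \<xi> j)"
      using \<xi> K C by (intro mult_left_mono stepsize_sum_powr) auto
    then have "- (iota H * (\<Sum>j<k. stepsize \<alpha> K \<xi> j))
        \<le> iota H * \<alpha> / (1 - \<xi>) * K powr (1 - \<xi>) + - (iota H * \<alpha> / (1 - \<xi>) * (real k + K) powr (1 - \<xi>))"
      by (simp add: right_diff_distrib)
    then show "exp (- (iota H * (\<Sum>j<k. stepsize \<alpha> K \<xi> j)))
        \<le> exp (iota H * \<alpha> / (1 - \<xi>) * K powr (1 - \<xi>)) * exp (- (iota H * \<alpha> / (1 - \<xi>) * (real k + K) powr (1 - \<xi>)))"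
      unfolding exp_add[symmetric] by simp
  qed (use \<xi> in auto)
  have part3: "\<exists>K0\<ge>2. \<exists>C1>0. \<forall>K\<ge>K0. \<forall>\<epsilon>>0. \<exists>C2>0. \<forall>z0 k.
      (\<forall>j. stepsize \<alpha> K 1 j \<le> 1) \<and>
      square_integrable M z0 \<and> (second_moment M z0 = 0 \<or> \<epsilon> \<le> second_moment M z0) \<and> 1 \<le> k \<longrightarrow>
      W \<alpha> K 1 z0 k \<le> ennreal (C1 * (ln (real k + K) / (real k + K) powr (1 / 2))
        + C2 * (second_moment M z0 * (1 / (real k + K) powr (iota H * \<alpha>))))"
    if \<alpha>: "0 < \<alpha> \<and> iota H * \<alpha> > 1 / 2" for \<alpha> :: real
  proof (rule decreasing)
    show "0 < K powr (iota H * \<alpha>)" if "2 \<le> K" for K :: real using that by simp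
    fix K :: real and k :: nat assume K: "2 \<le> K"
    have "iota H * (\<alpha> * (ln (real k + K) - ln K)) \<le> iota H * (\<Sum>j<k. stepsize \<alpha> K 1 j)"
      using \<alpha> K C by (intro mult_left_mono stepsize_sum_ln) auto
    then have "- (iota H * (\<Sum>j<k. stepsize \<alpha> K 1 j)) \<le> iota H * \<alpha> * ln K + - (iota H * \<alpha> * ln (real k + K))"
      by (simp add: right_diff_distrib)
    then have "exp (- (iota H * (\<Sum>j<k. stepsize \<alpha> K 1 j))) \<le> exp (iota H * \<alpha> * ln K) * exp (- (iota H * \<alpha> * ln (real k + K)))"
      unfolding exp_add[symmetric] by simp
    then show "exp (- (iota H * (\<Sum>j<k. stepsize \<alpha> K 1 j))) \<le> K powr (iota H * \<alpha>) * (1 / (real k + K) powr (iota H * \<alpha>))"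
      using K by (simp add: powr_def exp_minus field_simps)
  qed (use \<alpha> in auto)
  have "\<exists>K0\<ge>2. \<exists>C1>0. \<forall>K\<ge>K0. \<forall>\<epsilon>>0. \<exists>C2>0. \<forall>z0 k.
      (\<forall>j. stepsize \<alpha> K 1 j \<le> 1) \<and>
      square_integrable M z0 \<and> (second_moment M z0 = 0 \<or> \<epsilon> \<le> second_moment M z0) \<and> 1 \<le> k \<longrightarrow>
      W \<alpha> K 1 z0 k \<le> ennreal (C1 * (ln (real k + K) / sqrt (real k + K))
        + C2 * (second_moment M z0 / (real k + K) powr (iota H * \<alpha>)))"
    if \<alpha>: "0 < \<alpha> \<and> iota H * \<alpha> > 1 / 2" for \<alpha> :: real
  proof -
    obtain K0 C1 where K0: "2 \<le> K0" "0 < C1" and P: "\<forall>K\<ge>K0. \<forall>\<epsilon>>0. \<exists>C2>0. \<forall>z0 k.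
      (\<forall>j. stepsize \<alpha> K 1 j \<le> 1) \<and>
      square_integrable M z0 \<and> (second_moment M z0 = 0 \<or> \<epsilon> \<le> second_moment M z0) \<and> 1 \<le> k \<longrightarrow>
      W \<alpha> K 1 z0 k \<le> ennreal (C1 * (ln (real k + K) / (real k + K) powr (1 / 2))
        + C2 * (second_moment M z0 * (1 / (real k + K) powr (iota H * \<alpha>))))"
      using part3[OF \<alpha>] by blast
    have "(real k + K) powr (1 / 2) = sqrt (real k + K)" if "K0 \<le> K" for k K
      using that K0 by (simp add: powr_half_sqrt)
    with P have "\<forall>K\<ge>K0. \<forall>\<epsilon>>0. \<exists>C2>0. \<forall>z0 k.
      (\<forall>j. stepsize \<alpha> K 1 j \<le> 1) \<and>
      square_integrable M z0 \<and> (second_moment M z0 = 0 \<or> \<epsilon> \<le> second_moment M z0) \<and> 1 \<le> k \<longrightarrow>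
      W \<alpha> K 1 z0 k \<le> ennreal (C1 * (ln (real k + K) / sqrt (real k + K))
        + C2 * (second_moment M z0 / (real k + K) powr (iota H * \<alpha>)))" by simp
    with K0 show ?thesis by blast
  qed
  with part1 part2 show ?thesis unfolding W_def Let_def by blast
qed

end
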